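(* Let $\omega>0$ and let $\mu\in\mathbb{R}$ be a constant. Suppose $\gamma\ge 2$ and $\mu\neq 0$. Let $L_{TE},\tilde L_{TE}:U_b^{\gamma}\to H^{0,\gamma-1}$ be the bounded linear operators $$L_{TE}(u)=u_{tt}-u_{xx}+2\mu u_t,\qquad \tilde L_{TE}(u)=u_{tt}-u_{xx}-2\mu u_t .$$ Then: (i) $L_{TE}$ is a Fredholm operator of index zero from $U_b^{\gamma}$ into $H^{0,\gamma-1}$. (ii) The image of $L_{TE}$ is the set of all $f\in H^{0,\gamma-1}$ such that $$\int_0^{2\pi/\omega}\int_0^1 f(x,t)\,u(x,t)\,dx\,dt=0\quad\text{for all } u\in\ker(\tilde L_{TE}).$$
   Context: Fix $\omega>0$. For $l\in\mathbb{N}_0$ and real $\gamma\ge 0$, $H^{l,\gamma}$ is the Banach space of all measurable functions $u:(0,1)\times\mathbb{R}\to\mathbb{R}$ (modulo equality a.e.) such that $u(x,t)=u(x,t+\frac{2\pi}{\omega})$ for a.a. $(x,t)$ and $$\|u\|_{H^{l,\gamma}}^2:=\sum_{k\in\mathbb{Z}}(1+k^2)^{\gamma}\sum_{m=0}^{l}\int_0^1\left|\int_0^{2\pi/\omega}\partial_x^m u(x,t)e^{-ik\omega t}\,dt\right|^2dx<\infty .$$ For real $\gamma\ge 1$ set $$U^{\gamma}=\{u\in H^{0,\gamma}:\ u_x\in H^{0,\gamma-1},\ u_{tt}-u_{xx}\in H^{0,\gamma-1}\},$$ with derivatives understood in the generalized (distributional) sense, and with norm $$\|u\|_{U^{\gamma}}^2=\|u\|_{H^{0,\gamma}}^2+\|u_x\|_{H^{0,\gamma-1}}^2+\|u_{tt}-u_{xx}\|_{H^{0,\gamma-1}}^2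 .$$ For every $x\in[0,1]$ there is a continuous trace map $u\in U^{\gamma}\mapsto u_x(x,\cdot)\in L^2(0,\frac{2\pi}{\omega})$. The closed subspace $U_b^{\gamma}$ of $U^{\gamma}$ consists of those $u\in U^\gamma$ with $u_x(0,t)=u_x(1,t)=0$ for a.a. $t\in\mathbb{R}$ (in the sense of traces). *)

theory Defs
  imports "HOL-Analysis.Analysis"
begin

text \<open>
  Functions on the strip (0,1) x R, written as functions of the pair (x,t), and their classes
  modulo equality almost everywhere. Representatives are Borel measurable; since every Lebesgue
  measurable function agrees almost everywhere with a Borel measurable one, these are the same
  classes as those of Lebesgue measurable functions.
\<close>

definition strip :: "(real \<times> real) set" where
  "strip = {0<..<1} \<times> UNIV"

abbreviation strip_measure :: "(real \<times> real) measure" where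
  "strip_measure \<equiv> restrict_space lborel strip"

definition strip_rel :: "(real \<times> real \<Rightarrow> real) \<Rightarrow> (real \<times> real \<Rightarrow> real) \<Rightarrow> bool" where
  "strip_rel f g \<longleftrightarrow> f \<in> borel_measurable strip_measure \<and> g \<in> borel_measurable strip_measure \<and>
     (AE z in strip_measure. f z = g z)"

quotient_type stripfun = "real \<times> real \<Rightarrow> real" / partial: strip_rel
  morphisms fn stripfun_of
proof (rule part_equivpI)
  show "\<exists>x. strip_rel x x"
    by (rule exI[of _ "\<lambda>_. 0"]) (simp add: strip_rel_def)
  show "symp strip_rel"
    by (auto simp: symp_def strip_rel_def eq_commute)
  show "transp strip_rel"
  proof (rule transpI)
    fix f g h assume "strip_rel f g" "strip_rel g h"
    then show "strip_rel f h"
      unfolding strip_rel_def by (auto elim: AE_mp)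
  qed
qed

text \<open>
  \<open>fn u\<close> is a chosen representative of the class \<open>u\<close>. All notions below that mention
  it depend only on the class.
\<close>

instantiation stripfun :: real_vector
begin

lift_definition zero_stripfun :: stripfun is "\<lambda>_. 0"
  by (simp add: strip_rel_def)

lift_definition plus_stripfun :: "stripfun \<Rightarrow> stripfun \<Rightarrow> stripfun" is "\<lambda>f g z. f z + g z"
  by (auto simp: strip_rel_def)

lift_definition minus_stripfun :: "stripfun \<Rightarrow> stripfun \<Rightarrow> stripfun" is "\<lambda>f g z. f z - g z"
  by (auto simp: strip_rel_def)

lift_definition uminus_stripfun :: "stripfun \<Rightarrow> stripfun" is "\<lambda>f z. - f z"
  by (auto simp: strip_rel_def)

lift_definition scaleR_stripfun :: "real \<Rightarrow> stripfun \<Rightarrow> stripfun" is "\<lambda>c f z. c * f z"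
  by (auto simp: strip_rel_def)

instance
  by standard (transfer; auto simp: strip_rel_def algebra_simps)+

end

lemma strip_rel_fn: "strip_rel (fn u) (fn u)"
  using Quotient3_rep_reflp[OF Quotient3_stripfun] .

lemma fn_stripfun_of:
  assumes "f \<in> borel_measurable strip_measure"
  shows "AE z in strip_measure. fn (stripfun_of f) z = f z"
  using assms rep_abs_rsp_left[OF Quotient3_stripfun, of f f]
  by (simp add: strip_rel_def)

lemma stripfun_eq_iff: "u = v \<longleftrightarrow> (AE z in strip_measure. fn u z = fn v z)"
  using Quotient3_rel_rep[OF Quotient3_stripfun, of u v] strip_rel_fn[of u] strip_rel_fn[of v]
  by (auto simp: strip_rel_def)


subsection \<open>The spaces of index \<open>l = 0\<close>\<close>

definition time_coeff :: "real \<Rightarrow> stripfun \<Rightarrow> int \<Rightarrow> real \<Rightarrow> complex" where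
  "time_coeff \<omega> u k x =
     (LINT t:{0..2*pi/\<omega>}|lborel.
        complex_of_real (fn u (x, t)) * exp (- \<i> * of_int k * of_real \<omega> * of_real t))"

definition H_sqnorm :: "real \<Rightarrow> real \<Rightarrow> stripfun \<Rightarrow> ennreal" where
  "H_sqnorm \<omega> \<gamma> u =
     (\<Sum>\<^sub>\<infinity>k::int. ennreal ((1 + (of_int k)\<^sup>2) powr \<gamma>) *
        (\<integral>\<^sup>+x\<in>{0<..<1}. ennreal ((cmod (time_coeff \<omega> u k x))\<^sup>2) \<partial>lborel))"

text \<open>
  Integrability over one period cell makes the Fourier coefficients (and distributional
  derivatives) meaningful; the Bochner integral of a non-integrable function is 0, so this has
  to be said explicitly. Together with finiteness of the sum it yields square integrability.
\<close>
definition H_space :: "real \<Rightarrow> real \<Rightarrow> stripfun set" where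
  "H_space \<omega> \<gamma> = {u.
     (AE (x, t) in strip_measure. fn u (x, t) = fn u (x, t + 2*pi/\<omega>)) \<and>
     set_integrable lborel ({0<..<1} \<times> {0..2*pi/\<omega>}) (fn u) \<and>
     H_sqnorm \<omega> \<gamma> u < \<infinity>}"

definition H_norm :: "real \<Rightarrow> real \<Rightarrow> stripfun \<Rightarrow> real" where
  "H_norm \<omega> \<gamma> u = sqrt (enn2real (H_sqnorm \<omega> \<gamma> u))"


subsection \<open>Distributional derivatives on the strip\<close>

definition pd_x :: "(real \<times> real \<Rightarrow> real) \<Rightarrow> real \<times> real \<Rightarrow> real" where
  "pd_x \<phi> = (\<lambda>(x, t). deriv (\<lambda>s. \<phi> (s, t)) x)"

definition pd_t :: "(real \<times> real \<Rightarrow> real) \<Rightarrow> real \<times> real \<Rightarrow> real" where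
  "pd_t \<phi> = (\<lambda>(x, t). deriv (\<lambda>s. \<phi> (x, s)) t)"

text \<open>Smoothness: all iterated partial derivatives, in any order, are Frechet differentiable.\<close>
definition test_function :: "(real \<times> real \<Rightarrow> real) \<Rightarrow> bool" where
  "test_function \<phi> \<longleftrightarrow>
     (\<forall>ds\<in>lists {pd_x, pd_t}. foldr (\<lambda>d \<psi>. d \<psi>) ds \<phi> differentiable_on UNIV) \<and>
     (\<exists>K. compact K \<and> K \<subseteq> strip \<and> (\<forall>z. z \<notin> K \<longrightarrow> \<phi> z = 0))"

definition locally_integrable :: "stripfun \<Rightarrow> bool" where
  "locally_integrable u \<longleftrightarrow> (\<forall>K. compact K \<and> K \<subseteq> strip \<longrightarrow> set_integrable lborel K (fn u))"

text \<open>
  \<open>v = D u\<close> as distributions, where \<open>D\<close> is a linear differential operator with constant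
  coefficients and \<open>P\<close> is its formal adjoint acting on test functions.
\<close>
definition weakly_eq ::
  "((real \<times> real \<Rightarrow> real) \<Rightarrow> real \<times> real \<Rightarrow> real) \<Rightarrow> stripfun \<Rightarrow> stripfun \<Rightarrow> bool" where
  "weakly_eq P u v \<longleftrightarrow> locally_integrable u \<and> locally_integrable v \<and>
     (\<forall>\<phi>. test_function \<phi> \<longrightarrow>
        (LINT z:strip|lborel. fn u z * P \<phi> z) = (LINT z:strip|lborel. fn v z * \<phi> z))"

definition is_dx :: "stripfun \<Rightarrow> stripfun \<Rightarrow> bool" where
  "is_dx = weakly_eq (\<lambda>\<phi> z. - pd_x \<phi> z)"

definition is_dt :: "stripfun \<Rightarrow> stripfun \<Rightarrow> bool" where
  "is_dt = weakly_eq (\<lambda>\<phi> z. - pd_t \<phi> z)"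

definition is_wave :: "stripfun \<Rightarrow> stripfun \<Rightarrow> bool" where
  "is_wave = weakly_eq (\<lambda>\<phi> z. pd_t (pd_t \<phi>) z - pd_x (pd_x \<phi>) z)"

text \<open>
  The generalized derivatives \<open>u\<^sub>x\<close>, \<open>u\<^sub>t\<close> and \<open>u\<^sub>t\<^sub>t - u\<^sub>x\<^sub>x\<close> as functions;
  the last one may exist although neither of its two terms is a function.
\<close>
definition dx :: "stripfun \<Rightarrow> stripfun" where "dx u = (THE v. is_dx u v)"
definition dt :: "stripfun \<Rightarrow> stripfun" where "dt u = (THE v. is_dt u v)"
definition wave :: "stripfun \<Rightarrow> stripfun" where "wave u = (THE w. is_wave u w)"


subsection \<open>The solution spaces\<close>

definition U_space :: "real \<Rightarrow> real \<Rightarrow> stripfun set" where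
  "U_space \<omega> \<gamma> = {u \<in> H_space \<omega> \<gamma>.
     (\<exists>v \<in> H_space \<omega> (\<gamma> - 1). is_dx u v) \<and> (\<exists>w \<in> H_space \<omega> (\<gamma> - 1). is_wave u w)}"

definition U_norm :: "real \<Rightarrow> real \<Rightarrow> stripfun \<Rightarrow> real" where
  "U_norm \<omega> \<gamma> u =
     sqrt ((H_norm \<omega> \<gamma> u)\<^sup>2 + (H_norm \<omega> (\<gamma> - 1) (dx u))\<^sup>2 + (H_norm \<omega> (\<gamma> - 1) (wave u))\<^sup>2)"

text \<open>
  \<open>g\<close> is the trace of \<open>v\<close> at \<open>x\<^sub>0\<close>: the value at \<open>x\<^sub>0\<close> of the representative of \<open>v\<close> that is
  continuous from [0,1] into the square integrable functions of time over one period. For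
  \<open>u\<close> in \<open>U_space\<close> the function \<open>dx u\<close> has such a representative, and it is unique.
\<close>
definition is_trace :: "real \<Rightarrow> stripfun \<Rightarrow> real \<Rightarrow> (real \<Rightarrow> real) \<Rightarrow> bool" where
  "is_trace \<omega> v x0 g \<longleftrightarrow>
     (\<exists>G :: real \<Rightarrow> real \<Rightarrow> real.
        (\<forall>x\<in>{0..1}. G x \<in> borel_measurable lborel \<and>
                     set_integrable lborel {0..2*pi/\<omega>} (\<lambda>t. (G x t)\<^sup>2)) \<and>
        (\<forall>x\<in>{0..1}. ((\<lambda>y. LINT t:{0..2*pi/\<omega>}|lborel. (G y t - G x t)\<^sup>2) \<longlongrightarrow> 0)
                       (at x within {0..1})) \<and>
        (AE x in lborel. x \<in> {0<..<1} \<longrightarrow>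
           (AE t in lborel. t \<in> {0..2*pi/\<omega>} \<longrightarrow> fn v (x, t) = G x t)) \<and>
        (AE t in lborel. t \<in> {0..2*pi/\<omega>} \<longrightarrow> g t = G x0 t))"

definition U_b :: "real \<Rightarrow> real \<Rightarrow> stripfun set" where
  "U_b \<omega> \<gamma> = {u \<in> U_space \<omega> \<gamma>. is_trace \<omega> (dx u) 0 (\<lambda>_. 0) \<and> is_trace \<omega> (dx u) 1 (\<lambda>_. 0)}"


subsection \<open>Fredholm operators\<close>

definition bounded_linear_between ::
  "'a::real_vector set \<Rightarrow> ('a \<Rightarrow> real) \<Rightarrow> 'b::real_vector set \<Rightarrow> ('b \<Rightarrow> real) \<Rightarrow> ('a \<Rightarrow> 'b) \<Rightarrow> bool" where
  "bounded_linear_between X nX Y nY L \<longleftrightarrow>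
     subspace X \<and> subspace Y \<and> L ` X \<subseteq> Y \<and>
     (\<forall>u\<in>X. \<forall>v\<in>X. L (u + v) = L u + L v) \<and> (\<forall>c. \<forall>u\<in>X. L (c *\<^sub>R u) = c *\<^sub>R L u) \<and>
     (\<exists>C. \<forall>u\<in>X. nY (L u) \<le> C * nX u)"

definition kernel_on :: "'a set \<Rightarrow> ('a \<Rightarrow> 'b::zero) \<Rightarrow> 'a set" where
  "kernel_on X L = {u \<in> X. L u = 0}"

text \<open>\<open>B\<close> represents a basis of the quotient space \<open>Y / W\<close>.\<close>
definition has_codim :: "'b::real_vector set \<Rightarrow> 'b set \<Rightarrow> nat \<Rightarrow> bool" where
  "has_codim Y W n \<longleftrightarrow>
     (\<exists>B. B \<subseteq> Y \<and> finite B \<and> card B = n \<and>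
        (\<forall>y\<in>Y. \<exists>c. y - (\<Sum>b\<in>B. c b *\<^sub>R b) \<in> W) \<and>
        (\<forall>c. (\<Sum>b\<in>B. c b *\<^sub>R b) \<in> W \<longrightarrow> (\<forall>b\<in>B. c b = 0)))"

definition fredholm_with_index ::
  "'a::real_vector set \<Rightarrow> ('a \<Rightarrow> real) \<Rightarrow> 'b::real_vector set \<Rightarrow> ('b \<Rightarrow> real) \<Rightarrow> ('a \<Rightarrow> 'b) \<Rightarrow> int \<Rightarrow> bool" where
  "fredholm_with_index X nX Y nY L i \<longleftrightarrow>
     bounded_linear_between X nX Y nY L \<and>
     (\<forall>y. \<forall>l\<in>Y. (\<forall>n::nat. y n \<in> L ` X) \<and> (\<lambda>n. nY (y n - l)) \<longlonglongrightarrow> 0 \<longrightarrow> l \<in> L ` X) \<and>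
     (\<exists>S. finite S \<and> kernel_on X L \<subseteq> span S) \<and>
     (\<exists>n. has_codim Y (L ` X) n \<and> i = int (dim (kernel_on X L)) - int n)"


subsection \<open>The operators\<close>

definition L_TE :: "real \<Rightarrow> stripfun \<Rightarrow> stripfun" where
  "L_TE \<mu> u = wave u + (2 * \<mu>) *\<^sub>R dt u"

definition L_TE_adj :: "real \<Rightarrow> stripfun \<Rightarrow> stripfun" where
  "L_TE_adj \<mu> u = wave u - (2 * \<mu>) *\<^sub>R dt u"

end

theory Submission
  imports Defs
begin

text \<open>
  Write \<open>T = 2 pi / omega\<close> and expand a function on the strip in the modes
  \<open>cos (n pi x) exp (i k omega t)\<close>, which satisfy both the periodicity and the Neumann conditions.
  The operator \<open>u_tt - u_xx + 2 mu u_t\<close> becomes multiplication of the coefficient with index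
  \<open>(k, n)\<close> by the symbol \<open>(n pi)^2 - (k omega)^2 + 2 i mu k omega\<close>. Since \<open>mu\<close> is not zero, the
  imaginary part forbids resonances: the symbol vanishes only at \<open>(0, 0)\<close>, and at all other indices
  its squared modulus dominates \<open>1 + k^2\<close> and \<open>(n pi)^2\<close> (lemma \<open>symbol_bounds\<close>). Hence the kernel consists of the
  constants, and an equation with right-hand side \<open>f\<close> is solvable exactly if \<open>f\<close> has mean zero. The
  same holds for the formal adjoint, whose symbol is obtained by changing the sign of \<open>mu\<close>; so the
  image is the orthogonal complement of the kernel of the adjoint, both defects are one and the index is
  zero.
  
  The work lies in showing that this computation is legitimate for the distributional definitions.
  
  Coefficients determine functions: an integrable function on the period cell all of whose coefficients
  vanish is zero (\<open>coeff_of_eq_0_imp\<close>), because polynomials in a cosine approximate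
  indicators of intervals. Conversely, weighted square summable coefficients are the coefficients of an
  element of the space \<open>H\<close> (\<open>synthesis\<close>), by completeness of L2 and
  orthogonality of the modes.
  
  From coefficients to derivatives: a generalized derivative passes to the limit in the partial sums,
  for which it is classical (\<open>series_dx\<close>, \<open>series_dt\<close>, \<open>series_wave\<close>); generalized derivatives are
  unique by the fundamental lemma of the calculus of variations. If \<open>n c(k, n)\<close> is square
  summable, the sine series with coefficients \<open>c\<close> converges uniformly in \<open>x\<close> with values in L2 of
  a period, so that its traces at both ends vanish (\<open>sine_series_trace\<close>). The index \<open>gamma\<close> being at
  least 2 makes this applicable to the derivative of the solution. Together these facts solve the equation
  (\<open>L_TE_solve\<close>).
  
  From derivatives to coefficients: for an arbitrary \<open>u\<close> in the domain, test functions that are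
  products \<open>a(x) b(t)\<close> show that the moments of \<open>u\<close>, \<open>u_x\<close> and of the wave operator applied to
  \<open>u\<close> satisfy an ordinary differential equation in \<open>x\<close> in the weak sense. The Neumann traces allow \<open>a\<close> to be
  replaced by \<open>cos (n pi x)\<close> through cutoffs (\<open>Neumann_cosine_moments\<close>), and the coefficients of the
  wave operator are those of \<open>u\<close> times \<open>(n pi)^2 - (k omega)^2\<close> (\<open>wave_coeffs\<close>).
  
  As a consequence the domain is described by coefficients alone (\<open>domain_iff_coeffs\<close>), and all the
  linear algebra, including the stability of the domain under linear combinations, is done on
  coefficients.
\<close>

section \<open>Integrable functions are determined by their integrals over boxes\<close>

text \<open>
  Boxes are stable under intersection and generate the Borel sets, so by the Dynkin argument all set
  integrals vanish. This turns convergence of test functions or of trigonometric polynomials to indicators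
  into vanishing almost everywhere.
\<close>

lemma AE_eq_0_if_box_integrals_0:
  fixes f :: "'a::euclidean_space \<Rightarrow> 'b::{second_countable_topology, banach}"
  assumes f: "integrable lborel f"
    and box: "\<And>a b. (LINT x:box a b|lborel. f x) = 0"
  shows "AE x in lborel. f x = 0"
proof (rule sigma_finite_measure.density_zero[OF lborel.sigma_finite_measure_axioms f])
  fix A :: "'a set"
  assume "A \<in> sets lborel"
  then have A: "A \<in> sigma_sets UNIV (range (\<lambda>(a, b). box a b :: 'a set))"
    by (simp add: borel_eq_box)
  have si: "set_integrable lborel B f" if "B \<in> sets lborel" for B
    using f that unfolding set_integrable_def by (intro integrable_mult_indicator) auto
  have sig: "sigma_sets UNIV (range (\<lambda>(a, b). box a b :: 'a set)) = sets lborel"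
    by (simp add: borel_eq_box)
  have UNIV_0: "(LINT x|lborel. f x) = 0"
  proof -
    let ?A = "\<lambda>n::nat. box (- (real n *\<^sub>R One)) (real n *\<^sub>R One) :: 'a set"
    have "(\<lambda>n. LINT x:?A n|lborel. f x) \<longlonglongrightarrow> (LINT x:(\<Union>n. ?A n)|lborel. f x)"
    proof (rule set_integral_cont_up)
      show "incseq ?A"
        unfolding incseq_def by (intro allI impI subset_box_imp) (auto)
      show "set_integrable lborel (\<Union>n. ?A n) f" by (rule si) auto
    qed auto
    then show ?thesis
      unfolding box UN_box_eq_UNIV by (simp add: LIMSEQ_const_iff set_lebesgue_integral_def)
  qed
  show "(LINT x:A|lborel. f x) = 0"
  proof (rule sigma_sets_induct_disjoint[OF _ _ A, where P="\<lambda>A. (LINT x:A|lborel. f x) = 0"])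
    show "Int_stable (range (\<lambda>(a, b). box a b :: 'a set))"
      by (auto simp: Int_stable_def box_Int_box)
  next
    fix B assume "B \<in> sigma_sets UNIV (range (\<lambda>(a, b). box a b :: 'a set))"
      and B0: "(LINT x:B|lborel. f x) = 0"
    then have B: "B \<in> sets lborel" using sig by auto
    then have "(LINT x:(UNIV - B) \<union> B|lborel. f x) = (LINT x:(UNIV - B)|lborel. f x) + (LINT x:B|lborel. f x)"
      by (intro set_integral_Un si) auto
    with B0 UNIV_0 show "(LINT x:UNIV - B|lborel. f x) = 0"
      by (simp add: set_lebesgue_integral_def)
  next
    fix B :: "nat \<Rightarrow> 'a set"
    assume d: "disjoint_family B" and r: "range B \<subseteq> sigma_sets UNIV (range (\<lambda>(a, b). box a b :: 'a set))"
      and 0: "\<And>i. (LINT x:B i|lborel. f x) = 0"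
    have B: "B i \<in> sets lborel" for i using r sig by auto
    have "(LINT x:(\<Union>i. B i)|lborel. f x) = (\<Sum>i. LINT x:B i|lborel. f x)"
      using d B by (intro lebesgue_integral_countable_add si) (auto simp: disjoint_family_on_def)
    then show "(LINT x:(\<Union>i. B i)|lborel. f x) = 0" using 0 by simp
  qed (use box in \<open>auto simp: set_lebesgue_integral_def\<close>)
qed

lemma AE_eq_0_if_interval_integrals_0:
  fixes f :: "real \<Rightarrow> 'b::{second_countable_topology, banach}"
  assumes f: "set_integrable lborel {a<..<b} f"
    and iv: "\<And>c d. a < c \<Longrightarrow> c < d \<Longrightarrow> d < b \<Longrightarrow> (LINT x:{c<..<d}|lborel. f x) = 0"
  shows "AE x in lborel. x \<in> {a<..<b} \<longrightarrow> f x = 0"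
proof -
  have 1: "(LINT x:{c<..<d}|lborel. f x) = 0" if cd: "a \<le> c" "c < d" "d \<le> b" for c d
  proof -
    let ?A = "\<lambda>n::nat. {c + (d-c) / (real n + 3) <..< d - (d-c) / (real n + 3)}"
    have U: "(\<Union>n. ?A n) = {c<..<d}"
    proof (intro equalityI subsetI)
      fix x assume "x \<in> (\<Union>n. ?A n)"
      then obtain n where n: "x \<in> ?A n" by auto
      have "(d-c) / (real n + 3) > 0" using cd by auto
      then show "x \<in> {c<..<d}" using n by (auto simp del: zero_less_divide_iff)
    next
      fix x assume x: "x \<in> {c<..<d}"
      have "(\<lambda>n. (d-c) / (real n + 3)) \<longlonglongrightarrow> 0" by real_asymp
      moreover have "min (x-c) (d-x) > 0" using x by auto
      ultimately have "eventually (\<lambda>n. (d-c) / (real n + 3) < min (x-c) (d-x)) sequentially"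
        by (rule order_tendstoD)
      then obtain n where "(d-c) / (real n + 3) < min (x-c) (d-x)"
        by (auto simp: eventually_sequentially)
      then show "x \<in> (\<Union>n. ?A n)" by (intro UN_I[of n]) (auto)
    qed
    have sub: "set_integrable lborel {c<..<d} f"
      by (rule set_integrable_subset[OF f]) (use cd in auto)
    have "(\<lambda>n. LINT x:?A n|lborel. f x) \<longlonglongrightarrow> (LINT x:(\<Union>n. ?A n)|lborel. f x)"
    proof (rule set_integral_cont_up)
      show "incseq ?A"
      proof (rule incseq_SucI)
        fix n
        have "(d-c) / (real (Suc n) + 3) \<le> (d-c) / (real n + 3)"
          using cd by (intro divide_left_mono) auto
        then show "?A n \<subseteq> ?A (Suc n)" by auto
      qed
    qed (use sub U in auto)
    moreover have "(LINT x:?A n|lborel. f x) = 0" for n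
    proof (rule iv)
      have p: "(d-c) / (real n + 3) > 0" using cd by auto
      have h: "(d-c) / (real n + 3) < (d-c) / 2" using cd by (intro divide_strict_left_mono) auto
      show "a < c + (d-c) / (real n + 3)" "d - (d-c) / (real n + 3) < b" using p cd by linarith+
      show "c + (d-c) / (real n + 3) < d - (d-c) / (real n + 3)" using h cd by argo
    qed
    ultimately show ?thesis unfolding U by (simp add: LIMSEQ_const_iff)
  qed
  have "AE x in lborel. indicator {a<..<b} x *\<^sub>R f x = 0"
  proof (rule AE_eq_0_if_box_integrals_0)
    show "integrable lborel (\<lambda>x. indicator {a<..<b} x *\<^sub>R f x)"
      using f by (simp add: set_integrable_def)
    fix c d :: real
    have "(LINT x:box c d|lborel. indicator {a<..<b} x *\<^sub>R f x) = (LINT x:{max a c<..<min b d}|lborel. f x)"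
      unfolding set_lebesgue_integral_def
      by (intro Bochner_Integration.integral_cong) (auto simp: box_real indicator_def)
    also have "\<dots> = 0"
    proof (cases "max a c < min b d")
      case True then show ?thesis by (intro 1) auto
    next
      case False then have "{max a c<..<min b d} = {}" by auto
      then show ?thesis by (simp add: set_lebesgue_integral_def)
    qed
    finally show "(LINT x:box c d|lborel. indicator {a<..<b} x *\<^sub>R f x) = 0" .
  qed
  then show ?thesis by (auto elim!: eventually_mono simp: indicator_def split: if_splits)
qed

section \<open>Completeness of L2\<close>

text \<open>
  A subsequence with square distances \<open>4^(-j)\<close> has summable increments almost everywhere, which gives
  the limit function; Fatou's lemma then transfers every Cauchy estimate to the limit. The conclusion
  keeps the threshold \<open>K\<close> of the Cauchy estimate, so that a family of sequences with common
  thresholds converges with a common rate.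
\<close>

lemma (in finite_measure) Riesz_Fischer:
  fixes f :: "nat \<Rightarrow> 'a \<Rightarrow> real"
  assumes [measurable]: "\<And>n. f n \<in> borel_measurable M"
    and cauchy: "\<And>e. e > 0 \<Longrightarrow> \<exists>K. \<forall>m\<ge>K. \<forall>n\<ge>K. (\<integral>\<^sup>+x. ennreal ((f m x - f n x)\<^sup>2) \<partial>M) \<le> ennreal e"
  obtains F where "F \<in> borel_measurable M"
    "\<And>e K n. (\<And>m n. m \<ge> K \<Longrightarrow> n \<ge> K \<Longrightarrow> (\<integral>\<^sup>+x. ennreal ((f m x - f n x)\<^sup>2) \<partial>M) \<le> ennreal e)
      \<Longrightarrow> n \<ge> K \<Longrightarrow> (\<integral>\<^sup>+x. ennreal ((f n x - F x)\<^sup>2) \<partial>M) \<le> ennreal e"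
proof -
  have "\<exists>K. \<forall>j. \<forall>m\<ge>K j. \<forall>n\<ge>K j. (\<integral>\<^sup>+x. ennreal ((f m x - f n x)\<^sup>2) \<partial>M) \<le> ennreal ((1/4)^j)"
    by (rule choice) (use cauchy in auto)
  then obtain K where K: "\<And>j m n. m \<ge> K j \<Longrightarrow> n \<ge> K j \<Longrightarrow>
      (\<integral>\<^sup>+x. ennreal ((f m x - f n x)\<^sup>2) \<partial>M) \<le> ennreal ((1/4)^j)" by blast
  define r where "r j = (\<Sum>i\<le>j. K i) + j" for j
  have rK: "r j \<ge> K j" for j
    unfolding r_def by (simp add: member_le_sum trans_le_add1)
  have rmono: "r j \<le> r (Suc j)" for j unfolding r_def by simp
  have rge: "r j \<ge> j" for j unfolding r_def by simp
  define d where "d j x = f (r (Suc j)) x - f (r j) x" for j x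
  have [measurable]: "d j \<in> borel_measurable M" for j unfolding d_def by measurable
  have d2: "(\<integral>\<^sup>+x. ennreal ((d j x)\<^sup>2) \<partial>M) \<le> ennreal ((1/4)^j)" for j
    unfolding d_def by (rule K) (use rK[of j] rmono[of j] in auto)
  \<comment> \<open>The inequality \<open>|d| <= 2^j d^2 + 2^(-j)\<close> turns the L2 bound \<open>4^(-j)\<close> into an L1 bound of order \<open>2^(-j)\<close>.\<close>
  have d1: "(\<integral>\<^sup>+x. ennreal \<bar>d j x\<bar> \<partial>M) \<le> ennreal ((1/2)^j * (1 + measure M (space M)))" for j
  proof -
    have "(\<integral>\<^sup>+x. ennreal \<bar>d j x\<bar> \<partial>M) \<le> (\<integral>\<^sup>+x. ennreal (2^j) * ennreal ((d j x)\<^sup>2) + ennreal ((1/2)^j) \<partial>M)"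
    proof (rule nn_integral_mono)
      fix x
      have "\<bar>d j x\<bar> \<le> 2^j * (d j x)\<^sup>2 + (1/2)^j"
      proof -
        have "0 \<le> (2^j * \<bar>d j x\<bar> - 1)\<^sup>2" by simp
        also have "\<dots> = 2^j * (2^j * (d j x)\<^sup>2 - 2 * \<bar>d j x\<bar> + (1/2)^j)"
          by (simp add: power2_eq_square algebra_simps power_one_over)
        finally have "0 \<le> 2^j * (d j x)\<^sup>2 - 2 * \<bar>d j x\<bar> + (1/2)^j"
          by (metis zero_le_mult_iff not_le zero_less_numeral zero_less_power)
        then show ?thesis by (smt (verit) zero_le_power)
      qed
      then show "ennreal \<bar>d j x\<bar> \<le> ennreal (2^j) * ennreal ((d j x)\<^sup>2) + ennreal ((1/2)^j)"
        by (simp flip: ennreal_mult ennreal_plus add: ennreal_leI)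
    qed
    also have "\<dots> = ennreal (2^j) * (\<integral>\<^sup>+x. ennreal ((d j x)\<^sup>2) \<partial>M) + ennreal ((1/2)^j) * ennreal (measure M (space M))"
      by (simp add: nn_integral_add nn_integral_cmult emeasure_eq_measure)
    also have "\<dots> \<le> ennreal (2^j) * ennreal ((1/4)^j) + ennreal ((1/2)^j) * ennreal (measure M (space M))"
      by (intro add_mono mult_left_mono d2) auto
    also have "\<dots> = ennreal (2^j * (1/4)^j + (1/2)^j * measure M (space M))"
      by (simp flip: ennreal_mult ennreal_plus)
    also have "2^j * (1/4)^j = ((1/2)^j :: real)"
      by (simp flip: power_mult_distrib)
    finally show ?thesis by (simp add: algebra_simps)
  qed
  have "(\<integral>\<^sup>+x. (\<Sum>j. ennreal \<bar>d j x\<bar>) \<partial>M) = (\<Sum>j. \<integral>\<^sup>+x. ennreal \<bar>d j x\<bar> \<partial>M)"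
    by (rule nn_integral_suminf) measurable
  also have "\<dots> \<le> (\<Sum>j. ennreal ((1/2)^j * (1 + measure M (space M))))"
    by (intro suminf_le d1) auto
  also have "\<dots> < \<infinity>"
    by (subst suminf_ennreal2) (auto intro!: summable_mult2 summable_geometric)
  finally have "AE x in M. (\<Sum>j. ennreal \<bar>d j x\<bar>) \<noteq> \<infinity>"
    by (intro nn_integral_PInf_AE) auto
  then have conv: "AE x in M. convergent (\<lambda>j. f (r j) x)"
  proof (rule AE_mp, intro AE_I2 impI)
    fix x assume "(\<Sum>j. ennreal \<bar>d j x\<bar>) \<noteq> \<infinity>"
    then have "summable (\<lambda>j. \<bar>d j x\<bar>)" by (intro summable_suminf_not_top) auto
    then have "summable (\<lambda>j. d j x)" by (rule summable_rabs_cancel)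
    then have "convergent (\<lambda>n. \<Sum>j<n. d j x)" by (simp add: summable_iff_convergent)
    moreover have "(\<Sum>j<n. d j x) = f (r n) x - f (r 0) x" for n
      unfolding d_def by (rule sum_lessThan_telescope)
    ultimately have "convergent (\<lambda>n. f (r n) x - f (r 0) x + f (r 0) x)"
      by (intro convergent_add convergent_const) simp
    then show "convergent (\<lambda>j. f (r j) x)" by simp
  qed
  define F where "F x = lim (\<lambda>j. f (r j) x)" for x
  have Fm: "F \<in> borel_measurable M" unfolding F_def by measurable
  show thesis
  proof (rule that[OF Fm])
    fix e K n
    assume c: "\<And>m n. m \<ge> K \<Longrightarrow> n \<ge> K \<Longrightarrow> (\<integral>\<^sup>+x. ennreal ((f m x - f n x)\<^sup>2) \<partial>M) \<le> ennreal e"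
      and n: "n \<ge> K"
    have "(\<integral>\<^sup>+x. ennreal ((f n x - F x)\<^sup>2) \<partial>M)
        = (\<integral>\<^sup>+x. liminf (\<lambda>j. ennreal ((f n x - f (r j) x)\<^sup>2)) \<partial>M)"
    proof (rule nn_integral_cong_AE, rule AE_mp[OF conv], intro AE_I2 impI)
      fix x assume "convergent (\<lambda>j. f (r j) x)"
      then have "(\<lambda>j. f (r j) x) \<longlonglongrightarrow> F x" unfolding F_def by (simp add: convergent_LIMSEQ_iff)
      then have "(\<lambda>j. ennreal ((f n x - f (r j) x)\<^sup>2)) \<longlonglongrightarrow> ennreal ((f n x - F x)\<^sup>2)"
        by (intro tendsto_ennrealI tendsto_intros)
      then show "ennreal ((f n x - F x)\<^sup>2) = liminf (\<lambda>j. ennreal ((f n x - f (r j) x)\<^sup>2))"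
        by (rule lim_imp_Liminf[OF sequentially_bot, symmetric])
    qed
    also have "\<dots> \<le> liminf (\<lambda>j. \<integral>\<^sup>+x. ennreal ((f n x - f (r j) x)\<^sup>2) \<partial>M)"
      by (rule nn_integral_liminf) measurable
    also have "\<dots> \<le> limsup (\<lambda>j. \<integral>\<^sup>+x. ennreal ((f n x - f (r j) x)\<^sup>2) \<partial>M)"
      by (rule Liminf_le_Limsup) auto
    also have "\<dots> \<le> ennreal e"
    proof (rule Limsup_bounded)
      show "eventually (\<lambda>j. (\<integral>\<^sup>+x. ennreal ((f n x - f (r j) x)\<^sup>2) \<partial>M) \<le> ennreal e) sequentially"
        using eventually_ge_at_top[of K]
      proof eventually_elim
        case (elim j)
        then show ?case using c[of n "r j"] n rge[of j] by auto
      qed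
    qed
    finally show "(\<integral>\<^sup>+x. ennreal ((f n x - F x)\<^sup>2) \<partial>M) \<le> ennreal e" .
  qed
qed

section \<open>Completeness of the trigonometric systems\<close>

lemma integrable_mult_bounded:
  fixes f b :: "'a \<Rightarrow> 'b::{banach, second_countable_topology, real_normed_algebra}"
  assumes f: "integrable M f" and b: "b \<in> borel_measurable M" "\<And>x. x \<in> space M \<Longrightarrow> norm (b x) \<le> C"
  shows "integrable M (\<lambda>x. f x * b x)"
proof (rule Bochner_Integration.integrable_bound)
  show "integrable M (\<lambda>x. C * norm (f x))" using f by simp
  show "(\<lambda>x. f x * b x) \<in> borel_measurable M" using f b by auto
  show "AE x in M. norm (f x * b x) \<le> norm (C * norm (f x))"
  proof (rule AE_I2)
    fix x assume "x \<in> space M"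
    then have "norm (f x * b x) \<le> norm (f x) * C"
      by (intro order_trans[OF norm_mult_ineq] mult_left_mono b) auto
    then show "norm (f x * b x) \<le> norm (C * norm (f x))" by (simp add: mult.commute)
  qed
qed

lemma set_integrable_mult_bounded:
  fixes f b :: "'a \<Rightarrow> 'b::{banach, second_countable_topology, real_normed_algebra}"
  assumes "set_integrable M S f" and "b \<in> borel_measurable M" "\<And>x. x \<in> space M \<Longrightarrow> norm (b x) \<le> C"
  shows "set_integrable M S (\<lambda>x. f x * b x)"
  using integrable_mult_bounded[OF assms(1)[unfolded set_integrable_def] assms(2,3)]
  unfolding set_integrable_def by simp

text \<open>
  By the Weierstrass theorem. Composed with a cosine the polynomials become trigonometric polynomials
  that converge boundedly to the indicator of an arc.
\<close>

lemma polynomials_to_step: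
  fixes \<eta> :: real
  obtains a :: "nat \<Rightarrow> nat \<Rightarrow> real" and d :: "nat \<Rightarrow> nat"
  where "\<And>m y. \<bar>y\<bar> \<le> 1 \<Longrightarrow> \<bar>\<Sum>i\<le>d m. a m i * y ^ i\<bar> \<le> 2"
    "\<And>y. \<bar>y\<bar> \<le> 1 \<Longrightarrow> (\<lambda>m. \<Sum>i\<le>d m. a m i * y ^ i) \<longlonglongrightarrow> indicator {\<eta><..} y"
proof -
  define h where "h m y = min 1 (max 0 (real m * (y - \<eta>)))" for m :: nat and y
  have "\<exists>a d. \<forall>y\<in>{-1..1}. \<bar>h m y - (\<Sum>i\<le>d. a i * y ^ i)\<bar> < 1 / real (Suc m)" for m
  proof -
    have "continuous_on {-1..1} (h m)" unfolding h_def by (intro continuous_intros)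
    then obtain g where g: "real_polynomial_function g"
      "\<And>y. y \<in> {-1..1} \<Longrightarrow> \<bar>h m y - g y\<bar> < 1 / real (Suc m)"
      using Stone_Weierstrass_real_polynomial_function[of "{-1..1}" "h m" "1 / real (Suc m)"] by auto
    then show ?thesis unfolding real_polynomial_function_iff_sum by blast
  qed
  then obtain a d where ad: "\<And>m y. \<bar>y\<bar> \<le> 1 \<Longrightarrow> \<bar>h m y - (\<Sum>i\<le>d m. a m i * y ^ i)\<bar> < 1 / real (Suc m)"
    by (metis abs_le_iff atLeastAtMost_iff minus_le_iff)
  show thesis
  proof (rule that)
    fix m and y :: real assume y: "\<bar>y\<bar> \<le> 1"
    have "1 / real (Suc m) \<le> 1" by simp
    moreover have "\<bar>h m y\<bar> \<le> 1" unfolding h_def by auto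
    ultimately show "\<bar>\<Sum>i\<le>d m. a m i * y ^ i\<bar> \<le> 2" using ad[OF y, of m] by linarith
  next
    fix y :: real assume y: "\<bar>y\<bar> \<le> 1"
    have "(\<lambda>m. h m y) \<longlonglongrightarrow> indicator {\<eta><..} y"
    proof (cases "y > \<eta>")
      case True
      then have "eventually (\<lambda>m. real m * (y - \<eta>) \<ge> 1) sequentially"
        by real_asymp
      then have "eventually (\<lambda>m. h m y = 1) sequentially"
        by eventually_elim (auto simp: h_def)
      then show ?thesis using True by (simp add: tendsto_eventually)
    next
      case False
      then have "h m y = 0" for m
        unfolding h_def by (simp add: max_absorb1 mult_nonneg_nonpos)
      then show ?thesis using False by simp
    qed
    moreover have "(\<lambda>m. (\<Sum>i\<le>d m. a m i * y ^ i) - h m y) \<longlonglongrightarrow> 0"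
    proof (rule Lim_null_comparison)
      show "(\<lambda>m. 1 / real (Suc m)) \<longlonglongrightarrow> 0" by real_asymp
      show "eventually (\<lambda>m. norm ((\<Sum>i\<le>d m. a m i * y ^ i) - h m y) \<le> 1 / real (Suc m)) sequentially"
        using ad[OF y] by (intro always_eventually) (auto simp: abs_minus_commute intro: less_imp_le)
    qed
    ultimately show "(\<lambda>m. \<Sum>i\<le>d m. a m i * y ^ i) \<longlonglongrightarrow> indicator {\<eta><..} y"
      using tendsto_add by fastforce
  qed
qed

text \<open>
  If \<open>g\<close> is orthogonal to all powers of \<open>\<tau>\<close>, it is orthogonal to every polynomial in \<open>\<tau>\<close>, and by
  bounded convergence to the indicator of a superlevel set.
\<close>

lemma superlevel_integral_0:
  fixes g :: "real \<Rightarrow> complex" and \<tau> :: "real \<Rightarrow> real"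
  assumes g: "set_integrable lborel S g" and S: "S \<in> sets lborel"
    and \<tau>[measurable]: "\<tau> \<in> borel_measurable lborel" "\<And>x. \<bar>\<tau> x\<bar> \<le> 1"
    and 0: "\<And>i. (LINT x:S|lborel. g x * of_real (\<tau> x ^ i)) = 0"
  shows "(LINT x:{x\<in>S. \<tau> x > \<eta>}|lborel. g x) = 0"
proof -
  obtain a d where b: "\<And>m y. \<bar>y\<bar> \<le> 1 \<Longrightarrow> \<bar>\<Sum>i\<le>d m. a m i * y ^ i\<bar> \<le> (2::real)"
    and l: "\<And>y. \<bar>y\<bar> \<le> 1 \<Longrightarrow> (\<lambda>m. \<Sum>i\<le>d m. a m i * y ^ i) \<longlonglongrightarrow> indicator {\<eta><..} y"
    by (rule polynomials_to_step[of \<eta>]) (rule that)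
  define G where "G x = indicator S x *\<^sub>R g x" for x
  have G: "integrable lborel G" using g unfolding G_def set_integrable_def .
  then have [measurable]: "G \<in> borel_measurable lborel" by auto
  have GI: "integrable lborel (\<lambda>x. G x * of_real (\<tau> x ^ i))" for i
  proof (rule Bochner_Integration.integrable_bound[OF G], measurable)
    show "AE x in lborel. cmod (G x * of_real (\<tau> x ^ i)) \<le> cmod (G x)"
      using \<tau>(2) by (auto intro!: AE_I2 mult_left_le power_le_one simp: norm_mult norm_power)
  qed
  have Z: "(LINT x|lborel. G x * of_real (\<Sum>i\<le>d m. a m i * \<tau> x ^ i)) = 0" for m
  proof -
    have "(LINT x|lborel. G x * of_real (\<Sum>i\<le>d m. a m i * \<tau> x ^ i))
      = (LINT x|lborel. (\<Sum>i\<le>d m. of_real (a m i) * (G x * of_real (\<tau> x ^ i))))"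
      by (simp add: sum_distrib_left algebra_simps)
    also have "\<dots> = (\<Sum>i\<le>d m. of_real (a m i) * (LINT x|lborel. G x * of_real (\<tau> x ^ i)))"
      by (subst Bochner_Integration.integral_sum, rule integrable_mult_right, rule GI, simp)
    also have "\<dots> = 0"
      using 0 by (simp add: G_def set_lebesgue_integral_def)
    finally show ?thesis .
  qed
  have "(\<lambda>m. LINT x|lborel. G x * of_real (\<Sum>i\<le>d m. a m i * \<tau> x ^ i))
      \<longlonglongrightarrow> (LINT x|lborel. G x * of_real (indicator {\<eta><..} (\<tau> x)))"
  proof (rule integral_dominated_convergence)
    show "integrable lborel (\<lambda>x. 2 * cmod (G x))" using G by simp
    show "AE x in lborel. (\<lambda>m. G x * of_real (\<Sum>i\<le>d m. a m i * \<tau> x ^ i))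
        \<longlonglongrightarrow> G x * of_real (indicator {\<eta><..} (\<tau> x))"
      by (intro AE_I2 tendsto_mult tendsto_const tendsto_of_real l \<tau>(2))
    show "AE x in lborel. cmod (G x * of_real (\<Sum>i\<le>d m. a m i * \<tau> x ^ i)) \<le> 2 * cmod (G x)" for m
    proof (rule AE_I2)
      fix x
      have "cmod (G x) * \<bar>\<Sum>i\<le>d m. a m i * \<tau> x ^ i\<bar> \<le> cmod (G x) * 2"
        by (intro mult_left_mono b \<tau>(2)) auto
      then show "cmod (G x * of_real (\<Sum>i\<le>d m. a m i * \<tau> x ^ i)) \<le> 2 * cmod (G x)"
        by (simp only: norm_mult norm_of_real mult.commute)
    qed
  qed measurable
  then have "(LINT x|lborel. G x * of_real (indicator {\<eta><..} (\<tau> x))) = 0"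
    unfolding Z by (simp add: LIMSEQ_const_iff)
  also have "(LINT x|lborel. G x * of_real (indicator {\<eta><..} (\<tau> x))) = (LINT x:{x\<in>S. \<tau> x > \<eta>}|lborel. g x)"
    unfolding set_lebesgue_integral_def G_def
    by (intro Bochner_Integration.integral_cong) (auto simp: indicator_def)
  finally show ?thesis .
qed

text \<open>
  The superlevel sets of \<open>cos (pi x)\<close> are the intervals starting at 0, and multiplication by
  \<open>cos (pi x)\<close> maps the linear span of the cosines into itself.
\<close>

lemma cos_coeffs_determine:
  fixes g :: "real \<Rightarrow> complex"
  assumes g: "set_integrable lborel {0<..<1} g"
    and 0: "\<And>n::nat. (LINT x:{0<..<1}|lborel. g x * of_real (cos (real n * pi * x))) = 0"
  shows "AE x in lborel. x \<in> {0<..<1} \<longrightarrow> g x = 0"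
proof (rule AE_eq_0_if_interval_integrals_0[OF g])
  have gi: "set_integrable lborel {0<..<1} (\<lambda>x. g x * of_real (b x))"
    if "continuous_on UNIV b" "\<And>x. \<bar>b x\<bar> \<le> 1" for b :: "real \<Rightarrow> real"
    by (rule set_integrable_mult_bounded[OF g, where C=1])
      (use that in \<open>auto intro: borel_measurable_continuous_onI\<close>)
  have Z: "(LINT x:{0<..<1}|lborel. g x * of_real (cos (of_int k * pi * x) * cos (pi * x) ^ i)) = 0" for k i
  proof (induction i arbitrary: k)
    case 0
    have "cos (of_int k * pi * x) = cos (real (nat \<bar>k\<bar>) * pi * x)" for x
      by (cases "k \<ge> 0") auto
    then show ?case using assms(2)[of "nat \<bar>k\<bar>"] by simp
  next
    case (Suc i)
    let ?F = "\<lambda>k x. g x * of_real (cos (of_int k * pi * x) * cos (pi * x) ^ i)"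
    have e: "cos (of_int k * pi * x) * cos (pi * x) ^ Suc i =
       (cos (of_int (k+1) * pi * x) * cos (pi * x) ^ i + cos (of_int (k-1) * pi * x) * cos (pi * x) ^ i) / 2" for x
      by (simp add: algebra_simps cos_add cos_diff)
    have i: "set_integrable lborel {0<..<1} (?F k)" for k
      by (rule gi) (auto intro!: continuous_intros mult_le_one power_le_one simp: abs_mult power_abs)
    have "(LINT x:{0<..<1}|lborel. g x * of_real (cos (of_int k * pi * x) * cos (pi * x) ^ Suc i))
      = (LINT x:{0<..<1}|lborel. (?F (k+1) x + ?F (k-1) x) / 2)"
      unfolding e by (intro arg_cong[where f="set_lebesgue_integral lborel _"] ext) (simp add: algebra_simps)
    also have "\<dots> = ((LINT x:{0<..<1}|lborel. ?F (k+1) x) + (LINT x:{0<..<1}|lborel. ?F (k-1) x)) / 2"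
      by (subst set_integral_divide_zero, subst set_integral_add(2)[OF i i]) simp
    also have "\<dots> = 0" by (simp only: Suc.IH) simp
    finally show ?case .
  qed
  have L: "(LINT x:{0<..<d}|lborel. g x) = 0" if d: "0 < d" "d < 1" for d
  proof -
    have "(LINT x:{x\<in>{0<..<1}. cos (pi * x) > cos (pi * d)}|lborel. g x) = 0"
      by (rule superlevel_integral_0[OF g]) (use Z[of 0] in auto)
    also have "{x\<in>{0<..<1}. cos (pi * x) > cos (pi * d)} = {0<..<d}"
    proof -
      have "cos (pi * x) > cos (pi * d) \<longleftrightarrow> x < d" if "0 < x" "x < 1" for x
        using that d by (subst cos_mono_less_eq) auto
      then show ?thesis using d by auto
    qed
    finally show ?thesis .
  qed
  fix c d :: real assume cd: "0 < c" "c < d" "d < 1"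
  have si: "set_integrable lborel S g" if "S \<subseteq> {0<..<1}" "S \<in> sets borel" for S
    by (rule set_integrable_subset[OF g]) (use that in auto)
  have sm: "set_borel_measurable lborel S g" if "S \<subseteq> {0<..<1}" "S \<in> sets borel" for S
    using si[OF that] unfolding set_integrable_def set_borel_measurable_def by auto
  have "{0<..<d} = {0<..c} \<union> {c<..<d}" using cd by auto
  then have "(LINT x:{0<..<d}|lborel. g x) = (LINT x:{0<..c}|lborel. g x) + (LINT x:{c<..<d}|lborel. g x)"
    using cd by (auto intro!: set_integral_Un si)
  moreover have "(LINT x:{0<..c}|lborel. g x) = (LINT x:{0<..<c}|lborel. g x)"
  proof (rule set_integral_cong_set)
    have "AE x in lborel. x \<noteq> c" by (rule AE_lborel_singleton)
    then show "AE x in lborel. (x \<in> {0<..<c}) = (x \<in> {0<..c})" by eventually_elim auto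
  qed (use cd in \<open>auto intro!: sm\<close>)
  ultimately show "(LINT x:{c<..<d}|lborel. g x) = 0" using L[of c] L[of d] cd by simp
qed

text \<open>
  An interval inside the period with midpoint \<open>c\<close> is a superlevel set of \<open>cos (\<omega> (t - c))\<close>, and
  multiplication by this function shifts the frequencies by one.
\<close>

lemma exp_coeffs_determine:
  fixes g :: "real \<Rightarrow> complex"
  assumes w: "\<omega> > 0" and g0: "set_integrable lborel {0..2*pi/\<omega>} g"
    and 0: "\<And>k::int. (LINT t:{0..2*pi/\<omega>}|lborel. g t * exp (- \<i> * of_int k * of_real \<omega> * of_real t)) = 0"
  shows "AE t in lborel. t \<in> {0..2*pi/\<omega>} \<longrightarrow> g t = 0"
proof -
  let ?T = "2*pi/\<omega>"
  have T: "?T > 0" using w by simp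
  have g: "set_integrable lborel {0<..<?T} g" by (rule set_integrable_subset[OF g0]) auto
  have gi: "set_integrable lborel {0..?T} (\<lambda>x. g x * b x)"
    if "continuous_on UNIV b" "\<And>x. cmod (b x) \<le> 1" for b :: "real \<Rightarrow> complex"
    by (rule set_integrable_mult_bounded[OF g0, where C=1])
      (use that in \<open>auto intro: borel_measurable_continuous_onI\<close>)
  have "AE t in lborel. t \<in> {0<..<?T} \<longrightarrow> g t = 0"
  proof (rule AE_eq_0_if_interval_integrals_0[OF g])
    fix a b :: real assume ab: "0 < a" "a < b" "b < ?T"
    define c \<delta> where "c = (a+b)/2" and "\<delta> = (b-a)/2"
    have cd: "\<delta> > 0" "c - \<delta> = a" "c + \<delta> = b" using ab by (auto simp: c_def \<delta>_def field_simps)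
    let ?e = "\<lambda>k::int. \<lambda>t. exp (- \<i> * of_int k * of_real \<omega> * of_real t) :: complex"
    have Z: "(LINT t:{0..?T}|lborel. g t * (?e k t * of_real (cos (\<omega> * (t - c)) ^ i))) = 0" for k i
    proof (induction i arbitrary: k)
      case 0 then show ?case using assms(3)[of k] by simp
    next
      case (Suc i)
      let ?F = "\<lambda>k t. g t * (?e k t * of_real (cos (\<omega> * (t - c)) ^ i))"
      define A where "A = exp (- \<i> * of_real (\<omega> * c)) / 2"
      define B where "B = exp (\<i> * of_real (\<omega> * c)) / 2"
      have co: "of_real (cos (\<omega> * (t - c))) = A * ?e (-1) t + B * ?e 1 t" for t
      proof -
        have "of_real (cos (\<omega> * (t - c))) = (exp (\<i> * of_real (\<omega> * (t - c))) + exp (- (\<i> * of_real (\<omega> * (t - c))))) / (2::complex)"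
          by (metis cos_exp_eq cos_of_real)
        moreover have "exp (\<i> * of_real (\<omega> * (t - c))) = 2 * (A * ?e (-1) t)"
          unfolding A_def by (simp add: right_diff_distrib mult_ac flip: exp_add)
        moreover have "exp (- (\<i> * of_real (\<omega> * (t - c)))) = 2 * (B * ?e 1 t)"
          unfolding B_def by (simp add: right_diff_distrib mult_ac flip: exp_add)
        ultimately show ?thesis by (simp only: add_divide_distrib) simp
      qed
      have ee: "?e k t * ?e l t = ?e (k + l) t" for k l t
      proof -
        have "- \<i> * of_int k * of_real \<omega> * of_real t + - \<i> * of_int l * of_real \<omega> * of_real t
          = - \<i> * of_int (k + l) * of_real \<omega> * (of_real t :: complex)" by (simp add: algebra_simps)
        then show ?thesis by (simp only: exp_add[symmetric])
      qed
      have e: "?F k t * (A * ?e (-1) t + B * ?e 1 t) = A * ?F (k - 1) t + B * ?F (k + 1) t" for t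
        unfolding diff_conv_add_uminus ee[symmetric] by (simp only: ring_distribs mult_ac)
      have i: "set_integrable lborel {0..?T} (?F k)" for k
        by (rule gi) (auto intro!: continuous_intros power_le_one simp: norm_mult norm_power power_abs norm_exp_eq_Re)
      have "(LINT t:{0..?T}|lborel. g t * (?e k t * of_real (cos (\<omega> * (t - c)) ^ Suc i)))
        = (LINT t:{0..?T}|lborel. A * ?F (k - 1) t + B * ?F (k + 1) t)"
      proof (intro arg_cong[where f="set_lebesgue_integral lborel _"] ext)
        fix t
        show "g t * (?e k t * of_real (cos (\<omega> * (t - c)) ^ Suc i)) = A * ?F (k - 1) t + B * ?F (k + 1) t"
          unfolding e[symmetric] co[symmetric] power_Suc of_real_mult by (simp only: mult_ac)
      qed
      also have "\<dots> = A * (LINT t:{0..?T}|lborel. ?F (k - 1) t) + B * (LINT t:{0..?T}|lborel. ?F (k + 1) t)"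
        by (subst set_integral_add(2)[OF set_integrable_mult_right[OF i] set_integrable_mult_right[OF i]]) simp_all
      also have "\<dots> = 0" by (simp only: Suc.IH) simp
      finally show ?case .
    qed
    have "(LINT t:{t\<in>{0..?T}. cos (\<omega> * (t - c)) > cos (\<omega> * \<delta>)}|lborel. g t) = 0"
      by (rule superlevel_integral_0[OF g0]) (use Z[of 0] in auto)
    also have "{t\<in>{0..?T}. cos (\<omega> * (t - c)) > cos (\<omega> * \<delta>)} = {a<..<b}"
    proof -
      have d: "\<omega> * \<delta> > 0" "\<omega> * \<delta> < pi"
      proof -
        have "\<omega> * (b - a) < \<omega> * ?T" using ab w by (intro mult_strict_left_mono) auto
        then show "\<omega> * \<delta> < pi" using w by (simp add: \<delta>_def)
      qed (use w cd in auto)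
      have "cos (\<omega> * (t - c)) > cos (\<omega> * \<delta>) \<longleftrightarrow> \<bar>t - c\<bar> < \<delta>" if t: "0 \<le> t" "t \<le> ?T" for t
      proof -
        have eq: "cos (\<omega> * (t - c)) = cos (\<omega> * \<bar>t - c\<bar>)"
          using w by (metis abs_mult abs_of_pos cos_abs_real)
        show ?thesis
        proof (cases "\<omega> * \<bar>t - c\<bar> \<le> pi")
          case True
          then have "cos (\<omega> * \<bar>t - c\<bar>) > cos (\<omega> * \<delta>) \<longleftrightarrow> \<omega> * \<bar>t - c\<bar> < \<omega> * \<delta>"
            using d w by (intro cos_mono_less_eq) auto
          then show ?thesis using eq w by simp
        next
          case False
          have "\<bar>t - c\<bar> < ?T - \<delta>" using t cd ab by (auto simp: abs_if)
          then have "\<omega> * \<bar>t - c\<bar> < \<omega> * (?T - \<delta>)" using w by simp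
          then have lt: "\<omega> * \<bar>t - c\<bar> < 2 * pi - \<omega> * \<delta>" using w by (simp add: algebra_simps)
          have "cos (2 * pi - \<omega> * \<bar>t - c\<bar>) < cos (\<omega> * \<delta>)"
            using d lt False by (subst cos_mono_less_eq) auto
          then have "cos (\<omega> * \<bar>t - c\<bar>) < cos (\<omega> * \<delta>)"
            by (simp add: cos_diff)
          moreover have "\<omega> * \<bar>t - c\<bar> > \<omega> * \<delta>" using False d by linarith
          ultimately show ?thesis using eq w by simp
        qed
      qed
      then show ?thesis using cd ab by (fastforce simp: abs_if split: if_splits)
    qed
    finally show "(LINT t:{a<..<b}|lborel. g t) = 0" .
  qed
  moreover have "AE t in lborel. t \<noteq> 0" "AE t in lborel. t \<noteq> ?T"
    by (auto intro: AE_lborel_singleton)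
  ultimately show ?thesis
    by eventually_elim auto
qed

section \<open>Smooth functions of one variable and cutoffs\<close>

text \<open>
  Levels of differentiability, as a recursive predicate on functions: closure under products and
  quotients is then a plain induction on the level.
\<close>

primrec n_diff :: "nat \<Rightarrow> (real \<Rightarrow> real) \<Rightarrow> bool" where
  "n_diff 0 f \<longleftrightarrow> True"
| "n_diff (Suc n) f \<longleftrightarrow> (\<exists>f'. (\<forall>x. (f has_real_derivative f' x) (at x)) \<and> n_diff n f')"

definition smooth_real :: "(real \<Rightarrow> real) \<Rightarrow> bool" where
  "smooth_real f \<longleftrightarrow> (\<forall>n. n_diff n f)"

lemma n_diff_Suc_imp: "n_diff (Suc n) f \<Longrightarrow> n_diff n f"
  by (induction n arbitrary: f) (simp, metis n_diff.simps(2))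

lemma n_diff_SucI: "\<forall>x. (f has_real_derivative f' x) (at x) \<Longrightarrow> n_diff n f' \<Longrightarrow> n_diff (Suc n) f"
  by auto

lemma n_diff_const: "n_diff n (\<lambda>_. c)"
proof (induction n arbitrary: c)
  case (Suc n)
  show ?case by (auto intro!: exI[of _ "\<lambda>_. 0"] Suc)
qed simp

lemma n_diff_add: "n_diff n f \<Longrightarrow> n_diff n g \<Longrightarrow> n_diff n (\<lambda>x. f x + g x)"
proof (induction n arbitrary: f g)
  case (Suc n)
  then obtain f' g' where d: "\<And>x. (f has_real_derivative f' x) (at x)" "n_diff n f'"
    "\<And>x. (g has_real_derivative g' x) (at x)" "n_diff n g'" by auto
  then have "\<forall>x. ((\<lambda>x. f x + g x) has_real_derivative (\<lambda>x. f' x + g' x) x) (at x)"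
    by (auto intro!: derivative_intros)
  moreover have "n_diff n (\<lambda>x. f' x + g' x)" using d Suc.IH by blast
  ultimately show ?case by (rule n_diff_SucI)
qed simp

lemma n_diff_mult: "n_diff n f \<Longrightarrow> n_diff n g \<Longrightarrow> n_diff n (\<lambda>x. f x * g x)"
proof (induction n arbitrary: f g)
  case (Suc n)
  then obtain f' g' where d: "\<And>x. (f has_real_derivative f' x) (at x)" "n_diff n f'"
    "\<And>x. (g has_real_derivative g' x) (at x)" "n_diff n g'" by auto
  then have "\<forall>x. ((\<lambda>x. f x * g x) has_real_derivative (\<lambda>x. f' x * g x + f x * g' x) x) (at x)"
    by (auto intro!: derivative_eq_intros)
  moreover have "n_diff n (\<lambda>x. f' x * g x + f x * g' x)"
    by (intro n_diff_add Suc.IH d n_diff_Suc_imp[OF Suc.prems(1)] n_diff_Suc_imp[OF Suc.prems(2)])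
  ultimately show ?case by (rule n_diff_SucI)
qed simp

lemma n_diff_inverse: "n_diff n f \<Longrightarrow> (\<And>x. f x \<noteq> 0) \<Longrightarrow> n_diff n (\<lambda>x. 1 / f x)"
proof (induction n arbitrary: f)
  case (Suc n)
  then obtain f' where d: "\<And>x. (f has_real_derivative f' x) (at x)" "n_diff n f'" by auto
  then have "\<forall>x. ((\<lambda>x. 1 / f x) has_real_derivative (\<lambda>x. (- 1) * (f' x * ((1 / f x) * (1 / f x)))) x) (at x)"
    using Suc.prems(2) by (auto intro!: derivative_eq_intros simp: power2_eq_square)
  moreover have "n_diff n (\<lambda>x. (- 1) * (f' x * ((1 / f x) * (1 / f x))))"
    using Suc.prems(2)
    by (intro n_diff_mult n_diff_const d Suc.IH n_diff_Suc_imp[OF Suc.prems(1)]) auto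
  ultimately show ?case by (rule n_diff_SucI)
qed simp

lemma n_diff_affine: "n_diff n f \<Longrightarrow> n_diff n (\<lambda>x. f (c * x + d))"
proof (induction n arbitrary: f)
  case (Suc n)
  then obtain f' where d: "\<And>x. (f has_real_derivative f' x) (at x)" "n_diff n f'" by auto
  have "\<forall>x. ((\<lambda>x. f (c * x + d)) has_real_derivative (\<lambda>x. c * f' (c * x + d)) x) (at x)"
  proof
    fix x
    have "((\<lambda>x. c * x + d) has_real_derivative c) (at x)" by (auto intro!: derivative_eq_intros)
    from DERIV_chain2[OF d(1) this]
    show "((\<lambda>x. f (c * x + d)) has_real_derivative c * f' (c * x + d)) (at x)" by (simp add: mult.commute)
  qed
  moreover have "n_diff n (\<lambda>x. c * f' (c * x + d))"
    by (intro n_diff_mult n_diff_const Suc.IH d)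
  ultimately show ?case by (rule n_diff_SucI)
qed simp

lemma n_diff_trig: "n_diff n (\<lambda>x. A * cos (c * x) + B * sin (c * x))"
proof (induction n arbitrary: A B)
  case (Suc n)
  have "\<forall>x. ((\<lambda>x. A * cos (c * x) + B * sin (c * x)) has_real_derivative (\<lambda>x. (B * c) * cos (c * x) + (- A * c) * sin (c * x)) x) (at x)"
    by (auto intro!: derivative_eq_intros)
  then show ?case by (rule n_diff_SucI) (rule Suc)
qed simp

lemma smooth_real_const: "smooth_real (\<lambda>_. c)"
  and smooth_real_add: "smooth_real f \<Longrightarrow> smooth_real g \<Longrightarrow> smooth_real (\<lambda>x. f x + g x)"
  and smooth_real_mult: "smooth_real f \<Longrightarrow> smooth_real g \<Longrightarrow> smooth_real (\<lambda>x. f x * g x)"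
  and smooth_real_inverse: "smooth_real f \<Longrightarrow> (\<And>x. f x \<noteq> 0) \<Longrightarrow> smooth_real (\<lambda>x. 1 / f x)"
  and smooth_real_affine: "smooth_real f \<Longrightarrow> smooth_real (\<lambda>x. f (c * x + d))"
  and smooth_real_cos: "smooth_real (\<lambda>x. cos (c * x))"
  and smooth_real_sin: "smooth_real (\<lambda>x. sin (c * x))"
  unfolding smooth_real_def
  using n_diff_const n_diff_add n_diff_mult n_diff_inverse n_diff_affine
    n_diff_trig[of _ 1 c 0] n_diff_trig[of _ 0 c 1] by auto

lemma smooth_real_DERIV: "smooth_real f \<Longrightarrow> (f has_real_derivative deriv f x) (at x)"
  unfolding smooth_real_def using n_diff.simps(2)[of 0 f] by (metis DERIV_imp_deriv)

lemma smooth_real_deriv: "smooth_real f \<Longrightarrow> smooth_real (deriv f)"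
  unfolding smooth_real_def
proof
  fix n assume "\<forall>n. n_diff n f"
  then obtain f' where f': "\<And>x. (f has_real_derivative f' x) (at x)" "n_diff n f'"
    using n_diff.simps(2)[of n f] by blast
  then have "deriv f = f'" using DERIV_imp_deriv by blast
  with f' show "n_diff n (deriv f)" by simp
qed

lemma smooth_real_continuous_on: "smooth_real f \<Longrightarrow> continuous_on S f"
  by (meson DERIV_continuous continuous_at_imp_continuous_on smooth_real_DERIV)

lemma deriv_mult_smooth:
  "smooth_real f \<Longrightarrow> smooth_real g \<Longrightarrow> deriv (\<lambda>x. f x * g x) x = deriv f x * g x + f x * deriv g x"
  by (rule DERIV_imp_deriv) (auto intro!: derivative_eq_intros smooth_real_DERIV)

lemma poly_exp_minus_tendsto_0: "((\<lambda>y. poly p y * exp (- y)) \<longlongrightarrow> (0::real)) at_top"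
proof -
  have "((\<lambda>y. \<Sum>i\<le>degree p. coeff p i * (y ^ i / exp y)) \<longlongrightarrow> (\<Sum>i\<le>degree p. coeff p i * 0)) at_top"
    by (intro tendsto_intros tendsto_power_div_exp_0)
  then show ?thesis
    by (simp add: poly_altdef sum_distrib_right exp_minus divide_inverse mult.assoc)
qed

text \<open>
  The functions \<open>p (1/x) exp (-1/x)\<close>, extended by zero, are closed under differentiation.
\<close>

lemma n_diff_flat: "n_diff n (\<lambda>x. if x > 0 then poly p (1 / x) * exp (- (1 / x)) else 0)"
proof (induction n arbitrary: p)
  case (Suc n)
  let ?F = "\<lambda>p x. if x > 0 then poly p (1 / x) * exp (- (1 / x)) else 0 :: real"
  \<comment> \<open>The factor \<open>y^2\<close> comes from differentiating \<open>y = 1/x\<close>.\<close>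
  let ?q = "(p - pderiv p) * [:0, 0, 1:]"
  have "(?F p has_real_derivative ?F ?q x) (at x)" for x
  proof -
    consider "x < 0" | "x > 0" | "x = 0" by linarith
    then show ?thesis
    proof cases
      case 1
      have "((\<lambda>_. 0) has_real_derivative ?F ?q x) (at x)" using 1 by simp
      moreover have "eventually (\<lambda>y. y < 0) (nhds x)" using 1 eventually_nhds_in_open[of "{..<0}" x] by simp
      then have "eventually (\<lambda>y. ?F p y = 0) (nhds x)" by eventually_elim auto
      ultimately show ?thesis by (subst DERIV_cong_ev[OF refl _ refl]) auto
    next
      case 2
      have "((\<lambda>x. poly p (1 / x) * exp (- (1 / x))) has_real_derivative
          (poly (pderiv p) (1 / x) * (- 1 / x\<^sup>2)) * exp (- (1 / x)) + poly p (1 / x) * (exp (- (1 / x)) * (1 / x\<^sup>2))) (at x)"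
        using 2 by (auto intro!: derivative_eq_intros DERIV_chain2[OF poly_DERIV] simp: power2_eq_square)
      also have "(poly (pderiv p) (1 / x) * (- 1 / x\<^sup>2)) * exp (- (1 / x)) + poly p (1 / x) * (exp (- (1 / x)) * (1 / x\<^sup>2)) = ?F ?q x"
        using 2 by (simp add: power2_eq_square field_simps)
      finally have "((\<lambda>x. poly p (1 / x) * exp (- (1 / x))) has_real_derivative ?F ?q x) (at x)" .
      moreover have "eventually (\<lambda>y. y > 0) (nhds x)" using 2 eventually_nhds_in_open[of "{0<..}" x] by simp
      then have "eventually (\<lambda>y. ?F p y = poly p (1 / y) * exp (- (1 / y))) (nhds x)" by eventually_elim auto
      ultimately show ?thesis by (subst DERIV_cong_ev[OF refl _ refl]) auto
    next
      case 3
      have "((\<lambda>y. ?F p y / y) \<longlongrightarrow> 0) (at_right 0)"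
      proof -
        have "((\<lambda>y. poly ([:0,1:] * p) (1 / y) * exp (- (1 / y))) \<longlongrightarrow> 0) (at_right 0)"
          by (rule filterlim_compose[OF poly_exp_minus_tendsto_0])
            (simp add: filterlim_inverse_at_top_right flip: inverse_eq_divide)
        moreover have "eventually (\<lambda>y. y > (0::real)) (at_right 0)" by (simp add: eventually_at_right_less)
        then have "eventually (\<lambda>y. poly ([:0,1:] * p) (1 / y) * exp (- (1 / y)) = ?F p y / y) (at_right 0)"
          by eventually_elim auto
        ultimately show ?thesis by (rule Lim_transform_eventually)
      qed
      moreover have "((\<lambda>y. ?F p y / y) \<longlongrightarrow> 0) (at_left 0)"
      proof (rule tendsto_eventually)
        have "eventually (\<lambda>y. y < (0::real)) (at_left 0)" by (simp add: eventually_at_filter)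
        then show "eventually (\<lambda>y. ?F p y / y = 0) (at_left 0)" by eventually_elim auto
      qed
      ultimately have "((\<lambda>y. ?F p y / y) \<longlongrightarrow> 0) (at 0)" by (simp add: filterlim_split_at)
      then show ?thesis using 3 by (simp add: has_field_derivative_iff)
    qed
  qed
  then have "\<forall>x. (?F p has_real_derivative ?F ?q x) (at x)" by blast
  then show ?case by (rule n_diff_SucI) (rule Suc)
qed simp

text \<open>
  The classical smooth function that is flat at the origin.
\<close>

definition flat :: "real \<Rightarrow> real" where
  "flat x = (if x > 0 then exp (- (1 / x)) else 0)"

lemma smooth_flat: "smooth_real flat"
  unfolding smooth_real_def
proof
  fix n
  show "n_diff n flat" using n_diff_flat[of n 1] by (simp add: flat_def[abs_def] cong: if_cong)
qed

lemma flat_pos: "flat x + flat (1 - x) > 0"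
  by (auto simp: flat_def intro: add_pos_pos)

definition step :: "real \<Rightarrow> real" where
  "step x = flat x * (1 / (flat x + flat (1 - x)))"

lemma smooth_step: "smooth_real step"
proof -
  have "smooth_real (\<lambda>x. flat ((-1) * x + 1))" by (rule smooth_real_affine[OF smooth_flat])
  then have "smooth_real (\<lambda>x. flat (1 - x))" by (simp add: algebra_simps)
  moreover have "flat x + flat (1 - x) \<noteq> 0" for x using flat_pos[of x] by linarith
  ultimately show ?thesis unfolding step_def
    by (intro smooth_real_mult smooth_flat smooth_real_inverse smooth_real_add)
qed

lemma step_eq_0: "x \<le> 0 \<Longrightarrow> step x = 0"
  by (simp add: step_def flat_def)

lemma step_eq_1: "x \<ge> 1 \<Longrightarrow> step x = 1"
  by (simp add: step_def flat_def)

lemma step_bounds: "0 \<le> step x" "step x \<le> 1"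
proof -
  have "flat y \<ge> 0" for y by (simp add: flat_def)
  from this[of x] this[of "1 - x"] flat_pos[of x] show "0 \<le> step x" "step x \<le> 1"
    by (auto simp: step_def)
qed

text \<open>
  Smooth functions supported in \<open>[a, b]\<close> that increase to the indicator of the open interval; the
  parameter \<open>m\<close> is the steepness of the two flanks.
\<close>

definition bump :: "real \<Rightarrow> real \<Rightarrow> nat \<Rightarrow> real \<Rightarrow> real" where
  "bump a b m x = step (real m * (x - a)) * step (real m * (b - x))"

lemma smooth_bump: "smooth_real (bump a b m)"
proof -
  have "smooth_real (\<lambda>x. step (real m * x + (- real m * a)))" "smooth_real (\<lambda>x. step ((- real m) * x + real m * b))"
    by (intro smooth_real_affine smooth_step)+
  from smooth_real_mult[OF this] show ?thesis
    unfolding bump_def by (simp add: algebra_simps)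
qed

lemma bump_eq_0: "x \<le> a \<or> x \<ge> b \<Longrightarrow> bump a b m x = 0"
  unfolding bump_def by (auto simp: step_eq_0 mult_nonneg_nonpos)

lemma bump_bounds: "0 \<le> bump a b m x" "bump a b m x \<le> 1"
  unfolding bump_def using step_bounds by (auto intro!: mult_le_one)

lemma bump_tendsto: "(\<lambda>m. bump a b m x) \<longlonglongrightarrow> indicator {a<..<b} x"
proof (cases "a < x \<and> x < b")
  case True
  then have "eventually (\<lambda>m. real m * (x - a) \<ge> 1) sequentially" "eventually (\<lambda>m. real m * (b - x) \<ge> 1) sequentially"
    by real_asymp+
  then have "eventually (\<lambda>m. bump a b m x = 1) sequentially"
    by eventually_elim (simp add: bump_def step_eq_1)
  then show ?thesis using True by (simp add: tendsto_eventually)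
next
  case False
  then have "bump a b m x = 0" for m by (intro bump_eq_0) auto
  then show ?thesis using False by (auto simp: indicator_def)
qed

section \<open>Test functions on the strip and uniqueness of generalized derivatives\<close>

lemma pd_x_product: "smooth_real a \<Longrightarrow> pd_x (\<lambda>(x,t). a x * b t) = (\<lambda>(x,t). deriv a x * b t)"
  unfolding pd_x_def
  by (auto intro!: ext DERIV_imp_deriv derivative_eq_intros smooth_real_DERIV)

lemma pd_t_product: "smooth_real b \<Longrightarrow> pd_t (\<lambda>(x,t). a x * b t) = (\<lambda>(x,t). a x * deriv b t)"
  unfolding pd_t_def
  by (auto intro!: ext DERIV_imp_deriv derivative_eq_intros smooth_real_DERIV)

text \<open>
  All iterated partial derivatives of \<open>a(x) b(t)\<close> are again of this form.
\<close>

lemma test_function_product: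
  assumes ab: "smooth_real a" "smooth_real b"
    and "0 < \<alpha>" "\<beta> < 1" and a0: "\<And>x. x \<notin> {\<alpha>..\<beta>} \<Longrightarrow> a x = 0" and b0: "\<And>t. t \<notin> {c..d} \<Longrightarrow> b t = 0"
  shows "test_function (\<lambda>(x,t). a x * b t)"
  unfolding test_function_def
proof
  show "\<exists>K. compact K \<and> K \<subseteq> strip \<and> (\<forall>z. z \<notin> K \<longrightarrow> (case z of (x, t) \<Rightarrow> a x * b t) = 0)"
    using assms by (intro exI[of _ "{\<alpha>..\<beta>} \<times> {c..d}"]) (auto simp: strip_def compact_Times)
  have "\<exists>a' b'. smooth_real a' \<and> smooth_real b' \<and> foldr (\<lambda>d. d) ds (\<lambda>(x,t). a x * b t) = (\<lambda>(x,t). a' x * b' t)"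
    if "ds \<in> lists {pd_x, pd_t}" for ds
    using that
  proof (induction ds)
    case Nil then show ?case using ab by auto
  next
    case (Cons D ds)
    then obtain a' b' where s: "smooth_real a'" "smooth_real b'"
      and eq: "foldr (\<lambda>d. d) ds (\<lambda>(x,t). a x * b t) = (\<lambda>(x,t). a' x * b' t)" by auto
    have "D = pd_x \<or> D = pd_t" using Cons(1) by blast
    then show ?case
    proof
      assume "D = pd_x"
      then have "foldr (\<lambda>d. d) (D # ds) (\<lambda>(x,t). a x * b t) = (\<lambda>(x,t). deriv a' x * b' t)"
        using eq s by (simp add: pd_x_product)
      then show ?case using s smooth_real_deriv by blast
    next
      assume "D = pd_t"
      then have "foldr (\<lambda>d. d) (D # ds) (\<lambda>(x,t). a x * b t) = (\<lambda>(x,t). a' x * deriv b' t)"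
        using eq s by (simp add: pd_t_product)
      then show ?case using s smooth_real_deriv by blast
    qed
  qed
  moreover have "(\<lambda>(x,t). a' x * b' t) differentiable_on UNIV" if "smooth_real a'" "smooth_real b'" for a' b'
  proof -
    have "((\<lambda>z. a' (fst z) * b' (snd z)) has_derivative
      (\<lambda>h. a' (fst z) * (snd h * deriv b' (snd z)) + (fst h * deriv a' (fst z)) * b' (snd z))) (at z)" for z
      by (auto intro!: derivative_eq_intros
         has_derivative_compose[OF has_derivative_fst[OF has_derivative_ident] smooth_real_DERIV[OF that(1), unfolded has_field_derivative_def]]
         has_derivative_compose[OF has_derivative_snd[OF has_derivative_ident] smooth_real_DERIV[OF that(2), unfolded has_field_derivative_def]])
    then show ?thesis
      by (auto simp: differentiable_on_def differentiable_def case_prod_unfold intro: has_derivative_at_withinI)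
  qed
  ultimately show "\<forall>ds\<in>lists {pd_x, pd_t}. foldr (\<lambda>d. d) ds (\<lambda>(x,t). a x * b t) differentiable_on UNIV"
    by metis
qed

lemma test_function_pd:
  assumes "test_function \<phi>"
  shows "test_function (pd_x \<phi>)" "test_function (pd_t \<phi>)"
proof -
  obtain K where K: "compact K" "K \<subseteq> strip" "\<And>z. z \<notin> K \<Longrightarrow> \<phi> z = 0"
    and d: "\<And>ds. ds \<in> lists {pd_x, pd_t} \<Longrightarrow> foldr (\<lambda>d. d) ds \<phi> differentiable_on UNIV"
    using assms unfolding test_function_def by blast
  have op: "open (- K)" using K(1) by (simp add: compact_imp_closed open_Compl)
  have "pd_x \<phi> z = 0" if "z \<notin> K" for z
  proof -
    obtain x t where z: "z = (x, t)" by fastforce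
    have "open ((\<lambda>s. (s, t)) -` (- K))" by (intro open_vimage op continuous_intros)
    moreover have "x \<in> (\<lambda>s. (s, t)) -` (- K)" using that z by auto
    ultimately have "eventually (\<lambda>s. s \<in> (\<lambda>s. (s, t)) -` (- K)) (nhds x)" by (rule eventually_nhds_in_open)
    then have "eventually (\<lambda>s. \<phi> (s, t) = 0) (nhds x)" by eventually_elim (auto intro: K(3))
    then have "deriv (\<lambda>s. \<phi> (s, t)) x = deriv (\<lambda>_. 0) x" by (rule deriv_cong_ev) simp
    then show ?thesis by (simp add: pd_x_def z)
  qed
  moreover have "pd_t \<phi> z = 0" if "z \<notin> K" for z
  proof -
    obtain x t where z: "z = (x, t)" by fastforce
    have "open ((\<lambda>s. (x, s)) -` (- K))" by (intro open_vimage op continuous_intros)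
    moreover have "t \<in> (\<lambda>s. (x, s)) -` (- K)" using that z by auto
    ultimately have "eventually (\<lambda>s. s \<in> (\<lambda>s. (x, s)) -` (- K)) (nhds t)" by (rule eventually_nhds_in_open)
    then have "eventually (\<lambda>s. \<phi> (x, s) = 0) (nhds t)" by eventually_elim (auto intro: K(3))
    then have "deriv (\<lambda>s. \<phi> (x, s)) t = deriv (\<lambda>_. 0) t" by (rule deriv_cong_ev) simp
    then show ?thesis by (simp add: pd_t_def z)
  qed
  moreover have "foldr (\<lambda>d. d) ds (D \<phi>) differentiable_on UNIV" if "ds \<in> lists {pd_x, pd_t}" "D \<in> {pd_x, pd_t}" for ds D
    using d[of "ds @ [D]"] that by simp
  ultimately show "test_function (pd_x \<phi>)" "test_function (pd_t \<phi>)"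
    unfolding test_function_def using K(1,2) by blast+
qed

lemma test_function_DERIV:
  assumes "test_function \<phi>"
  shows "((\<lambda>s. \<phi> (s, t)) has_real_derivative pd_x \<phi> (x, t)) (at x)"
    and "((\<lambda>s. \<phi> (x, s)) has_real_derivative pd_t \<phi> (x, t)) (at t)"
proof -
  have "\<phi> differentiable_on UNIV"
    using assms unfolding test_function_def by (elim conjE bspec[of _ _ "[]", elim_format]) auto
  then have dz: "\<phi> differentiable (at z)" for z unfolding differentiable_on_def by blast
  have "(\<lambda>s. \<phi> (s, t)) differentiable (at x)"
  proof -
    have "(\<lambda>s. (s, t)) differentiable (at x)"
      unfolding differentiable_def by (rule exI, rule has_derivative_Pair[OF has_derivative_ident has_derivative_const])
    from differentiable_chain_at[OF this dz] show ?thesis by (simp add: o_def)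
  qed
  then show "((\<lambda>s. \<phi> (s, t)) has_real_derivative pd_x \<phi> (x, t)) (at x)"
    by (simp add: pd_x_def DERIV_deriv_iff_real_differentiable)
  have "(\<lambda>s. \<phi> (x, s)) differentiable (at t)"
  proof -
    have "(\<lambda>s. (x, s)) differentiable (at t)"
      unfolding differentiable_def by (rule exI, rule has_derivative_Pair[OF has_derivative_const has_derivative_ident])
    from differentiable_chain_at[OF this dz] show ?thesis by (simp add: o_def)
  qed
  then show "((\<lambda>s. \<phi> (x, s)) has_real_derivative pd_t \<phi> (x, t)) (at t)"
    by (simp add: pd_t_def DERIV_deriv_iff_real_differentiable)
qed

lemma test_function_continuous_on:
  assumes "test_function \<phi>" shows "continuous_on S \<phi>"
proof -
  have "\<phi> differentiable_on UNIV"
    using assms unfolding test_function_def by (elim conjE bspec[of _ _ "[]", elim_format]) auto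
  then show ?thesis
    using continuous_on_subset differentiable_imp_continuous_on by blast
qed

lemma test_function_measurable: "test_function \<phi> \<Longrightarrow> \<phi> \<in> borel_measurable borel"
  by (simp add: test_function_continuous_on borel_measurable_continuous_onI)

lemma test_function_bounds:
  assumes "test_function \<phi>"
  obtains C R where "\<And>z. \<bar>\<phi> z\<bar> \<le> C" "0 \<le> C" "R > 0" "\<And>x t. \<bar>t\<bar> \<ge> R \<or> x \<le> 0 \<or> x \<ge> 1 \<Longrightarrow> \<phi> (x, t) = 0"
proof -
  obtain K where K: "compact K" "K \<subseteq> strip" "\<And>z. z \<notin> K \<Longrightarrow> \<phi> z = 0"
    using assms unfolding test_function_def by blast
  have "bounded (\<phi> ` K)"
    by (intro compact_imp_bounded compact_continuous_image test_function_continuous_on assms K)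
  then obtain C where "\<And>z. z \<in> K \<Longrightarrow> \<bar>\<phi> z\<bar> \<le> C" by (auto simp: bounded_iff)
  then have C: "\<bar>\<phi> z\<bar> \<le> max C 0" for z using K(3)[of z] by (cases "z \<in> K") (auto simp: le_max_iff_disj)
  obtain R where R: "\<And>z. z \<in> K \<Longrightarrow> norm z < R" "R > 0" using K(1) compact_imp_bounded bounded_pos_less by metis
  have "\<phi> (x, t) = 0" if "\<bar>t\<bar> \<ge> R \<or> x \<le> 0 \<or> x \<ge> 1" for x t
  proof (rule K(3))
    show "(x, t) \<notin> K"
    proof
      assume "(x, t) \<in> K"
      then have "norm (x, t) < R" "0 < x" "x < 1" using R K(2) by (auto simp: strip_def)
      moreover have "\<bar>t\<bar> \<le> norm (x, t)" using norm_snd_le[of t x] by simp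
      ultimately show False using that by auto
    qed
  qed
  then show thesis using that[of "max C 0" R] C R(2) by auto
qed

lemma strip_sets[measurable]: "strip \<in> sets borel"
  unfolding strip_def by (intro borel_open open_Times) auto

lemma fn_measurable_strip: "fn u \<in> borel_measurable (restrict_space lborel strip)"
  using strip_rel_fn[of u] by (simp add: strip_rel_def)

lemma fn_measurable_indicator[measurable]:
  "A \<subseteq> strip \<Longrightarrow> A \<in> sets borel \<Longrightarrow> (\<lambda>z. indicator A z *\<^sub>R fn u z) \<in> borel_measurable lborel"
proof -
  assume A: "A \<subseteq> strip" "A \<in> sets borel"
  have "(\<lambda>z. indicator strip z *\<^sub>R fn u z) \<in> borel_measurable lborel"
    using fn_measurable_strip[of u] by (subst (asm) borel_measurable_restrict_space_iff) auto
  then have "(\<lambda>z. indicator A z *\<^sub>R (indicator strip z *\<^sub>R fn u z)) \<in> borel_measurable lborel"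
    by (rule borel_measurable_scaleR[rotated]) (use A in simp)
  also have "(\<lambda>z. indicator A z *\<^sub>R (indicator strip z *\<^sub>R fn u z)) = (\<lambda>z. indicator A z *\<^sub>R fn u z)"
    using A by (auto intro!: ext simp: indicator_def)
  finally show ?thesis .
qed

lemma test_function_integrable:
  assumes u: "locally_integrable u" and \<phi>: "test_function \<phi>"
  shows "set_integrable lborel strip (\<lambda>z. fn u z * \<phi> z)"
proof -
  obtain K where K: "compact K" "K \<subseteq> strip" "\<And>z. z \<notin> K \<Longrightarrow> \<phi> z = 0"
    using \<phi> unfolding test_function_def by blast
  obtain C where C: "\<And>z. \<bar>\<phi> z\<bar> \<le> C" using test_function_bounds[OF \<phi>] by metis
  have "set_integrable lborel K (\<lambda>z. fn u z * \<phi> z)"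
    by (rule set_integrable_mult_bounded[where C=C])
      (use u K C test_function_measurable[OF \<phi>] in \<open>auto simp: locally_integrable_def\<close>)
  also have "set_integrable lborel K (\<lambda>z. fn u z * \<phi> z) \<longleftrightarrow> set_integrable lborel strip (\<lambda>z. fn u z * \<phi> z)"
    unfolding set_integrable_def using K
    by (intro Bochner_Integration.integrable_cong) (auto simp: indicator_def)
  finally show ?thesis .
qed

lemma AE_strip_iff: "(AE z in restrict_space lborel strip. P z) \<longleftrightarrow> (AE z in lborel. z \<in> strip \<longrightarrow> P z)"
  by (subst AE_restrict_space_iff) auto

text \<open>
  Products of bumps converge boundedly to the indicators of boxes whose closure lies in the strip.
\<close>

lemma fundamental_lemma:
  fixes h :: "real \<times> real \<Rightarrow> real"
  assumes h: "\<And>K. compact K \<Longrightarrow> K \<subseteq> strip \<Longrightarrow> set_integrable lborel K h"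
    and 0: "\<And>\<phi>. test_function \<phi> \<Longrightarrow> (LINT z:strip|lborel. h z * \<phi> z) = 0"
  shows "AE z in lborel. z \<in> strip \<longrightarrow> h z = 0"
proof -
  have box0: "(LINT z:{a<..<b}\<times>{c<..<d}|lborel. h z) = 0" if ab: "0 < a" "b < 1" for a b c d :: real
  proof -
    let ?K = "{a..b} \<times> {c..d}"
    let ?\<phi> = "\<lambda>m (x,t). bump a b m x * bump c d m t"
    have K: "compact ?K" "?K \<subseteq> strip" using ab by (auto simp: strip_def compact_Times)
    have t: "test_function (?\<phi> m)" for m
      by (rule test_function_product[OF smooth_bump smooth_bump ab, where c=c and d=d])
        (auto intro!: bump_eq_0 simp: not_le)
    have I: "integrable lborel (\<lambda>z. indicator ?K z *\<^sub>R h z)"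
      using h[OF K] by (simp add: set_integrable_def)
    have Z: "(LINT z|lborel. (indicator ?K z *\<^sub>R h z) * ?\<phi> m z) = 0" for m
    proof -
      have "(LINT z|lborel. (indicator ?K z *\<^sub>R h z) * ?\<phi> m z) = (LINT z:strip|lborel. h z * ?\<phi> m z)"
        unfolding set_lebesgue_integral_def
      proof (intro Bochner_Integration.integral_cong refl)
        fix z :: "real \<times> real"
        show "(indicator ?K z *\<^sub>R h z) * ?\<phi> m z = indicator strip z *\<^sub>R (h z * ?\<phi> m z)"
          using K(2) bump_eq_0[of "fst z" a b m] bump_eq_0[of "snd z" c d m]
          by (cases "z \<in> ?K") (auto simp: indicator_def case_prod_unfold mem_Times_iff)
      qed
      then show ?thesis using 0[OF t] by simp
    qed
    have "(\<lambda>m. LINT z|lborel. (indicator ?K z *\<^sub>R h z) * ?\<phi> m z)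
      \<longlonglongrightarrow> (LINT z|lborel. (indicator ?K z *\<^sub>R h z) * (indicator {a<..<b} (fst z) * indicator {c<..<d} (snd z)))"
    proof (rule integral_dominated_convergence)
      show "integrable lborel (\<lambda>z. \<bar>indicator ?K z *\<^sub>R h z\<bar>)" using I by simp
      show "AE z in lborel. (\<lambda>m. (indicator ?K z *\<^sub>R h z) * ?\<phi> m z)
        \<longlonglongrightarrow> (indicator ?K z *\<^sub>R h z) * (indicator {a<..<b} (fst z) * indicator {c<..<d} (snd z))"
        unfolding case_prod_unfold by (intro AE_I2 tendsto_mult tendsto_const bump_tendsto)
      show "AE z in lborel. norm ((indicator ?K z *\<^sub>R h z) * ?\<phi> m z) \<le> \<bar>indicator ?K z *\<^sub>R h z\<bar>" for m
      proof (rule AE_I2)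
        fix z
        have "\<bar>?\<phi> m z\<bar> \<le> 1"
          using bump_bounds by (auto simp: case_prod_unfold abs_mult intro!: mult_le_one)
        then show "norm ((indicator ?K z *\<^sub>R h z) * ?\<phi> m z) \<le> \<bar>indicator ?K z *\<^sub>R h z\<bar>"
          by (simp only: real_norm_def abs_mult) (rule mult_left_le, auto)
      qed
      show "(\<lambda>z. (indicator ?K z *\<^sub>R h z) * ?\<phi> m z) \<in> borel_measurable lborel" for m
        by (intro borel_measurable_times borel_measurable_integrable[OF I])
          (use test_function_measurable[OF t] in simp)
      show "(\<lambda>z. (indicator ?K z *\<^sub>R h z) * (indicator {a<..<b} (fst z) * indicator {c<..<d} (snd z))) \<in> borel_measurable lborel"
        by (intro borel_measurable_times borel_measurable_integrable[OF I])
          (auto simp: borel_prod[symmetric])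
    qed
    then have "(LINT z|lborel. (indicator ?K z *\<^sub>R h z) * (indicator {a<..<b} (fst z) * indicator {c<..<d} (snd z))) = 0"
      unfolding Z by (simp add: LIMSEQ_const_iff)
    also have "(LINT z|lborel. (indicator ?K z *\<^sub>R h z) * (indicator {a<..<b} (fst z) * indicator {c<..<d} (snd z)))
       = (LINT z:{a<..<b}\<times>{c<..<d}|lborel. h z)"
      unfolding set_lebesgue_integral_def
      by (intro Bochner_Integration.integral_cong refl) (auto simp: indicator_def)
    finally show ?thesis .
  qed
  have "AE z in lborel. \<forall>n. indicator ({1 / real (n+2)<..<1 - 1 / real (n+2)} \<times> {- real n<..<real n}) z *\<^sub>R h z = 0"
    unfolding AE_all_countable
  proof
    fix n :: nat
    let ?S = "{1 / real (n+2)<..<1 - 1 / real (n+2)} \<times> {- real n<..<real n}"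
    show "AE z in lborel. indicator ?S z *\<^sub>R h z = 0"
    proof (rule AE_eq_0_if_box_integrals_0)
      have "set_integrable lborel ({1 / real (n+2)..1 - 1 / real (n+2)} \<times> {- real n..real n}) h"
      proof (rule h)
        have "1 / real (n+2) > 0" by simp
        then show "{1 / real (n+2)..1 - 1 / real (n+2)} \<times> {- real n..real n} \<subseteq> strip"
          unfolding strip_def by (intro Sigma_mono subsetI) (simp_all only: atLeastAtMost_iff greaterThanLessThan_iff UNIV_I, linarith)
      qed (simp add: compact_Times)
      then have "set_integrable lborel ?S h"
        by (rule set_integrable_subset) (auto simp: borel_Times)
      then show "integrable lborel (\<lambda>z. indicator ?S z *\<^sub>R h z)" by (simp add: set_integrable_def)
      fix p q :: "real \<times> real"
      have "(LINT z:box p q|lborel. indicator ?S z *\<^sub>R h z)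
        = (LINT z:{max (fst p) (1 / real (n+2))<..<min (fst q) (1 - 1 / real (n+2))} \<times> {max (snd p) (- real n)<..<min (snd q) (real n)}|lborel. h z)"
        unfolding set_lebesgue_integral_def
        by (intro Bochner_Integration.integral_cong refl) (auto simp: indicator_def box_def Basis_prod_def inner_prod_def)
      also have "\<dots> = 0"
        by (rule box0) (auto simp: less_max_iff_disj min_less_iff_disj)
      finally show "(LINT z:box p q|lborel. indicator ?S z *\<^sub>R h z) = 0" .
    qed
  qed
  then show ?thesis
  proof (eventually_elim, intro impI)
    fix z :: "real \<times> real"
    assume z: "\<forall>n. indicator ({1 / real (n+2)<..<1 - 1 / real (n+2)} \<times> {- real n<..<real n}) z *\<^sub>R h z = 0" "z \<in> strip"
    obtain x t where xt: "z = (x, t)" by fastforce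
    have x: "0 < x" "x < 1" using z xt by (auto simp: strip_def)
    have "(\<lambda>n. 1 / real (n+2)) \<longlonglongrightarrow> 0" by real_asymp
    then have "eventually (\<lambda>n. 1 / real (n+2) < min x (1 - x)) sequentially"
      using x by (intro order_tendstoD) auto
    moreover have "eventually (\<lambda>n. real n > \<bar>t\<bar>) sequentially" by real_asymp
    ultimately have "eventually (\<lambda>n. 1 / real (n+2) < min x (1 - x) \<and> real n > \<bar>t\<bar>) sequentially"
      by (rule eventually_conj)
    then obtain n where n: "1 / real (n+2) < min x (1 - x)" "real n > \<bar>t\<bar>"
      by (auto simp: eventually_sequentially)
    then have "z \<in> {1 / real (n+2)<..<1 - 1 / real (n+2)} \<times> {- real n<..<real n}"
      using xt by (auto simp: abs_less_iff)
    then show "h z = 0" using z(1)[rule_format, of n] by simp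
  qed
qed

text \<open>
  This is what makes the definite descriptions of the generalized derivatives meaningful: exhibiting
  one weak derivative determines the value of the operator, as recorded in the next three facts.
\<close>

lemma weakly_eq_unique:
  assumes "weakly_eq P u v" "weakly_eq P u w"
  shows "v = w"
proof -
  have li: "locally_integrable v" "locally_integrable w" using assms by (auto simp: weakly_eq_def)
  have "AE z in lborel. z \<in> strip \<longrightarrow> fn v z - fn w z = 0"
  proof (rule fundamental_lemma)
    fix K assume "compact K" "K \<subseteq> strip"
    then show "set_integrable lborel K (\<lambda>z. fn v z - fn w z)"
      using li by (intro set_integral_diff) (auto simp: locally_integrable_def)
  next
    fix \<phi> assume \<phi>: "test_function \<phi>"
    have "(LINT z:strip|lborel. (fn v z - fn w z) * \<phi> z) = (LINT z:strip|lborel. fn v z * \<phi> z) - (LINT z:strip|lborel. fn w z * \<phi> z)"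
      unfolding left_diff_distrib by (intro set_integral_diff test_function_integrable li \<phi>)
    also have "\<dots> = 0" using assms \<phi> by (simp add: weakly_eq_def)
    finally show "(LINT z:strip|lborel. (fn v z - fn w z) * \<phi> z) = 0" .
  qed
  then show ?thesis unfolding stripfun_eq_iff AE_strip_iff by eventually_elim auto
qed

lemma dx_eq: "is_dx u v \<Longrightarrow> dx u = v"
  unfolding dx_def is_dx_def by (rule the_equality) (auto intro: weakly_eq_unique)

lemma dt_eq: "is_dt u v \<Longrightarrow> dt u = v"
  unfolding dt_def is_dt_def by (rule the_equality) (auto intro: weakly_eq_unique)

lemma wave_eq: "is_wave u v \<Longrightarrow> wave u = v"
  unfolding wave_def is_wave_def by (rule the_equality) (auto intro: weakly_eq_unique)

section \<open>The period cell and the unfolding of integrals over the strip\<close>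

lemma AE_lborel_translate:
  fixes c :: "'a::euclidean_space"
  assumes "AE z in lborel. P z"
  shows "AE z in lborel. P (c + z)"
proof (rule AE_distrD[where f="(+) c" and M'=borel])
  show "(+) c \<in> measurable lborel borel" by simp
  show "AE z in distr lborel borel ((+) c). P z" using assms unfolding lborel_distr_plus .
qed

lemma translate_integrable_iff:
  fixes c :: "'a::euclidean_space" and g :: "'a \<Rightarrow> 'b::{banach, second_countable_topology}"
  assumes "g \<in> borel_measurable borel"
  shows "integrable lborel (\<lambda>z. g (c + z)) \<longleftrightarrow> integrable lborel g"
    and "(LINT z|lborel. g (c + z)) = (LINT z|lborel. g z)"
  using integrable_distr_eq[of "(+) c" lborel borel g] integral_distr[of "(+) c" lborel borel g] assms
  by (simp_all add: lborel_distr_plus)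

locale time_period =
  fixes \<omega> :: real
  assumes \<omega>_pos: "\<omega> > 0"
begin

definition T :: real where "T = 2*pi/\<omega>"

lemma T_pos: "T > 0" using \<omega>_pos by (simp add: T_def)

abbreviation MX :: "real measure" where "MX \<equiv> restrict_space lborel {0<..<1}"
abbreviation MT :: "real measure" where "MT \<equiv> restrict_space lborel {0..T}"
definition Q :: "(real \<times> real) measure" where "Q = MX \<Otimes>\<^sub>M MT"
definition cell :: "(real \<times> real) set" where "cell = {0<..<1} \<times> {0..T}"

lemma cell_sets[measurable]: "cell \<in> sets borel"
  unfolding cell_def by (simp add: borel_Times)

lemma cell_strip: "cell \<subseteq> strip" by (auto simp: cell_def strip_def)

lemma finite_measure_MX: "finite_measure MX"
  by (rule finite_measureI) (simp add: emeasure_restrict_space space_restrict_space)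

lemma finite_measure_MT: "finite_measure MT"
  using T_pos by (intro finite_measureI) (simp add: emeasure_restrict_space space_restrict_space)

sublocale MX: finite_measure MX by (rule finite_measure_MX)
sublocale MT: finite_measure MT by (rule finite_measure_MT)
sublocale XT: pair_sigma_finite MX MT ..

lemma measure_MX: "measure MX (space MX) = 1"
  by (simp add: measure_restrict_space space_restrict_space)

lemma measure_MT: "measure MT (space MT) = T"
  using T_pos by (simp add: measure_restrict_space space_restrict_space)

lemma finite_measure_Q: "finite_measure Q"
  unfolding Q_def by (intro finite_measure_pair_measure finite_measure_MX finite_measure_MT)

sublocale Q: finite_measure Q by (rule finite_measure_Q)

lemma space_Q: "space Q = cell"
  by (simp add: Q_def space_pair_measure space_restrict_space cell_def)

text \<open>
  The product form of the measure gives Fubini's theorem, the restricted form gives the set integrals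
  in which the spaces are defined.
\<close>

lemma Q_eq: "Q = restrict_space lborel cell"
  unfolding Q_def
proof (rule pair_measure_eqI)
  show "sigma_finite_measure MX" "sigma_finite_measure MT"
    using MX.sigma_finite_measure_axioms MT.sigma_finite_measure_axioms by auto
  show "sets (MX \<Otimes>\<^sub>M MT) = sets (restrict_space lborel cell)"
  proof (intro equalityI subsetI)
    fix S assume "S \<in> sets (MX \<Otimes>\<^sub>M MT)"
    then have S: "S \<in> sigma_sets (space MX \<times> space MT) {a \<times> b |a b. a \<in> sets MX \<and> b \<in> sets MT}"
      by (simp add: sets_pair_measure)
    have "sigma_sets (space (restrict_space lborel cell)) {a \<times> b |a b. a \<in> sets MX \<and> b \<in> sets MT} \<subseteq> sets (restrict_space lborel cell)"
    proof (rule sets.sigma_sets_subset, safe)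
      fix a b assume "a \<in> sets MX" "b \<in> sets MT"
      then have "a \<in> sets borel" "b \<in> sets borel" "a \<subseteq> {0<..<1}" "b \<subseteq> {0..T}"
        by (auto simp: sets_restrict_space_iff)
      then show "a \<times> b \<in> sets (restrict_space lborel cell)"
        by (subst sets_restrict_space_iff) (auto simp: cell_def borel_Times)
    qed
    moreover have "space (restrict_space lborel cell) = space MX \<times> space MT"
      by (simp add: space_restrict_space cell_def)
    ultimately show "S \<in> sets (restrict_space lborel cell)" using S by auto
  next
    fix S assume S: "S \<in> sets (restrict_space lborel cell)"
    have "sets (borel \<Otimes>\<^sub>M borel) = sets (borel :: (real \<times> real) measure)"
      by (simp only: borel_prod)
    then have S': "S \<subseteq> cell" "S \<in> sets (borel \<Otimes>\<^sub>M borel)"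
      using S by (auto simp: sets_restrict_space_iff)
    have m: "(\<lambda>z. (fst z, snd z)) \<in> MX \<Otimes>\<^sub>M MT \<rightarrow>\<^sub>M borel \<Otimes>\<^sub>M borel"
    proof (rule measurable_Pair)
      have i: "(\<lambda>x. x) \<in> MX \<rightarrow>\<^sub>M borel" "(\<lambda>x. x) \<in> MT \<rightarrow>\<^sub>M borel"
        by (auto intro!: measurable_restrict_space1)
      show "fst \<in> MX \<Otimes>\<^sub>M MT \<rightarrow>\<^sub>M borel" by (rule measurable_compose[OF measurable_fst i(1)])
      show "snd \<in> MX \<Otimes>\<^sub>M MT \<rightarrow>\<^sub>M borel" by (rule measurable_compose[OF measurable_snd i(2)])
    qed
    have "(\<lambda>z. (fst z, snd z)) -` S \<inter> space (MX \<Otimes>\<^sub>M MT) \<in> sets (MX \<Otimes>\<^sub>M MT)"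
      by (rule measurable_sets[OF m]) (use S' in auto)
    also have "(\<lambda>z. (fst z, snd z)) -` S \<inter> space (MX \<Otimes>\<^sub>M MT) = S"
      using S' by (auto simp: space_pair_measure space_restrict_space cell_def)
    finally show "S \<in> sets (MX \<Otimes>\<^sub>M MT)" .
  qed
  fix a b assume "a \<in> sets MX" "b \<in> sets MT"
  then have ab: "a \<in> sets borel" "b \<in> sets borel" "a \<subseteq> {0<..<1}" "b \<subseteq> {0..T}"
    by (auto simp: sets_restrict_space_iff)
  then have "emeasure (restrict_space lborel cell) (a \<times> b) = emeasure lborel (a \<times> b)"
  proof (subst emeasure_restrict_space)
    show "a \<times> b \<subseteq> cell" using ab by (auto simp: cell_def)
  qed auto
  also have "\<dots> = emeasure lborel a * emeasure lborel b"
    using ab by (subst lborel_prod[symmetric], subst lborel.emeasure_pair_measure_Times) auto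
  finally show "emeasure MX a * emeasure MT b = emeasure (restrict_space lborel cell) (a \<times> b)"
    using ab by (simp add: emeasure_restrict_space)
qed

lemma integrable_Q_iff:
  fixes f :: "real \<times> real \<Rightarrow> 'b::{banach, second_countable_topology}"
  shows "integrable Q f \<longleftrightarrow> set_integrable lborel cell f"
  unfolding Q_eq set_integrable_def by (rule integrable_restrict_space) auto

lemma integral_Q:
  fixes f :: "real \<times> real \<Rightarrow> 'b::{banach, second_countable_topology}"
  shows "(LINT z|Q. f z) = (LINT z:cell|lborel. f z)"
  unfolding Q_eq set_lebesgue_integral_def by (rule integral_restrict_space) auto

lemma integral_MT:
  fixes f :: "real \<Rightarrow> 'b::{banach, second_countable_topology}"
  shows "(LINT t|MT. f t) = (LINT t:{0..T}|lborel. f t)"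
  unfolding set_lebesgue_integral_def by (rule integral_restrict_space) auto

lemma integral_MX:
  fixes f :: "real \<Rightarrow> 'b::{banach, second_countable_topology}"
  shows "(LINT t|MX. f t) = (LINT t:{0<..<1}|lborel. f t)"
  unfolding set_lebesgue_integral_def by (rule integral_restrict_space) auto

lemma AE_Q_iff: "(AE z in Q. P z) \<longleftrightarrow> (AE z in lborel. z \<in> cell \<longrightarrow> P z)"
  unfolding Q_eq by (subst AE_restrict_space_iff) auto

lemma AE_MX_iff: "(AE z in MX. P z) \<longleftrightarrow> (AE z in lborel. z \<in> {0<..<1} \<longrightarrow> P z)"
  by (subst AE_restrict_space_iff) auto

lemma AE_MT_iff: "(AE z in MT. P z) \<longleftrightarrow> (AE z in lborel. z \<in> {0..T} \<longrightarrow> P z)"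
  by (subst AE_restrict_space_iff) auto

lemma borel_measurable_Q: "f \<in> borel_measurable borel \<Longrightarrow> f \<in> borel_measurable Q"
  unfolding Q_eq by (simp add: measurable_restrict_space1)

lemma fn_measurable_Q[measurable]: "fn u \<in> borel_measurable Q"
  unfolding Q_eq
  by (subst borel_measurable_restrict_space_iff) (use fn_measurable_indicator[OF cell_strip] in auto)

lemma integrable_Q_fst:
  fixes f :: "real \<times> real \<Rightarrow> 'b::{banach, second_countable_topology}"
  assumes "integrable Q f"
  shows "AE x in MX. integrable MT (\<lambda>t. f (x, t))"
    and "integrable MX (\<lambda>x. LINT t|MT. f (x, t))"
    and "(LINT x|MX. LINT t|MT. f (x, t)) = (LINT z|Q. f z)"
  using assms XT.AE_integrable_fst' XT.integrable_fst' XT.integral_fst' unfolding Q_def by blast+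

text \<open>
  The class in which coefficients make sense; it contains all spaces \<open>H\<close>, and an element of \<open>H\<close> is a
  member of this class with finite norm.
\<close>

definition periodic_integrable :: "stripfun \<Rightarrow> bool" where
  "periodic_integrable u \<longleftrightarrow> (AE z in lborel. z \<in> strip \<longrightarrow> fn u (z + (0, T)) = fn u z) \<and> integrable Q (fn u)"

text \<open>
  Iterating an identity that holds almost everywhere is possible because translations preserve null
  sets.
\<close>

lemma period_shift:
  assumes "periodic_integrable u"
  shows "AE z in lborel. z \<in> strip \<longrightarrow> fn u ((0, of_int j * T) + z) = fn u z"
proof -
  have nat: "AE z in lborel. z \<in> strip \<longrightarrow> fn u ((0, real n * T) + z) = fn u z" for n
  proof (induction n)
    case (Suc n)
    have "AE z in lborel. ((0, real n * T) + z) \<in> strip \<longrightarrow> fn u (((0, real n * T) + z) + (0, T)) = fn u ((0, real n * T) + z)"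
      using assms by (intro AE_lborel_translate) (simp add: periodic_integrable_def)
    with Suc show ?case
    proof eventually_elim
      case (elim z)
      show ?case
      proof
        assume z: "z \<in> strip"
        have "((0, real n * T) + z) + (0, T) = (0, real (Suc n) * T) + z"
          by (cases z) (simp add: algebra_simps)
        moreover have "(0, real n * T) + z \<in> strip" using z by (cases z) (simp add: strip_def)
        ultimately show "fn u ((0, real (Suc n) * T) + z) = fn u z"
          using elim z by metis
      qed
    qed
  qed (simp flip: zero_prod_def)
  show ?thesis
  proof (cases "j \<ge> 0")
    case True
    then show ?thesis using nat[of "nat j"] by simp
  next
    case False
    let ?n = "nat (- j)"
    have "AE z in lborel. ((0, of_int j * T) + z) \<in> strip \<longrightarrow>
       fn u ((0, real ?n * T) + ((0, of_int j * T) + z)) = fn u ((0, of_int j * T) + z)"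
      by (rule AE_lborel_translate[OF nat])
    then show ?thesis
    proof eventually_elim
      case (elim z)
      have "(0, real ?n * T) + ((0, of_int j * T) + z) = z"
        using False by (cases z) (simp)
      moreover have "z \<in> strip \<Longrightarrow> ((0, of_int j * T) + z) \<in> strip" by (cases z) (simp add: strip_def)
      ultimately show ?case using elim by metis
    qed
  qed
qed

definition shifted_cell :: "int \<Rightarrow> (real \<times> real) set" where
  "shifted_cell j = {0<..<1} \<times> {of_int j * T ..< (of_int j + 1) * T}"

lemma AE_snd_neq: "AE z in lborel. snd z \<noteq> (c::real) \<and> fst z \<noteq> (d::real)"
proof -
  have "AE z in lborel \<Otimes>\<^sub>M lborel. snd z \<noteq> c \<and> fst z \<noteq> d"
  proof (rule lborel_pair.AE_pair_measure)
    have "AE x in lborel. x \<noteq> d" "AE y in lborel. y \<noteq> c" by (auto intro: AE_lborel_singleton)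
    then show "AE x in lborel. AE y in lborel. snd (x, y) \<noteq> c \<and> fst (x, y) \<noteq> d"
      by (auto elim!: eventually_mono)
  qed measurable
  then show ?thesis unfolding lborel_prod .
qed

lemma integrable_Q_mult:
  fixes u \<psi> :: "real \<times> real \<Rightarrow> real"
  assumes "integrable Q u" "\<psi> \<in> borel_measurable borel" "\<And>z. \<bar>\<psi> z\<bar> \<le> C"
  shows "integrable Q (\<lambda>z. u z * \<psi> z)"
  using assms by (intro integrable_mult_bounded[where C=C]) (auto intro: borel_measurable_Q)

lemma shifted_cell_integral:
  assumes u: "periodic_integrable u" and \<psi>: "\<psi> \<in> borel_measurable borel" "\<And>z. \<bar>\<psi> z\<bar> \<le> C"
  shows "set_integrable lborel (shifted_cell j) (\<lambda>z. fn u z * \<psi> z)"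
    and "(LINT z:shifted_cell j|lborel. fn u z * \<psi> z) = (LINT z|Q. fn u z * \<psi> ((0, of_int j * T) + z))"
proof -
  let ?c = "(0::real, of_int j * T)"
  let ?g = "\<lambda>z. indicator (shifted_cell j) z *\<^sub>R (fn u z * \<psi> z)"
  have cs: "shifted_cell j \<subseteq> strip" "shifted_cell j \<in> sets borel"
    by (auto simp: shifted_cell_def strip_def borel_Times)
  have gm: "?g \<in> borel_measurable borel"
    using borel_measurable_times[OF fn_measurable_indicator[OF cs, of u], of \<psi>] \<psi>(1) by (simp add: mult.assoc)
  have \<psi>m: "(\<lambda>z. \<psi> (?c + z)) \<in> borel_measurable borel"
    by (rule measurable_compose[OF _ \<psi>(1)]) simp
  have "integrable Q (\<lambda>z. fn u z * \<psi> (?c + z))"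
    by (rule integrable_Q_mult[where C=C]) (use u \<psi> \<psi>m in \<open>auto simp: periodic_integrable_def\<close>)
  then have I: "integrable lborel (\<lambda>z. indicator cell z *\<^sub>R (fn u z * \<psi> (?c + z)))"
    by (simp add: integrable_Q_iff set_integrable_def)
  have ae: "AE z in lborel. ?g (?c + z) = indicator cell z *\<^sub>R (fn u z * \<psi> (?c + z))"
    using period_shift[OF u, of j] AE_snd_neq[of T 0]
  proof eventually_elim
    case (elim z)
    have "?c + z \<in> shifted_cell j \<longleftrightarrow> z \<in> {0<..<1} \<times> {0..<T}"
      by (cases z) (simp add: shifted_cell_def ring_distribs)
    moreover have "z \<in> {0<..<1} \<times> {0..<T} \<longleftrightarrow> z \<in> cell" using elim by (cases z) (auto simp: cell_def)
    moreover have "z \<in> cell \<Longrightarrow> z \<in> strip" using cell_strip by auto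
    ultimately show ?case using elim(1) by (auto simp: indicator_def)
  qed
  have m1: "(\<lambda>z. ?g (?c + z)) \<in> borel_measurable lborel"
    using measurable_compose[OF _ gm, of "\<lambda>z. ?c + z" lborel] by simp
  have "integrable lborel (\<lambda>z. ?g (?c + z))"
    using I ae m1 by (subst integrable_cong_AE) auto
  then show "set_integrable lborel (shifted_cell j) (\<lambda>z. fn u z * \<psi> z)"
    unfolding set_integrable_def translate_integrable_iff(1)[OF gm] .
  have "(LINT z:shifted_cell j|lborel. fn u z * \<psi> z) = (LINT z|lborel. ?g (?c + z))"
    unfolding set_lebesgue_integral_def translate_integrable_iff(2)[OF gm] ..
  also have "\<dots> = (LINT z|lborel. indicator cell z *\<^sub>R (fn u z * \<psi> (?c + z)))"
    using I ae m1 by (intro integral_cong_AE) auto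
  finally show "(LINT z:shifted_cell j|lborel. fn u z * \<psi> z) = (LINT z|Q. fn u z * \<psi> ((0, of_int j * T) + z))"
    by (simp add: integral_Q set_lebesgue_integral_def)
qed

text \<open>
  An integral over the strip against a function of bounded support is an integral over one cell against
  the finite sum of its translates.
\<close>

lemma unfolding_integral:
  assumes u: "periodic_integrable u" and \<psi>: "\<psi> \<in> borel_measurable borel" "\<And>z. \<bar>\<psi> z\<bar> \<le> C"
    and supp: "\<And>x t. \<bar>t\<bar> \<ge> real J * T \<Longrightarrow> \<psi> (x, t) = 0"
  shows "set_integrable lborel strip (\<lambda>z. fn u z * \<psi> z)"
    and "(LINT z:strip|lborel. fn u z * \<psi> z) = (\<Sum>j\<in>{- int J..<int J}. LINT z|Q. fn u z * \<psi> ((0, of_int j * T) + z))"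
proof -
  have U: "indicator strip z *\<^sub>R (fn u z * \<psi> z) = (\<Sum>j\<in>{- int J..<int J}. indicator (shifted_cell j) z *\<^sub>R (fn u z * \<psi> z))" for z
  proof (cases "z \<in> strip \<and> \<psi> z \<noteq> 0")
    case True
    obtain x t where z: "z = (x, t)" by fastforce
    have t: "\<bar>t\<bar> < real J * T" using True z supp[of t x] by force
    have x: "x \<in> {0<..<1}" using True z by (simp add: strip_def)
    define m where "m = \<lfloor>t / T\<rfloor>"
    have iff: "z \<in> shifted_cell j \<longleftrightarrow> j = m" for j
    proof -
      have "z \<in> shifted_cell j \<longleftrightarrow> of_int j \<le> t / T \<and> t / T < of_int j + 1"
        using x T_pos unfolding shifted_cell_def z by (simp add: pos_le_divide_eq pos_divide_less_eq)
      then show ?thesis unfolding m_def by (metis floor_eq_iff)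
    qed
    have m: "m \<in> {- int J..<int J}"
    proof -
      have "- real J \<le> t / T" "t / T < real J"
        using t T_pos by (simp_all only: pos_le_divide_eq pos_divide_less_eq)
      then show ?thesis unfolding m_def by (auto simp: le_floor_iff floor_less_iff)
    qed
    have "(\<Sum>j\<in>{- int J..<int J}. indicator (shifted_cell j) z *\<^sub>R (fn u z * \<psi> z)) = (\<Sum>j\<in>{- int J..<int J}. if j = m then fn u z * \<psi> z else 0)"
      by (intro sum.cong refl) (simp add: indicator_def iff)
    also have "\<dots> = fn u z * \<psi> z" using m by simp
    finally show ?thesis using True by simp
  next
    case False
    have "shifted_cell j \<subseteq> strip" for j by (auto simp: shifted_cell_def strip_def)
    then have "z \<notin> strip \<Longrightarrow> z \<notin> shifted_cell j" for j by auto
    then show ?thesis using False by (auto simp: indicator_def)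
  qed
  show "set_integrable lborel strip (\<lambda>z. fn u z * \<psi> z)"
    unfolding set_integrable_def U
    using shifted_cell_integral(1)[OF u \<psi>] by (intro Bochner_Integration.integrable_sum) (simp add: set_integrable_def)
  have "(LINT z:strip|lborel. fn u z * \<psi> z) = (\<Sum>j\<in>{- int J..<int J}. LINT z:shifted_cell j|lborel. fn u z * \<psi> z)"
    unfolding set_lebesgue_integral_def U
    using shifted_cell_integral(1)[OF u \<psi>] by (intro Bochner_Integration.integral_sum) (simp add: set_integrable_def)
  then show "(LINT z:strip|lborel. fn u z * \<psi> z) = (\<Sum>j\<in>{- int J..<int J}. LINT z|Q. fn u z * \<psi> ((0, of_int j * T) + z))"
    by (simp add: shifted_cell_integral(2)[OF u \<psi>])
qed

lemma period_multiple:
  obtains J :: nat where "real J * T \<ge> R"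
proof -
  obtain J :: nat where "real J > R / T" using reals_Archimedean2 by blast
  then have "real J * T > R" using T_pos by (simp only: pos_divide_less_eq)
  then show thesis using that[of J] by simp
qed

lemma periodic_integrable_locally_integrable:
  assumes u: "periodic_integrable u" shows "locally_integrable u"
  unfolding locally_integrable_def
proof (intro allI impI, elim conjE)
  fix K :: "(real \<times> real) set" assume K: "compact K" "K \<subseteq> strip"
  obtain R where R: "\<And>z. z \<in> K \<Longrightarrow> norm z < R" using K(1) compact_imp_bounded bounded_pos_less by metis
  obtain J :: nat where J: "real J * T \<ge> R" by (rule period_multiple)
  have "set_integrable lborel strip (\<lambda>z. fn u z * indicator K z)"
  proof (rule unfolding_integral(1)[OF u, where C=1])
    fix x t :: real assume t: "\<bar>t\<bar> \<ge> real J * T"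
    have "\<bar>t\<bar> \<le> norm (x, t)" using norm_snd_le[of t x] by simp
    then have "(x, t) \<notin> K" using R[of "(x,t)"] J t by linarith
    then show "indicator K (x, t) = (0::real)" by simp
  qed (use K in \<open>auto simp: borel_compact intro!: borel_measurable_indicator\<close>)
  then show "set_integrable lborel K (fn u)"
    unfolding set_integrable_def
    by (rule Bochner_Integration.integrable_cong[THEN iffD1, rotated 2]) (use K in \<open>auto simp: indicator_def\<close>)
qed

text \<open>
  The translates of the cell cover the strip, so equality on one cell suffices.
\<close>

lemma periodic_integrable_eqI:
  assumes u: "periodic_integrable u" and v: "periodic_integrable v" and eq: "AE z in Q. fn u z = fn v z"
  shows "u = v"
proof -
  have "AE z in lborel. z \<in> shifted_cell j \<longrightarrow> fn u z = fn v z" for j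
  proof -
    have "AE z in lborel. (0, of_int (- j) * T) + z \<in> cell \<longrightarrow> fn u ((0, of_int (- j) * T) + z) = fn v ((0, of_int (- j) * T) + z)"
      using eq unfolding AE_Q_iff by (rule AE_lborel_translate)
    with period_shift[OF u, of "- j"] period_shift[OF v, of "- j"] show ?thesis
    proof eventually_elim
      case (elim z)
      show ?case
      proof
        assume z: "z \<in> shifted_cell j"
        have "(0, of_int (- j) * T) + z \<in> cell" "z \<in> strip"
          using z by (cases z, auto simp: shifted_cell_def cell_def strip_def ring_distribs)+
        then show "fn u z = fn v z" using elim by metis
      qed
    qed
  qed
  then have "AE z in lborel. \<forall>j. z \<in> shifted_cell j \<longrightarrow> fn u z = fn v z"
    unfolding AE_all_countable by blast
  then have "AE z in lborel. z \<in> strip \<longrightarrow> fn u z = fn v z"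
  proof eventually_elim
    case (elim z)
    show ?case
    proof
      assume z: "z \<in> strip"
      obtain x t where xt: "z = (x, t)" by fastforce
      have "z \<in> shifted_cell \<lfloor>t / T\<rfloor>"
      proof -
        have "of_int \<lfloor>t / T\<rfloor> \<le> t / T" "t / T < of_int \<lfloor>t / T\<rfloor> + 1" by linarith+
        then have "of_int \<lfloor>t / T\<rfloor> * T \<le> t" "t < (of_int \<lfloor>t / T\<rfloor> + 1) * T"
          using T_pos by (simp_all only: pos_le_divide_eq pos_divide_less_eq)
        then show ?thesis using z by (simp add: xt shifted_cell_def strip_def)
      qed
      then show "fn u z = fn v z" using elim by auto
    qed
  qed
  then show ?thesis unfolding stripfun_eq_iff AE_strip_iff .
qed

section \<open>Fourier modes and Fourier coefficients\<close>

text \<open>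
  The kernel \<open>exp (-i k \<omega> t)\<close> of the time coefficients in the norm of \<open>H\<close>.
\<close>

definition time_exp :: "int \<Rightarrow> real \<Rightarrow> complex" where
  "time_exp k t = exp (- \<i> * of_int k * of_real \<omega> * of_real t)"

lemma time_exp_norm[simp]: "cmod (time_exp k t) = 1"
  by (simp add: time_exp_def norm_exp_eq_Re)

lemma time_exp_cnj: "cnj (time_exp k t) = time_exp (- k) t"
  by (simp add: time_exp_def exp_cnj)

lemma time_exp_mult: "time_exp k t * time_exp l t = time_exp (k + l) t"
proof -
  have "- \<i> * of_int k * of_real \<omega> * of_real t + - \<i> * of_int l * of_real \<omega> * of_real t
    = - \<i> * of_int (k + l) * of_real \<omega> * (of_real t :: complex)" by (simp add: algebra_simps)
  then show ?thesis unfolding time_exp_def by (simp only: exp_add[symmetric])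
qed

lemma time_exp_0[simp]: "time_exp 0 t = 1" by (simp add: time_exp_def)

lemma time_exp_continuous: "continuous_on S (time_exp k)"
  unfolding time_exp_def by (intro continuous_intros)

lemma time_exp_measurable[measurable]: "time_exp k \<in> borel_measurable borel"
  by (intro borel_measurable_continuous_onI time_exp_continuous)

lemma time_exp_deriv: "(time_exp k has_vector_derivative (- \<i> * of_int k * of_real \<omega>) * time_exp k t) (at t within S)"
proof -
  let ?a = "- \<i> * of_int k * of_real \<omega> :: complex"
  have "((\<lambda>z. exp (?a * z)) has_field_derivative ?a * exp (?a * of_real t)) (at (of_real t))"
    by (auto intro!: derivative_eq_intros)
  then show ?thesis unfolding time_exp_def by (rule has_vector_derivative_real_field)
qed

lemma time_exp_shift: "time_exp k (of_int j * T + t) = time_exp k t"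
proof -
  have "- \<i> * of_int k * of_real \<omega> * of_real (of_int j * T + t)
     = - \<i> * of_int k * of_real \<omega> * of_real t + \<i> * (of_int (- (k * j)) * (of_real pi * 2))"
    using \<omega>_pos by (simp add: T_def field_simps)
  then show ?thesis
    unfolding time_exp_def by (simp only: exp_plus_2pin)
qed

lemma time_exp_integral: "(LINT t|MT. time_exp k t) = (if k = 0 then of_real T else 0)"
proof (cases "k = 0")
  case True
  then show ?thesis using measure_MT by (simp add: scaleR_conv_of_real)
next
  case False
  let ?a = "- \<i> * of_int k * of_real \<omega> :: complex"
  have a: "?a \<noteq> 0" using False \<omega>_pos by simp
  have "(LINT t|MT. time_exp k t) = time_exp k T / ?a - time_exp k 0 / ?a"
    unfolding integral_MT set_lebesgue_integral_def
  proof (rule integral_FTC_Icc)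
    fix t
    have "((\<lambda>t. time_exp k t / ?a) has_vector_derivative (?a * time_exp k t) / ?a) (at t within {0..T})"
      by (intro has_vector_derivative_divide time_exp_deriv)
    then show "((\<lambda>t. time_exp k t / ?a) has_vector_derivative time_exp k t) (at t within {0..T})" using a by simp
  qed (use T_pos time_exp_continuous in auto)
  also have "time_exp k T = time_exp k 0" using time_exp_shift[of k 1 0] by simp
  finally show ?thesis using False by simp
qed

text \<open>
  The factor makes the cosines orthonormal on the unit interval.
\<close>

definition cos_mode :: "nat \<Rightarrow> real \<Rightarrow> real" where
  "cos_mode n x = (if n = 0 then 1 else sqrt 2) * cos (real n * pi * x)"

definition sin_mode :: "nat \<Rightarrow> real \<Rightarrow> real" where
  "sin_mode n x = sqrt 2 * sin (real n * pi * x)"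

lemma sqrt2_le_2: "sqrt 2 \<le> 2"
  by (rule real_le_lsqrt) auto

lemma cos_mode_bound: "\<bar>cos_mode n x\<bar> \<le> 2"
proof -
  have "\<bar>cos_mode n x\<bar> \<le> 2 * 1" unfolding cos_mode_def abs_mult
    using sqrt2_le_2 by (intro mult_mono) auto
  then show ?thesis by simp
qed

lemma sin_mode_bound: "\<bar>sin_mode n x\<bar> \<le> 2"
proof -
  have "\<bar>sin_mode n x\<bar> \<le> 2 * 1" unfolding sin_mode_def abs_mult
    using sqrt2_le_2 by (intro mult_mono) auto
  then show ?thesis by simp
qed

lemma cos_mode_measurable[measurable]: "cos_mode n \<in> borel_measurable borel"
  unfolding cos_mode_def by measurable

lemma sin_mode_measurable[measurable]: "sin_mode n \<in> borel_measurable borel"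
  unfolding sin_mode_def by measurable

lemma integral_MX_Icc: "(LINT x|MX. f x) = (LINT x|lborel. indicator {0..1} x *\<^sub>R (f x :: real))"
  if "f \<in> borel_measurable borel" for f
  unfolding integral_MX set_lebesgue_integral_def
proof (rule integral_cong_AE)
  have "AE x in lborel. x \<noteq> (0::real)" "AE x in lborel. x \<noteq> (1::real)" by (auto intro: AE_lborel_singleton)
  then show "AE x in lborel. indicator {0<..<1} x *\<^sub>R f x = indicator {0..1} x *\<^sub>R f x"
    by eventually_elim (auto simp: indicator_def)
qed (use that in auto)

lemma cos_integral: "(LINT x|MX. cos (of_int l * pi * x)) = (if l = 0 then 1 else 0)"
proof (cases "l = 0")
  case True
  then show ?thesis using measure_MX by simp
next
  case False
  have "(LINT x|MX. cos (of_int l * pi * x)) = (LINT x|lborel. indicator {0..1} x *\<^sub>R cos (of_int l * pi * x))"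
    by (rule integral_MX_Icc) measurable
  also have "\<dots> = sin (of_int l * pi * 1) / (of_int l * pi) - sin (of_int l * pi * 0) / (of_int l * pi)"
  proof (rule integral_FTC_Icc)
    fix x
    have "((\<lambda>x. sin (of_int l * pi * x) / (of_int l * pi)) has_real_derivative cos (of_int l * pi * x)) (at x within {0..1})"
      using False by (auto intro!: derivative_eq_intros)
    then show "((\<lambda>x. sin (of_int l * pi * x) / (of_int l * pi)) has_vector_derivative cos (of_int l * pi * x)) (at x within {0..1})"
      by (simp add: has_real_derivative_iff_has_vector_derivative)
  qed (auto intro!: continuous_intros)
  also have "sin (of_int l * pi * 1) = 0" by (simp add: sin_zero_iff_int2)
  finally show ?thesis using False by simp
qed

lemma integrable_MX_bounded:
  fixes f :: "real \<Rightarrow> 'b::{banach, second_countable_topology}"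
  assumes "f \<in> borel_measurable borel" "\<And>x. norm (f x) \<le> C"
  shows "integrable MX f"
  by (rule MX.integrable_const_bound[where B=C]) (use assms in \<open>auto intro: measurable_restrict_space1\<close>)

text \<open>
  The common properties of the cosine and of the sine system that synthesis needs. The number \<open>\<nu> n\<close> is
  the square norm of \<open>r n\<close>; it is 0 for the sine of index 0.
\<close>

definition orth_family :: "(nat \<Rightarrow> real \<Rightarrow> real) \<Rightarrow> (nat \<Rightarrow> real) \<Rightarrow> bool" where
  "orth_family r \<nu> \<longleftrightarrow> (\<forall>n. r n \<in> borel_measurable borel \<and> (\<forall>x. \<bar>r n x\<bar> \<le> 2) \<and> 0 \<le> \<nu> n \<and> \<nu> n \<le> 1) \<and>
     (\<forall>n m. (LINT x|MX. r n x * r m x) = (if n = m then \<nu> n else 0))"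

lemma orth_cos_mode: "orth_family cos_mode (\<lambda>_. 1)"
proof -
  have "(LINT x|MX. cos_mode n x * cos_mode m x) = (if n = m then 1 else 0)" for n m
  proof -
    let ?c = "(if n = 0 then 1 else sqrt 2) * (if m = 0 then 1 else sqrt 2) / 2 :: real"
    let ?C = "\<lambda>l::int. \<lambda>x. cos (of_int l * pi * x)"
    have e: "cos_mode n x * cos_mode m x = ?c * (?C (int n - int m) x + ?C (int n + int m) x)" for x
      unfolding cos_mode_def by (simp add: cos_add cos_diff algebra_simps)
    have i: "integrable MX (?C l)" for l by (rule integrable_MX_bounded[where C=1]) auto
    have f: "(LINT x|MX. cos_mode n x * cos_mode m x) = ?c * ((LINT x|MX. ?C (int n - int m) x) + (LINT x|MX. ?C (int n + int m) x))"
      unfolding e by (simp only: integral_mult_right_zero Bochner_Integration.integral_add[OF i i])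
    show ?thesis unfolding f cos_integral by auto
  qed
  then show ?thesis unfolding orth_family_def using cos_mode_bound by auto
qed

lemma orth_sin_mode: "orth_family sin_mode (\<lambda>n. if n = 0 then 0 else 1)"
proof -
  have "(LINT x|MX. sin_mode n x * sin_mode m x) = (if n = m then (if n = 0 then 0 else 1) else 0)" for n m
  proof -
    let ?C = "\<lambda>l::int. \<lambda>x. cos (of_int l * pi * x)"
    have e: "sin_mode n x * sin_mode m x = ?C (int n - int m) x - ?C (int n + int m) x" for x
      unfolding sin_mode_def by (simp add: cos_add cos_diff algebra_simps)
    have i: "integrable MX (?C l)" for l by (rule integrable_MX_bounded[where C=1]) auto
    have f: "(LINT x|MX. sin_mode n x * sin_mode m x) = (LINT x|MX. ?C (int n - int m) x) - (LINT x|MX. ?C (int n + int m) x)"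
      unfolding e by (simp only: Bochner_Integration.integral_diff[OF i i])
    show ?thesis unfolding f cos_integral by auto
  qed
  then show ?thesis unfolding orth_family_def using sin_mode_bound by auto
qed

end

text \<open>
  Expansion of the square of a finite sum of orthogonal functions.
\<close>

lemma (in finite_measure) pythagoras:
  fixes e :: "'i \<Rightarrow> 'a \<Rightarrow> complex"
  assumes I: "finite I" and m: "\<And>i. e i \<in> borel_measurable M" and b: "\<And>i x. cmod (e i x) \<le> C"
    and o: "\<And>i j. (LINT x|M. e i x * cnj (e j x)) = (if i = j then of_real (\<nu> i) else 0)"
  shows "integrable M (\<lambda>x. (cmod (\<Sum>i\<in>I. c i * e i x))\<^sup>2)"
    and "(LINT x|M. (cmod (\<Sum>i\<in>I. c i * e i x))\<^sup>2) = (\<Sum>i\<in>I. (cmod (c i))\<^sup>2 * \<nu> i)"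
proof -
  have ii: "integrable M (\<lambda>x. e i x * cnj (e j x))" for i j
  proof (rule integrable_const_bound[where B="C * C"])
    show "AE x in M. cmod (e i x * cnj (e j x)) \<le> C * C"
      using b by (auto simp: norm_mult intro!: mult_mono order_trans[OF norm_ge_zero b])
    have "(\<lambda>x. cnj (e j x)) \<in> borel_measurable M"
      by (rule measurable_compose[OF m borel_measurable_continuous_onI]) (intro continuous_intros)
    then show "(\<lambda>x. e i x * cnj (e j x)) \<in> borel_measurable M" using m by auto
  qed
  have e: "of_real ((cmod (\<Sum>i\<in>I. c i * e i x))\<^sup>2) = (\<Sum>i\<in>I. \<Sum>j\<in>I. (c i * cnj (c j)) * (e i x * cnj (e j x)))" for x
    unfolding complex_norm_square cnj_sum sum_product
    by (intro sum.cong refl) (simp add: mult_ac)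
  have I1: "integrable M (\<lambda>x. complex_of_real ((cmod (\<Sum>i\<in>I. c i * e i x))\<^sup>2))"
    unfolding e by (intro Bochner_Integration.integrable_sum integrable_mult_right ii)
  then show "integrable M (\<lambda>x. (cmod (\<Sum>i\<in>I. c i * e i x))\<^sup>2)"
    by (simp only: complex_of_real_integrable_eq)
  have "complex_of_real (LINT x|M. (cmod (\<Sum>i\<in>I. c i * e i x))\<^sup>2) = (LINT x|M. of_real ((cmod (\<Sum>i\<in>I. c i * e i x))\<^sup>2))"
    by (rule integral_complex_of_real[symmetric])
  also have "\<dots> = (\<Sum>i\<in>I. \<Sum>j\<in>I. (c i * cnj (c j)) * (if i = j then of_real (\<nu> i) else 0))"
    unfolding e
    by (simp only: Bochner_Integration.integral_sum Bochner_Integration.integrable_sum integrable_mult_right ii integral_mult_right_zero o)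
  also have "\<dots> = of_real (\<Sum>i\<in>I. (cmod (c i))\<^sup>2 * \<nu> i)"
    using I by (simp add: if_distrib[where f="\<lambda>y. _ * y"] complex_norm_square[symmetric] cong: if_cong)
  finally show "(LINT x|M. (cmod (\<Sum>i\<in>I. c i * e i x))\<^sup>2) = (\<Sum>i\<in>I. (cmod (c i))\<^sup>2 * \<nu> i)"
    by (simp only: of_real_eq_iff)
qed

lemma cmod_diff_squared: "(cmod (a - b))\<^sup>2 = ((cmod a)\<^sup>2 - 2 * Re (a * cnj b)) + (cmod b)\<^sup>2"
  unfolding cmod_power2 by (simp add: power2_eq_square algebra_simps)

text \<open>
  The square norm of \<open>g\<close> minus its projection is nonnegative.
\<close>

lemma (in finite_measure) Bessel:
  fixes g :: "'a \<Rightarrow> complex" and e :: "'i \<Rightarrow> 'a \<Rightarrow> real"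
  assumes J: "finite J" and m: "\<And>i. e i \<in> borel_measurable M" and b: "\<And>i x. \<bar>e i x\<bar> \<le> C"
    and o: "\<And>i j. (LINT x|M. e i x * e j x) = (if i = j then 1 else 0)"
    and g: "integrable M g" and g2: "integrable M (\<lambda>x. (cmod (g x))\<^sup>2)"
  shows "(\<Sum>n\<in>J. (cmod (LINT x|M. g x * of_real (e n x)))\<^sup>2) \<le> (LINT x|M. (cmod (g x))\<^sup>2)"
proof -
  define c where "c n = (LINT x|M. g x * of_real (e n x))" for n
  define S where "S x = (\<Sum>n\<in>J. c n * of_real (e n x))" for x
  have ge: "integrable M (\<lambda>x. g x * of_real (e n x))" for n
    by (rule integrable_mult_bounded[OF g, where C=C]) (use m b in auto)
  have orth: "(LINT x|M. complex_of_real (e i x) * cnj (of_real (e j x))) = (if i = j then of_real 1 else 0)" for i j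
  proof -
    have "(LINT x|M. complex_of_real (e i x) * cnj (of_real (e j x))) = (LINT x|M. of_real (e i x * e j x))" by simp
    also have "\<dots> = of_real (if i = j then 1 else 0)" unfolding integral_complex_of_real o ..
    finally show ?thesis by simp
  qed
  have S1: "integrable M (\<lambda>x. (cmod (S x))\<^sup>2)"
    unfolding S_def by (rule pythagoras(1)[where C=C and \<nu>="\<lambda>_. 1"]) (use J m b orth in auto)
  have S2: "(LINT x|M. (cmod (S x))\<^sup>2) = (\<Sum>n\<in>J. (cmod (c n))\<^sup>2 * 1)"
    unfolding S_def by (rule pythagoras(2)[where C=C and \<nu>="\<lambda>_. 1"]) (use J m b orth in auto)
  have gs: "g x * cnj (S x) = (\<Sum>n\<in>J. cnj (c n) * (g x * of_real (e n x)))" for x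
    unfolding S_def cnj_sum sum_distrib_left by (intro sum.cong refl) (simp add: mult_ac)
  have G1: "integrable M (\<lambda>x. g x * cnj (S x))"
    unfolding gs by (intro Bochner_Integration.integrable_sum integrable_mult_right ge)
  have G2: "(LINT x|M. g x * cnj (S x)) = of_real (\<Sum>n\<in>J. (cmod (c n))\<^sup>2)"
    unfolding gs of_real_sum complex_norm_square
    by (simp only: Bochner_Integration.integral_sum integrable_mult_right ge integral_mult_right_zero c_def[symmetric] mult.commute)
  have "0 \<le> (LINT x|M. (cmod (g x - S x))\<^sup>2)" by simp
  also have "\<dots> = (LINT x|M. ((cmod (g x))\<^sup>2 - 2 * Re (g x * cnj (S x))) + (cmod (S x))\<^sup>2)"
    by (intro Bochner_Integration.integral_cong refl)
      (rule cmod_diff_squared)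
  also have "\<dots> = (LINT x|M. (cmod (g x))\<^sup>2) - 2 * Re (LINT x|M. g x * cnj (S x)) + (LINT x|M. (cmod (S x))\<^sup>2)"
  proof -
    have "integrable M (\<lambda>x. 2 * Re (g x * cnj (S x)))" by (rule integrable_mult_right[OF integrable_Re[OF G1]])
    then show ?thesis
      by (simp only: Bochner_Integration.integral_add Bochner_Integration.integral_diff
        Bochner_Integration.integrable_diff g2 S1 integral_mult_right_zero integral_Re[OF G1])
  qed
  finally show ?thesis unfolding G2 S2 c_def[symmetric] by simp
qed

context time_period begin

definition time_fourier :: "(real \<times> real \<Rightarrow> real) \<Rightarrow> int \<Rightarrow> real \<Rightarrow> complex" where
  "time_fourier f k x = (LINT t|MT. of_real (f (x, t)) * time_exp k t)"

text \<open>
  The coefficient with respect to the mode of index \<open>(k, n)\<close>. It is normalised in \<open>x\<close> but, like the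
  time coefficient, carries a factor \<open>T\<close> in time.
\<close>

definition coeff_of :: "(real \<times> real \<Rightarrow> real) \<Rightarrow> int \<Rightarrow> nat \<Rightarrow> complex" where
  "coeff_of f k n = (LINT x|MX. time_fourier f k x * of_real (cos_mode n x))"

lemma time_coeff_eq: "time_coeff \<omega> u k x = time_fourier (fn u) k x"
  by (simp only: time_coeff_def time_fourier_def integral_MT time_exp_def) (simp only: T_def)

lemma borel_measurable_Q_fst: "f \<in> borel_measurable borel \<Longrightarrow> (\<lambda>z. f (fst z)) \<in> borel_measurable Q"
  and borel_measurable_Q_snd: "f \<in> borel_measurable borel \<Longrightarrow> (\<lambda>z. f (snd z)) \<in> borel_measurable Q"
  for f :: "real \<Rightarrow> 'b::topological_space"
proof -
  have 1: "fst \<in> borel_measurable (borel :: (real \<times> real) measure)" "snd \<in> borel_measurable (borel :: (real \<times> real) measure)"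
    by (auto intro!: borel_measurable_continuous_onI continuous_intros)
  show "f \<in> borel_measurable borel \<Longrightarrow> (\<lambda>z. f (fst z)) \<in> borel_measurable Q"
    unfolding Q_eq by (rule measurable_restrict_space1) (use measurable_compose[OF 1(1)] in simp)
  show "f \<in> borel_measurable borel \<Longrightarrow> (\<lambda>z. f (snd z)) \<in> borel_measurable Q"
    unfolding Q_eq by (rule measurable_restrict_space1) (use measurable_compose[OF 1(2)] in simp)
qed

lemma integrable_Q_time_exp:
  assumes "integrable Q f"
  shows "integrable Q (\<lambda>z. complex_of_real (f z) * time_exp k (snd z))"
proof (rule integrable_mult_bounded[where C=1])
  show "integrable Q (\<lambda>z. complex_of_real (f z))" using assms by simp
qed (auto intro: borel_measurable_Q_snd)

lemma time_fourier_integrable: "integrable Q f \<Longrightarrow> integrable MX (time_fourier f k)"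
  unfolding time_fourier_def using integrable_Q_fst(2)[OF integrable_Q_time_exp, of f k] by simp

lemma time_fourier_measurable: "integrable Q f \<Longrightarrow> time_fourier f k \<in> borel_measurable MX"
  by (rule borel_measurable_integrable[OF time_fourier_integrable])

lemma time_fourier_AE_diff:
  assumes "integrable Q f" "integrable Q g"
  shows "AE x in MX. \<forall>k. time_fourier (\<lambda>z. a * f z + b * g z) k x = of_real a * time_fourier f k x + of_real b * time_fourier g k x"
proof -
  have "AE x in MX. \<forall>k. integrable MT (\<lambda>t. complex_of_real (f (x, t)) * time_exp k t)"
    "AE x in MX. \<forall>k. integrable MT (\<lambda>t. complex_of_real (g (x, t)) * time_exp k t)"
    unfolding AE_all_countable
    using integrable_Q_fst(1)[OF integrable_Q_time_exp[OF assms(1)]] integrable_Q_fst(1)[OF integrable_Q_time_exp[OF assms(2)]]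
    by simp_all
  then show ?thesis
  proof eventually_elim
    case (elim x)
    show ?case
    proof
      fix k
      have i: "integrable MT (\<lambda>t. complex_of_real (f (x, t)) * time_exp k t)" "integrable MT (\<lambda>t. complex_of_real (g (x, t)) * time_exp k t)"
        using elim by auto
      have e: "complex_of_real (a * f (x, t) + b * g (x, t)) * time_exp k t
        = of_real a * (of_real (f (x, t)) * time_exp k t) + of_real b * (of_real (g (x, t)) * time_exp k t)" for t
        by (simp add: algebra_simps)
      show "time_fourier (\<lambda>z. a * f z + b * g z) k x = of_real a * time_fourier f k x + of_real b * time_fourier g k x"
        unfolding time_fourier_def e
        by (simp only: Bochner_Integration.integral_add[OF integrable_mult_right[OF i(1)] integrable_mult_right[OF i(2)]] integral_mult_right_zero)
    qed
  qed
qed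

lemma time_fourier_cong_AE:
  assumes "AE z in Q. f z = g z" "f \<in> borel_measurable Q" "g \<in> borel_measurable Q"
  shows "AE x in MX. \<forall>k. time_fourier f k x = time_fourier g k x"
proof -
  have "AE x in MX. AE t in MT. f (x, t) = g (x, t)"
    using assms(1) unfolding Q_def by (rule XT.AE_pair)
  then show ?thesis
  proof (rule AE_mp, intro AE_I2 impI allI)
    fix x k assume x: "x \<in> space MX" and ae: "AE t in MT. f (x, t) = g (x, t)"
    have m: "(\<lambda>t. h (x, t)) \<in> borel_measurable MT" if "h \<in> borel_measurable Q" for h :: "real \<times> real \<Rightarrow> real"
      using that x unfolding Q_def by (intro measurable_compose[OF measurable_Pair1']) auto
    have time_exp: "time_exp k \<in> borel_measurable MT" by (simp add: measurable_restrict_space1)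
    show "time_fourier f k x = time_fourier g k x"
      unfolding time_fourier_def
      by (rule integral_cong_AE) (use m[OF assms(2)] m[OF assms(3)] time_exp ae in \<open>auto elim!: eventually_mono\<close>)
  qed
qed

lemma coeff_of_cell_integral:
  assumes f: "integrable Q f"
  shows "coeff_of f k n = (LINT z|Q. of_real (f z) * (time_exp k (snd z) * of_real (cos_mode n (fst z))))"
    and "integrable Q (\<lambda>z. of_real (f z) * (time_exp k (snd z) * of_real (cos_mode n (fst z))))"
proof -
  show i: "integrable Q (\<lambda>z. of_real (f z) * (time_exp k (snd z) * of_real (cos_mode n (fst z))))"
  proof (rule integrable_mult_bounded[where C=2])
    show "integrable Q (\<lambda>z. complex_of_real (f z))" using f by simp
    show "(\<lambda>z. time_exp k (snd z) * complex_of_real (cos_mode n (fst z))) \<in> borel_measurable Q"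
      by (intro borel_measurable_times borel_measurable_of_real borel_measurable_Q_fst borel_measurable_Q_snd) auto
  qed (auto simp: norm_mult cos_mode_bound)
  have "(LINT z|Q. of_real (f z) * (time_exp k (snd z) * of_real (cos_mode n (fst z))))
     = (LINT x|MX. LINT t|MT. of_real (f (x,t)) * (time_exp k t * of_real (cos_mode n x)))"
    using integrable_Q_fst(3)[OF i] by simp
  also have "\<dots> = coeff_of f k n"
    unfolding coeff_of_def time_fourier_def by (simp only: mult.assoc[symmetric] integral_mult_left_zero)
  finally show "coeff_of f k n = (LINT z|Q. of_real (f z) * (time_exp k (snd z) * of_real (cos_mode n (fst z))))" ..
qed

lemma coeff_of_linear:
  assumes "integrable Q f" "integrable Q g"
  shows "coeff_of (\<lambda>z. a * f z + b * g z) k n = of_real a * coeff_of f k n + of_real b * coeff_of g k n"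
proof -
  have "integrable Q (\<lambda>z. a * f z + b * g z)" using assms by simp
  then have "coeff_of (\<lambda>z. a * f z + b * g z) k n
    = (LINT z|Q. of_real a * (of_real (f z) * (time_exp k (snd z) * of_real (cos_mode n (fst z)))) + of_real b * (of_real (g z) * (time_exp k (snd z) * of_real (cos_mode n (fst z)))))"
    by (subst coeff_of_cell_integral) (auto simp: algebra_simps)
  also have "\<dots> = of_real a * coeff_of f k n + of_real b * coeff_of g k n"
    using coeff_of_cell_integral[OF assms(1), of k n] coeff_of_cell_integral[OF assms(2), of k n]
    by (subst Bochner_Integration.integral_add) (auto intro!: integrable_mult_right)
  finally show ?thesis .
qed

lemma coeff_of_cong_AE:
  assumes "AE z in Q. f z = g z" "integrable Q f" "integrable Q g"
  shows "coeff_of f k n = coeff_of g k n"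
  unfolding coeff_of_cell_integral(1)[OF assms(2)] coeff_of_cell_integral(1)[OF assms(3)]
  by (rule integral_cong_AE)
    (use coeff_of_cell_integral(2)[OF assms(2), of k n] coeff_of_cell_integral(2)[OF assms(3), of k n] assms(1) in \<open>auto elim!: eventually_mono\<close>)

lemma cos_system_total:
  assumes g: "integrable MX g" and 0: "\<And>n. (LINT x|MX. g x * of_real (cos_mode n x)) = 0"
  shows "AE x in MX. g x = (0::complex)"
  unfolding AE_MX_iff
proof (rule cos_coeffs_determine)
  show "set_integrable lborel {0<..<1} g"
    using g by (subst (asm) integrable_restrict_space) (auto simp: set_integrable_def)
  fix n :: nat
  let ?c = "if n = 0 then 1 else sqrt 2 :: real"
  have "(LINT x:{0<..<1}|lborel. g x * of_real (cos (real n * pi * x))) = (LINT x|MX. g x * of_real (cos (real n * pi * x)))"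
    by (simp add: integral_MX)
  also have "\<dots> = (LINT x|MX. of_real (1 / ?c) * (g x * of_real (cos_mode n x)))"
    by (intro Bochner_Integration.integral_cong refl) (simp add: cos_mode_def)
  also have "\<dots> = 0" using 0 by simp
  finally show "(LINT x:{0<..<1}|lborel. g x * of_real (cos (real n * pi * x))) = 0" .
qed

lemma time_fourier_eqI:
  assumes f: "integrable Q f" and g: "integrable Q g" and eq: "\<And>n. coeff_of f k n = c * coeff_of g k n"
  shows "AE x in MX. time_fourier f k x = c * time_fourier g k x"
proof -
  have "AE x in MX. time_fourier f k x - c * time_fourier g k x = 0"
  proof (rule cos_system_total)
    show "integrable MX (\<lambda>x. time_fourier f k x - c * time_fourier g k x)"
      by (intro Bochner_Integration.integrable_diff integrable_mult_right time_fourier_integrable f g)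
    fix n
    have i: "integrable MX (\<lambda>x. time_fourier h k x * of_real (cos_mode n x))" if "integrable Q h" for h
      by (rule integrable_mult_bounded[OF time_fourier_integrable[OF that], where C=2])
        (auto simp: cos_mode_bound intro: measurable_restrict_space1)
    have "(LINT x|MX. (time_fourier f k x - c * time_fourier g k x) * of_real (cos_mode n x)) = coeff_of f k n - c * coeff_of g k n"
      unfolding coeff_of_def left_diff_distrib mult.assoc
      by (simp only: Bochner_Integration.integral_diff[OF i[OF f] integrable_mult_right[OF i[OF g]]] integral_mult_right_zero)
    then show "(LINT x|MX. (time_fourier f k x - c * time_fourier g k x) * of_real (cos_mode n x)) = 0" using eq by simp
  qed
  then show ?thesis by eventually_elim simp
qed

text \<open>
  Totality of the cosines annihilates every time coefficient for almost all \<open>x\<close>, and totality of the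
  exponentials then annihilates almost every slice.
\<close>

lemma coeff_of_eq_0_imp:
  assumes f: "integrable Q f" and 0: "\<And>k n. coeff_of f k n = 0"
  shows "AE z in Q. f z = 0"
proof -
  have "AE x in MX. \<forall>k. time_fourier f k x = 0"
    unfolding AE_all_countable using time_fourier_eqI[OF f f, of _ 0] 0 by simp
  moreover have "AE x in MX. integrable MT (\<lambda>t. f (x, t))" using integrable_Q_fst(1)[OF f] .
  ultimately have "AE x in MX. AE t in MT. f (x, t) = 0"
  proof eventually_elim
    case (elim x)
    have "AE t in lborel. t \<in> {0..2*pi/\<omega>} \<longrightarrow> complex_of_real (f (x, t)) = 0"
    proof (rule exp_coeffs_determine[OF \<omega>_pos])
      have "integrable MT (\<lambda>t. complex_of_real (f (x, t)))" using elim by simp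
      then show "set_integrable lborel {0..2*pi/\<omega>} (\<lambda>t. complex_of_real (f (x, t)))"
        by (subst (asm) integrable_restrict_space) (auto simp: set_integrable_def T_def)
      fix k
      have "time_fourier f k x = 0" using elim by blast
      then show "(LINT t:{0..2*pi/\<omega>}|lborel. complex_of_real (f (x, t)) * exp (- \<i> * of_int k * of_real \<omega> * of_real t)) = 0"
        by (simp only: time_fourier_def integral_MT time_exp_def) (simp only: T_def)
    qed
    then show ?case unfolding AE_MT_iff by (simp add: T_def)
  qed
  moreover have "{z \<in> space Q. f z = 0} \<in> sets Q"
    using borel_measurable_integrable[OF f] by measurable
  ultimately show ?thesis
    unfolding Q_def by (intro XT.AE_pair_measure)
qed

lemma periodic_integrable_integrable: "periodic_integrable u \<Longrightarrow> integrable Q (fn u)" by (simp add: periodic_integrable_def)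

lemma periodic_integrable_eqI_coeff:
  assumes u: "periodic_integrable u" and v: "periodic_integrable v" and eq: "\<And>k n. coeff_of (fn u) k n = coeff_of (fn v) k n"
  shows "u = v"
proof (rule periodic_integrable_eqI[OF u v])
  have "AE z in Q. 1 * fn u z + (-1) * fn v z = 0"
  proof (rule coeff_of_eq_0_imp)
    show "integrable Q (\<lambda>z. 1 * fn u z + (-1) * fn v z)" using u v by (simp add: periodic_integrable_integrable)
    show "coeff_of (\<lambda>z. 1 * fn u z + (-1) * fn v z) k n = 0" for k n
      by (subst coeff_of_linear) (use u v eq in \<open>auto simp: periodic_integrable_integrable\<close>)
  qed
  then show "AE z in Q. fn u z = fn v z" by eventually_elim simp
qed

end

section \<open>Synthesis of functions from their coefficients\<close>

lemma infsum_ennreal_SUP: "infsum f A = (SUP F\<in>{F. finite F \<and> F \<subseteq> A}. sum f F)" for f :: "'a \<Rightarrow> ennreal"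
  by (simp add: nonneg_infsum_complete)

text \<open>
  The discriminant of the nonnegative quadratic polynomial \<open>\<integral> (\<mu> |g| - m)^2\<close>.
\<close>

lemma (in finite_measure) L1_le_L2:
  fixes g :: "'a \<Rightarrow> real"
  assumes m: "g \<in> borel_measurable M" and i: "integrable M (\<lambda>x. (g x)\<^sup>2)"
  shows "(LINT x|M. \<bar>g x\<bar>)\<^sup>2 \<le> (LINT x|M. (g x)\<^sup>2) * measure M (space M)"
proof -
  let ?\<mu> = "measure M (space M)"
  define m where "m = (LINT x|M. \<bar>g x\<bar>)"
  have g: "integrable M (\<lambda>x. \<bar>g x\<bar>)" using square_integrable_imp_integrable[OF assms] by simp
  have "0 \<le> (LINT x|M. (?\<mu> * \<bar>g x\<bar> - m)\<^sup>2)" by simp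
  also have "\<dots> = (LINT x|M. ?\<mu>\<^sup>2 * (g x)\<^sup>2 - (2 * ?\<mu> * m) * \<bar>g x\<bar> + m\<^sup>2)"
    by (intro Bochner_Integration.integral_cong refl) (simp add: power2_eq_square algebra_simps)
  also have "\<dots> = ?\<mu>\<^sup>2 * (LINT x|M. (g x)\<^sup>2) - (2 * ?\<mu> * m) * m + m\<^sup>2 * ?\<mu>"
    using g i by (simp add: m_def mult.commute)
  also have "\<dots> = ?\<mu> * ((LINT x|M. (g x)\<^sup>2) * ?\<mu> - m\<^sup>2)" by (simp add: power2_eq_square algebra_simps)
  finally have *: "0 \<le> ?\<mu> * ((LINT x|M. (g x)\<^sup>2) * ?\<mu> - m\<^sup>2)" .
  show ?thesis
  proof (cases "?\<mu> = 0")
    case True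
    then have "emeasure M (space M) = 0" by (simp add: emeasure_eq_measure)
    then have "AE x in M. False" by (auto simp: AE_iff_measurable[OF sets.top])
    then have "m = 0" unfolding m_def by (intro integral_eq_zero_AE) auto
    then show ?thesis using True m_def by simp
  next
    case False
    then have "?\<mu> > 0" using zero_less_measure_iff by blast
    then show ?thesis using * by (simp add: zero_le_mult_iff m_def)
  qed
qed

context time_period begin

definition freqs :: "nat \<Rightarrow> (int \<times> nat) set" where "freqs N = {- int N..int N} \<times> {..N}"

lemma finite_freqs[simp]: "finite (freqs N)" by (simp add: freqs_def)

lemma freqs_mono: "M \<le> N \<Longrightarrow> freqs M \<subseteq> freqs N" by (auto simp: freqs_def)

definition mode :: "(nat \<Rightarrow> real \<Rightarrow> real) \<Rightarrow> int \<times> nat \<Rightarrow> real \<times> real \<Rightarrow> complex" where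
  "mode r i z = of_real (r (snd i) (fst z)) * time_exp (- fst i) (snd z)"

text \<open>
  The factor \<open>1/T\<close> compensates for the unnormalised exponentials, so that \<open>c\<close> is recovered by the
  coefficients. The exponential with index \<open>-k\<close> is the complex conjugate of the one with index \<open>k\<close>.
\<close>

definition complex_sum :: "(nat \<Rightarrow> real \<Rightarrow> real) \<Rightarrow> (int \<Rightarrow> nat \<Rightarrow> complex) \<Rightarrow> nat \<Rightarrow> real \<times> real \<Rightarrow> complex" where
  "complex_sum r c N z = (\<Sum>i\<in>freqs N. (c (fst i) (snd i) / of_real T) * mode r i z)"

text \<open>
  For Hermitian coefficients the complex sum over the symmetric set of frequencies is real, so that
  taking the real part loses nothing.
\<close>

definition partial_sum :: "(nat \<Rightarrow> real \<Rightarrow> real) \<Rightarrow> (int \<Rightarrow> nat \<Rightarrow> complex) \<Rightarrow> nat \<Rightarrow> real \<times> real \<Rightarrow> real" where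
  "partial_sum r c N z = Re (complex_sum r c N z)"

text \<open>
  The symmetry of the coefficients of real functions.
\<close>

definition hermitian :: "(int \<Rightarrow> nat \<Rightarrow> complex) \<Rightarrow> bool" where
  "hermitian c \<longleftrightarrow> (\<forall>k n. c (- k) n = cnj (c k n))"

text \<open>
  Convergence in L2 of the cell, in a form that does not require the integrals to be finite beforehand.
\<close>

definition L2_lim :: "(nat \<Rightarrow> real \<times> real \<Rightarrow> real) \<Rightarrow> (real \<times> real \<Rightarrow> real) \<Rightarrow> bool" where
  "L2_lim f F \<longleftrightarrow> F \<in> borel_measurable Q \<and> (\<forall>e>0. \<exists>K. \<forall>N\<ge>K. (\<integral>\<^sup>+z. ennreal ((f N z - F z)\<^sup>2) \<partial>Q) \<le> ennreal e)"

lemma complex_sum_real: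
  assumes "hermitian c"
  shows "of_real (partial_sum r c N z) = complex_sum r c N z"
proof -
  have "cnj (complex_sum r c N z) = (\<Sum>i\<in>freqs N. (c (- fst i) (snd i) / of_real T) * mode r (- fst i, snd i) z)"
    unfolding complex_sum_def using assms by (simp add: hermitian_def mode_def time_exp_cnj)
  also have "\<dots> = complex_sum r c N z" unfolding complex_sum_def
    by (rule sum.reindex_bij_witness[of _ "\<lambda>i. (- fst i, snd i)" "\<lambda>i. (- fst i, snd i)"]) (auto simp: freqs_def)
  finally have "complex_sum r c N z \<in> \<real>" by (simp add: Reals_cnj_iff)
  then show ?thesis unfolding partial_sum_def by (simp add: of_real_Re)
qed

lemma mode_measurable_borel:
  assumes "orth_family r \<nu>"
  shows "mode r i \<in> borel_measurable borel"
proof -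
  have 1: "fst \<in> borel_measurable (borel :: (real \<times> real) measure)" "snd \<in> borel_measurable (borel :: (real \<times> real) measure)"
    by (auto intro!: borel_measurable_continuous_onI continuous_intros)
  have "(\<lambda>z. r (snd i) (fst z)) \<in> borel_measurable (borel :: (real \<times> real) measure)"
    by (rule measurable_compose[OF 1(1)]) (use assms in \<open>auto simp: orth_family_def\<close>)
  moreover have "(\<lambda>z. time_exp (- fst i) (snd z)) \<in> borel_measurable (borel :: (real \<times> real) measure)"
    by (rule measurable_compose[OF 1(2)]) auto
  ultimately show ?thesis unfolding mode_def by measurable
qed

lemma mode_measurable: "orth_family r \<nu> \<Longrightarrow> mode r i \<in> borel_measurable Q"
  by (rule borel_measurable_Q[OF mode_measurable_borel])

lemma mode_bound: "orth_family r \<nu> \<Longrightarrow> cmod (mode r i z) \<le> 2"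
  by (simp add: mode_def norm_mult orth_family_def)

lemma mode_orth:
  assumes r: "orth_family r \<nu>"
  shows "(LINT z|Q. mode r i z * cnj (mode r j z)) = (if i = j then of_real (T * \<nu> (snd i)) else 0)"
proof -
  have m: "(\<lambda>z. cnj (mode r j z)) \<in> borel_measurable Q"
    by (rule measurable_compose[OF mode_measurable[OF r] borel_measurable_continuous_onI]) (intro continuous_intros)
  have i: "integrable Q (\<lambda>z. mode r i z * cnj (mode r j z))"
  proof (rule Q.integrable_const_bound[where B="2 * 2"])
    show "AE z in Q. cmod (mode r i z * cnj (mode r j z)) \<le> 2 * 2"
      using mode_bound[OF r] unfolding norm_mult complex_mod_cnj by (intro AE_I2 mult_mono) auto
  qed (intro borel_measurable_times mode_measurable[OF r] m)
  have "(LINT z|Q. mode r i z * cnj (mode r j z)) = (LINT x|MX. LINT t|MT. mode r i (x,t) * cnj (mode r j (x,t)))"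
    by (rule integrable_Q_fst(3)[OF i, symmetric])
  also have "\<dots> = (LINT x|MX. LINT t|MT. of_real (r (snd i) x * r (snd j) x) * time_exp (fst j - fst i) t)"
  proof (intro Bochner_Integration.integral_cong refl)
    fix x t
    have "mode r i (x,t) * cnj (mode r j (x,t)) = of_real (r (snd i) x * r (snd j) x) * (time_exp (- fst i) t * time_exp (fst j) t)"
      by (simp add: mode_def time_exp_cnj)
    then show "mode r i (x,t) * cnj (mode r j (x,t)) = of_real (r (snd i) x * r (snd j) x) * time_exp (fst j - fst i) t"
      unfolding time_exp_mult by (simp add: add.commute)
  qed
  also have "\<dots> = of_real (LINT x|MX. r (snd i) x * r (snd j) x) * (LINT t|MT. time_exp (fst j - fst i) t)"
    by (simp only: integral_mult_right_zero integral_mult_left_zero integral_complex_of_real)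
  also have "\<dots> = (if i = j then of_real (T * \<nu> (snd i)) else 0)"
    using r by (auto simp: orth_family_def time_exp_integral prod_eq_iff)
  finally show ?thesis .
qed

lemma mode_sum_L2:
  assumes r: "orth_family r \<nu>" and A: "finite A"
  shows "(\<integral>\<^sup>+z. ennreal ((cmod (\<Sum>i\<in>A. d i * mode r i z))\<^sup>2) \<partial>Q) \<le> ennreal (T * (\<Sum>i\<in>A. (cmod (d i))\<^sup>2))"
proof -
  have "(\<integral>\<^sup>+z. ennreal ((cmod (\<Sum>i\<in>A. d i * mode r i z))\<^sup>2) \<partial>Q) = ennreal (LINT z|Q. (cmod (\<Sum>i\<in>A. d i * mode r i z))\<^sup>2)"
    using Q.pythagoras(1)[OF A mode_measurable[OF r] mode_bound[OF r] mode_orth[OF r]]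
    by (intro nn_integral_eq_integral) auto
  also have "(LINT z|Q. (cmod (\<Sum>i\<in>A. d i * mode r i z))\<^sup>2) = (\<Sum>i\<in>A. (cmod (d i))\<^sup>2 * (T * \<nu> (snd i)))"
    by (rule Q.pythagoras(2)[OF A mode_measurable[OF r] mode_bound[OF r] mode_orth[OF r]])
  also have "\<dots> \<le> (\<Sum>i\<in>A. T * (cmod (d i))\<^sup>2)"
  proof (rule sum_mono)
    fix i
    have "(cmod (d i))\<^sup>2 * (T * \<nu> (snd i)) \<le> (cmod (d i))\<^sup>2 * (T * 1)"
      using r T_pos by (intro mult_left_mono) (auto simp: orth_family_def)
    then show "(cmod (d i))\<^sup>2 * (T * \<nu> (snd i)) \<le> T * (cmod (d i))\<^sup>2" by (simp add: mult.commute)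
  qed
  finally show ?thesis by (simp add: sum_distrib_left ennreal_leI)
qed

lemma partial_sum_measurable_borel: "orth_family r \<nu> \<Longrightarrow> partial_sum r c N \<in> borel_measurable borel"
  unfolding partial_sum_def complex_sum_def using mode_measurable_borel[of r \<nu>] by measurable

lemma partial_sum_measurable: "orth_family r \<nu> \<Longrightarrow> partial_sum r c N \<in> borel_measurable Q"
  by (rule borel_measurable_Q[OF partial_sum_measurable_borel])

lemma partial_sum_bound:
  assumes r: "orth_family r \<nu>"
  obtains C where "\<And>z. \<bar>partial_sum r c N z\<bar> \<le> C"
proof
  fix z
  have "\<bar>partial_sum r c N z\<bar> \<le> cmod (complex_sum r c N z)" unfolding partial_sum_def by (rule abs_Re_le_cmod)
  also have "\<dots> \<le> (\<Sum>i\<in>freqs N. cmod ((c (fst i) (snd i) / of_real T) * mode r i z))"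
    unfolding complex_sum_def by (rule norm_sum)
  also have "\<dots> \<le> (\<Sum>i\<in>freqs N. cmod (c (fst i) (snd i) / of_real T) * 2)"
    unfolding norm_mult by (intro sum_mono mult_left_mono mode_bound[OF r]) auto
  finally show "\<bar>partial_sum r c N z\<bar> \<le> (\<Sum>i\<in>freqs N. cmod (c (fst i) (snd i) / of_real T) * 2)" .
qed

lemma partial_sum_integrable:
  assumes r: "orth_family r \<nu>" shows "integrable Q (partial_sum r c N)"
proof -
  obtain C where "\<And>z. \<bar>partial_sum r c N z\<bar> \<le> C" using partial_sum_bound[OF r, of c N] by blast
  then show ?thesis by (intro Q.integrable_const_bound[where B=C]) (auto intro: partial_sum_measurable[OF r])
qed

lemma partial_sum_diff_L2:
  assumes r: "orth_family r \<nu>" and MN: "M \<le> N"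
  shows "(\<integral>\<^sup>+z. ennreal ((partial_sum r c N z - partial_sum r c M z)\<^sup>2) \<partial>Q)
    \<le> ennreal (((\<Sum>i\<in>freqs N. (cmod (c (fst i) (snd i)))\<^sup>2) - (\<Sum>i\<in>freqs M. (cmod (c (fst i) (snd i)))\<^sup>2)) / T)"
proof -
  let ?d = "\<lambda>i. c (fst i) (snd i) / complex_of_real T"
  have "(\<integral>\<^sup>+z. ennreal ((partial_sum r c N z - partial_sum r c M z)\<^sup>2) \<partial>Q) \<le> (\<integral>\<^sup>+z. ennreal ((cmod (\<Sum>i\<in>freqs N - freqs M. ?d i * mode r i z))\<^sup>2) \<partial>Q)"
  proof (intro nn_integral_mono ennreal_leI)
    fix z
    have "partial_sum r c N z - partial_sum r c M z = Re (\<Sum>i\<in>freqs N - freqs M. ?d i * mode r i z)"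
      unfolding partial_sum_def complex_sum_def by (simp only: sum_diff[OF finite_freqs freqs_mono[OF MN]] minus_complex.sel)
    then show "(partial_sum r c N z - partial_sum r c M z)\<^sup>2 \<le> (cmod (\<Sum>i\<in>freqs N - freqs M. ?d i * mode r i z))\<^sup>2"
      by (simp only: cmod_power2) simp
  qed
  also have "\<dots> \<le> ennreal (T * (\<Sum>i\<in>freqs N - freqs M. (cmod (?d i))\<^sup>2))"
    by (rule mode_sum_L2[OF r]) simp
  also have "T * (\<Sum>i\<in>freqs N - freqs M. (cmod (?d i))\<^sup>2) = (\<Sum>i\<in>freqs N - freqs M. (cmod (c (fst i) (snd i)))\<^sup>2) / T"
    using T_pos by (simp add: norm_divide power_divide sum_distrib_left sum_divide_distrib power2_eq_square)
  also have "(\<Sum>i\<in>freqs N - freqs M. (cmod (c (fst i) (snd i)))\<^sup>2) = (\<Sum>i\<in>freqs N. (cmod (c (fst i) (snd i)))\<^sup>2) - (\<Sum>i\<in>freqs M. (cmod (c (fst i) (snd i)))\<^sup>2)"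
    by (rule sum_diff[OF finite_freqs freqs_mono[OF MN]])
  finally show ?thesis .
qed

lemma bounded_sums_Cauchy:
  fixes g :: "int \<times> nat \<Rightarrow> real"
  assumes g: "\<And>i. g i \<ge> 0" and B: "\<And>N. sum g (freqs N) \<le> B" and e: "e > 0"
  obtains K where "\<And>M N. K \<le> M \<Longrightarrow> M \<le> N \<Longrightarrow> sum g (freqs N) - sum g (freqs M) \<le> e"
proof -
  have "incseq (\<lambda>N. sum g (freqs N))"
    unfolding incseq_def using g by (auto intro!: sum_mono2 simp: freqs_mono[THEN subsetD])
  then obtain L where "(\<lambda>N. sum g (freqs N)) \<longlonglongrightarrow> L"
    using incseq_convergent[of "\<lambda>N. sum g (freqs N)" B] B by blast
  then have "Cauchy (\<lambda>N. sum g (freqs N))" by (rule LIMSEQ_imp_Cauchy)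
  then obtain K where "\<And>m n. m \<ge> K \<Longrightarrow> n \<ge> K \<Longrightarrow> dist (sum g (freqs m)) (sum g (freqs n)) < e"
    using e unfolding Cauchy_def by blast
  then have "\<And>M N. K \<le> M \<Longrightarrow> M \<le> N \<Longrightarrow> \<bar>sum g (freqs N) - sum g (freqs M)\<bar> < e"
    unfolding dist_real_def by simp
  then show thesis using that[of K] by force
qed

text \<open>
  By orthogonality the distance of two partial sums is a difference of two values of a bounded
  increasing sequence.
\<close>

lemma partial_sum_converges:
  assumes r: "orth_family r \<nu>" and B: "\<And>N. (\<Sum>i\<in>freqs N. (cmod (c (fst i) (snd i)))\<^sup>2) \<le> B"
  obtains F where "L2_lim (partial_sum r c) F"
proof -
  have K: "\<exists>K. \<forall>m\<ge>K. \<forall>n\<ge>K. (\<integral>\<^sup>+z. ennreal ((partial_sum r c m z - partial_sum r c n z)\<^sup>2) \<partial>Q) \<le> ennreal e" if "e > 0" for e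
  proof -
    have "e * T > 0" using that T_pos by simp
    then obtain K where K: "\<And>M N. K \<le> M \<Longrightarrow> M \<le> N \<Longrightarrow>
      (\<Sum>i\<in>freqs N. (cmod (c (fst i) (snd i)))\<^sup>2) - (\<Sum>i\<in>freqs M. (cmod (c (fst i) (snd i)))\<^sup>2) \<le> e * T"
      using bounded_sums_Cauchy[of "\<lambda>i. (cmod (c (fst i) (snd i)))\<^sup>2" B "e * T"] B by auto
    have *: "(\<integral>\<^sup>+z. ennreal ((partial_sum r c N z - partial_sum r c M z)\<^sup>2) \<partial>Q) \<le> ennreal e" if "K \<le> M" "M \<le> N" for M N
      using partial_sum_diff_L2[OF r that(2), of c] K[OF that] T_pos
      by (elim order_trans) (auto intro!: ennreal_leI simp: pos_divide_le_eq)
    show ?thesis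
    proof (intro exI allI impI)
      fix m n assume "m \<ge> K" "n \<ge> K"
      then show "(\<integral>\<^sup>+z. ennreal ((partial_sum r c m z - partial_sum r c n z)\<^sup>2) \<partial>Q) \<le> ennreal e"
        using *[of n m] *[of m n] by (cases "n \<le> m") (auto simp: power2_commute)
    qed
  qed
  from Q.Riesz_Fischer[of "partial_sum r c", OF partial_sum_measurable[OF r] K]
  obtain F where F: "F \<in> borel_measurable Q"
    "\<And>e K n. (\<And>m n. m \<ge> K \<Longrightarrow> n \<ge> K \<Longrightarrow> (\<integral>\<^sup>+z. ennreal ((partial_sum r c m z - partial_sum r c n z)\<^sup>2) \<partial>Q) \<le> ennreal e)
      \<Longrightarrow> n \<ge> K \<Longrightarrow> (\<integral>\<^sup>+z. ennreal ((partial_sum r c n z - F z)\<^sup>2) \<partial>Q) \<le> ennreal e" by blast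
  have "L2_lim (partial_sum r c) F"
    unfolding L2_lim_def
  proof (intro conjI allI impI F(1))
    fix e :: real assume "e > 0"
    then obtain K where "\<forall>m\<ge>K. \<forall>n\<ge>K. (\<integral>\<^sup>+z. ennreal ((partial_sum r c m z - partial_sum r c n z)\<^sup>2) \<partial>Q) \<le> ennreal e" using K by blast
    then have "\<forall>n\<ge>K. (\<integral>\<^sup>+z. ennreal ((partial_sum r c n z - F z)\<^sup>2) \<partial>Q) \<le> ennreal e" using F(2)[of K e] by blast
    then show "\<exists>K. \<forall>n\<ge>K. (\<integral>\<^sup>+z. ennreal ((partial_sum r c n z - F z)\<^sup>2) \<partial>Q) \<le> ennreal e" ..
  qed
  then show thesis by (rule that)
qed

lemma L2_lim_L1:
  assumes l: "L2_lim f F" and f: "\<And>N. integrable Q (f N)"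
  shows "integrable Q F" and "(\<lambda>N. LINT z|Q. \<bar>f N z - F z\<bar>) \<longlonglongrightarrow> 0"
proof -
  have Fm: "F \<in> borel_measurable Q" using l by (simp add: L2_lim_def)
  have sq: "integrable Q (\<lambda>z. (f N z - F z)\<^sup>2) \<and> (LINT z|Q. (f N z - F z)\<^sup>2) \<le> e"
    if "(\<integral>\<^sup>+z. ennreal ((f N z - F z)\<^sup>2) \<partial>Q) \<le> ennreal e" "e > 0" for N e
  proof
    have m: "(\<lambda>z. (f N z - F z)\<^sup>2) \<in> borel_measurable Q" using Fm borel_measurable_integrable[OF f] by measurable
    show i: "integrable Q (\<lambda>z. (f N z - F z)\<^sup>2)"
      using m le_less_trans[OF that(1) ennreal_less_top] by (intro integrableI_bounded) auto
    have "ennreal (LINT z|Q. (f N z - F z)\<^sup>2) \<le> ennreal e"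
      using that(1) by (subst nn_integral_eq_integral[symmetric]) (use i in auto)
    then show "(LINT z|Q. (f N z - F z)\<^sup>2) \<le> e" using that(2) by (simp add: ennreal_le_iff)
  qed
  have fF: "integrable Q (\<lambda>z. f N z - F z)" if "integrable Q (\<lambda>z. (f N z - F z)\<^sup>2)" for N
    by (rule Q.square_integrable_imp_integrable[OF _ that]) (use Fm borel_measurable_integrable[OF f] in measurable)
  obtain K where "\<forall>N\<ge>K. (\<integral>\<^sup>+z. ennreal ((f N z - F z)\<^sup>2) \<partial>Q) \<le> ennreal 1"
    using l zero_less_one unfolding L2_lim_def by blast
  then have "integrable Q (\<lambda>z. f K z - F z)" using sq[of K 1] fF by auto
  then have "integrable Q (\<lambda>z. f K z - (f K z - F z))" by (rule Bochner_Integration.integrable_diff[OF f])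
  then show "integrable Q F" by simp
  show "(\<lambda>N. LINT z|Q. \<bar>f N z - F z\<bar>) \<longlonglongrightarrow> 0"
  proof (rule LIMSEQ_I)
    fix d :: real assume d: "d > 0"
    define e where "e = (d/2)\<^sup>2 / (measure Q (space Q) + 1)"
    have e: "e > 0" unfolding e_def using d by (intro divide_pos_pos) (auto intro: add_nonneg_pos)
    obtain K where K: "\<forall>N\<ge>K. (\<integral>\<^sup>+z. ennreal ((f N z - F z)\<^sup>2) \<partial>Q) \<le> ennreal e"
      using l e unfolding L2_lim_def by blast
    show "\<exists>K. \<forall>N\<ge>K. norm ((LINT z|Q. \<bar>f N z - F z\<bar>) - 0) < d"
    proof (intro exI[of _ K] allI impI)
      fix N assume "N \<ge> K"
      then have s: "integrable Q (\<lambda>z. (f N z - F z)\<^sup>2)" "(LINT z|Q. (f N z - F z)\<^sup>2) \<le> e" using K sq e by auto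
      have "(LINT z|Q. \<bar>f N z - F z\<bar>)\<^sup>2 \<le> (LINT z|Q. (f N z - F z)\<^sup>2) * measure Q (space Q)"
        by (rule Q.L1_le_L2[OF _ s(1)]) (use Fm borel_measurable_integrable[OF f] in measurable)
      also have "\<dots> \<le> e * (measure Q (space Q) + 1)" using s(2) e by (intro mult_mono) auto
      also have "\<dots> = (d/2)\<^sup>2"
      proof -
        have "measure Q (space Q) + 1 > 0" by (intro add_nonneg_pos) auto
        then show ?thesis by (simp add: e_def)
      qed
      finally have "(LINT z|Q. \<bar>f N z - F z\<bar>) \<le> d / 2" by (rule power2_le_imp_le) (use d in simp)
      moreover have "0 \<le> (LINT z|Q. \<bar>f N z - F z\<bar>)" by simp
      ultimately show "norm ((LINT z|Q. \<bar>f N z - F z\<bar>) - 0) < d" using d by simp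
    qed
  qed
qed

text \<open>
  A function on the cell is extended by reducing the time variable modulo the period.
\<close>

lemma periodic_representative:
  assumes F: "F \<in> borel_measurable Q" "integrable Q F"
  obtains u where "periodic_integrable u" "AE z in Q. fn u z = F z"
proof -
  define G where "G z = indicator cell z *\<^sub>R F z" for z
  define wrap where "wrap z = (fst z, snd z - T * of_int \<lfloor>snd z / T\<rfloor>)" for z :: "real \<times> real"
  have G: "G \<in> borel_measurable borel"
    using F(1) unfolding G_def Q_eq by (subst (asm) borel_measurable_restrict_space_iff) auto
  have 1[measurable]: "fst \<in> borel_measurable (borel :: (real \<times> real) measure)" "snd \<in> borel_measurable (borel :: (real \<times> real) measure)"
    by (auto intro!: borel_measurable_continuous_onI continuous_intros)
  have "wrap \<in> borel_measurable borel"
    unfolding wrap_def by (intro borel_measurable_Pair) measurable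
  then have m: "(\<lambda>z. G (wrap z)) \<in> borel_measurable borel" using measurable_compose[OF _ G] by blast
  define u where "u = stripfun_of (\<lambda>z. G (wrap z))"
  have "AE z in restrict_space lborel strip. fn u z = G (wrap z)"
    unfolding u_def by (rule fn_stripfun_of) (use m in \<open>simp add: measurable_restrict_space1\<close>)
  then have ae: "AE z in lborel. z \<in> strip \<longrightarrow> fn u z = G (wrap z)" by (simp add: AE_strip_iff)
  have "AE z in lborel. ((0, T) + z) \<in> strip \<longrightarrow> fn u ((0, T) + z) = G (wrap ((0, T) + z))"
    by (rule AE_lborel_translate[OF ae])
  with ae have per: "AE z in lborel. z \<in> strip \<longrightarrow> fn u (z + (0, T)) = fn u z"
  proof eventually_elim
    case (elim z)
    obtain x t where z: "z = (x, t)" by fastforce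
    have "(T + t) / T = t / T + 1" using T_pos by (simp add: add_divide_distrib)
    then have "\<lfloor>(T + t) / T\<rfloor> = \<lfloor>t / T\<rfloor> + 1" by simp
    then have "wrap ((0, T) + z) = wrap z" by (simp add: wrap_def z algebra_simps)
    then show ?case using elim by (simp add: z strip_def add.commute)
  qed
  have eq: "AE z in Q. fn u z = F z"
    unfolding AE_Q_iff using ae AE_snd_neq[of T 0]
  proof eventually_elim
    case (elim z)
    show ?case
    proof
      assume z: "z \<in> cell"
      then have t: "0 \<le> snd z" "snd z < T" "z \<in> strip" using elim cell_strip by (auto simp: cell_def)
      then have "\<lfloor>snd z / T\<rfloor> = 0" using T_pos by (simp add: floor_eq_iff)
      then have "wrap z = z" by (simp add: wrap_def)
      then show "fn u z = F z" using elim t z by (simp add: G_def)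
    qed
  qed
  have "integrable Q (fn u)"
    by (rule integrable_cong_AE_imp[OF F(2)]) (use eq in \<open>auto elim!: eventually_mono\<close>)
  then show thesis using that per eq unfolding periodic_integrable_def by blast
qed

text \<open>
  The time coefficients depend continuously on the function in L2, slice by slice.
\<close>

lemma time_fourier_L2:
  assumes g: "g \<in> borel_measurable Q"
  shows "(\<integral>\<^sup>+x. ennreal ((cmod (time_fourier g k x))\<^sup>2) \<partial>MX) \<le> ennreal T * (\<integral>\<^sup>+z. ennreal ((g z)\<^sup>2) \<partial>Q)"
proof -
  have hm: "(\<lambda>z. ennreal ((g z)\<^sup>2)) \<in> borel_measurable (MX \<Otimes>\<^sub>M MT)"
    using g unfolding Q_def[symmetric] by measurable
  have "(\<integral>\<^sup>+x. ennreal ((cmod (time_fourier g k x))\<^sup>2) \<partial>MX) \<le> (\<integral>\<^sup>+x. ennreal T * (\<integral>\<^sup>+t. ennreal ((g (x, t))\<^sup>2) \<partial>MT) \<partial>MX)"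
  proof (rule nn_integral_mono)
    fix x assume x: "x \<in> space MX"
    have m: "(\<lambda>t. g (x, t)) \<in> borel_measurable MT"
      using g x unfolding Q_def by (intro measurable_compose[OF measurable_Pair1']) auto
    show "ennreal ((cmod (time_fourier g k x))\<^sup>2) \<le> ennreal T * (\<integral>\<^sup>+t. ennreal ((g (x, t))\<^sup>2) \<partial>MT)"
    proof (cases "(\<integral>\<^sup>+t. ennreal ((g (x, t))\<^sup>2) \<partial>MT) < \<infinity>")
      case True
      then have i2: "integrable MT (\<lambda>t. (g (x, t))\<^sup>2)" using m by (intro integrableI_bounded) auto
      have "cmod (time_fourier g k x) \<le> (LINT t|MT. cmod (of_real (g (x, t)) * time_exp k t))"
        unfolding time_fourier_def by (rule integral_norm_bound)
      also have "\<dots> = (LINT t|MT. \<bar>g (x, t)\<bar>)" by (simp add: norm_mult)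
      finally have "(cmod (time_fourier g k x))\<^sup>2 \<le> (LINT t|MT. \<bar>g (x, t)\<bar>)\<^sup>2" by (intro power_mono) auto
      also have "\<dots> \<le> (LINT t|MT. (g (x, t))\<^sup>2) * T"
        using MT.L1_le_L2[OF m i2] by (simp only: measure_MT)
      finally have "ennreal ((cmod (time_fourier g k x))\<^sup>2) \<le> ennreal (T * (LINT t|MT. (g (x, t))\<^sup>2))"
        by (intro ennreal_leI) (simp add: mult.commute)
      also have "\<dots> = ennreal T * (\<integral>\<^sup>+t. ennreal ((g (x, t))\<^sup>2) \<partial>MT)"
        using T_pos by (subst nn_integral_eq_integral[OF i2]) (auto simp: ennreal_mult)
      finally show ?thesis .
    next
      case False
      then have "(\<integral>\<^sup>+t. ennreal ((g (x, t))\<^sup>2) \<partial>MT) = \<infinity>" by (simp add: not_less top_unique)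
      then show ?thesis using T_pos by (simp add: ennreal_mult_top)
    qed
  qed
  also have "\<dots> = ennreal T * (\<integral>\<^sup>+x. (\<integral>\<^sup>+t. ennreal ((g (x, t))\<^sup>2) \<partial>MT) \<partial>MX)"
    by (rule nn_integral_cmult[OF MT.borel_measurable_nn_integral_fst[OF hm]])
  also have "(\<integral>\<^sup>+x. (\<integral>\<^sup>+t. ennreal ((g (x, t))\<^sup>2) \<partial>MT) \<partial>MX) = (\<integral>\<^sup>+z. ennreal ((g z)\<^sup>2) \<partial>Q)"
    unfolding Q_def by (rule MT.nn_integral_fst[OF hm])
  finally show ?thesis .
qed

lemma time_fourier_partial_sum:
  assumes r: "orth_family r \<nu>" and c: "hermitian c"
  shows "time_fourier (partial_sum r c N) k x = (if \<bar>k\<bar> \<le> int N then (\<Sum>n\<le>N. c k n * of_real (r n x)) else 0)"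
proof -
  have "time_fourier (partial_sum r c N) k x = (LINT t|MT. (\<Sum>i\<in>freqs N. (c (fst i) (snd i) / of_real T * of_real (r (snd i) x)) * time_exp (k - fst i) t))"
    unfolding time_fourier_def
  proof (intro Bochner_Integration.integral_cong refl)
    fix t
    have "of_real (partial_sum r c N (x, t)) * time_exp k t = (\<Sum>i\<in>freqs N. (c (fst i) (snd i) / of_real T * of_real (r (snd i) x)) * (time_exp (- fst i) t * time_exp k t))"
      unfolding complex_sum_real[OF c] complex_sum_def mode_def sum_distrib_right by (intro sum.cong refl) (simp add: mult_ac)
    then show "of_real (partial_sum r c N (x, t)) * time_exp k t = (\<Sum>i\<in>freqs N. (c (fst i) (snd i) / of_real T * of_real (r (snd i) x)) * time_exp (k - fst i) t)"
      by (simp add: time_exp_mult)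
  qed
  also have "\<dots> = (\<Sum>i\<in>freqs N. (c (fst i) (snd i) / of_real T * of_real (r (snd i) x)) * (if k - fst i = 0 then of_real T else 0))"
  proof -
    have "integrable MT (time_exp j)" for j
      by (rule MT.integrable_const_bound[where B=1]) (auto intro: measurable_restrict_space1)
    then show ?thesis
      by (simp only: Bochner_Integration.integral_sum integrable_mult_right integral_mult_right_zero time_exp_integral)
  qed
  also have "\<dots> = (\<Sum>l\<in>{- int N..int N}. \<Sum>n\<le>N. if l = k then c k n * of_real (r n x) else 0)"
    unfolding freqs_def sum.cartesian_product using T_pos
    by (intro sum.cong refl) auto
  also have "\<dots> = (\<Sum>l\<in>{- int N..int N}. if l = k then (\<Sum>n\<le>N. c k n * of_real (r n x)) else 0)"
    by (intro sum.cong refl) auto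
  also have "\<dots> = (if \<bar>k\<bar> \<le> int N then (\<Sum>n\<le>N. c k n * of_real (r n x)) else 0)"
    by (auto simp: abs_le_iff)
  finally show ?thesis .
qed

lemma orth_sum_L2:
  assumes r: "orth_family r \<nu>"
  shows "(\<integral>\<^sup>+x. ennreal ((cmod (\<Sum>n\<le>N. c n * of_real (r n x)))\<^sup>2) \<partial>MX) \<le> ennreal (\<Sum>n\<le>N. (cmod (c n))\<^sup>2)"
proof -
  have o: "(LINT x|MX. complex_of_real (r n x) * cnj (of_real (r m x))) = (if n = m then of_real (\<nu> n) else 0)" for n m
  proof -
    have "(LINT x|MX. complex_of_real (r n x) * cnj (of_real (r m x))) = (LINT x|MX. of_real (r n x * r m x))" by simp
    also have "\<dots> = of_real (if n = m then \<nu> n else 0)"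
      unfolding integral_complex_of_real using r by (simp add: orth_family_def)
    finally show ?thesis by simp
  qed
  have m: "(\<lambda>x. complex_of_real (r n x)) \<in> borel_measurable MX" for n
  proof -
    have "r n \<in> borel_measurable borel" using r by (simp add: orth_family_def)
    then show ?thesis by (intro measurable_restrict_space1) simp
  qed
  have b: "cmod (complex_of_real (r n x)) \<le> 2" for n x using r by (simp add: orth_family_def)
  have "(\<integral>\<^sup>+x. ennreal ((cmod (\<Sum>n\<le>N. c n * of_real (r n x)))\<^sup>2) \<partial>MX) = ennreal (LINT x|MX. (cmod (\<Sum>n\<le>N. c n * of_real (r n x)))\<^sup>2)"
    by (rule nn_integral_eq_integral) (use MX.pythagoras(1)[OF finite_atMost m b o] in auto)
  also have "(LINT x|MX. (cmod (\<Sum>n\<le>N. c n * of_real (r n x)))\<^sup>2) = (\<Sum>n\<le>N. (cmod (c n))\<^sup>2 * \<nu> n)"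
    by (rule MX.pythagoras(2)[OF finite_atMost m b o])
  also have "\<dots> \<le> (\<Sum>n\<le>N. (cmod (c n))\<^sup>2)"
    using r by (intro sum_mono mult_left_le) (auto simp: orth_family_def)
  finally show ?thesis by (simp add: ennreal_leI)
qed

lemma H_sqnorm_eq:
  "H_sqnorm \<omega> s u = (\<Sum>\<^sub>\<infinity>k::int. ennreal ((1 + (of_int k)\<^sup>2) powr s) * (\<integral>\<^sup>+x. ennreal ((cmod (time_fourier (fn u) k x))\<^sup>2) \<partial>MX))"
  unfolding H_sqnorm_def time_coeff_eq by (simp add: nn_integral_restrict_space)

lemma H_space_iff: "u \<in> H_space \<omega> s \<longleftrightarrow> periodic_integrable u \<and> H_sqnorm \<omega> s u < \<infinity>"
proof -
  have "(AE (x, t) in restrict_space lborel strip. fn u (x, t) = fn u (x, t + 2*pi/\<omega>))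
    \<longleftrightarrow> (AE z in lborel. z \<in> strip \<longrightarrow> fn u (z + (0, T)) = fn u z)"
    unfolding AE_strip_iff by (intro AE_cong) (auto simp: T_def)
  moreover have "set_integrable lborel ({0<..<1} \<times> {0..2*pi/\<omega>}) (fn u) \<longleftrightarrow> integrable Q (fn u)"
    unfolding integrable_Q_iff cell_def T_def ..
  ultimately show ?thesis unfolding H_space_def periodic_integrable_def by simp
qed

definition weight :: "real \<Rightarrow> int \<Rightarrow> real" where "weight s k = (1 + (of_int k)\<^sup>2) powr s"

lemma weight_ge_1: "s \<ge> 0 \<Longrightarrow> weight s k \<ge> 1"
  unfolding weight_def by (intro ge_one_powr_ge_zero) auto

lemma weight_nonneg: "weight s k \<ge> 0" by (simp add: weight_def)

lemma weight_add1: "weight (s + 1) k = weight s k * (1 + (of_int k)\<^sup>2)"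
  unfolding weight_def by (simp add: powr_add add_nonneg_eq_0_iff)

lemma time_fourier_diff_L2:
  assumes u: "integrable Q u" and v: "integrable Q v"
  shows "(\<integral>\<^sup>+x. ennreal ((cmod (time_fourier u k x))\<^sup>2) \<partial>MX)
    \<le> 2 * (\<integral>\<^sup>+x. ennreal ((cmod (time_fourier v k x))\<^sup>2) \<partial>MX) + 2 * (ennreal T * (\<integral>\<^sup>+z. ennreal ((v z - u z)\<^sup>2) \<partial>Q))"
proof -
  let ?g = "\<lambda>z. 1 * v z + (-1) * u z"
  have gi: "integrable Q ?g" using u v by simp
  have m: "(\<lambda>x. ennreal ((cmod (time_fourier f k x))\<^sup>2)) \<in> borel_measurable MX" if "integrable Q f" for f
    using time_fourier_measurable[OF that, of k] by measurable
  have "(\<integral>\<^sup>+x. ennreal ((cmod (time_fourier u k x))\<^sup>2) \<partial>MX)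
    \<le> (\<integral>\<^sup>+x. 2 * ennreal ((cmod (time_fourier v k x))\<^sup>2) + 2 * ennreal ((cmod (time_fourier ?g k x))\<^sup>2) \<partial>MX)"
  proof (rule nn_integral_mono_AE)
    show "AE x in MX. ennreal ((cmod (time_fourier u k x))\<^sup>2) \<le> 2 * ennreal ((cmod (time_fourier v k x))\<^sup>2) + 2 * ennreal ((cmod (time_fourier ?g k x))\<^sup>2)"
      using time_fourier_AE_diff[OF v u, of 1 "-1"]
    proof eventually_elim
      case (elim x)
      have "time_fourier ?g k x = of_real 1 * time_fourier v k x + of_real (- 1) * time_fourier u k x" using elim by blast
      then have "time_fourier u k x = time_fourier v k x - time_fourier ?g k x" by simp
      then have "cmod (time_fourier u k x) \<le> cmod (time_fourier v k x) + cmod (time_fourier ?g k x)" by (simp only: norm_triangle_ineq4)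
      then have "(cmod (time_fourier u k x))\<^sup>2 \<le> (cmod (time_fourier v k x) + cmod (time_fourier ?g k x))\<^sup>2" by (intro power_mono) auto
      also have "\<dots> \<le> 2 * (cmod (time_fourier v k x))\<^sup>2 + 2 * (cmod (time_fourier ?g k x))\<^sup>2"
        using sum_squares_bound[of "cmod (time_fourier v k x)" "cmod (time_fourier ?g k x)"] by (simp add: power2_sum)
      finally have "ennreal ((cmod (time_fourier u k x))\<^sup>2) \<le> ennreal (2 * (cmod (time_fourier v k x))\<^sup>2 + 2 * (cmod (time_fourier ?g k x))\<^sup>2)"
        by (rule ennreal_leI)
      then show ?case by (simp add: ennreal_mult)
    qed
  qed
  also have "\<dots> = 2 * (\<integral>\<^sup>+x. ennreal ((cmod (time_fourier v k x))\<^sup>2) \<partial>MX) + 2 * (\<integral>\<^sup>+x. ennreal ((cmod (time_fourier ?g k x))\<^sup>2) \<partial>MX)"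
    using m[OF v] m[OF gi] by (simp add: nn_integral_add nn_integral_cmult)
  also have "(\<integral>\<^sup>+x. ennreal ((cmod (time_fourier ?g k x))\<^sup>2) \<partial>MX) \<le> ennreal T * (\<integral>\<^sup>+z. ennreal ((?g z)\<^sup>2) \<partial>Q)"
    by (rule time_fourier_L2) (use gi in auto)
  finally show ?thesis by (simp add: add_left_mono mult_left_mono)
qed

text \<open>
  Time coefficients of the limit are controlled by those of a late partial sum, at the price of a
  factor 2 and an error that vanishes for any finite set of frequencies. This suffices for finiteness of
  the norm.
\<close>

lemma L2_lim_sqnorm:
  assumes r: "orth_family r \<nu>" and c: "hermitian c" and u: "periodic_integrable u" and l: "L2_lim (partial_sum r c) (fn u)"
    and B: "\<And>N. (\<Sum>i\<in>freqs N. weight s (fst i) * (cmod (c (fst i) (snd i)))\<^sup>2) \<le> B"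
  shows "H_sqnorm \<omega> s u < \<infinity>"
proof -
  have ui: "integrable Q (fn u)" using u by (rule periodic_integrable_integrable)
  let ?t = "\<lambda>k. \<integral>\<^sup>+x. ennreal ((cmod (time_fourier (fn u) k x))\<^sup>2) \<partial>MX"
  have fin: "(\<Sum>k\<in>F. ennreal (weight s k) * ?t k) \<le> ennreal (2 * B + 1)" if F: "finite F" for F :: "int set"
  proof -
    define W where "W = (\<Sum>k\<in>F. weight s k)"
    have W: "W \<ge> 0" unfolding W_def by (intro sum_nonneg weight_nonneg)
    \<comment> \<open>Chosen so that the error, summed over \<open>F\<close> with weights, is at most 1.\<close>
    define e where "e = 1 / (W + 1) / (2 * T)"
    have e: "e > 0" unfolding e_def using T_pos W by simp
    obtain K where K: "\<forall>N\<ge>K. (\<integral>\<^sup>+z. ennreal ((partial_sum r c N z - fn u z)\<^sup>2) \<partial>Q) \<le> ennreal e"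
      using l e unfolding L2_lim_def by blast
    obtain m where m: "\<And>k. k \<in> F \<Longrightarrow> \<bar>k\<bar> \<le> m" using F by (metis Max_ge finite_imageI imageI)
    define N where "N = max K (nat m)"
    have FN: "k \<in> {- int N..int N}" if "k \<in> F" for k using m[OF that] unfolding N_def by auto
    have t: "?t k \<le> ennreal (2 * (\<Sum>n\<le>N. (cmod (c k n))\<^sup>2) + 2 * (T * e))" if "k \<in> F" for k
    proof -
      have "?t k \<le> 2 * (\<integral>\<^sup>+x. ennreal ((cmod (time_fourier (partial_sum r c N) k x))\<^sup>2) \<partial>MX) + 2 * (ennreal T * (\<integral>\<^sup>+z. ennreal ((partial_sum r c N z - fn u z)\<^sup>2) \<partial>Q))"
        by (rule time_fourier_diff_L2[OF ui partial_sum_integrable[OF r]])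
      also have "\<dots> \<le> 2 * ennreal (\<Sum>n\<le>N. (cmod (c k n))\<^sup>2) + 2 * (ennreal T * ennreal e)"
      proof (intro add_mono mult_left_mono)
        have "\<bar>k\<bar> \<le> int N" using FN[OF that] by auto
        then show "(\<integral>\<^sup>+x. ennreal ((cmod (time_fourier (partial_sum r c N) k x))\<^sup>2) \<partial>MX) \<le> ennreal (\<Sum>n\<le>N. (cmod (c k n))\<^sup>2)"
          unfolding time_fourier_partial_sum[OF r c] using orth_sum_L2[OF r] by simp
        show "(\<integral>\<^sup>+z. ennreal ((partial_sum r c N z - fn u z)\<^sup>2) \<partial>Q) \<le> ennreal e" using K by (simp add: N_def)
      qed auto
      also have "\<dots> = ennreal (2 * (\<Sum>n\<le>N. (cmod (c k n))\<^sup>2) + 2 * (T * e))"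
        using T_pos e by (simp add: ennreal_mult sum_nonneg)
      finally show ?thesis .
    qed
    have "(\<Sum>k\<in>F. ennreal (weight s k) * ?t k) \<le> (\<Sum>k\<in>F. ennreal (weight s k * (2 * (\<Sum>n\<le>N. (cmod (c k n))\<^sup>2) + 2 * (T * e))))"
      by (intro sum_mono) (simp only: ennreal_mult'[OF weight_nonneg], intro mult_left_mono t, auto)
    also have "\<dots> = ennreal (\<Sum>k\<in>F. weight s k * (2 * (\<Sum>n\<le>N. (cmod (c k n))\<^sup>2) + 2 * (T * e)))"
      using T_pos e by (intro sum_ennreal mult_nonneg_nonneg weight_nonneg add_nonneg_nonneg sum_nonneg) auto
    also have "\<dots> \<le> ennreal (2 * B + 1)"
    proof (rule ennreal_leI)
      have "(\<Sum>k\<in>F. weight s k * (2 * (\<Sum>n\<le>N. (cmod (c k n))\<^sup>2) + 2 * (T * e)))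
        = 2 * (\<Sum>k\<in>F. weight s k * (\<Sum>n\<le>N. (cmod (c k n))\<^sup>2)) + 2 * (T * e) * W"
        unfolding W_def by (simp add: algebra_simps sum.distrib sum_distrib_left sum_distrib_right)
      also have "(\<Sum>k\<in>F. weight s k * (\<Sum>n\<le>N. (cmod (c k n))\<^sup>2)) \<le> (\<Sum>k\<in>{- int N..int N}. weight s k * (\<Sum>n\<le>N. (cmod (c k n))\<^sup>2))"
        using FN by (intro sum_mono2) (auto intro!: mult_nonneg_nonneg weight_nonneg sum_nonneg)
      also have "\<dots> = (\<Sum>i\<in>freqs N. weight s (fst i) * (cmod (c (fst i) (snd i)))\<^sup>2)"
        unfolding freqs_def sum_distrib_left sum.cartesian_product by (simp add: case_prod_unfold)
      also have "\<dots> \<le> B" by (rule B)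
      also have "2 * (T * e) * W \<le> 1"
      proof -
        define q where "q = 1 / (W + 1)"
        have "2 * (T * (q / (2 * T))) = q" using T_pos by simp
        then have "2 * (T * e) = 1 / (W + 1)" unfolding e_def q_def .
        then have "2 * (T * e) * W = W / (W + 1)" by simp
        then show ?thesis using W by simp
      qed
      finally show "(\<Sum>k\<in>F. weight s k * (2 * (\<Sum>n\<le>N. (cmod (c k n))\<^sup>2) + 2 * (T * e))) \<le> 2 * B + 1" by simp
    qed
    finally show ?thesis .
  qed
  have "H_sqnorm \<omega> s u \<le> ennreal (2 * B + 1)"
    unfolding H_sqnorm_eq infsum_ennreal_SUP weight_def[symmetric] by (rule SUP_least) (use fin in auto)
  then show ?thesis using le_less_trans ennreal_less_top by (metis infinity_ennreal_def)
qed

text \<open>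
  The Riesz-Fischer direction of the correspondence between functions and coefficients.
\<close>

lemma synthesis:
  assumes r: "orth_family r \<nu>" and c: "hermitian c" and s: "s \<ge> 0"
    and B: "\<And>N. (\<Sum>i\<in>freqs N. weight s (fst i) * (cmod (c (fst i) (snd i)))\<^sup>2) \<le> B"
  obtains u where "u \<in> H_space \<omega> s" "L2_lim (partial_sum r c) (fn u)"
proof -
  have "(\<Sum>i\<in>freqs N. (cmod (c (fst i) (snd i)))\<^sup>2) \<le> B" for N
  proof -
    have "(\<Sum>i\<in>freqs N. 1 * (cmod (c (fst i) (snd i)))\<^sup>2) \<le> (\<Sum>i\<in>freqs N. weight s (fst i) * (cmod (c (fst i) (snd i)))\<^sup>2)"
      by (intro sum_mono mult_right_mono weight_ge_1 s) auto
    then show ?thesis using B[of N] by simp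
  qed
  then obtain F where F: "L2_lim (partial_sum r c) F" using partial_sum_converges[OF r] by blast
  have "F \<in> borel_measurable Q" using F by (simp add: L2_lim_def)
  moreover have "integrable Q F" by (rule L2_lim_L1(1)[OF F partial_sum_integrable[OF r]])
  ultimately obtain u where u: "periodic_integrable u" "AE z in Q. fn u z = F z" by (rule periodic_representative)
  have "(\<integral>\<^sup>+z. ennreal ((partial_sum r c N z - fn u z)\<^sup>2) \<partial>Q) = (\<integral>\<^sup>+z. ennreal ((partial_sum r c N z - F z)\<^sup>2) \<partial>Q)" for N
    by (rule nn_integral_cong_AE) (use u(2) in \<open>auto elim!: eventually_mono\<close>)
  then have l: "L2_lim (partial_sum r c) (fn u)" using F by (simp add: L2_lim_def)
  then show thesis using that u(1) L2_lim_sqnorm[OF r c u(1) l B] by (simp add: H_space_iff)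
qed

lemma coeff_of_partial_sum:
  assumes c: "hermitian c" and N: "\<bar>k\<bar> \<le> int N" "n \<le> N"
  shows "coeff_of (partial_sum cos_mode c N) k n = c k n"
proof -
  have i: "integrable MX (\<lambda>x. complex_of_real (cos_mode m x * cos_mode n x))" for m
  proof (rule integrable_MX_bounded[where C="2 * 2"])
    show "cmod (complex_of_real (cos_mode m x * cos_mode n x)) \<le> 2 * 2" for x
      unfolding norm_of_real abs_mult by (intro mult_mono cos_mode_bound) auto
  qed auto
  have "coeff_of (partial_sum cos_mode c N) k n = (LINT x|MX. (\<Sum>m\<le>N. c k m * of_real (cos_mode m x * cos_mode n x)))"
    unfolding coeff_of_def time_fourier_partial_sum[OF orth_cos_mode c] using N by (simp add: sum_distrib_right mult.assoc)
  also have "\<dots> = (\<Sum>m\<le>N. c k m * of_real (LINT x|MX. cos_mode m x * cos_mode n x))"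
    by (simp only: Bochner_Integration.integral_sum integrable_mult_right i integral_mult_right_zero integral_complex_of_real)
  also have "\<dots> = (\<Sum>m\<le>N. if m = n then c k n else 0)"
    using orth_cos_mode by (intro sum.cong refl) (simp add: orth_family_def)
  also have "\<dots> = c k n" using N by simp
  finally show ?thesis .
qed

lemma coeff_of_limit:
  assumes c: "hermitian c" and l: "L2_lim (partial_sum cos_mode c) f"
  shows "coeff_of f k n = c k n"
proof -
  have f: "integrable Q f" by (rule L2_lim_L1(1)[OF l partial_sum_integrable[OF orth_cos_mode]])
  have 1: "cmod (c k n - coeff_of f k n) \<le> 2 * (LINT z|Q. \<bar>partial_sum cos_mode c N z - f z\<bar>)" if N: "\<bar>k\<bar> \<le> int N" "n \<le> N" for N
  proof -
    let ?g = "\<lambda>z. 1 * partial_sum cos_mode c N z + (-1) * f z"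
    have gi: "integrable Q ?g" using f partial_sum_integrable[OF orth_cos_mode] by simp
    have "c k n - coeff_of f k n = coeff_of ?g k n"
      by (subst coeff_of_linear[OF partial_sum_integrable[OF orth_cos_mode] f]) (simp add: coeff_of_partial_sum[OF c N])
    also have "cmod \<dots> \<le> (LINT z|Q. cmod (of_real (?g z) * (time_exp k (snd z) * of_real (cos_mode n (fst z)))))"
      unfolding coeff_of_cell_integral(1)[OF gi] by (rule integral_norm_bound)
    also have "\<dots> \<le> (LINT z|Q. 2 * \<bar>?g z\<bar>)"
    proof (rule integral_mono)
      show "integrable Q (\<lambda>z. cmod (of_real (?g z) * (time_exp k (snd z) * of_real (cos_mode n (fst z)))))"
        by (rule integrable_norm[OF coeff_of_cell_integral(2)[OF gi]])
      show "integrable Q (\<lambda>z. 2 * \<bar>?g z\<bar>)" using gi by simp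
      fix z
      show "cmod (of_real (?g z) * (time_exp k (snd z) * of_real (cos_mode n (fst z)))) \<le> 2 * \<bar>?g z\<bar>"
        using mult_left_mono[OF cos_mode_bound[of n "fst z"], of "\<bar>?g z\<bar>"] by (simp add: norm_mult mult.commute del: of_real_add of_real_diff)
    qed
    also have "\<dots> = 2 * (LINT z|Q. \<bar>partial_sum cos_mode c N z - f z\<bar>)" by simp
    finally show ?thesis .
  qed
  have "(\<lambda>N. 2 * (LINT z|Q. \<bar>partial_sum cos_mode c N z - f z\<bar>)) \<longlonglongrightarrow> 2 * 0"
    by (intro tendsto_intros L2_lim_L1(2)[OF l partial_sum_integrable[OF orth_cos_mode]])
  moreover have "eventually (\<lambda>N. cmod (c k n - coeff_of f k n) \<le> 2 * (LINT z|Q. \<bar>partial_sum cos_mode c N z - f z\<bar>)) sequentially"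
    using eventually_ge_at_top[of "max n (nat \<bar>k\<bar>)"] by eventually_elim (rule 1, auto)
  ultimately have "cmod (c k n - coeff_of f k n) \<le> 2 * 0"
    by (rule tendsto_lowerbound) simp
  then show ?thesis by simp
qed

lemma coeff_of_hermitian: "integrable Q f \<Longrightarrow> hermitian (coeff_of f)"
  unfolding hermitian_def
proof (intro allI)
  fix k n assume f: "integrable Q f"
  show "coeff_of f (- k) n = cnj (coeff_of f k n)"
    unfolding coeff_of_cell_integral(1)[OF f] by (simp add: time_exp_cnj flip: Bochner_Integration.integral_cnj)
qed

text \<open>
  Bessel's inequality in \<open>x\<close> for every time frequency; its analogue for coefficients instead of time
  coefficients of membership in \<open>H\<close>.
\<close>

lemma coeff_of_weighted_le:
  assumes u: "u \<in> H_space \<omega> s"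
  shows "(\<Sum>i\<in>freqs N. weight s (fst i) * (cmod (coeff_of (fn u) (fst i) (snd i)))\<^sup>2) \<le> enn2real (H_sqnorm \<omega> s u)"
proof -
  have ui: "integrable Q (fn u)" and fin: "H_sqnorm \<omega> s u < \<infinity>" using u by (auto simp: H_space_iff periodic_integrable_def)
  let ?t = "\<lambda>k. \<integral>\<^sup>+x. ennreal ((cmod (time_fourier (fn u) k x))\<^sup>2) \<partial>MX"
  have le: "(\<Sum>k\<in>F. ennreal (weight s k) * ?t k) \<le> H_sqnorm \<omega> s u" if "finite F" for F :: "int set"
    unfolding H_sqnorm_eq infsum_ennreal_SUP weight_def[symmetric] by (rule SUP_upper) (use that in auto)
  have fk: "ennreal (\<Sum>n\<le>N. (cmod (coeff_of (fn u) k n))\<^sup>2) \<le> ?t k" for k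
  proof -
    have "ennreal (weight s k) * ?t k \<le> H_sqnorm \<omega> s u" using le[of "{k}"] by simp
    then have "ennreal (weight s k) * ?t k < \<infinity>" using fin by (rule le_less_trans)
    moreover have "weight s k > 0" unfolding weight_def by (simp add: add_nonneg_eq_0_iff)
    ultimately have "?t k < \<infinity>" by (auto simp: ennreal_mult_less_top)
    then have i2: "integrable MX (\<lambda>x. (cmod (time_fourier (fn u) k x))\<^sup>2)"
      using time_fourier_measurable[OF ui, of k] by (intro integrableI_bounded) auto
    have "(\<Sum>n\<le>N. (cmod (coeff_of (fn u) k n))\<^sup>2) \<le> (LINT x|MX. (cmod (time_fourier (fn u) k x))\<^sup>2)"
      unfolding coeff_of_def
      by (rule MX.Bessel[where C=2])
        (use time_fourier_integrable[OF ui] i2 orth_cos_mode in \<open>auto simp: cos_mode_bound orth_family_def intro: measurable_restrict_space1\<close>)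
    then show ?thesis by (subst nn_integral_eq_integral[OF i2]) (auto intro: ennreal_leI)
  qed
  have "ennreal (\<Sum>i\<in>freqs N. weight s (fst i) * (cmod (coeff_of (fn u) (fst i) (snd i)))\<^sup>2)
    = ennreal (\<Sum>k\<in>{- int N..int N}. weight s k * (\<Sum>n\<le>N. (cmod (coeff_of (fn u) k n))\<^sup>2))"
    unfolding freqs_def sum_distrib_left sum.cartesian_product by (simp add: case_prod_unfold)
  also have "\<dots> = (\<Sum>k\<in>{- int N..int N}. ennreal (weight s k) * ennreal (\<Sum>n\<le>N. (cmod (coeff_of (fn u) k n))\<^sup>2))"
    unfolding ennreal_mult'[OF weight_nonneg, symmetric]
    by (rule sum_ennreal[symmetric]) (intro mult_nonneg_nonneg weight_nonneg sum_nonneg, auto)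
  also have "\<dots> \<le> (\<Sum>k\<in>{- int N..int N}. ennreal (weight s k) * ?t k)"
    by (intro sum_mono mult_left_mono fk) auto
  also have "\<dots> \<le> H_sqnorm \<omega> s u" by (rule le) simp
  also have "\<dots> = ennreal (enn2real (H_sqnorm \<omega> s u))" using fin by simp
  finally show ?thesis
    by (simp add: ennreal_le_iff)
qed

lemma coeff_of_weighted_bounded:
  assumes "u \<in> H_space \<omega> s"
  obtains B where "\<And>N. (\<Sum>i\<in>freqs N. weight s (fst i) * (cmod (coeff_of (fn u) (fst i) (snd i)))\<^sup>2) \<le> B"
  using coeff_of_weighted_le[OF assms] by blast

text \<open>
  The synthesised function has the same coefficients and hence is the given one.
\<close>

lemma series_of_H_space:
  assumes u: "u \<in> H_space \<omega> s" and s: "s \<ge> 0"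
  shows "L2_lim (partial_sum cos_mode (coeff_of (fn u))) (fn u)"
proof -
  have ui: "periodic_integrable u" "integrable Q (fn u)" using u by (auto simp: H_space_iff periodic_integrable_def)
  obtain B where B: "\<And>N. (\<Sum>i\<in>freqs N. weight s (fst i) * (cmod (coeff_of (fn u) (fst i) (snd i)))\<^sup>2) \<le> B"
    using coeff_of_weighted_bounded[OF u] by blast
  obtain v where v: "v \<in> H_space \<omega> s" "L2_lim (partial_sum cos_mode (coeff_of (fn u))) (fn v)"
    using synthesis[OF orth_cos_mode coeff_of_hermitian[OF ui(2)] s B] by blast
  have "v = u"
    by (rule periodic_integrable_eqI_coeff) (use v ui coeff_of_limit[OF coeff_of_hermitian[OF ui(2)] v(2)] in \<open>auto simp: H_space_iff\<close>)
  then show ?thesis using v by simp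
qed

end

section \<open>Generalized derivatives of Fourier series\<close>

lemma continuous_vanishing_integrable:
  fixes F :: "real \<times> real \<Rightarrow> real"
  assumes c: "continuous_on UNIV F" and F0: "\<And>x t. \<bar>x\<bar> \<ge> R \<or> \<bar>t\<bar> \<ge> R \<Longrightarrow> F (x, t) = 0"
  shows "integrable lborel F"
proof -
  have K: "compact ({-R..R} \<times> {-R..R})" by (simp add: compact_Times)
  have "integrable lborel (\<lambda>z. indicator ({-R..R} \<times> {-R..R}) z *\<^sub>R F z)"
    by (rule borel_integrable_compact[OF K]) (use c continuous_on_subset in blast)
  also have "(\<lambda>z. indicator ({-R..R} \<times> {-R..R}) z *\<^sub>R F z) = F"
  proof
    fix z :: "real \<times> real"
    obtain x t where z: "z = (x, t)" by fastforce
    show "indicator ({-R..R} \<times> {-R..R}) z *\<^sub>R F z = F z"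
    proof (cases "F (x, t) = 0")
      case False
      then have "\<bar>x\<bar> < R" "\<bar>t\<bar> < R" using F0[of x t] by (meson not_less)+
      then show ?thesis by (auto simp: z indicator_def)
    qed (simp add: z)
  qed
  finally show ?thesis .
qed

lemma integral_compact_derivative_0:
  fixes g G :: "real \<Rightarrow> real"
  assumes d: "\<And>x. (G has_real_derivative g x) (at x)" and c: "continuous_on UNIV g"
    and G0: "\<And>x. \<bar>x\<bar> \<ge> R \<Longrightarrow> G x = 0" and g0: "\<And>x. \<bar>x\<bar> \<ge> R \<Longrightarrow> g x = 0" and R: "R > 0"
  shows "(LINT x|lborel. g x) = 0"
proof -
  have "(LINT x|lborel. g x) = (LINT x|lborel. g x * indicator {-R..R} x)"
    using g0 by (intro Bochner_Integration.integral_cong refl) (force simp: indicator_def)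
  also have "\<dots> = G R - G (-R)"
    by (rule integral_FTC_Icc_real) (use R d c in \<open>auto simp: continuous_on_eq_continuous_at\<close>)
  also have "\<dots> = 0" using G0 R by simp
  finally show ?thesis .
qed

lemma test_function_box:
  assumes "test_function \<phi>"
  obtains R where "R > 0" "\<And>x t. \<bar>x\<bar> \<ge> R \<or> \<bar>t\<bar> \<ge> R \<Longrightarrow> \<phi> (x, t) = 0"
proof -
  obtain C R where R: "R > 0" "\<And>x t. \<bar>t\<bar> \<ge> R \<or> x \<le> 0 \<or> x \<ge> 1 \<Longrightarrow> \<phi> (x, t) = 0"
    by (rule test_function_bounds[OF assms]) blast
  have "\<phi> (x, t) = 0" if "\<bar>x\<bar> \<ge> max R 1 \<or> \<bar>t\<bar> \<ge> max R 1" for x t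
    by (rule R(2)) (use that in auto)
  then show thesis using that[of "max R 1"] by auto
qed

lemma strip_integral_test:
  assumes "\<And>z. z \<notin> strip \<Longrightarrow> g z = (0::real)"
  shows "(LINT z:strip|lborel. g z) = (LINT z|lborel. g z)"
  unfolding set_lebesgue_integral_def
  by (intro Bochner_Integration.integral_cong refl) (use assms in \<open>auto simp: indicator_def\<close>)

lemma test_function_0: "test_function \<phi> \<Longrightarrow> z \<notin> strip \<Longrightarrow> \<phi> z = 0"
  unfolding test_function_def by blast

lemma continuous_test_integrable:
  assumes g: "continuous_on UNIV g" and \<psi>: "test_function \<psi>"
  shows "integrable lborel (\<lambda>z. g z * \<psi> z)"
proof -
  obtain R where R: "\<And>x t. \<bar>x\<bar> \<ge> R \<or> \<bar>t\<bar> \<ge> R \<Longrightarrow> \<psi> (x, t) = 0"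
    by (rule test_function_box[OF \<psi>]) blast
  show ?thesis
  proof (rule continuous_vanishing_integrable[where R=R])
    show "continuous_on UNIV (\<lambda>z. g z * \<psi> z)"
      by (intro continuous_intros g test_function_continuous_on \<psi>)
  qed (use R in simp)
qed

lemma continuous_test_set_integrable:
  assumes "continuous_on UNIV g" "test_function \<psi>"
  shows "set_integrable lborel strip (\<lambda>z. g z * \<psi> z)"
  unfolding set_integrable_def
  by (rule integrable_mult_indicator) (use continuous_test_integrable[OF assms] in auto)

text \<open>
  The derivative of the product has compact support in every slice, and so its integral vanishes.
\<close>

lemma integral_by_parts_x:
  assumes d: "\<And>x t. ((\<lambda>s. f (s, t)) has_real_derivative f' (x, t)) (at x)"
    and c: "continuous_on UNIV f" "continuous_on UNIV f'" and \<phi>: "test_function \<phi>"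
  shows "(LINT z:strip|lborel. f z * pd_x \<phi> z) = - (LINT z:strip|lborel. f' z * \<phi> z)"
proof -
  note tx = test_function_pd(1)[OF \<phi>]
  obtain R1 where R1: "R1 > 0" "\<And>x t. \<bar>x\<bar> \<ge> R1 \<or> \<bar>t\<bar> \<ge> R1 \<Longrightarrow> \<phi> (x, t) = 0"
    by (rule test_function_box[OF \<phi>]) blast
  obtain R2 where R2: "\<And>x t. \<bar>x\<bar> \<ge> R2 \<or> \<bar>t\<bar> \<ge> R2 \<Longrightarrow> pd_x \<phi> (x, t) = 0"
    by (rule test_function_box[OF tx]) blast
  define R where "R = max R1 R2"
  define F where "F z = f z * pd_x \<phi> z + f' z * \<phi> z" for z
  have c': "continuous_on UNIV F" unfolding F_def
    by (intro continuous_intros c test_function_continuous_on tx \<phi>)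
  have i: "integrable lborel F"
    by (rule continuous_vanishing_integrable[OF c', of R]) (use R1 R2 in \<open>auto simp: R_def F_def\<close>)
  have slice: "(LINT x|lborel. F (x, t)) = 0" for t
  proof (rule integral_compact_derivative_0[where G="\<lambda>s. f (s, t) * \<phi> (s, t)" and R=R])
    show "((\<lambda>s. f (s, t) * \<phi> (s, t)) has_real_derivative F (x, t)) (at x)" for x
      unfolding F_def by (auto intro!: derivative_eq_intros d test_function_DERIV(1)[OF \<phi>])
    show "continuous_on UNIV (\<lambda>x. F (x, t))"
      by (rule continuous_on_compose2[OF c']) (auto intro!: continuous_intros)
  qed (use R1 R2 in \<open>auto simp: R_def F_def\<close>)
  have "(LINT z|lborel. F z) = (LINT t|lborel. LINT x|lborel. F (x, t))"
    using lborel_pair.integral_snd[of "\<lambda>x t. F (x, t)"] i by (simp add: lborel_prod)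
  then have "(LINT z|lborel. F z) = 0" by (simp only: slice) simp
  then have "(LINT z|lborel. f z * pd_x \<phi> z) + (LINT z|lborel. f' z * \<phi> z) = 0"
    unfolding F_def by (subst (asm) Bochner_Integration.integral_add) (use continuous_test_integrable c tx \<phi> in auto)
  then show ?thesis
    using test_function_0[OF \<phi>] test_function_0[OF tx] by (simp add: strip_integral_test)
qed

lemma integral_by_parts_t:
  assumes d: "\<And>x t. ((\<lambda>s. f (x, s)) has_real_derivative f' (x, t)) (at t)"
    and c: "continuous_on UNIV f" "continuous_on UNIV f'" and \<phi>: "test_function \<phi>"
  shows "(LINT z:strip|lborel. f z * pd_t \<phi> z) = - (LINT z:strip|lborel. f' z * \<phi> z)"
proof -
  note tx = test_function_pd(2)[OF \<phi>]
  obtain R1 where R1: "R1 > 0" "\<And>x t. \<bar>x\<bar> \<ge> R1 \<or> \<bar>t\<bar> \<ge> R1 \<Longrightarrow> \<phi> (x, t) = 0"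
    by (rule test_function_box[OF \<phi>]) blast
  obtain R2 where R2: "\<And>x t. \<bar>x\<bar> \<ge> R2 \<or> \<bar>t\<bar> \<ge> R2 \<Longrightarrow> pd_t \<phi> (x, t) = 0"
    by (rule test_function_box[OF tx]) blast
  define R where "R = max R1 R2"
  define F where "F z = f z * pd_t \<phi> z + f' z * \<phi> z" for z
  have c': "continuous_on UNIV F" unfolding F_def
    by (intro continuous_intros c test_function_continuous_on tx \<phi>)
  have i: "integrable lborel F"
    by (rule continuous_vanishing_integrable[OF c', of R]) (use R1 R2 in \<open>auto simp: R_def F_def\<close>)
  have slice: "(LINT t|lborel. F (x, t)) = 0" for x
  proof (rule integral_compact_derivative_0[where G="\<lambda>s. f (x, s) * \<phi> (x, s)" and R=R])
    show "((\<lambda>s. f (x, s) * \<phi> (x, s)) has_real_derivative F (x, t)) (at t)" for t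
      unfolding F_def by (auto intro!: derivative_eq_intros d test_function_DERIV(2)[OF \<phi>])
    show "continuous_on UNIV (\<lambda>t. F (x, t))"
      by (rule continuous_on_compose2[OF c']) (auto intro!: continuous_intros)
  qed (use R1 R2 in \<open>auto simp: R_def F_def\<close>)
  have "(LINT z|lborel. F z) = (LINT x|lborel. LINT t|lborel. F (x, t))"
    using lborel_pair.integral_fst'[of F] i by (simp add: lborel_prod)
  then have "(LINT z|lborel. F z) = 0" by (simp only: slice) simp
  then have "(LINT z|lborel. f z * pd_t \<phi> z) + (LINT z|lborel. f' z * \<phi> z) = 0"
    unfolding F_def by (subst (asm) Bochner_Integration.integral_add) (use continuous_test_integrable c tx \<phi> in auto)
  then show ?thesis
    using test_function_0[OF \<phi>] test_function_0[OF tx] by (simp add: strip_integral_test)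
qed

context time_period begin

text \<open>
  Unfolding reduces convergence against a test function to convergence in L1 of one cell.
\<close>

lemma strip_integral_tendsto:
  assumes f: "\<And>N. periodic_integrable (f N)" and u: "periodic_integrable u"
    and l: "(\<lambda>N. LINT z|Q. \<bar>fn (f N) z - fn u z\<bar>) \<longlonglongrightarrow> 0" and \<psi>: "test_function \<psi>"
  shows "(\<lambda>N. LINT z:strip|lborel. fn (f N) z * \<psi> z) \<longlonglongrightarrow> (LINT z:strip|lborel. fn u z * \<psi> z)"
proof -
  obtain C R where C: "\<And>z. \<bar>\<psi> z\<bar> \<le> C" "0 \<le> C" and R: "\<And>x t. \<bar>t\<bar> \<ge> R \<or> x \<le> 0 \<or> x \<ge> 1 \<Longrightarrow> \<psi> (x, t) = 0"
    by (rule test_function_bounds[OF \<psi>]) blast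
  obtain J :: nat where J: "real J * T \<ge> R" by (rule period_multiple)
  have \<psi>m: "\<psi> \<in> borel_measurable borel" by (rule test_function_measurable[OF \<psi>])
  have supp: "\<bar>t\<bar> \<ge> real J * T \<Longrightarrow> \<psi> (x, t) = 0" for x t using R[of t x] J by auto
  have m: "(\<lambda>z. \<psi> (a + z)) \<in> borel_measurable borel" for a by (rule measurable_compose[OF _ \<psi>m]) simp
  have int: "integrable Q (\<lambda>z. fn v z * \<psi> (a + z))" if "periodic_integrable v" for v a
    by (rule integrable_Q_mult[where C=C]) (use that C m in \<open>auto simp: periodic_integrable_def\<close>)
  have "(\<lambda>N. LINT z|Q. fn (f N) z * \<psi> (a + z)) \<longlonglongrightarrow> (LINT z|Q. fn u z * \<psi> (a + z))" for a
  proof (rule LIM_zero_cancel, rule Lim_null_comparison)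
    show "(\<lambda>N. C * (LINT z|Q. \<bar>fn (f N) z - fn u z\<bar>)) \<longlonglongrightarrow> 0"
      using tendsto_mult[OF tendsto_const[of C] l] by simp
    show "eventually (\<lambda>N. norm ((LINT z|Q. fn (f N) z * \<psi> (a + z)) - (LINT z|Q. fn u z * \<psi> (a + z)))
        \<le> C * (LINT z|Q. \<bar>fn (f N) z - fn u z\<bar>)) sequentially"
    proof (rule always_eventually, rule allI)
      fix N
      have fu: "integrable Q (\<lambda>z. fn (f N) z - fn u z)" using f u by (auto simp: periodic_integrable_def)
      have "(LINT z|Q. fn (f N) z * \<psi> (a + z)) - (LINT z|Q. fn u z * \<psi> (a + z)) = (LINT z|Q. (fn (f N) z - fn u z) * \<psi> (a + z))"
        by (simp add: left_diff_distrib Bochner_Integration.integral_diff[OF int[OF f] int[OF u]])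
      also have "norm \<dots> \<le> (LINT z|Q. norm ((fn (f N) z - fn u z) * \<psi> (a + z)))" by (rule integral_norm_bound)
      also have "\<dots> \<le> (LINT z|Q. C * \<bar>fn (f N) z - fn u z\<bar>)"
      proof (rule integral_mono)
        show "integrable Q (\<lambda>z. norm ((fn (f N) z - fn u z) * \<psi> (a + z)))"
          by (intro integrable_norm integrable_Q_mult[OF fu m C(1)])
        show "integrable Q (\<lambda>z. C * \<bar>fn (f N) z - fn u z\<bar>)" using fu by simp
        show "norm ((fn (f N) z - fn u z) * \<psi> (a + z)) \<le> C * \<bar>fn (f N) z - fn u z\<bar>" for z
          using mult_left_mono[OF C(1)[of "a + z"], of "\<bar>fn (f N) z - fn u z\<bar>"] by (simp add: abs_mult mult.commute)
      qed
      finally show "norm ((LINT z|Q. fn (f N) z * \<psi> (a + z)) - (LINT z|Q. fn u z * \<psi> (a + z)))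
        \<le> C * (LINT z|Q. \<bar>fn (f N) z - fn u z\<bar>)" by simp
    qed
  qed
  moreover have "(LINT z:strip|lborel. fn v z * \<psi> z) = (\<Sum>j\<in>{- int J..<int J}. LINT z|Q. fn v z * \<psi> ((0, of_int j * T) + z))"
    if "periodic_integrable v" for v
    by (rule unfolding_integral(2)[OF that \<psi>m C(1) supp])
  ultimately show ?thesis
    using f u by (simp only:) (intro tendsto_sum)
qed

lemma partial_sum_period:
  "partial_sum r c N (z + (0, T)) = partial_sum r c N z"
proof -
  have "time_exp k (t + T) = time_exp k t" for k t using time_exp_shift[of k 1 t] by (simp add: add.commute)
  then show ?thesis unfolding partial_sum_def complex_sum_def mode_def by simp
qed

definition partial_sum_fun :: "(nat \<Rightarrow> real \<Rightarrow> real) \<Rightarrow> (int \<Rightarrow> nat \<Rightarrow> complex) \<Rightarrow> nat \<Rightarrow> stripfun" where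
  "partial_sum_fun r c N = stripfun_of (partial_sum r c N)"

lemma partial_sum_fun_AE:
  assumes r: "orth_family r \<nu>"
  shows "AE z in lborel. z \<in> strip \<longrightarrow> fn (partial_sum_fun r c N) z = partial_sum r c N z"
  unfolding partial_sum_fun_def AE_strip_iff[symmetric]
  by (rule fn_stripfun_of) (use partial_sum_measurable_borel[OF r] in \<open>simp add: measurable_restrict_space1\<close>)

lemma partial_sum_fun_AE_Q:
  assumes r: "orth_family r \<nu>"
  shows "AE z in Q. fn (partial_sum_fun r c N) z = partial_sum r c N z"
  unfolding AE_Q_iff using partial_sum_fun_AE[OF r, of c N] by eventually_elim (use cell_strip in auto)

lemma partial_sum_fun_periodic_integrable:
  assumes r: "orth_family r \<nu>"
  shows "periodic_integrable (partial_sum_fun r c N)"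
  unfolding periodic_integrable_def
proof
  have "AE z in lborel. ((0, T) + z) \<in> strip \<longrightarrow> fn (partial_sum_fun r c N) ((0, T) + z) = partial_sum r c N ((0, T) + z)"
    by (rule AE_lborel_translate[OF partial_sum_fun_AE[OF r]])
  then show "AE z in lborel. z \<in> strip \<longrightarrow> fn (partial_sum_fun r c N) (z + (0, T)) = fn (partial_sum_fun r c N) z"
    using partial_sum_fun_AE[OF r, of c N]
  proof eventually_elim
    case (elim z)
    have "z \<in> strip \<Longrightarrow> (0, T) + z \<in> strip" by (cases z) (simp add: strip_def)
    then show ?case using elim partial_sum_period[of r c N z] by (simp add: add.commute)
  qed
  show "integrable Q (fn (partial_sum_fun r c N))"
    by (rule integrable_cong_AE_imp[OF partial_sum_integrable[OF r]]) (use partial_sum_fun_AE_Q[OF r, of c N] in \<open>auto elim!: eventually_mono\<close>)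
qed

lemma partial_sum_strip_tendsto:
  assumes r: "orth_family r \<nu>" and u: "periodic_integrable u" and l: "L2_lim (partial_sum r c) (fn u)" and \<psi>: "test_function \<psi>"
  shows "(\<lambda>N. LINT z:strip|lborel. partial_sum r c N z * \<psi> z) \<longlonglongrightarrow> (LINT z:strip|lborel. fn u z * \<psi> z)"
proof -
  have "(LINT z|Q. \<bar>fn (partial_sum_fun r c N) z - fn u z\<bar>) = (LINT z|Q. \<bar>partial_sum r c N z - fn u z\<bar>)" for N
    by (rule integral_cong_AE) (use partial_sum_fun_AE_Q[OF r, of c N] partial_sum_measurable[OF r] in \<open>auto elim!: eventually_mono\<close>)
  then have "(\<lambda>N. LINT z|Q. \<bar>fn (partial_sum_fun r c N) z - fn u z\<bar>) \<longlonglongrightarrow> 0"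
    using L2_lim_L1(2)[OF l partial_sum_integrable[OF r]] by simp
  from strip_integral_tendsto[OF partial_sum_fun_periodic_integrable[OF r] u this \<psi>]
  have "(\<lambda>N. LINT z:strip|lborel. fn (partial_sum_fun r c N) z * \<psi> z) \<longlonglongrightarrow> (LINT z:strip|lborel. fn u z * \<psi> z)" .
  moreover have "(LINT z:strip|lborel. fn (partial_sum_fun r c N) z * \<psi> z) = (LINT z:strip|lborel. partial_sum r c N z * \<psi> z)" for N
    unfolding set_lebesgue_integral_def
  proof (rule integral_cong_AE)
    show "(\<lambda>z. indicator strip z *\<^sub>R (fn (partial_sum_fun r c N) z * \<psi> z)) \<in> borel_measurable lborel"
      using borel_measurable_times[OF fn_measurable_indicator[OF order_refl strip_sets, of "partial_sum_fun r c N"], of \<psi>] test_function_measurable[OF \<psi>]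
      by (simp add: mult.assoc)
    show "(\<lambda>z. indicator strip z *\<^sub>R (partial_sum r c N z * \<psi> z)) \<in> borel_measurable lborel"
      using partial_sum_measurable_borel[OF r, of c N] test_function_measurable[OF \<psi>] by simp
    show "AE z in lborel. indicator strip z *\<^sub>R (fn (partial_sum_fun r c N) z * \<psi> z) = indicator strip z *\<^sub>R (partial_sum r c N z * \<psi> z)"
      using partial_sum_fun_AE[OF r, of c N] by eventually_elim (auto simp: indicator_def)
  qed
  ultimately show ?thesis by simp
qed

lemma partial_sum_continuous:
  assumes "\<And>n. continuous_on UNIV (r n)"
  shows "continuous_on UNIV (partial_sum r c N)"
proof -
  have "continuous_on UNIV (\<lambda>z::real\<times>real. time_exp k (snd z))" for k
    by (rule continuous_on_compose2[OF time_exp_continuous]) (auto intro!: continuous_intros)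
  moreover have "continuous_on UNIV (\<lambda>z::real\<times>real. r n (fst z))" for n
    by (rule continuous_on_compose2[OF assms]) (auto intro!: continuous_intros)
  ultimately show ?thesis
    unfolding partial_sum_def complex_sum_def mode_def by (intro continuous_intros)
qed

lemma cos_mode_continuous: "continuous_on A (cos_mode n)" and sin_mode_continuous: "continuous_on A (sin_mode n)"
  unfolding cos_mode_def sin_mode_def by (auto intro!: continuous_intros)

lemma partial_sum_eq: "partial_sum r c N (x, t) = (\<Sum>i\<in>freqs N. r (snd i) x * Re ((c (fst i) (snd i) / of_real T) * time_exp (- fst i) t))"
  unfolding partial_sum_def complex_sum_def mode_def Re_sum
  by (intro sum.cong refl) (simp add: algebra_simps)

lemma cos_mode_DERIV: "(cos_mode n has_real_derivative - (real n * pi) * sin_mode n x) (at x)"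
  unfolding cos_mode_def sin_mode_def by (auto intro!: derivative_eq_intros)

lemma sin_mode_DERIV: "(sin_mode n has_real_derivative (real n * pi) * cos_mode n x) (at x)"
  unfolding cos_mode_def sin_mode_def by (auto intro!: derivative_eq_intros)

lemma partial_sum_DERIV_x:
  assumes r: "\<And>n x. (r n has_real_derivative a n * r' n x) (at x)"
  shows "((\<lambda>s. partial_sum r c N (s, t)) has_real_derivative partial_sum r' (\<lambda>k n. of_real (a n) * c k n) N (x, t)) (at x)"
proof -
  have "((\<lambda>s. partial_sum r c N (s, t)) has_real_derivative
     (\<Sum>i\<in>freqs N. (a (snd i) * r' (snd i) x) * Re ((c (fst i) (snd i) / of_real T) * time_exp (- fst i) t))) (at x)"
    unfolding partial_sum_eq by (intro DERIV_sum DERIV_cmult_right r)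
  also have "(\<Sum>i\<in>freqs N. (a (snd i) * r' (snd i) x) * Re ((c (fst i) (snd i) / of_real T) * time_exp (- fst i) t))
    = partial_sum r' (\<lambda>k n. of_real (a n) * c k n) N (x, t)"
    unfolding partial_sum_eq by (intro sum.cong refl) (simp add: algebra_simps)
  finally show ?thesis .
qed

lemma partial_sum_DERIV_t:
  "((\<lambda>s. partial_sum r c N (x, s)) has_real_derivative partial_sum r (\<lambda>k n. (\<i> * of_int k * of_real \<omega>) * c k n) N (x, t)) (at t)"
proof -
  have d: "((\<lambda>s. Re (w * time_exp (- k) s)) has_real_derivative Re (((\<i> * of_int k * of_real \<omega>) * w) * time_exp (- k) t)) (at t)" for w k
  proof -
    have "((\<lambda>s. w * time_exp (- k) s) has_vector_derivative w * ((- \<i> * of_int (- k) * of_real \<omega>) * time_exp (- k) t)) (at t)"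
      by (rule has_vector_derivative_mult_right[OF time_exp_deriv])
    then have "((\<lambda>s. Re (w * time_exp (- k) s)) has_vector_derivative Re (w * ((- \<i> * of_int (- k) * of_real \<omega>) * time_exp (- k) t))) (at t)"
      by (rule bounded_linear.has_vector_derivative[OF bounded_linear_Re])
    also have "w * ((- \<i> * of_int (- k) * of_real \<omega>) * time_exp (- k) t) = ((\<i> * of_int k * of_real \<omega>) * w) * time_exp (- k) t"
      by (simp add: mult_ac)
    finally show ?thesis by (simp add: has_real_derivative_iff_has_vector_derivative)
  qed
  have "((\<lambda>s. partial_sum r c N (x, s)) has_real_derivative
     (\<Sum>i\<in>freqs N. r (snd i) x * Re (((\<i> * of_int (fst i) * of_real \<omega>) * (c (fst i) (snd i) / of_real T)) * time_exp (- fst i) t))) (at t)"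
    unfolding partial_sum_eq by (intro DERIV_sum DERIV_cmult d)
  also have "(\<Sum>i\<in>freqs N. r (snd i) x * Re (((\<i> * of_int (fst i) * of_real \<omega>) * (c (fst i) (snd i) / of_real T)) * time_exp (- fst i) t))
    = partial_sum r (\<lambda>k n. (\<i> * of_int k * of_real \<omega>) * c k n) N (x, t)"
    unfolding partial_sum_eq by (intro sum.cong refl) simp
  finally show ?thesis .
qed

lemma partial_sum_add_coeffs: "partial_sum r (\<lambda>k n. c k n + d k n) N z = partial_sum r c N z + partial_sum r d N z"
  by (cases z) (simp add: partial_sum_eq sum.distrib[symmetric] algebra_simps add_divide_distrib)

text \<open>
  For the partial sums this is integration by parts, and both sides pass to the limit in L2.
\<close>

lemma series_dx:
  assumes u: "periodic_integrable u" "L2_lim (partial_sum cos_mode c) (fn u)"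
    and v: "periodic_integrable v" "L2_lim (partial_sum sin_mode (\<lambda>k n. of_real (- (real n * pi)) * c k n)) (fn v)"
  shows "is_dx u v"
  unfolding is_dx_def weakly_eq_def
proof (intro conjI allI impI periodic_integrable_locally_integrable u(1) v(1))
  fix \<phi> assume \<phi>: "test_function \<phi>"
  have "(LINT z:strip|lborel. partial_sum cos_mode c N z * pd_x \<phi> z) = - (LINT z:strip|lborel. partial_sum sin_mode (\<lambda>k n. of_real (- (real n * pi)) * c k n) N z * \<phi> z)" for N
    by (intro integral_by_parts_x partial_sum_DERIV_x cos_mode_DERIV partial_sum_continuous cos_mode_continuous sin_mode_continuous \<phi>)
  then have "(\<lambda>N. LINT z:strip|lborel. partial_sum cos_mode c N z * pd_x \<phi> z) \<longlonglongrightarrow> - (LINT z:strip|lborel. fn v z * \<phi> z)"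
    using tendsto_minus[OF partial_sum_strip_tendsto[OF orth_sin_mode v \<phi>]] by simp
  from LIMSEQ_unique[OF this partial_sum_strip_tendsto[OF orth_cos_mode u test_function_pd(1)[OF \<phi>]]]
  show "(LINT z:strip|lborel. fn u z * - pd_x \<phi> z) = (LINT z:strip|lborel. fn v z * \<phi> z)"
    by (simp add: set_lebesgue_integral_def)
qed

lemma series_dt:
  assumes u: "periodic_integrable u" "L2_lim (partial_sum cos_mode c) (fn u)"
    and v: "periodic_integrable v" "L2_lim (partial_sum cos_mode (\<lambda>k n. (\<i> * of_int k * of_real \<omega>) * c k n)) (fn v)"
  shows "is_dt u v"
  unfolding is_dt_def weakly_eq_def
proof (intro conjI allI impI periodic_integrable_locally_integrable u(1) v(1))
  fix \<phi> assume \<phi>: "test_function \<phi>"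
  have "(LINT z:strip|lborel. partial_sum cos_mode c N z * pd_t \<phi> z) = - (LINT z:strip|lborel. partial_sum cos_mode (\<lambda>k n. (\<i> * of_int k * of_real \<omega>) * c k n) N z * \<phi> z)" for N
    by (intro integral_by_parts_t partial_sum_DERIV_t partial_sum_continuous cos_mode_continuous \<phi>)
  then have "(\<lambda>N. LINT z:strip|lborel. partial_sum cos_mode c N z * pd_t \<phi> z) \<longlonglongrightarrow> - (LINT z:strip|lborel. fn v z * \<phi> z)"
    using tendsto_minus[OF partial_sum_strip_tendsto[OF orth_cos_mode v \<phi>]] by simp
  from LIMSEQ_unique[OF this partial_sum_strip_tendsto[OF orth_cos_mode u test_function_pd(2)[OF \<phi>]]]
  show "(LINT z:strip|lborel. fn u z * - pd_t \<phi> z) = (LINT z:strip|lborel. fn v z * \<phi> z)"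
    by (simp add: set_lebesgue_integral_def)
qed

text \<open>
  The wave operator is treated as a whole: the two second derivatives of the series need not converge
  separately in L2, only their difference does.
\<close>

lemma series_wave:
  assumes u: "periodic_integrable u" "L2_lim (partial_sum cos_mode c) (fn u)"
    and v: "periodic_integrable v" "L2_lim (partial_sum cos_mode (\<lambda>k n. of_real ((real n * pi)\<^sup>2 - (of_int k * \<omega>)\<^sup>2) * c k n)) (fn v)"
  shows "is_wave u v"
  unfolding is_wave_def weakly_eq_def
proof (intro conjI allI impI periodic_integrable_locally_integrable u(1) v(1))
  fix \<phi> assume \<phi>: "test_function \<phi>"
  let ?ct = "\<lambda>k n. (\<i> * of_int k * of_real \<omega>) * c k n"
  let ?ctt = "\<lambda>k n. (\<i> * of_int k * of_real \<omega>) * ?ct k n"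
  let ?cx = "\<lambda>k n. of_real (- (real n * pi)) * c k n"
  let ?cxx = "\<lambda>k n. of_real (real n * pi) * ?cx k n"
  let ?cw = "\<lambda>k n. of_real ((real n * pi)\<^sup>2 - (of_int k * \<omega>)\<^sup>2) * c k n"
  note \<phi>t = test_function_pd(2)[OF \<phi>] and \<phi>x = test_function_pd(1)[OF \<phi>]
  note \<phi>tt = test_function_pd(2)[OF \<phi>t] and \<phi>xx = test_function_pd(1)[OF \<phi>x]
  have tt: "(LINT z:strip|lborel. partial_sum cos_mode c N z * pd_t (pd_t \<phi>) z) = (LINT z:strip|lborel. partial_sum cos_mode ?ctt N z * \<phi> z)" for N
  proof -
    have "(LINT z:strip|lborel. partial_sum cos_mode c N z * pd_t (pd_t \<phi>) z) = - (LINT z:strip|lborel. partial_sum cos_mode ?ct N z * pd_t \<phi> z)"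
      by (intro integral_by_parts_t partial_sum_DERIV_t partial_sum_continuous cos_mode_continuous \<phi>t)
    also have "(LINT z:strip|lborel. partial_sum cos_mode ?ct N z * pd_t \<phi> z) = - (LINT z:strip|lborel. partial_sum cos_mode ?ctt N z * \<phi> z)"
      by (intro integral_by_parts_t partial_sum_DERIV_t partial_sum_continuous cos_mode_continuous \<phi>)
    finally show ?thesis by simp
  qed
  have xx: "(LINT z:strip|lborel. partial_sum cos_mode c N z * pd_x (pd_x \<phi>) z) = (LINT z:strip|lborel. partial_sum cos_mode ?cxx N z * \<phi> z)" for N
  proof -
    have "(LINT z:strip|lborel. partial_sum cos_mode c N z * pd_x (pd_x \<phi>) z) = - (LINT z:strip|lborel. partial_sum sin_mode ?cx N z * pd_x \<phi> z)"
      by (intro integral_by_parts_x partial_sum_DERIV_x cos_mode_DERIV partial_sum_continuous cos_mode_continuous sin_mode_continuous \<phi>x)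
    also have "(LINT z:strip|lborel. partial_sum sin_mode ?cx N z * pd_x \<phi> z) = - (LINT z:strip|lborel. partial_sum cos_mode ?cxx N z * \<phi> z)"
      by (intro integral_by_parts_x partial_sum_DERIV_x sin_mode_DERIV partial_sum_continuous cos_mode_continuous sin_mode_continuous \<phi>)
    finally show ?thesis by simp
  qed
  have "?ctt = (\<lambda>k n. ?cw k n + ?cxx k n)"
    by (intro ext) (simp add: power2_eq_square algebra_simps)
  then have split: "partial_sum cos_mode ?ctt N z = partial_sum cos_mode ?cw N z + partial_sum cos_mode ?cxx N z" for N z
    using partial_sum_add_coeffs[of cos_mode ?cw ?cxx N z] by simp
  have "(LINT z:strip|lborel. partial_sum cos_mode ?ctt N z * \<phi> z) = (LINT z:strip|lborel. partial_sum cos_mode ?cw N z * \<phi> z) + (LINT z:strip|lborel. partial_sum cos_mode ?cxx N z * \<phi> z)" for N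
    unfolding split ring_distribs
    by (intro set_integral_add(2) continuous_test_set_integrable partial_sum_continuous cos_mode_continuous \<phi>)
  then have "(LINT z:strip|lborel. partial_sum cos_mode ?cw N z * \<phi> z) = (LINT z:strip|lborel. partial_sum cos_mode c N z * pd_t (pd_t \<phi>) z) - (LINT z:strip|lborel. partial_sum cos_mode c N z * pd_x (pd_x \<phi>) z)" for N
    unfolding tt xx by simp
  then have "(\<lambda>N. LINT z:strip|lborel. partial_sum cos_mode ?cw N z * \<phi> z) \<longlonglongrightarrow>
     (LINT z:strip|lborel. fn u z * pd_t (pd_t \<phi>) z) - (LINT z:strip|lborel. fn u z * pd_x (pd_x \<phi>) z)"
    using tendsto_diff[OF partial_sum_strip_tendsto[OF orth_cos_mode u \<phi>tt] partial_sum_strip_tendsto[OF orth_cos_mode u \<phi>xx]] by simp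
  from LIMSEQ_unique[OF this partial_sum_strip_tendsto[OF orth_cos_mode v \<phi>]]
  have "(LINT z:strip|lborel. fn u z * pd_t (pd_t \<phi>) z) - (LINT z:strip|lborel. fn u z * pd_x (pd_x \<phi>) z) = (LINT z:strip|lborel. fn v z * \<phi> z)" .
  moreover have "(LINT z:strip|lborel. fn u z * (pd_t (pd_t \<phi>) z - pd_x (pd_x \<phi>) z))
    = (LINT z:strip|lborel. fn u z * pd_t (pd_t \<phi>) z) - (LINT z:strip|lborel. fn u z * pd_x (pd_x \<phi>) z)"
    unfolding right_diff_distrib
    by (intro set_integral_diff(2) test_function_integrable periodic_integrable_locally_integrable u \<phi>tt \<phi>xx)
  ultimately show "(LINT z:strip|lborel. fn u z * (pd_t (pd_t \<phi>) z - pd_x (pd_x \<phi>) z)) = (LINT z:strip|lborel. fn v z * \<phi> z)"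
    by simp
qed

text \<open>
  One order of the weight pays for the factor \<open>k\<close> of the time derivative.
\<close>

lemma dt_exists:
  assumes u: "u \<in> H_space \<omega> (s + 1)" and s: "s \<ge> 0"
  obtains d where "d \<in> H_space \<omega> s" "is_dt u d" "\<And>k n. coeff_of (fn d) k n = (\<i> * of_int k * of_real \<omega>) * coeff_of (fn u) k n"
proof -
  have ui: "periodic_integrable u" "integrable Q (fn u)" using u by (auto simp: H_space_iff periodic_integrable_def)
  let ?a = "coeff_of (fn u)"
  let ?b = "\<lambda>k n. (\<i> * of_int k * of_real \<omega>) * ?a k n"
  have b: "hermitian ?b" using coeff_of_hermitian[OF ui(2)] unfolding hermitian_def by simp
  obtain B where B: "\<And>N. (\<Sum>i\<in>freqs N. weight (s + 1) (fst i) * (cmod (?a (fst i) (snd i)))\<^sup>2) \<le> B"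
    using coeff_of_weighted_bounded[OF u] by blast
  have "(\<Sum>i\<in>freqs N. weight s (fst i) * (cmod (?b (fst i) (snd i)))\<^sup>2) \<le> \<omega>\<^sup>2 * B" for N
  proof -
    have "(\<Sum>i\<in>freqs N. weight s (fst i) * (cmod (?b (fst i) (snd i)))\<^sup>2) \<le> (\<Sum>i\<in>freqs N. \<omega>\<^sup>2 * (weight (s + 1) (fst i) * (cmod (?a (fst i) (snd i)))\<^sup>2))"
    proof (rule sum_mono)
      fix i
      have "weight s (fst i) * (cmod (?b (fst i) (snd i)))\<^sup>2 = (\<omega>\<^sup>2 * (weight s (fst i) * (cmod (?a (fst i) (snd i)))\<^sup>2)) * (of_int (fst i))\<^sup>2"
        by (simp add: norm_mult power_mult_distrib)
      also have "\<dots> \<le> (\<omega>\<^sup>2 * (weight s (fst i) * (cmod (?a (fst i) (snd i)))\<^sup>2)) * (1 + (of_int (fst i))\<^sup>2)"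
        by (intro mult_left_mono mult_nonneg_nonneg weight_nonneg) auto
      finally show "weight s (fst i) * (cmod (?b (fst i) (snd i)))\<^sup>2 \<le> \<omega>\<^sup>2 * (weight (s + 1) (fst i) * (cmod (?a (fst i) (snd i)))\<^sup>2)"
        by (simp add: weight_add1 mult_ac)
    qed
    also have "\<dots> = \<omega>\<^sup>2 * (\<Sum>i\<in>freqs N. weight (s + 1) (fst i) * (cmod (?a (fst i) (snd i)))\<^sup>2)" by (simp add: sum_distrib_left)
    also have "\<dots> \<le> \<omega>\<^sup>2 * B" by (intro mult_left_mono B) auto
    finally show ?thesis .
  qed
  then obtain d where d: "d \<in> H_space \<omega> s" "L2_lim (partial_sum cos_mode ?b) (fn d)"
    using synthesis[OF orth_cos_mode b s] by blast
  have "is_dt u d"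
    by (rule series_dt[OF ui(1) series_of_H_space[OF u] _ d(2)]) (use s d in \<open>auto simp: H_space_iff\<close>)
  then show thesis using that d(1) coeff_of_limit[OF b d(2)] by blast
qed

end

section \<open>Traces of sine series\<close>

lemma sum_inverse_squares_bounded:
  obtains D :: real where "D \<ge> 0" "\<And>N. (\<Sum>n\<le>N. (1 / real n)\<^sup>2) \<le> D"
proof
  let ?f = "\<lambda>n::nat. (1 / real n)\<^sup>2"
  have s: "summable ?f"
    using inverse_power_summable[of 2, where 'a=real] by (simp add: power_divide inverse_eq_divide)
  show "suminf ?f \<ge> 0" by (rule suminf_nonneg[OF s]) auto
  show "(\<Sum>n\<le>N. ?f n) \<le> suminf ?f" for N by (rule sum_le_suminf[OF s]) auto
qed

context time_period begin

lemma time_exp_orth: "(LINT t|MT. time_exp (- k) t * cnj (time_exp (- l) t)) = (if k = l then of_real T else 0)"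
proof -
  have "time_exp (- k) t * cnj (time_exp (- l) t) = time_exp (l - k) t" for t by (simp add: time_exp_cnj time_exp_mult)
  then show ?thesis by (simp add: time_exp_integral)
qed

text \<open>
  By the Cauchy-Schwarz inequality with weights \<open>n\<close> and \<open>1/n\<close> the bound is uniform in \<open>x\<close>.
\<close>

lemma sine_slice_Cauchy:
  assumes D: "D \<ge> 0" "\<And>N. (\<Sum>n\<le>N. (1 / real n)\<^sup>2) \<le> D" and MN: "M \<le> N"
  shows "(\<integral>\<^sup>+t. ennreal ((partial_sum sin_mode c N (x, t) - partial_sum sin_mode c M (x, t))\<^sup>2) \<partial>MT)
    \<le> ennreal (4 * D / T * ((\<Sum>i\<in>freqs N. (real (snd i) * cmod (c (fst i) (snd i)))\<^sup>2) - (\<Sum>i\<in>freqs M. (real (snd i) * cmod (c (fst i) (snd i)))\<^sup>2)))"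
proof -
  define d where "d k n = (if (k, n) \<in> freqs M then 0 else c k n / complex_of_real T)" for k n
  define b where "b k = (\<Sum>n\<le>N. d k n * of_real (sin_mode n x))" for k
  let ?K = "{- int N..int N}"
  have diff: "partial_sum sin_mode c N (x, t) - partial_sum sin_mode c M (x, t) = Re (\<Sum>k\<in>?K. b k * time_exp (- k) t)" for t
  proof -
    have "complex_sum sin_mode c N (x, t) - complex_sum sin_mode c M (x, t) = (\<Sum>i\<in>freqs N - freqs M. (c (fst i) (snd i) / of_real T) * mode sin_mode i (x, t))"
      unfolding complex_sum_def by (simp only: sum_diff[OF finite_freqs freqs_mono[OF MN]])
    also have "\<dots> = (\<Sum>i\<in>freqs N. d (fst i) (snd i) * mode sin_mode i (x, t))"
      by (rule sum.mono_neutral_cong_left) (auto simp: d_def)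
    also have "\<dots> = (\<Sum>k\<in>?K. b k * time_exp (- k) t)"
      unfolding freqs_def b_def sum_distrib_right sum.cartesian_product
      by (intro sum.cong refl) (auto simp: mode_def)
    finally show ?thesis unfolding partial_sum_def by (metis minus_complex.sel(1))
  qed
  have m: "time_exp (- k) \<in> borel_measurable MT" for k by (simp add: measurable_restrict_space1)
  have o: "(LINT t|MT. time_exp (- k) t * cnj (time_exp (- l) t)) = (if k = l then of_real T else 0)" for k l by (rule time_exp_orth)
  have n: "cmod (time_exp (- k) t) \<le> 1" for k t by simp
  have "(\<integral>\<^sup>+t. ennreal ((partial_sum sin_mode c N (x, t) - partial_sum sin_mode c M (x, t))\<^sup>2) \<partial>MT) \<le> (\<integral>\<^sup>+t. ennreal ((cmod (\<Sum>k\<in>?K. b k * time_exp (- k) t))\<^sup>2) \<partial>MT)"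
    unfolding diff by (intro nn_integral_mono ennreal_leI) (simp only: cmod_power2, simp)
  also have "\<dots> = ennreal (LINT t|MT. (cmod (\<Sum>k\<in>?K. b k * time_exp (- k) t))\<^sup>2)"
    by (rule nn_integral_eq_integral) (use MT.pythagoras(1)[OF _ m n o, of ?K b] in auto)
  also have "(LINT t|MT. (cmod (\<Sum>k\<in>?K. b k * time_exp (- k) t))\<^sup>2) = (\<Sum>k\<in>?K. (cmod (b k))\<^sup>2 * T)"
    by (rule MT.pythagoras(2)[OF _ m n o]) simp
  also have "\<dots> \<le> (\<Sum>k\<in>?K. (4 * D * (\<Sum>n\<le>N. (real n * cmod (d k n))\<^sup>2)) * T)"
  proof (intro sum_mono mult_right_mono)
    fix k
    have "cmod (b k) \<le> (\<Sum>n\<le>N. cmod (d k n * of_real (sin_mode n x)))" unfolding b_def by (rule norm_sum)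
    also have "\<dots> \<le> (\<Sum>n\<le>N. (real n * cmod (d k n)) * (2 * (1 / real n)))"
    proof (rule sum_mono)
      fix n
      show "cmod (d k n * of_real (sin_mode n x)) \<le> (real n * cmod (d k n)) * (2 * (1 / real n))"
        using mult_left_mono[OF sin_mode_bound[of n x], of "cmod (d k n)"]
        unfolding norm_mult norm_of_real
        by (cases "n = 0") (simp_all add: sin_mode_def[of 0] mult.commute)
    qed
    finally have "(cmod (b k))\<^sup>2 \<le> (\<Sum>n\<le>N. (real n * cmod (d k n)) * (2 * (1 / real n)))\<^sup>2" by (intro power_mono) auto
    also have "\<dots> \<le> (\<Sum>n\<le>N. (real n * cmod (d k n))\<^sup>2) * (\<Sum>n\<le>N. (2 * (1 / real n))\<^sup>2)" by (rule Cauchy_Schwarz_ineq_sum)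
    also have "(\<Sum>n\<le>N. (2 * (1 / real n))\<^sup>2) = 4 * (\<Sum>n\<le>N. (1 / real n)\<^sup>2)"
      by (simp add: power_mult_distrib sum_distrib_left power_divide)
    also have "(\<Sum>n\<le>N. (real n * cmod (d k n))\<^sup>2) * (4 * (\<Sum>n\<le>N. (1 / real n)\<^sup>2)) \<le> (\<Sum>n\<le>N. (real n * cmod (d k n))\<^sup>2) * (4 * D)"
      by (intro mult_left_mono sum_nonneg) (auto intro: D(2))
    finally show "(cmod (b k))\<^sup>2 \<le> 4 * D * (\<Sum>n\<le>N. (real n * cmod (d k n))\<^sup>2)" by (simp add: mult.commute)
  qed (use T_pos in auto)
  also have "\<dots> = 4 * D * T * (\<Sum>i\<in>freqs N. (real (snd i) * cmod (d (fst i) (snd i)))\<^sup>2)"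
    unfolding freqs_def sum_distrib_left sum_distrib_right sum.cartesian_product
    by (intro sum.cong refl) (auto simp: mult_ac)
  also have "(\<Sum>i\<in>freqs N. (real (snd i) * cmod (d (fst i) (snd i)))\<^sup>2) = (\<Sum>i\<in>freqs N - freqs M. (real (snd i) * cmod (c (fst i) (snd i)))\<^sup>2 / T\<^sup>2)"
    by (rule sum.mono_neutral_cong_right) (use T_pos in \<open>auto simp: d_def norm_divide power_divide power_mult_distrib\<close>)
  also have "\<dots> = ((\<Sum>i\<in>freqs N. (real (snd i) * cmod (c (fst i) (snd i)))\<^sup>2) - (\<Sum>i\<in>freqs M. (real (snd i) * cmod (c (fst i) (snd i)))\<^sup>2)) / T\<^sup>2"
    by (simp only: sum_divide_distrib[symmetric] sum_diff[OF finite_freqs freqs_mono[OF MN]])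
  also have "4 * D * T * (((\<Sum>i\<in>freqs N. (real (snd i) * cmod (c (fst i) (snd i)))\<^sup>2) - (\<Sum>i\<in>freqs M. (real (snd i) * cmod (c (fst i) (snd i)))\<^sup>2)) / T\<^sup>2)
    = 4 * D / T * ((\<Sum>i\<in>freqs N. (real (snd i) * cmod (c (fst i) (snd i)))\<^sup>2) - (\<Sum>i\<in>freqs M. (real (snd i) * cmod (c (fst i) (snd i)))\<^sup>2))"
    using T_pos by (simp add: power2_eq_square)
  finally show ?thesis by (simp add: ennreal_leI)
qed

lemma partial_sum_slice_measurable:
  assumes r: "orth_family r \<nu>"
  shows "(\<lambda>t. partial_sum r c N (x, t)) \<in> borel_measurable MT"
proof -
  have "(\<lambda>t. (x, t)) \<in> borel_measurable (borel :: real measure)"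
    by (auto intro!: borel_measurable_continuous_onI continuous_intros)
  from measurable_compose[OF this partial_sum_measurable_borel[OF r]] show ?thesis
    by (simp add: measurable_restrict_space1)
qed

text \<open>
  The partial sums are Lipschitz in \<open>x\<close> and converge in L2 of a period, uniformly in \<open>x\<close>; the limit is the
  continuous representative. It vanishes at the two ends because all partial sums do.
\<close>

lemma sine_series_trace:
  assumes v: "periodic_integrable v" and l: "L2_lim (partial_sum sin_mode c) (fn v)"
    and B: "\<And>N. (\<Sum>i\<in>freqs N. (real (snd i) * cmod (c (fst i) (snd i)))\<^sup>2) \<le> B"
    and x0: "x0 = 0 \<or> x0 = 1"
  shows "is_trace \<omega> v x0 (\<lambda>_. 0)"
proof -
  let ?f = "partial_sum sin_mode c"
  let ?g = "\<lambda>i. (real (snd i) * cmod (c (fst i) (snd i)))\<^sup>2"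
  note fm = partial_sum_slice_measurable[OF orth_sin_mode, of c]
  obtain D :: real where D: "D \<ge> 0" "\<And>N. (\<Sum>n\<le>N. (1 / real n)\<^sup>2) \<le> D" by (rule sum_inverse_squares_bounded) blast
  have cau: "\<exists>K. \<forall>x. \<forall>m\<ge>K. \<forall>n\<ge>K. (\<integral>\<^sup>+t. ennreal ((?f m (x, t) - ?f n (x, t))\<^sup>2) \<partial>MT) \<le> ennreal e" if e: "e > 0" for e
  proof -
    have "e * T / (4 * D + 1) > 0" using e T_pos D by (intro divide_pos_pos mult_pos_pos) auto
    then obtain K where K: "\<And>M N. K \<le> M \<Longrightarrow> M \<le> N \<Longrightarrow> sum ?g (freqs N) - sum ?g (freqs M) \<le> e * T / (4 * D + 1)"
      using bounded_sums_Cauchy[of ?g B "e * T / (4 * D + 1)"] B by auto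
    have *: "(\<integral>\<^sup>+t. ennreal ((?f N (x, t) - ?f M (x, t))\<^sup>2) \<partial>MT) \<le> ennreal e" if MN: "K \<le> M" "M \<le> N" for M N x
    proof -
      have "4 * D / T * (sum ?g (freqs N) - sum ?g (freqs M)) \<le> 4 * D / T * (e * T / (4 * D + 1))"
        using D T_pos by (intro mult_left_mono K MN) auto
      also have "\<dots> = e * (4 * D / (4 * D + 1))" using T_pos by simp
      also have "\<dots> \<le> e * 1" using D e by (intro mult_left_mono) auto
      finally have "ennreal (4 * D / T * (sum ?g (freqs N) - sum ?g (freqs M))) \<le> ennreal e" by (simp add: ennreal_leI)
      then show ?thesis using sine_slice_Cauchy[OF D MN(2), of c x] by (rule order_trans[rotated])
    qed
    show ?thesis
    proof (intro exI allI impI)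
      fix x m n assume "m \<ge> K" "n \<ge> K"
      then show "(\<integral>\<^sup>+t. ennreal ((?f m (x, t) - ?f n (x, t))\<^sup>2) \<partial>MT) \<le> ennreal e"
        using *[of n m x] *[of m n x] by (cases "n \<le> m") (auto simp: power2_commute)
    qed
  qed
  \<comment> \<open>The limit inherits the Cauchy estimates with their indices, so that the uniformity in \<open>x\<close> survives.\<close>
  define approx where "approx x H \<longleftrightarrow> H \<in> borel_measurable MT \<and>
    (\<forall>e K n. (\<forall>m\<ge>K. \<forall>n\<ge>K. (\<integral>\<^sup>+t. ennreal ((?f m (x, t) - ?f n (x, t))\<^sup>2) \<partial>MT) \<le> ennreal e)
      \<longrightarrow> n \<ge> K \<longrightarrow> (\<integral>\<^sup>+t. ennreal ((?f n (x, t) - H t)\<^sup>2) \<partial>MT) \<le> ennreal e)" for x and H :: "real \<Rightarrow> real"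
  have "\<exists>H. approx x H" for x
  proof -
    have "\<exists>K. \<forall>m\<ge>K. \<forall>n\<ge>K. (\<integral>\<^sup>+t. ennreal ((?f m (x, t) - ?f n (x, t))\<^sup>2) \<partial>MT) \<le> ennreal e" if "e > 0" for e
      using cau[OF that] by blast
    from MT.Riesz_Fischer[of "\<lambda>n t. ?f n (x, t)", OF fm this]
    obtain H where H: "H \<in> borel_measurable MT"
      "\<And>e K n. (\<And>m n. m \<ge> K \<Longrightarrow> n \<ge> K \<Longrightarrow> (\<integral>\<^sup>+t. ennreal ((?f m (x, t) - ?f n (x, t))\<^sup>2) \<partial>MT) \<le> ennreal e)
        \<Longrightarrow> n \<ge> K \<Longrightarrow> (\<integral>\<^sup>+t. ennreal ((?f n (x, t) - H t)\<^sup>2) \<partial>MT) \<le> ennreal e"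
      by blast
    have "approx x H"
      unfolding approx_def
    proof (intro conjI allI impI H(1))
      fix e K n
      assume a: "\<forall>m\<ge>K. \<forall>n\<ge>K. (\<integral>\<^sup>+t. ennreal ((?f m (x, t) - ?f n (x, t))\<^sup>2) \<partial>MT) \<le> ennreal e" and n: "n \<ge> K"
      show "(\<integral>\<^sup>+t. ennreal ((?f n (x, t) - H t)\<^sup>2) \<partial>MT) \<le> ennreal e"
        by (rule H(2)[OF _ n]) (use a in simp)
    qed
    then show ?thesis by blast
  qed
  then obtain G0 where "\<And>x. approx x (G0 x)" by metis
  then have G0: "\<And>x. G0 x \<in> borel_measurable MT"
    "\<And>x e K n. (\<forall>m\<ge>K. \<forall>n\<ge>K. (\<integral>\<^sup>+t. ennreal ((?f m (x, t) - ?f n (x, t))\<^sup>2) \<partial>MT) \<le> ennreal e)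
      \<Longrightarrow> n \<ge> K \<Longrightarrow> (\<integral>\<^sup>+t. ennreal ((?f n (x, t) - G0 x t)\<^sup>2) \<partial>MT) \<le> ennreal e"
    unfolding approx_def by simp_all
  \<comment> \<open>At the two ends the limit is chosen to be exactly zero; elsewhere it is cut off to the period to be Borel on the line.\<close>
  define G where "G x t = (if x = 0 \<or> x = 1 then 0 else indicator {0..T} t *\<^sub>R G0 x t)" for x t
  have G_borel: "G x \<in> borel_measurable lborel" for x
  proof (cases "x = 0 \<or> x = 1")
    case True then show ?thesis unfolding G_def by simp
  next
    case False
    have "(\<lambda>t. indicator {0..T} t *\<^sub>R G0 x t) \<in> borel_measurable lborel"
      using G0(1)[of x] by (subst (asm) borel_measurable_restrict_space_iff) auto
    then show ?thesis using False unfolding G_def by simp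
  qed
  have G_MT: "G x \<in> borel_measurable MT" for x using G_borel[of x] by (simp add: measurable_restrict_space1)
  have f01: "?f n (x, t) = 0" if "x = 0 \<or> x = 1" for n x t
    using that by (auto simp: partial_sum_eq sin_mode_def)
  have lim: "\<exists>K. \<forall>x. \<forall>n\<ge>K. (\<integral>\<^sup>+t. ennreal ((?f n (x, t) - G x t)\<^sup>2) \<partial>MT) \<le> ennreal e" if e: "e > 0" for e
  proof -
    obtain K where K: "\<forall>x. \<forall>m\<ge>K. \<forall>n\<ge>K. (\<integral>\<^sup>+t. ennreal ((?f m (x, t) - ?f n (x, t))\<^sup>2) \<partial>MT) \<le> ennreal e"
      using cau[OF e] by blast
    have "(\<integral>\<^sup>+t. ennreal ((?f n (x, t) - G x t)\<^sup>2) \<partial>MT) \<le> ennreal e" if n: "n \<ge> K" for x n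
    proof (cases "x = 0 \<or> x = 1")
      case True then show ?thesis using f01[OF True] by (simp add: G_def)
    next
      case False
      have "(\<integral>\<^sup>+t. ennreal ((?f n (x, t) - G x t)\<^sup>2) \<partial>MT) = (\<integral>\<^sup>+t. ennreal ((?f n (x, t) - G0 x t)\<^sup>2) \<partial>MT)"
        using False by (intro nn_integral_cong) (auto simp: G_def space_restrict_space)
      also have "\<dots> \<le> ennreal e" by (rule G0(2)[of K]) (use K n in auto)
      finally show ?thesis .
    qed
    then show ?thesis by blast
  qed
  have bnd: "(\<integral>\<^sup>+t. ennreal ((h t - k t)\<^sup>2) \<partial>MT) \<le> 2 * (\<integral>\<^sup>+t. ennreal ((p t - h t)\<^sup>2) \<partial>MT) + 2 * (\<integral>\<^sup>+t. ennreal ((p t - k t)\<^sup>2) \<partial>MT)"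
    if [measurable]: "h \<in> borel_measurable MT" "k \<in> borel_measurable MT" "p \<in> borel_measurable MT" for h k p :: "real \<Rightarrow> real"
  proof -
    have "(\<integral>\<^sup>+t. ennreal ((h t - k t)\<^sup>2) \<partial>MT) \<le> (\<integral>\<^sup>+t. 2 * ennreal ((p t - h t)\<^sup>2) + 2 * ennreal ((p t - k t)\<^sup>2) \<partial>MT)"
    proof (rule nn_integral_mono)
      fix t
      have "0 \<le> ((p t - h t) + (p t - k t))\<^sup>2" by simp
      then have "(h t - k t)\<^sup>2 \<le> 2 * (p t - h t)\<^sup>2 + 2 * (p t - k t)\<^sup>2"
        by (simp add: power2_eq_square algebra_simps)
      then have "ennreal ((h t - k t)\<^sup>2) \<le> ennreal (2 * (p t - h t)\<^sup>2 + 2 * (p t - k t)\<^sup>2)" by (rule ennreal_leI)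
      then show "ennreal ((h t - k t)\<^sup>2) \<le> 2 * ennreal ((p t - h t)\<^sup>2) + 2 * ennreal ((p t - k t)\<^sup>2)"
        by (simp add: ennreal_mult)
    qed
    also have "\<dots> = 2 * (\<integral>\<^sup>+t. ennreal ((p t - h t)\<^sup>2) \<partial>MT) + 2 * (\<integral>\<^sup>+t. ennreal ((p t - k t)\<^sup>2) \<partial>MT)"
      by (simp add: nn_integral_add nn_integral_cmult)
    finally show ?thesis .
  qed
  have fin: "(\<integral>\<^sup>+t. ennreal ((G x t)\<^sup>2) \<partial>MT) < \<infinity>" for x
  proof -
    obtain K where K: "\<forall>x. \<forall>n\<ge>K. (\<integral>\<^sup>+t. ennreal ((?f n (x, t) - G x t)\<^sup>2) \<partial>MT) \<le> ennreal 1" using lim[of 1] by auto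
    obtain C where C: "\<And>z. \<bar>?f K z\<bar> \<le> C" using partial_sum_bound[OF orth_sin_mode, of c K] by blast
    have "integrable MT (\<lambda>t. (?f K (x, t))\<^sup>2)"
    proof (rule MT.integrable_const_bound[where B="C\<^sup>2"])
      show "AE t in MT. norm ((?f K (x, t))\<^sup>2) \<le> C\<^sup>2"
        using C by (intro AE_I2) (simp add: abs_le_square_iff[symmetric] order_trans[OF C abs_ge_self])
    qed (use fm in measurable)
    then have f2: "(\<integral>\<^sup>+t. ennreal ((?f K (x, t))\<^sup>2) \<partial>MT) < \<infinity>" by (simp add: integrable_iff_bounded)
    have "(\<integral>\<^sup>+t. ennreal ((G x t - 0)\<^sup>2) \<partial>MT) \<le> 2 * (\<integral>\<^sup>+t. ennreal ((?f K (x, t) - G x t)\<^sup>2) \<partial>MT) + 2 * (\<integral>\<^sup>+t. ennreal ((?f K (x, t) - 0)\<^sup>2) \<partial>MT)"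
      by (rule bnd[OF G_MT _ fm]) simp
    also have "\<dots> < \<infinity>"
      using f2 K[rule_format, of K x] by (auto simp: ennreal_mult_less_top ennreal_add_eq_top less_top intro: le_less_trans)
    finally show ?thesis by simp
  qed
  have c1: "set_integrable lborel {0..T} (\<lambda>t. (G x t)\<^sup>2)" for x
  proof -
    have "integrable MT (\<lambda>t. (G x t)\<^sup>2)" using fin[of x] G_MT[of x] by (intro integrableI_bounded) auto
    then show ?thesis by (subst (asm) integrable_restrict_space) (auto simp: set_integrable_def)
  qed
  have c2: "((\<lambda>y. LINT t:{0..T}|lborel. (G y t - G x t)\<^sup>2) \<longlongrightarrow> 0) (at x within {0..1})" for x
  proof (rule tendstoI)
    fix \<epsilon> :: real assume \<epsilon>: "\<epsilon> > 0"
    define e where "e = \<epsilon> / 16"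
    have e: "e > 0" using \<epsilon> by (simp add: e_def)
    obtain K where K: "\<And>x. (\<integral>\<^sup>+t. ennreal ((?f K (x, t) - G x t)\<^sup>2) \<partial>MT) \<le> ennreal e" using lim[OF e] by blast
    obtain L where L: "\<And>z. \<bar>partial_sum cos_mode (\<lambda>k n. of_real (real n * pi) * c k n) K z\<bar> \<le> L"
      using partial_sum_bound[OF orth_cos_mode, of "\<lambda>k n. of_real (real n * pi) * c k n" K] by blast
    have L0: "L \<ge> 0" using order_trans[OF abs_ge_zero L[of 0]] .
    have Lip: "\<bar>?f K (y, t) - ?f K (x, t)\<bar> \<le> L * \<bar>y - x\<bar>" for y t
      using field_differentiable_bound[of UNIV "\<lambda>s. ?f K (s, t)" "\<lambda>s. partial_sum cos_mode (\<lambda>k n. of_real (real n * pi) * c k n) K (s, t)" L y x]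
        partial_sum_DERIV_x[OF sin_mode_DERIV] L by simp
    define \<delta> where "\<delta> = e / (T * (L + 1)\<^sup>2)"
    have \<delta>: "\<delta> > 0" unfolding \<delta>_def using e T_pos L0 by (intro divide_pos_pos mult_pos_pos) auto
    have "eventually (\<lambda>y. (y - x)\<^sup>2 < \<delta>) (at x within {0..1})"
    proof -
      have "((\<lambda>y. (y - x)\<^sup>2) \<longlongrightarrow> (x - x)\<^sup>2) (at x within {0..1})" by (intro tendsto_intros)
      then show ?thesis using \<delta> by (intro order_tendstoD(2)) auto
    qed
    then show "eventually (\<lambda>y. dist (LINT t:{0..T}|lborel. (G y t - G x t)\<^sup>2) 0 < \<epsilon>) (at x within {0..1})"
    proof eventually_elim
      case (elim y)
      have ff: "(\<integral>\<^sup>+t. ennreal ((?f K (x, t) - ?f K (y, t))\<^sup>2) \<partial>MT) \<le> ennreal e"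
      proof -
        have "(\<integral>\<^sup>+t. ennreal ((?f K (x, t) - ?f K (y, t))\<^sup>2) \<partial>MT) \<le> (\<integral>\<^sup>+t. ennreal (e / T) \<partial>MT)"
        proof (intro nn_integral_mono ennreal_leI)
          fix t
          have "(?f K (x, t) - ?f K (y, t))\<^sup>2 = \<bar>?f K (y, t) - ?f K (x, t)\<bar>\<^sup>2" by (simp add: power2_commute)
          also have "\<dots> \<le> (L * \<bar>y - x\<bar>)\<^sup>2" by (intro power_mono Lip) auto
          also have "\<dots> \<le> (L + 1)\<^sup>2 * (y - x)\<^sup>2" unfolding power_mult_distrib power2_abs
            using L0 by (intro mult_right_mono power_mono) auto
          also have "\<dots> \<le> (L + 1)\<^sup>2 * \<delta>" using elim by (intro mult_left_mono) auto
          also have "\<dots> = e / T" unfolding \<delta>_def using L0 by (simp add: add_nonneg_eq_0_iff)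
          finally show "(?f K (x, t) - ?f K (y, t))\<^sup>2 \<le> e / T" .
        qed
        also have "\<dots> = ennreal (e / T) * ennreal T" using measure_MT MT.emeasure_eq_measure[of "space MT"] by simp
        also have "\<dots> = ennreal e" using T_pos e by (simp add: ennreal_mult[symmetric])
        finally show ?thesis .
      qed
      have "(\<integral>\<^sup>+t. ennreal ((G y t - G x t)\<^sup>2) \<partial>MT) \<le> 2 * (\<integral>\<^sup>+t. ennreal ((?f K (y, t) - G y t)\<^sup>2) \<partial>MT) + 2 * (\<integral>\<^sup>+t. ennreal ((?f K (y, t) - G x t)\<^sup>2) \<partial>MT)"
        by (rule bnd[OF G_MT G_MT fm])
      also have "\<dots> \<le> 2 * (\<integral>\<^sup>+t. ennreal ((?f K (y, t) - G y t)\<^sup>2) \<partial>MT) + 2 * (2 * (\<integral>\<^sup>+t. ennreal ((?f K (x, t) - ?f K (y, t))\<^sup>2) \<partial>MT) + 2 * (\<integral>\<^sup>+t. ennreal ((?f K (x, t) - G x t)\<^sup>2) \<partial>MT))"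
        by (intro add_left_mono mult_left_mono bnd[OF fm G_MT fm]) auto
      also have "\<dots> \<le> 2 * ennreal e + 2 * (2 * ennreal e + 2 * ennreal e)"
        by (intro add_mono mult_left_mono K ff) auto
      also have "\<dots> = ennreal (10 * e)" using e by (simp add: ennreal_mult distrib_right[symmetric])
      finally have "(\<integral>\<^sup>+t. ennreal ((G y t - G x t)\<^sup>2) \<partial>MT) \<le> ennreal (10 * e)" .
      moreover have "(LINT t:{0..T}|lborel. (G y t - G x t)\<^sup>2) = enn2real (\<integral>\<^sup>+t. ennreal ((G y t - G x t)\<^sup>2) \<partial>MT)"
        unfolding integral_MT[symmetric] by (rule integral_eq_nn_integral) (use G_MT in auto)
      ultimately have "(LINT t:{0..T}|lborel. (G y t - G x t)\<^sup>2) \<le> 10 * e"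
        using enn2real_mono[of "\<integral>\<^sup>+t. ennreal ((G y t - G x t)\<^sup>2) \<partial>MT" "ennreal (10 * e)"] e by simp
      moreover have "0 \<le> (LINT t:{0..T}|lborel. (G y t - G x t)\<^sup>2)" unfolding integral_MT[symmetric] by simp
      ultimately show ?case using \<epsilon> by (simp add: e_def)
    qed
  qed
  have c3: "AE x in MX. AE t in MT. fn v (x, t) = G x t"
  proof -
    have vi: "fn v \<in> borel_measurable Q" by measurable
    have "\<exists>N. (\<integral>\<^sup>+z. ennreal ((?f N z - fn v z)\<^sup>2) \<partial>Q) \<le> ennreal ((1/2)^j) \<and> N \<ge> j" for j :: nat
    proof -
      obtain K where "\<forall>N\<ge>K. (\<integral>\<^sup>+z. ennreal ((?f N z - fn v z)\<^sup>2) \<partial>Q) \<le> ennreal ((1/2)^j)"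
        using l unfolding L2_lim_def by (meson half_gt_zero_iff zero_less_one zero_less_power)
      then show ?thesis by (intro exI[of _ "max K j"]) auto
    qed
    then obtain q where q: "\<And>j. (\<integral>\<^sup>+z. ennreal ((?f (q j) z - fn v z)\<^sup>2) \<partial>Q) \<le> ennreal ((1/2)^j)" "\<And>j. q j \<ge> j" by metis
    have hm: "(\<lambda>z. ennreal ((?f N z - fn v z)\<^sup>2)) \<in> borel_measurable (MX \<Otimes>\<^sub>M MT)" for N
      using partial_sum_measurable[OF orth_sin_mode, of c N] vi unfolding Q_def[symmetric] by measurable
    let ?h = "\<lambda>j x. \<integral>\<^sup>+t. ennreal ((?f (q j) (x, t) - fn v (x, t))\<^sup>2) \<partial>MT"
    have hmx: "?h j \<in> borel_measurable MX" for j by (rule MT.borel_measurable_nn_integral_fst[OF hm])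
    have "(\<integral>\<^sup>+x. (\<Sum>j. ?h j x) \<partial>MX) = (\<Sum>j. \<integral>\<^sup>+x. ?h j x \<partial>MX)" by (rule nn_integral_suminf[OF hmx])
    also have "\<dots> \<le> (\<Sum>j. ennreal ((1/2)^j))"
      by (intro suminf_le) (use q(1) MT.nn_integral_fst[OF hm] in \<open>auto simp: Q_def[symmetric]\<close>)
    also have "\<dots> < \<infinity>" by (subst suminf_ennreal2) (auto intro!: summable_geometric)
    finally have "AE x in MX. (\<Sum>j. ?h j x) \<noteq> \<infinity>" using hmx by (intro nn_integral_PInf_AE) auto
    then show ?thesis using AE_space
    proof eventually_elim
      case (elim x)
      then have x: "x \<in> space MX" and s: "(\<Sum>j. ?h j x) \<noteq> \<infinity>" by auto
      have vm: "(\<lambda>t. fn v (x, t)) \<in> borel_measurable MT"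
        using vi x unfolding Q_def by (intro measurable_compose[OF measurable_Pair1']) auto
      have "(\<integral>\<^sup>+t. ennreal ((fn v (x, t) - G x t)\<^sup>2) \<partial>MT) \<le> ennreal (4 * e)" if e: "e > 0" for e
      proof -
        obtain K where K: "\<And>n. n \<ge> K \<Longrightarrow> (\<integral>\<^sup>+t. ennreal ((?f n (x, t) - G x t)\<^sup>2) \<partial>MT) \<le> ennreal e" using lim[OF e] by blast
        have "\<exists>j\<ge>K. ?h j x \<le> ennreal e"
        proof (rule ccontr)
          assume "\<not> (\<exists>j\<ge>K. ?h j x \<le> ennreal e)"
          then have "\<forall>j\<ge>K. \<not> ?h j x \<le> ennreal e" by blast
          from this[rule_format, of "j + K" for j]
          have ge: "ennreal e \<le> ?h (j + K) x" for j by (simp add: not_le less_imp_le)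
          obtain b where b: "(\<Sum>j. ?h j x) = ennreal b" "b \<ge> 0"
            using s by (cases "\<Sum>j. ?h j x") auto
          obtain n :: nat where n: "real n > b / e" using reals_Archimedean2 by blast
          have "ennreal (real n * e) = (\<Sum>j<n. ennreal e)" using e by (simp add: ennreal_mult ennreal_of_nat_eq_real_of_nat)
          also have "\<dots> \<le> (\<Sum>j<n. ?h (j + K) x)" by (intro sum_mono ge)
          also have "\<dots> = (\<Sum>j\<in>{K..<n + K}. ?h j x)"
            by (rule sum.reindex_bij_witness[of _ "\<lambda>j. j - K" "\<lambda>j. j + K"]) auto
          also have "\<dots> \<le> (\<Sum>j. ?h j x)" by (rule sum_le_suminf) auto
          finally have "real n * e \<le> b" using b by (simp add: ennreal_le_iff)
          then show False using n e by (simp add: pos_divide_less_eq)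
        qed
        then obtain j where j: "j \<ge> K" "?h j x \<le> ennreal e" by blast
        have "(\<integral>\<^sup>+t. ennreal ((fn v (x, t) - G x t)\<^sup>2) \<partial>MT) \<le> 2 * ?h j x + 2 * (\<integral>\<^sup>+t. ennreal ((?f (q j) (x, t) - G x t)\<^sup>2) \<partial>MT)"
          by (rule bnd[OF vm G_MT fm])
        also have "\<dots> \<le> 2 * ennreal e + 2 * ennreal e"
          using j q(2)[of j] by (intro add_mono mult_left_mono K) auto
        also have "\<dots> = ennreal (4 * e)" using e by (simp add: ennreal_mult distrib_right[symmetric])
        finally show ?thesis .
      qed
      from this[of "e' / 4" for e'] have "(\<integral>\<^sup>+t. ennreal ((fn v (x, t) - G x t)\<^sup>2) \<partial>MT) \<le> ennreal e'" if "e' > 0" for e'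
        using that by simp
      then have "(\<integral>\<^sup>+t. ennreal ((fn v (x, t) - G x t)\<^sup>2) \<partial>MT) \<le> 0 + ennreal e'" if "e' > 0" for e'
        using that by (simp only: add_0)
      then have "(\<integral>\<^sup>+t. ennreal ((fn v (x, t) - G x t)\<^sup>2) \<partial>MT) \<le> 0"
        by (rule ennreal_le_epsilon)
      then have "(\<integral>\<^sup>+t. ennreal ((fn v (x, t) - G x t)\<^sup>2) \<partial>MT) = 0" by (simp only: le_zero_eq)
      then have "AE t in MT. ennreal ((fn v (x, t) - G x t)\<^sup>2) = 0"
        by (subst (asm) nn_integral_0_iff_AE) (use vm G_MT in auto)
      then show ?case by eventually_elim simp
    qed
  qed
  show ?thesis
    unfolding is_trace_def T_def[symmetric]
  proof (intro exI[of _ G] conjI ballI)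
    show "AE x in lborel. x \<in> {0<..<1} \<longrightarrow> (AE t in lborel. t \<in> {0..T} \<longrightarrow> fn v (x, t) = G x t)"
      using c3 unfolding AE_MX_iff AE_MT_iff .
    show "AE t in lborel. t \<in> {0..T} \<longrightarrow> 0 = G x0 t" using x0 by (simp add: G_def)
  qed (use G_borel c1 c2 in auto)
qed

end

section \<open>Cosine moments under the Neumann condition\<close>

lemma smooth_real_deriv_locally_const:
  assumes "open A" "x \<in> A" "\<And>y. y \<in> A \<Longrightarrow> f y = c"
  shows "deriv f x = 0"
proof -
  have "eventually (\<lambda>y. y \<in> A) (nhds x)" using assms by (intro eventually_nhds_in_open)
  then have "eventually (\<lambda>y. f y = c) (nhds x)" by eventually_elim (rule assms)
  then have "deriv f x = deriv (\<lambda>_. c) x" by (rule deriv_cong_ev) simp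
  then show ?thesis by simp
qed

lemma step_deriv_0: "x < 0 \<or> x > 1 \<Longrightarrow> deriv step x = 0"
  using smooth_real_deriv_locally_const[of "{..<0}" x step 0] smooth_real_deriv_locally_const[of "{1<..}" x step 1]
  by (auto simp: step_eq_0 step_eq_1)

lemma step_deriv_bounded:
  obtains D where "D \<ge> 0" "\<And>x. \<bar>deriv step x\<bar> \<le> D"
proof -
  have "compact (deriv step ` {0..1})"
    by (intro compact_continuous_image smooth_real_continuous_on smooth_real_deriv smooth_step) simp
  then obtain D where D: "\<And>y. y \<in> deriv step ` {0..1} \<Longrightarrow> norm y \<le> D"
    using compact_imp_bounded bounded_iff by metis
  have "\<bar>deriv step x\<bar> \<le> max D 0" for x
  proof (cases "x \<in> {0..1}")
    case True then show ?thesis using D[of "deriv step x"] by auto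
  next
    case False then show ?thesis using step_deriv_0[of x] by auto
  qed
  then show thesis using that[of "max D 0"] by auto
qed

text \<open>
  Equal to 1 on \<open>[1/m, 1 - 1/m]\<close>, supported inside the open unit interval, with derivative of size \<open>m\<close>.
\<close>

definition cutoff :: "nat \<Rightarrow> real \<Rightarrow> real" where
  "cutoff m = bump (1 / (2 * real m)) (1 - 1 / (2 * real m)) (2 * m)"

lemma smooth_cutoff: "smooth_real (cutoff m)"
  unfolding cutoff_def by (rule smooth_bump)

lemma cutoff_bounds: "0 \<le> cutoff m x" "cutoff m x \<le> 1"
  unfolding cutoff_def by (rule bump_bounds)+

lemma cutoff_eq_0: "x \<notin> {1 / (2 * real m)..1 - 1 / (2 * real m)} \<Longrightarrow> cutoff m x = 0"
  unfolding cutoff_def by (rule bump_eq_0) auto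

lemma cutoff_eq_1:
  assumes m: "m > 0" and x: "1 / real m \<le> x" "x \<le> 1 - 1 / real m"
  shows "cutoff m x = 1"
proof -
  have "real (2 * m) * (x - 1 / (2 * real m)) \<ge> 1" "real (2 * m) * ((1 - 1 / (2 * real m)) - x) \<ge> 1"
  proof -
    have e: "real (2 * m) * (y - 1 / (2 * real m)) = 2 * (real m * y) - 1" for y
      using m by (simp add: right_diff_distrib)
    have "1 \<le> real m * x" "1 \<le> real m * (1 - x)" using m x by (simp_all add: field_simps)
    moreover have "(1 - 1 / (2 * real m)) - x = (1 - x) - 1 / (2 * real m)" by simp
    ultimately show "real (2 * m) * (x - 1 / (2 * real m)) \<ge> 1" "real (2 * m) * ((1 - 1 / (2 * real m)) - x) \<ge> 1"
      unfolding e by (simp_all only: e)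
  qed
  then show ?thesis unfolding cutoff_def bump_def by (simp add: step_eq_1)
qed

lemma cutoff_deriv_0:
  assumes m: "m > 0" and x: "1 / real m < x" "x < 1 - 1 / real m"
  shows "deriv (cutoff m) x = 0"
  by (rule smooth_real_deriv_locally_const[of "{1 / real m<..<1 - 1 / real m}" _ _ 1])
    (use x in \<open>auto intro!: cutoff_eq_1[OF m]\<close>)

lemma cutoff_deriv_bound:
  obtains D where "D \<ge> 0" "\<And>m x. \<bar>deriv (cutoff m) x\<bar> \<le> D * real m"
proof -
  obtain D where D: "D \<ge> 0" "\<And>x. \<bar>deriv step x\<bar> \<le> D" by (rule step_deriv_bounded) blast
  have "\<bar>deriv (cutoff m) x\<bar> \<le> (4 * D) * real m" for m x
  proof -
    let ?a = "1 / (2 * real m)"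
    let ?k = "real (2 * m)"
    let ?p = "?k * (x - ?a)" and ?q = "?k * ((1 - ?a) - x)"
    have "((\<lambda>x. step (?k * (x - ?a)) * step (?k * ((1 - ?a) - x))) has_real_derivative
      (deriv step ?p * ?k) * step ?q + step ?p * (deriv step ?q * (- ?k))) (at x)"
    proof -
      have 1: "((\<lambda>x. ?k * (x - ?a)) has_real_derivative ?k) (at x)" by (auto intro!: derivative_eq_intros)
      have 2: "((\<lambda>x. ?k * ((1 - ?a) - x)) has_real_derivative - ?k) (at x)" by (auto intro!: derivative_eq_intros)
      show ?thesis
        by (rule DERIV_cong[OF DERIV_mult[OF DERIV_chain2[OF smooth_real_DERIV[OF smooth_step] 1] DERIV_chain2[OF smooth_real_DERIV[OF smooth_step] 2]]])
          (simp add: algebra_simps)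
    qed
    then have "deriv (cutoff m) x = (deriv step ?p * ?k) * step ?q + step ?p * (deriv step ?q * (- ?k))"
      unfolding cutoff_def bump_def[abs_def] by (rule DERIV_imp_deriv)
    also have "\<bar>\<dots>\<bar> \<le> \<bar>(deriv step ?p * ?k) * step ?q\<bar> + \<bar>step ?p * (deriv step ?q * (- ?k))\<bar>" by (rule abs_triangle_ineq)
    also have "\<dots> \<le> (D * ?k) * 1 + 1 * (D * ?k)"
    proof (rule add_mono)
      have s: "\<bar>step y\<bar> \<le> 1" for y using step_bounds[of y] by simp
      show "\<bar>(deriv step ?p * ?k) * step ?q\<bar> \<le> (D * ?k) * 1"
        unfolding abs_mult using D s by (intro mult_mono) auto
      show "\<bar>step ?p * (deriv step ?q * (- ?k))\<bar> \<le> 1 * (D * ?k)"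
        unfolding abs_mult using D s by (intro mult_mono) auto
    qed
    finally show ?thesis by simp
  qed
  then show thesis using that[of "4 * D"] D(1) by auto
qed

lemma cutoff_tendsto:
  assumes "0 < x" "x < 1"
  shows "eventually (\<lambda>m. cutoff m x = 1 \<and> deriv (cutoff m) x = 0) sequentially"
proof -
  have "(\<lambda>m. 1 / real m) \<longlonglongrightarrow> 0" by real_asymp
  then have "eventually (\<lambda>m. 1 / real m < min x (1 - x)) sequentially" using assms by (intro order_tendstoD) auto
  with eventually_gt_at_top[of 0] show ?thesis
  proof eventually_elim
    case (elim m)
    then show ?case using cutoff_eq_1[of m x] cutoff_deriv_0[of m x] by auto
  qed
qed

context time_period begin

lemma space_MX: "space MX = {0<..<1}" by (simp add: space_restrict_space)

lemma integrable_MX_mult: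
  fixes U a :: "real \<Rightarrow> real"
  assumes "integrable MX U" "a \<in> borel_measurable borel" "\<And>x. x \<in> {0<..<1} \<Longrightarrow> \<bar>a x\<bar> \<le> C"
  shows "integrable MX (\<lambda>x. U x * a x)"
  using assms by (intro integrable_mult_bounded[where C=C]) (auto simp: space_MX intro: measurable_restrict_space1)

lemma smooth_measurable: "smooth_real a \<Longrightarrow> a \<in> borel_measurable borel"
  by (intro borel_measurable_continuous_onI smooth_real_continuous_on)

lemma cutoff_integral_tendsto:
  assumes U: "integrable MX U" and A: "A \<in> borel_measurable borel" "\<And>x. \<bar>A x\<bar> \<le> C"
  shows "(\<lambda>m. LINT x|MX. U x * (cutoff m x * A x)) \<longlonglongrightarrow> (LINT x|MX. U x * A x)"
proof (rule integral_dominated_convergence)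
  have m: "cutoff m \<in> borel_measurable MX" "A \<in> borel_measurable MX" for m
    using A smooth_measurable[OF smooth_cutoff] by (auto intro: measurable_restrict_space1)
  show "(\<lambda>x. U x * A x) \<in> borel_measurable MX" "\<And>m. (\<lambda>x. U x * (cutoff m x * A x)) \<in> borel_measurable MX"
    using m U by auto
  show "integrable MX (\<lambda>x. C * \<bar>U x\<bar>)" using U by simp
  show "AE x in MX. (\<lambda>m. U x * (cutoff m x * A x)) \<longlonglongrightarrow> U x * A x"
  proof (rule AE_I2)
    fix x assume "x \<in> space MX"
    then have "eventually (\<lambda>m. cutoff m x = 1 \<and> deriv (cutoff m) x = 0) sequentially"
      by (intro cutoff_tendsto) (auto simp: space_MX)
    then have "eventually (\<lambda>m. U x * (cutoff m x * A x) = U x * A x) sequentially" by eventually_elim simp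
    then show "(\<lambda>m. U x * (cutoff m x * A x)) \<longlonglongrightarrow> U x * A x" by (rule tendsto_eventually)
  qed
  fix m
  show "AE x in MX. norm (U x * (cutoff m x * A x)) \<le> C * \<bar>U x\<bar>"
  proof (rule AE_I2)
    fix x
    have "\<bar>cutoff m x * A x\<bar> \<le> 1 * C" unfolding abs_mult using cutoff_bounds[of m x] A(2)[of x] by (intro mult_mono) auto
    then show "norm (U x * (cutoff m x * A x)) \<le> C * \<bar>U x\<bar>"
      using mult_left_mono[of "\<bar>cutoff m x * A x\<bar>" C "\<bar>U x\<bar>"] by (simp add: abs_mult mult.commute)
  qed
qed

text \<open>
  Formally \<open>V = U'\<close>, \<open>Z = - V'\<close> and \<open>V\<close> vanishes at both ends, so two integrations by parts give the claim.
  The test functions are \<open>cutoff m x * sin (\<kappa> x)\<close> and \<open>cutoff m x * cos (\<kappa> x)\<close>. In the first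
  case the derivative of the cutoff is multiplied by the sine, which is of size \<open>1/m\<close> near the ends because
  \<open>sin \<kappa> = 0\<close>; in the second it is multiplied by \<open>V\<close>, which is small near the ends, while the
  integral of the modulus of the derivative of the cutoff stays bounded.
\<close>

lemma Neumann_cosine_moments:
  fixes U V Z :: "real \<Rightarrow> real"
  assumes U: "integrable MX U" and V: "integrable MX V" and Z: "integrable MX Z"
    and UV: "\<And>a \<alpha> \<beta>. smooth_real a \<Longrightarrow> 0 < \<alpha> \<Longrightarrow> \<beta> < 1 \<Longrightarrow> (\<And>x. x \<notin> {\<alpha>..\<beta>} \<Longrightarrow> a x = 0) \<Longrightarrow>
      (LINT x|MX. U x * deriv a x) = - (LINT x|MX. V x * a x)"
    and VZ: "\<And>a \<alpha> \<beta>. smooth_real a \<Longrightarrow> 0 < \<alpha> \<Longrightarrow> \<beta> < 1 \<Longrightarrow> (\<And>x. x \<notin> {\<alpha>..\<beta>} \<Longrightarrow> a x = 0) \<Longrightarrow>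
      (LINT x|MX. V x * deriv a x) = (LINT x|MX. Z x * a x)"
    and V0: "\<And>e. e > 0 \<Longrightarrow> \<exists>\<delta>>0. AE x in MX. x < \<delta> \<or> x > 1 - \<delta> \<longrightarrow> \<bar>V x\<bar> \<le> e"
    and \<kappa>: "sin \<kappa> = 0"
  shows "(LINT x|MX. Z x * cos (\<kappa> * x)) = \<kappa>\<^sup>2 * (LINT x|MX. U x * cos (\<kappa> * x))"
proof -
  obtain D where D: "D \<ge> 0" "\<And>m x. \<bar>deriv (cutoff m) x\<bar> \<le> D * real m" by (rule cutoff_deriv_bound) blast
  have meas: "deriv (cutoff m) \<in> borel_measurable borel" "cutoff m \<in> borel_measurable borel" for m
    by (intro smooth_measurable smooth_real_deriv smooth_cutoff)+
  have cm: "(\<lambda>x. cos (\<kappa> * x)) \<in> borel_measurable borel" "(\<lambda>x. sin (\<kappa> * x)) \<in> borel_measurable borel" by measurable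
  have dc: "deriv (\<lambda>x. cos (\<kappa> * x)) x = - \<kappa> * sin (\<kappa> * x)" and ds: "deriv (\<lambda>x. sin (\<kappa> * x)) x = \<kappa> * cos (\<kappa> * x)" for x
    by (auto intro!: DERIV_imp_deriv derivative_eq_intros)
  have I1: "integrable MX (\<lambda>x. W x * (deriv (cutoff m) x * B x))" and I2: "integrable MX (\<lambda>x. W x * (cutoff m x * B x))"
    if W: "integrable MX W" and B: "B \<in> borel_measurable borel" "\<And>x. \<bar>B x\<bar> \<le> 1" for W B m
  proof -
    show "integrable MX (\<lambda>x. W x * (deriv (cutoff m) x * B x))"
    proof (rule integrable_MX_mult[OF W, where C="(D * real m) * 1"])
      show "\<bar>deriv (cutoff m) x * B x\<bar> \<le> (D * real m) * 1" for x
        unfolding abs_mult using D B by (intro mult_mono) auto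
    qed (use meas B in measurable)
    show "integrable MX (\<lambda>x. W x * (cutoff m x * B x))"
    proof (rule integrable_MX_mult[OF W, where C="1 * 1"])
      show "\<bar>cutoff m x * B x\<bar> \<le> 1 * 1" for x
        unfolding abs_mult using cutoff_bounds[of m x] B by (intro mult_mono) auto
    qed (use meas B in measurable)
  qed
  have supp: "0 < 1 / (2 * real m)" "1 - 1 / (2 * real m) < 1" if "m > 0" for m :: nat using that by auto
  have prod: "smooth_real (\<lambda>x. cutoff m x * B x)" if "smooth_real B" for m B
    by (intro smooth_real_mult smooth_cutoff that)
  have s1: "(LINT x|MX. U x * (deriv (cutoff m) x * sin (\<kappa> * x))) + \<kappa> * (LINT x|MX. U x * (cutoff m x * cos (\<kappa> * x)))
    = - (LINT x|MX. V x * (cutoff m x * sin (\<kappa> * x)))" if m: "m > 0" for m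
  proof -
    have "(LINT x|MX. U x * deriv (\<lambda>x. cutoff m x * sin (\<kappa> * x)) x) = - (LINT x|MX. V x * (cutoff m x * sin (\<kappa> * x)))"
      by (rule UV[OF prod[OF smooth_real_sin] supp[OF m]]) (simp add: cutoff_eq_0)
    moreover have "U x * deriv (\<lambda>x. cutoff m x * sin (\<kappa> * x)) x
      = U x * (deriv (cutoff m) x * sin (\<kappa> * x)) + \<kappa> * (U x * (cutoff m x * cos (\<kappa> * x)))" for x
      by (simp only: deriv_mult_smooth[OF smooth_cutoff smooth_real_sin] ds) (simp add: algebra_simps)
    ultimately show ?thesis
      using I1[OF U cm(2), of m] I2[OF U cm(1), of m]
      by (simp add: Bochner_Integration.integral_add)
  qed
  have c1: "(LINT x|MX. V x * (deriv (cutoff m) x * cos (\<kappa> * x))) - \<kappa> * (LINT x|MX. V x * (cutoff m x * sin (\<kappa> * x)))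
    = (LINT x|MX. Z x * (cutoff m x * cos (\<kappa> * x)))" if m: "m > 0" for m
  proof -
    have "(LINT x|MX. V x * deriv (\<lambda>x. cutoff m x * cos (\<kappa> * x)) x) = (LINT x|MX. Z x * (cutoff m x * cos (\<kappa> * x)))"
      by (rule VZ[OF prod[OF smooth_real_cos] supp[OF m]]) (simp add: cutoff_eq_0)
    moreover have "V x * deriv (\<lambda>x. cutoff m x * cos (\<kappa> * x)) x
      = V x * (deriv (cutoff m) x * cos (\<kappa> * x)) - \<kappa> * (V x * (cutoff m x * sin (\<kappa> * x)))" for x
      by (simp only: deriv_mult_smooth[OF smooth_cutoff smooth_real_cos] dc) (simp add: algebra_simps)
    ultimately show ?thesis
      using I1[OF V cm(1), of m] I2[OF V cm(2), of m]
      by (simp add: Bochner_Integration.integral_diff)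
  qed
  have sin_small: "\<bar>sin (\<kappa> * x)\<bar> \<le> \<bar>\<kappa>\<bar> * min x (1 - x)" if x: "0 < x" "x < 1" for x
  proof -
    have "\<bar>sin (\<kappa> * x)\<bar> \<le> \<bar>\<kappa>\<bar> * x" using abs_sin_x_le_abs_x[of "\<kappa> * x"] x by (simp add: abs_mult)
    moreover have "\<bar>sin (\<kappa> * x)\<bar> = \<bar>sin (\<kappa> * (1 - x))\<bar>"
    proof -
      have c: "\<bar>cos \<kappa>\<bar> = 1" using sin_cos_squared_add[of \<kappa>] \<kappa> by (simp add: abs_square_eq_1)
      have "sin (\<kappa> * (1 - x)) = - cos \<kappa> * sin (\<kappa> * x)"
        using \<kappa> by (simp add: right_diff_distrib sin_diff)
      then show ?thesis using c by (simp add: abs_mult)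
    qed
    moreover have "\<bar>sin (\<kappa> * (1 - x))\<bar> \<le> \<bar>\<kappa>\<bar> * (1 - x)" using abs_sin_x_le_abs_x[of "\<kappa> * (1 - x)"] x by (simp add: abs_mult)
    ultimately show ?thesis by (auto simp: min_def)
  qed
  have u0: "(\<lambda>m. LINT x|MX. U x * (deriv (cutoff m) x * sin (\<kappa> * x))) \<longlonglongrightarrow> (LINT x|MX. (0::real))"
  proof (rule integral_dominated_convergence)
    show "integrable MX (\<lambda>x. (D * \<bar>\<kappa>\<bar>) * \<bar>U x\<bar>)" using U by simp
    show "\<And>m. (\<lambda>x. U x * (deriv (cutoff m) x * sin (\<kappa> * x))) \<in> borel_measurable MX"
      using I1[OF U cm(2)] by auto
    show "AE x in MX. (\<lambda>m. U x * (deriv (cutoff m) x * sin (\<kappa> * x))) \<longlonglongrightarrow> 0"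
    proof (rule AE_I2)
      fix x assume "x \<in> space MX"
      then have "eventually (\<lambda>m. cutoff m x = 1 \<and> deriv (cutoff m) x = 0) sequentially"
        by (intro cutoff_tendsto) (auto simp: space_MX)
      then have "eventually (\<lambda>m. U x * (deriv (cutoff m) x * sin (\<kappa> * x)) = 0) sequentially" by eventually_elim simp
      then show "(\<lambda>m. U x * (deriv (cutoff m) x * sin (\<kappa> * x))) \<longlonglongrightarrow> 0" by (rule tendsto_eventually)
    qed
    fix m
    show "AE x in MX. norm (U x * (deriv (cutoff m) x * sin (\<kappa> * x))) \<le> (D * \<bar>\<kappa>\<bar>) * \<bar>U x\<bar>"
    proof (rule AE_I2)
      fix x assume x: "x \<in> space MX"
      have "\<bar>deriv (cutoff m) x * sin (\<kappa> * x)\<bar> \<le> D * \<bar>\<kappa>\<bar>"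
      proof (cases "m > 0 \<and> (x \<le> 1 / real m \<or> x \<ge> 1 - 1 / real m)")
        case True
        have "\<bar>sin (\<kappa> * x)\<bar> \<le> \<bar>\<kappa>\<bar> * min x (1 - x)" using sin_small x by (simp add: space_MX)
        also have "\<dots> \<le> \<bar>\<kappa>\<bar> * (1 / real m)" using True by (intro mult_left_mono) auto
        finally have "\<bar>deriv (cutoff m) x * sin (\<kappa> * x)\<bar> \<le> (D * real m) * (\<bar>\<kappa>\<bar> * (1 / real m))"
          unfolding abs_mult using D by (intro mult_mono) auto
        then show ?thesis using True by simp
      next
        case False
        then have "deriv (cutoff m) x = 0"
          using D(2)[of 0 x] cutoff_deriv_0[of m x] by (cases "m = 0") auto
        then show ?thesis using D by simp
      qed
      from mult_left_mono[OF this, of "\<bar>U x\<bar>"]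
      show "norm (U x * (deriv (cutoff m) x * sin (\<kappa> * x))) \<le> (D * \<bar>\<kappa>\<bar>) * \<bar>U x\<bar>" by (simp add: abs_mult mult_ac)
    qed
  qed simp
  have v0: "(\<lambda>m. LINT x|MX. V x * (deriv (cutoff m) x * cos (\<kappa> * x))) \<longlonglongrightarrow> 0"
  proof (rule LIMSEQ_I)
    fix r :: real assume r: "r > 0"
    define e where "e = r / (4 * D + 1)"
    have e: "e > 0" unfolding e_def using r D by (intro divide_pos_pos) auto
    obtain \<delta> where \<delta>: "\<delta> > 0" "AE x in MX. x < \<delta> \<or> x > 1 - \<delta> \<longrightarrow> \<bar>V x\<bar> \<le> e" using V0[OF e] by blast
    obtain K :: nat where K: "real K > 1 / \<delta>" using reals_Archimedean2 by blast
    have "norm (LINT x|MX. V x * (deriv (cutoff m) x * cos (\<kappa> * x))) < r" if mK: "m \<ge> K + 1" for m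
    proof -
      have m: "m > 0" using mK by simp
      have md: "1 / real m < \<delta>"
      proof -
        have "1 / \<delta> < real m" using K mK by linarith
        then show ?thesis using \<delta>(1) m by (simp add: field_simps)
      qed
      have "norm (LINT x|MX. V x * (deriv (cutoff m) x * cos (\<kappa> * x))) \<le> (LINT x|MX. norm (V x * (deriv (cutoff m) x * cos (\<kappa> * x))))"
        by (rule integral_norm_bound)
      also have "\<dots> \<le> (LINT x|MX. (e * (D * real m)) * (indicator {0..1 / real m} x + indicator {1 - 1 / real m..1} x))"
      proof (rule integral_mono_AE)
        show "integrable MX (\<lambda>x. norm (V x * (deriv (cutoff m) x * cos (\<kappa> * x))))"
          using I1[OF V cm(1), of m] by simp
        show "integrable MX (\<lambda>x. (e * (D * real m)) * (indicator {0..1 / real m} x + indicator {1 - 1 / real m..1} x))"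
          by (rule integrable_MX_bounded[where C="\<bar>e * (D * real m)\<bar> * 2"]) (auto simp: abs_mult indicator_def intro!: mult_left_mono)
        show "AE x in MX. norm (V x * (deriv (cutoff m) x * cos (\<kappa> * x))) \<le> (e * (D * real m)) * (indicator {0..1 / real m} x + indicator {1 - 1 / real m..1} x)"
        proof (rule AE_mp[OF \<delta>(2)], intro AE_I2 impI)
          fix x assume x: "x \<in> space MX" and V: "x < \<delta> \<or> x > 1 - \<delta> \<longrightarrow> \<bar>V x\<bar> \<le> e"
          show "norm (V x * (deriv (cutoff m) x * cos (\<kappa> * x))) \<le> (e * (D * real m)) * (indicator {0..1 / real m} x + indicator {1 - 1 / real m..1} x)"
          proof (cases "x \<le> 1 / real m \<or> x \<ge> 1 - 1 / real m")
            case True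
            then have "\<bar>V x\<bar> \<le> e" using V md by auto
            then have "\<bar>V x\<bar> * (\<bar>deriv (cutoff m) x\<bar> * \<bar>cos (\<kappa> * x)\<bar>) \<le> e * ((D * real m) * 1)"
              using D e by (intro mult_mono) auto
            also have "\<dots> \<le> (e * (D * real m)) * (indicator {0..1 / real m} x + indicator {1 - 1 / real m..1} x)"
              using True x D e by (auto simp: space_MX indicator_def)
            finally show ?thesis by (simp add: abs_mult)
          next
            case False
            then have "deriv (cutoff m) x = 0" using cutoff_deriv_0[OF m, of x] by auto
            then show ?thesis using D e by (simp add: indicator_def)
          qed
        qed
      qed
      also have "\<dots> = (e * (D * real m)) * (measure MX ({0..1 / real m} \<inter> space MX) + measure MX ({1 - 1 / real m..1} \<inter> space MX))"
      proof -
        have i: "integrable MX (indicator {a..b} :: real \<Rightarrow> real)" for a b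
          by (rule integrable_MX_bounded[where C=1]) (auto simp: indicator_def)
        show ?thesis
          by (simp only: integral_mult_right_zero Bochner_Integration.integral_add[OF i i] Bochner_Integration.integral_indicator)
      qed
      also have "\<dots> \<le> (e * (D * real m)) * (1 / real m + 1 / real m)"
      proof (intro mult_left_mono add_mono)
        have le: "measure MX ({a..b} \<inter> space MX) \<le> b - a" if "a \<le> b" for a b
        proof -
          have "measure MX ({a..b} \<inter> space MX) = measure lborel ({a..b} \<inter> {0<..<1})"
            by (subst measure_restrict_space) (auto simp: space_MX)
          also have "\<dots> \<le> measure lborel {a..b}"
            by (rule measure_mono_fmeasurable) (auto simp: fmeasurable_def emeasure_lborel_Icc_eq)
          also have "\<dots> = b - a" using that by simp
          finally show ?thesis .
        qed
        show "measure MX ({0..1 / real m} \<inter> space MX) \<le> 1 / real m" using le[of 0 "1 / real m"] by simp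
        show "measure MX ({1 - 1 / real m..1} \<inter> space MX) \<le> 1 / real m" using le[of "1 - 1 / real m" 1] by simp
      qed (use D e in auto)
      also have "\<dots> = 2 * D * e" using m by simp
      also have "\<dots> < (4 * D + 1) * e" using D e by (intro mult_strict_right_mono) auto
      also have "\<dots> = r" unfolding e_def using D by simp
      finally show ?thesis .
    qed
    then show "\<exists>no. \<forall>m\<ge>no. norm ((LINT x|MX. V x * (deriv (cutoff m) x * cos (\<kappa> * x))) - 0) < r" by auto
  qed
  have ev: "eventually (\<lambda>m::nat. m > 0) sequentially" by (rule eventually_gt_at_top)
  have ev1: "eventually (\<lambda>m. (LINT x|MX. U x * (deriv (cutoff m) x * sin (\<kappa> * x))) + \<kappa> * (LINT x|MX. U x * (cutoff m x * cos (\<kappa> * x)))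
    = - (LINT x|MX. V x * (cutoff m x * sin (\<kappa> * x)))) sequentially"
    using ev by eventually_elim (rule s1)
  have ev2: "eventually (\<lambda>m. (LINT x|MX. V x * (deriv (cutoff m) x * cos (\<kappa> * x))) - \<kappa> * (LINT x|MX. V x * (cutoff m x * sin (\<kappa> * x)))
    = (LINT x|MX. Z x * (cutoff m x * cos (\<kappa> * x)))) sequentially"
    using ev by eventually_elim (rule c1)
  have Uc: "(\<lambda>m. LINT x|MX. U x * (cutoff m x * cos (\<kappa> * x))) \<longlonglongrightarrow> (LINT x|MX. U x * cos (\<kappa> * x))"
    by (rule cutoff_integral_tendsto[OF U cm(1), of 1]) simp
  have Vs: "(\<lambda>m. LINT x|MX. V x * (cutoff m x * sin (\<kappa> * x))) \<longlonglongrightarrow> (LINT x|MX. V x * sin (\<kappa> * x))"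
    by (rule cutoff_integral_tendsto[OF V cm(2), of 1]) simp
  have Zc: "(\<lambda>m. LINT x|MX. Z x * (cutoff m x * cos (\<kappa> * x))) \<longlonglongrightarrow> (LINT x|MX. Z x * cos (\<kappa> * x))"
    by (rule cutoff_integral_tendsto[OF Z cm(1), of 1]) simp
  have "(\<lambda>m. - (LINT x|MX. V x * (cutoff m x * sin (\<kappa> * x)))) \<longlonglongrightarrow> (LINT x|MX. (0::real)) + \<kappa> * (LINT x|MX. U x * cos (\<kappa> * x))"
    by (rule Lim_transform_eventually[OF tendsto_add[OF u0 tendsto_mult[OF tendsto_const Uc]] ev1])
  from LIMSEQ_unique[OF this tendsto_minus[OF Vs]]
  have e1: "\<kappa> * (LINT x|MX. U x * cos (\<kappa> * x)) = - (LINT x|MX. V x * sin (\<kappa> * x))" by simp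
  have "(\<lambda>m. LINT x|MX. Z x * (cutoff m x * cos (\<kappa> * x))) \<longlonglongrightarrow> 0 - \<kappa> * (LINT x|MX. V x * sin (\<kappa> * x))"
    by (rule Lim_transform_eventually[OF tendsto_diff[OF v0 tendsto_mult[OF tendsto_const Vs]] ev2])
  from LIMSEQ_unique[OF this Zc]
  have "(LINT x|MX. Z x * cos (\<kappa> * x)) = \<kappa> * (- (LINT x|MX. V x * sin (\<kappa> * x)))" by simp
  also have "\<dots> = \<kappa>\<^sup>2 * (LINT x|MX. U x * cos (\<kappa> * x))" unfolding e1[symmetric] by (simp add: power2_eq_square)
  finally show ?thesis .
qed

section \<open>Coefficients of the wave operator\<close>

text \<open>
  Only two cells meet the support, and their contributions are added on one cell.
\<close>

lemma test_time_unfold: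
  assumes u: "periodic_integrable u" and \<phi>: "test_function \<phi>" and supp: "\<And>x t. \<bar>t\<bar> \<ge> T \<Longrightarrow> \<phi> (x, t) = 0"
    and \<Phi>: "\<And>x t. 0 < t \<Longrightarrow> t < T \<Longrightarrow> \<phi> (x, t - T) + \<phi> (x, t) = \<Phi> (x, t)"
    and m: "\<Phi> \<in> borel_measurable borel"
  shows "(LINT z:strip|lborel. fn u z * \<phi> z) = (LINT z|Q. fn u z * \<Phi> z)"
proof -
  obtain C R where C: "\<And>z. \<bar>\<phi> z\<bar> \<le> C" by (rule test_function_bounds[OF \<phi>]) blast
  have \<phi>m: "\<phi> \<in> borel_measurable borel" by (rule test_function_measurable[OF \<phi>])
  have m': "(\<lambda>z. \<phi> (a + z)) \<in> borel_measurable borel" for a by (rule measurable_compose[OF _ \<phi>m]) simp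
  have int: "integrable Q (\<lambda>z. fn u z * \<phi> (a + z))" for a
    by (rule integrable_Q_mult[where C=C]) (use u C m' in \<open>auto simp: periodic_integrable_def\<close>)
  have j: "{- int 1..<int 1} = {-1, 0}" by auto
  have "(LINT z:strip|lborel. fn u z * \<phi> z) = (\<Sum>j\<in>{- int 1..<int 1}. LINT z|Q. fn u z * \<phi> ((0, of_int j * T) + z))"
    by (rule unfolding_integral(2)[OF u \<phi>m C]) (use supp in simp)
  also have "\<dots> = (LINT z|Q. fn u z * \<phi> ((0, - T) + z)) + (LINT z|Q. fn u z * \<phi> ((0, 0) + z))"
    unfolding j by simp
  also have "\<dots> = (LINT z|Q. fn u z * \<phi> ((0, - T) + z) + fn u z * \<phi> ((0, 0) + z))"
    by (rule Bochner_Integration.integral_add[OF int int, symmetric])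
  also have "\<dots> = (LINT z|Q. fn u z * \<Phi> z)"
  proof (rule integral_cong_AE)
    show "(\<lambda>z. fn u z * \<phi> ((0, - T) + z) + fn u z * \<phi> ((0, 0) + z)) \<in> borel_measurable Q"
      using int[of "(0, - T)"] int[of "(0, 0)"] by auto
    show "(\<lambda>z. fn u z * \<Phi> z) \<in> borel_measurable Q" using borel_measurable_Q[OF m] by auto
    show "AE z in Q. fn u z * \<phi> ((0, - T) + z) + fn u z * \<phi> ((0, 0) + z) = fn u z * \<Phi> z"
      unfolding AE_Q_iff using AE_snd_neq[of 0 0] AE_snd_neq[of T 0]
    proof eventually_elim
      case (elim z)
      obtain x t where z: "z = (x, t)" by fastforce
      show ?case
      proof
        assume "z \<in> cell"
        then have "0 < t" "t < T" using elim by (auto simp: z cell_def)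
        from \<Phi>[OF this, of x] show "fn u z * \<phi> ((0, - T) + z) + fn u z * \<phi> ((0, 0) + z) = fn u z * \<Phi> z"
          by (simp add: z distrib_left[symmetric])
      qed
    qed
  qed
  finally show ?thesis .
qed

text \<open>
  A difference of two translates of a smooth step. Its translates by multiples of the period form a
  partition of unity, so that a periodic function times this cutoff unfolds to the periodic function.
\<close>

definition time_cutoff :: "real \<Rightarrow> real" where
  "time_cutoff t = step ((1 / T) * t + 1) + (- 1) * step ((1 / T) * t + 0)"

lemma smooth_time_cutoff: "smooth_real time_cutoff"
  unfolding time_cutoff_def
  by (intro smooth_real_add smooth_real_mult smooth_real_const smooth_real_affine smooth_step)

lemma time_cutoff_eq_0: "\<bar>t\<bar> \<ge> T \<Longrightarrow> time_cutoff t = 0"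
proof -
  assume t: "\<bar>t\<bar> \<ge> T"
  show ?thesis
  proof (cases "t \<ge> T")
    case True
    then have "(1 / T) * t \<ge> 1" using T_pos by simp
    then show ?thesis by (simp add: time_cutoff_def step_eq_1)
  next
    case False
    then have "t \<le> - T" using t T_pos by linarith
    then have "(1 / T) * t \<le> - 1" using T_pos by (simp add: divide_le_eq)
    then show ?thesis by (simp add: time_cutoff_def step_eq_0)
  qed
qed

lemma time_cutoff_partition: "0 < t \<Longrightarrow> t < T \<Longrightarrow> time_cutoff (t - T) + time_cutoff t = 1"
proof -
  assume t: "0 < t" "t < T"
  have e: "(1 / T) * (t - T) = (1 / T) * t - 1" using T_pos by (simp add: diff_divide_distrib)
  have "0 \<le> (1 / T) * t" "(1 / T) * t \<le> 1" using t T_pos by simp_all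
  then show ?thesis unfolding time_cutoff_def e by (simp add: step_eq_0 step_eq_1)
qed

lemma shift_DERIV: "smooth_real f \<Longrightarrow> ((\<lambda>t. f (t - T) + f t) has_real_derivative deriv f (t - T) + deriv f t) (at t)"
proof -
  assume f: "smooth_real f"
  have "((\<lambda>t. t - T) has_real_derivative 1) (at t)" by (auto intro!: derivative_eq_intros)
  from DERIV_chain2[OF smooth_real_DERIV[OF f] this]
  have "((\<lambda>t. f (t - T)) has_real_derivative deriv f (t - T)) (at t)" by simp
  then show ?thesis by (rule DERIV_add) (rule smooth_real_DERIV[OF f])
qed

lemma time_cutoff_deriv_partition: "0 < t \<Longrightarrow> t < T \<Longrightarrow> deriv time_cutoff (t - T) + deriv time_cutoff t = 0"
  using smooth_real_deriv_locally_const[of "{0<..<T}" t "\<lambda>t. time_cutoff (t - T) + time_cutoff t" 1] time_cutoff_partition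
    DERIV_imp_deriv[OF shift_DERIV[OF smooth_time_cutoff, of t]] by simp

lemma time_cutoff_deriv2_partition: "0 < t \<Longrightarrow> t < T \<Longrightarrow> deriv (deriv time_cutoff) (t - T) + deriv (deriv time_cutoff) t = 0"
  using smooth_real_deriv_locally_const[of "{0<..<T}" t "\<lambda>t. deriv time_cutoff (t - T) + deriv time_cutoff t" 0] time_cutoff_deriv_partition
    DERIV_imp_deriv[OF shift_DERIV[OF smooth_real_deriv[OF smooth_time_cutoff], of t]] by simp

definition trig :: "int \<Rightarrow> real \<Rightarrow> real \<Rightarrow> real \<Rightarrow> real" where
  "trig k A B t = A * cos (of_int k * \<omega> * t) + B * sin (of_int k * \<omega> * t)"

lemma smooth_trig: "smooth_real (trig k A B)"
  unfolding trig_def by (intro smooth_real_add smooth_real_mult smooth_real_const smooth_real_cos smooth_real_sin)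

lemma trig_deriv: "deriv (trig k A B) = trig k (B * (of_int k * \<omega>)) (- A * (of_int k * \<omega>))"
  unfolding trig_def by (rule ext, rule DERIV_imp_deriv) (auto intro!: derivative_eq_intros)

lemma trig_deriv2: "deriv (deriv (trig k A B)) t = - (of_int k * \<omega>)\<^sup>2 * trig k A B t"
  unfolding trig_deriv by (simp add: trig_def power2_eq_square algebra_simps)

lemma trig_shift: "trig k A B (t - T) = trig k A B t"
proof -
  have "of_int k * \<omega> * (t - T) = of_int k * \<omega> * t + 2 * pi * of_int (- k)"
    using \<omega>_pos by (simp add: T_def field_simps)
  moreover have "cos (y + 2 * pi * of_int j) = cos y" "sin (y + 2 * pi * of_int j) = sin y" for y j
    by (simp_all add: cos_add sin_add)
  ultimately show ?thesis unfolding trig_def by (simp only:)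
qed

lemma trig_bound: "\<bar>trig k A B t\<bar> \<le> \<bar>A\<bar> + \<bar>B\<bar>"
proof -
  have "\<bar>trig k A B t\<bar> \<le> \<bar>A * cos (of_int k * \<omega> * t)\<bar> + \<bar>B * sin (of_int k * \<omega> * t)\<bar>"
    unfolding trig_def by (rule abs_triangle_ineq)
  also have "\<dots> \<le> \<bar>A\<bar> + \<bar>B\<bar>" unfolding abs_mult by (intro add_mono mult_left_le) auto
  finally show ?thesis .
qed

lemma trig_measurable[measurable]: "trig k A B \<in> borel_measurable borel"
  by (rule smooth_measurable[OF smooth_trig])

definition time_moment :: "(real \<times> real \<Rightarrow> real) \<Rightarrow> (real \<Rightarrow> real) \<Rightarrow> real \<Rightarrow> real" where
  "time_moment f e x = (LINT t|MT. f (x, t) * e t)"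

lemma time_moment_cell_integral:
  assumes f: "integrable Q f" and e: "e \<in> borel_measurable borel" "\<And>t. \<bar>e t\<bar> \<le> M"
    and a: "a \<in> borel_measurable borel" "\<And>x. \<bar>a x\<bar> \<le> C"
  shows "integrable MX (time_moment f e)" and "integrable Q (\<lambda>z. f z * (a (fst z) * e (snd z)))"
    and "(LINT z|Q. f z * (a (fst z) * e (snd z))) = (LINT x|MX. time_moment f e x * a x)"
proof -
  have C: "C \<ge> 0" using order_trans[OF abs_ge_zero a(2)] .
  have M: "M \<ge> 0" using order_trans[OF abs_ge_zero e(2)] .
  have "integrable Q (\<lambda>z. f z * e (snd z))"
    by (rule integrable_mult_bounded[OF f, where C=M]) (use e in \<open>auto intro: borel_measurable_Q_snd\<close>)
  from integrable_Q_fst(2)[OF this] show "integrable MX (time_moment f e)" unfolding time_moment_def by simp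
  show i: "integrable Q (\<lambda>z. f z * (a (fst z) * e (snd z)))"
  proof (rule integrable_mult_bounded[OF f, where C="C * M"])
    show "(\<lambda>z. a (fst z) * e (snd z)) \<in> borel_measurable Q"
      by (intro borel_measurable_times borel_measurable_Q_fst borel_measurable_Q_snd a e)
    show "norm (a (fst z) * e (snd z)) \<le> C * M" for z
      unfolding real_norm_def abs_mult using a e C by (intro mult_mono) auto
  qed
  have "(LINT z|Q. f z * (a (fst z) * e (snd z))) = (LINT x|MX. LINT t|MT. f (x, t) * (a x * e t))"
    using integrable_Q_fst(3)[OF i] by simp
  also have "\<dots> = (LINT x|MX. LINT t|MT. (f (x, t) * e t) * a x)" by (simp only: mult_ac)
  also have "\<dots> = (LINT x|MX. time_moment f e x * a x)"
    unfolding time_moment_def by (simp only: integral_mult_left_zero)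
  finally show "(LINT z|Q. f z * (a (fst z) * e (snd z))) = (LINT x|MX. time_moment f e x * a x)" .
qed

lemma supported_bounded:
  assumes "smooth_real a" "\<And>x. x \<notin> {\<alpha>..\<beta>} \<Longrightarrow> a x = 0"
  obtains C where "\<And>x. \<bar>a x\<bar> \<le> C"
proof -
  have "compact (a ` {\<alpha>..\<beta>})" by (intro compact_continuous_image smooth_real_continuous_on assms) simp
  then obtain C where C: "\<And>y. y \<in> a ` {\<alpha>..\<beta>} \<Longrightarrow> norm y \<le> C" using compact_imp_bounded bounded_iff by metis
  have "\<bar>a x\<bar> \<le> max C 0" for x using C[of "a x"] assms(2)[of x] by (cases "x \<in> {\<alpha>..\<beta>}") auto
  then show thesis by (rule that)
qed

lemma supported_deriv:
  assumes "\<And>x. x \<notin> {\<alpha>..\<beta>} \<Longrightarrow> a x = (0::real)" "x \<notin> {\<alpha>..\<beta>}"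
  shows "deriv a x = 0"
  by (rule smooth_real_deriv_locally_const[of "- {\<alpha>..\<beta>}" _ _ 0]) (use assms in auto)

text \<open>
  Integrals over the strip against the product of \<open>a(x)\<close>, a trigonometric function and the time cutoff
  are integrals over the unit interval of time moments. The derivatives of the cutoff drop out because
  their translates sum to zero.
\<close>

lemma product_test_unfold:
  fixes a :: "real \<Rightarrow> real" and k :: int and A B :: real
  defines "e \<equiv> trig k A B"
  defines "\<phi> \<equiv> \<lambda>(x, t). a x * (e t * time_cutoff t)"
  assumes a: "smooth_real a" "0 < \<alpha>" "\<beta> < 1" "\<And>x. x \<notin> {\<alpha>..\<beta>} \<Longrightarrow> a x = 0" and u: "periodic_integrable u"
  shows "test_function \<phi>"
    and "(LINT z:strip|lborel. fn u z * \<phi> z) = (LINT x|MX. time_moment (fn u) e x * a x)"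
    and "(LINT z:strip|lborel. fn u z * pd_x \<phi> z) = (LINT x|MX. time_moment (fn u) e x * deriv a x)"
    and "(LINT z:strip|lborel. fn u z * pd_x (pd_x \<phi>) z) = (LINT x|MX. time_moment (fn u) e x * deriv (deriv a) x)"
    and "(LINT z:strip|lborel. fn u z * pd_t (pd_t \<phi>) z) = - (of_int k * \<omega>)\<^sup>2 * (LINT x|MX. time_moment (fn u) e x * a x)"
proof -
  define b where "b t = e t * time_cutoff t" for t
  have e: "smooth_real e" unfolding e_def by (rule smooth_trig)
  have b: "smooth_real b" unfolding b_def by (intro smooth_real_mult e smooth_time_cutoff)
  have b0: "b t = 0" if "\<bar>t\<bar> \<ge> T" for t using time_cutoff_eq_0[OF that] by (simp add: b_def)
  have tf: "test_function (\<lambda>(x, t). a' x * b t)" if "smooth_real a'" "\<And>x. x \<notin> {\<alpha>..\<beta>} \<Longrightarrow> a' x = 0" for a'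
    by (rule test_function_product[OF that(1) b a(2,3) that(2), where c="- T" and d=T]) (use b0 in auto)
  have \<phi>_eq: "\<phi> = (\<lambda>(x, t). a x * b t)" by (simp add: \<phi>_def b_def)
  show \<phi>: "test_function \<phi>" unfolding \<phi>_eq by (rule tf[OF a(1,4)])
  have ui: "integrable Q (fn u)" using u by (rule periodic_integrable_integrable)
  have main: "(LINT z:strip|lborel. fn u z * (case z of (x, t) \<Rightarrow> a' x * b t)) = (LINT x|MX. time_moment (fn u) e x * a' x)"
    if a': "smooth_real a'" "\<And>x. x \<notin> {\<alpha>..\<beta>} \<Longrightarrow> a' x = 0" for a'
  proof -
    obtain C where C: "\<And>x. \<bar>a' x\<bar> \<le> C" using supported_bounded[OF a'] by blast
    have "(LINT z:strip|lborel. fn u z * (case z of (x, t) \<Rightarrow> a' x * b t)) = (LINT z|Q. fn u z * (a' (fst z) * e (snd z)))"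
    proof (rule test_time_unfold[OF u tf[OF a']])
      fix x t assume t: "0 < t" "t < T"
      have "a' x * b (t - T) + a' x * b t = a' x * (e t * (time_cutoff (t - T) + time_cutoff t))"
        unfolding b_def using trig_shift[of k A B t] by (simp add: e_def algebra_simps)
      then show "(case (x, t - T) of (x, t) \<Rightarrow> a' x * b t) + (case (x, t) of (x, t) \<Rightarrow> a' x * b t) = a' (fst (x, t)) * e (snd (x, t))"
        using time_cutoff_partition[OF t] by simp
    next
      have 1[measurable]: "fst \<in> borel_measurable (borel :: (real \<times> real) measure)" "snd \<in> borel_measurable (borel :: (real \<times> real) measure)"
        by (auto intro!: borel_measurable_continuous_onI continuous_intros)
      have [measurable]: "a' \<in> borel_measurable borel" "e \<in> borel_measurable borel"
        using smooth_measurable a' e by auto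
      show "(\<lambda>z. a' (fst z) * e (snd z)) \<in> borel_measurable borel" by measurable
    qed (use b0 in auto)
    also have "\<dots> = (LINT x|MX. time_moment (fn u) e x * a' x)"
      by (rule time_moment_cell_integral(3)[OF ui _ _ smooth_measurable[OF a'(1)] C, where M="\<bar>A\<bar> + \<bar>B\<bar>"]) (auto simp: e_def trig_bound)
    finally show ?thesis .
  qed
  show "(LINT z:strip|lborel. fn u z * \<phi> z) = (LINT x|MX. time_moment (fn u) e x * a x)"
    unfolding \<phi>_eq by (rule main[OF a(1,4)])
  have a1: "smooth_real (deriv a)" "\<And>x. x \<notin> {\<alpha>..\<beta>} \<Longrightarrow> deriv a x = 0"
    using smooth_real_deriv[OF a(1)] supported_deriv[of \<alpha> \<beta> a] a(4) by auto
  have a2: "smooth_real (deriv (deriv a))" "\<And>x. x \<notin> {\<alpha>..\<beta>} \<Longrightarrow> deriv (deriv a) x = 0"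
    using smooth_real_deriv[OF a1(1)] supported_deriv[of \<alpha> \<beta> "deriv a"] a1(2) by auto
  have px: "pd_x \<phi> = (\<lambda>(x, t). deriv a x * b t)" unfolding \<phi>_eq by (rule pd_x_product[OF a(1)])
  have pxx: "pd_x (pd_x \<phi>) = (\<lambda>(x, t). deriv (deriv a) x * b t)" unfolding px by (rule pd_x_product[OF a1(1)])
  show "(LINT z:strip|lborel. fn u z * pd_x \<phi> z) = (LINT x|MX. time_moment (fn u) e x * deriv a x)"
    unfolding px by (rule main[OF a1])
  show "(LINT z:strip|lborel. fn u z * pd_x (pd_x \<phi>) z) = (LINT x|MX. time_moment (fn u) e x * deriv (deriv a) x)"
    unfolding pxx by (rule main[OF a2])
  have ptt: "pd_t (pd_t \<phi>) = (\<lambda>(x, t). a x * deriv (deriv b) t)"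
    unfolding \<phi>_eq pd_t_product[OF b] by (rule pd_t_product[OF smooth_real_deriv[OF b]])
  have b1: "deriv b = (\<lambda>t. deriv e t * time_cutoff t + e t * deriv time_cutoff t)"
    unfolding b_def[abs_def] by (rule ext, rule deriv_mult_smooth[OF e smooth_time_cutoff])
  have b2: "deriv (deriv b) t = deriv (deriv e) t * time_cutoff t + 2 * (deriv e t * deriv time_cutoff t) + e t * deriv (deriv time_cutoff) t" for t
    unfolding b1
    by (rule DERIV_imp_deriv)
      (auto intro!: derivative_eq_intros smooth_real_DERIV smooth_real_deriv e smooth_time_cutoff simp: algebra_simps)
  \<comment> \<open>Outside the closed support the derivative is locally constant; at its boundary it vanishes by continuity.\<close>
  have b2_0: "deriv (deriv b) t = 0" if t: "\<bar>t\<bar> \<ge> T" for t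
  proof -
    have "deriv (deriv b) t = 0" if "\<bar>t\<bar> > T" for t
    proof -
      have o: "open {t. \<bar>t\<bar> > T}" by (intro open_Collect_less continuous_intros)
      have "deriv b s = 0" if "s \<in> {t. \<bar>t\<bar> > T}" for s
        by (rule smooth_real_deriv_locally_const[OF o that, of _ 0]) (simp add: b0)
      then show ?thesis using that by (intro smooth_real_deriv_locally_const[OF o, where f="deriv b" and c=0]) auto
    qed
    note out = this
    show ?thesis
    proof (rule ccontr)
      assume nz: "deriv (deriv b) t \<noteq> 0"
      have cont: "continuous_on UNIV (deriv (deriv b))"
        by (intro smooth_real_continuous_on smooth_real_deriv b)
      have "open ((deriv (deriv b)) -` (- {0}) \<inter> UNIV)"
        by (rule continuous_on_open_vimage[THEN iffD1, rule_format, OF open_UNIV cont]) auto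
      moreover have "t \<in> (deriv (deriv b)) -` (- {0}) \<inter> UNIV" using nz by simp
      ultimately obtain d where d: "d > 0" "ball t d \<subseteq> (deriv (deriv b)) -` (- {0}) \<inter> UNIV"
        by (meson openE)
      define s where "s = (if t \<ge> 0 then t + d / 2 else t - d / 2)"
      have "s \<in> ball t d" using d(1) by (auto simp: s_def dist_real_def)
      moreover have "\<bar>s\<bar> > T" using t d(1) T_pos by (auto simp: s_def)
      ultimately show False using d(2) out[of s] by auto
    qed
  qed
  obtain C where C: "\<And>x. \<bar>a x\<bar> \<le> C" using supported_bounded[OF a(1,4)] by blast
  have "(LINT z:strip|lborel. fn u z * pd_t (pd_t \<phi>) z) = (LINT z|Q. fn u z * (- (of_int k * \<omega>)\<^sup>2 * (a (fst z) * e (snd z))))"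
  proof (rule test_time_unfold[OF u test_function_pd(2)[OF test_function_pd(2)[OF \<phi>]]])
    fix x t assume t: "0 < t" "t < T"
    have sh: "e (t - T) = e t" "deriv e (t - T) = deriv e t" "deriv (deriv e) (t - T) = deriv (deriv e) t"
      unfolding e_def trig_deriv by (rule trig_shift)+
    have "deriv (deriv b) (t - T) + deriv (deriv b) t
      = deriv (deriv e) t * (time_cutoff (t - T) + time_cutoff t) + 2 * (deriv e t * (deriv time_cutoff (t - T) + deriv time_cutoff t))
        + e t * (deriv (deriv time_cutoff) (t - T) + deriv (deriv time_cutoff) t)"
      unfolding b2 sh by (simp add: algebra_simps)
    also have "\<dots> = deriv (deriv e) t"
      unfolding time_cutoff_partition[OF t] time_cutoff_deriv_partition[OF t] time_cutoff_deriv2_partition[OF t] by simp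
    also have "\<dots> = - (of_int k * \<omega>)\<^sup>2 * e t" unfolding e_def by (rule trig_deriv2)
    finally have *: "deriv (deriv b) (t - T) + deriv (deriv b) t = - (of_int k * \<omega>)\<^sup>2 * e t" .
    have "pd_t (pd_t \<phi>) (x, t - T) + pd_t (pd_t \<phi>) (x, t) = a x * (deriv (deriv b) (t - T) + deriv (deriv b) t)"
      unfolding ptt by (simp add: distrib_left)
    then show "pd_t (pd_t \<phi>) (x, t - T) + pd_t (pd_t \<phi>) (x, t) = - (of_int k * \<omega>)\<^sup>2 * (a (fst (x, t)) * e (snd (x, t)))"
      unfolding * by simp
  next
    have 1[measurable]: "fst \<in> borel_measurable (borel :: (real \<times> real) measure)" "snd \<in> borel_measurable (borel :: (real \<times> real) measure)"
      by (auto intro!: borel_measurable_continuous_onI continuous_intros)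
    have [measurable]: "a \<in> borel_measurable borel" "e \<in> borel_measurable borel"
      using smooth_measurable a e by auto
    show "(\<lambda>z. - (of_int k * \<omega>)\<^sup>2 * (a (fst z) * e (snd z))) \<in> borel_measurable borel" by measurable
  qed (simp add: ptt b2_0)
  also have "\<dots> = (LINT z|Q. - (of_int k * \<omega>)\<^sup>2 * (fn u z * (a (fst z) * e (snd z))))"
    by (simp only: mult.left_commute)
  also have "\<dots> = - (of_int k * \<omega>)\<^sup>2 * (LINT z|Q. fn u z * (a (fst z) * e (snd z)))"
    by (rule integral_mult_right_zero)
  also have "(LINT z|Q. fn u z * (a (fst z) * e (snd z))) = (LINT x|MX. time_moment (fn u) e x * a x)"
    by (rule time_moment_cell_integral(3)[OF ui _ _ smooth_measurable[OF a(1)] C, where M="\<bar>A\<bar> + \<bar>B\<bar>"]) (auto simp: e_def trig_bound)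
  finally show "(LINT z:strip|lborel. fn u z * pd_t (pd_t \<phi>) z) = - (of_int k * \<omega>)\<^sup>2 * (LINT x|MX. time_moment (fn u) e x * a x)" .
qed

text \<open>
  Continuity of the representative at \<open>x0\<close> in L2 of a period bounds the time moments near \<open>x0\<close>.
\<close>

lemma trace_zero_small:
  assumes tr: "is_trace \<omega> v x0 (\<lambda>_. 0)" and x0: "x0 \<in> {0..1}"
    and e: "e \<in> borel_measurable borel" "\<And>t. \<bar>e t\<bar> \<le> M" and r: "r > 0"
  shows "\<exists>\<delta>>0. AE x in MX. \<bar>x - x0\<bar> < \<delta> \<longrightarrow> \<bar>time_moment (fn v) e x\<bar> \<le> r"
proof -
  have M: "M \<ge> 0" using order_trans[OF abs_ge_zero e(2)] .
  from tr obtain G where G1: "\<And>x. x \<in> {0..1} \<Longrightarrow> G x \<in> borel_measurable lborel \<and> set_integrable lborel {0..T} (\<lambda>t. (G x t)\<^sup>2)"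
    and G2: "\<And>x. x \<in> {0..1} \<Longrightarrow> ((\<lambda>y. LINT t:{0..T}|lborel. (G y t - G x t)\<^sup>2) \<longlongrightarrow> 0) (at x within {0..1})"
    and G3: "AE x in lborel. x \<in> {0<..<1} \<longrightarrow> (AE t in lborel. t \<in> {0..T} \<longrightarrow> fn v (x, t) = G x t)"
    and G4: "AE t in lborel. t \<in> {0..T} \<longrightarrow> 0 = G x0 t"
    unfolding is_trace_def T_def[symmetric] by blast
  \<comment> \<open>By the Cauchy-Schwarz inequality the moment is then at most \<open>M sqrt (T q)\<close>, which is less than \<open>r\<close>.\<close>
  define q where "q = (r / (M + 1))\<^sup>2 / T"
  have q: "q > 0" unfolding q_def using r M T_pos by (intro divide_pos_pos zero_less_power) auto
  have "eventually (\<lambda>y. (LINT t:{0..T}|lborel. (G y t - G x0 t)\<^sup>2) < q) (at x0 within {0..1})"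
    using G2[OF x0] q by (rule order_tendstoD(2))
  then obtain \<delta> where \<delta>: "\<delta> > 0" "\<And>y. y \<in> {0..1} \<Longrightarrow> y \<noteq> x0 \<Longrightarrow> dist y x0 < \<delta> \<Longrightarrow> (LINT t:{0..T}|lborel. (G y t - G x0 t)\<^sup>2) < q"
    unfolding eventually_at by blast
  have "AE x in MX. \<bar>x - x0\<bar> < \<delta> \<longrightarrow> \<bar>time_moment (fn v) e x\<bar> \<le> r"
    unfolding AE_MX_iff using G3 AE_lborel_singleton[of x0]
  proof eventually_elim
    case (elim x)
    show ?case
    proof (intro impI)
      assume x: "x \<in> {0<..<1}" and d: "\<bar>x - x0\<bar> < \<delta>"
      have x': "x \<in> {0..1}" using x by auto
      have Gm: "G x \<in> borel_measurable MT" using G1[OF x'] by (simp add: measurable_restrict_space1)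
      have G2i: "integrable MT (\<lambda>t. (G x t)\<^sup>2)"
        using G1[OF x'] by (subst integrable_restrict_space) (auto simp: set_integrable_def)
      have ae: "AE t in MT. fn v (x, t) = G x t" using elim x unfolding AE_MT_iff by blast
      have "(LINT t|MT. (G x t)\<^sup>2) = (LINT t|MT. (G x t - G x0 t)\<^sup>2)"
      proof (rule integral_cong_AE)
        show "AE t in MT. (G x t)\<^sup>2 = (G x t - G x0 t)\<^sup>2"
          unfolding AE_MT_iff using G4 by eventually_elim auto
        have "G x0 \<in> borel_measurable MT" using G1[OF x0] by (simp add: measurable_restrict_space1)
        then show "(\<lambda>t. (G x t - G x0 t)\<^sup>2) \<in> borel_measurable MT" using Gm by measurable
      qed (use Gm in measurable)
      also have "\<dots> < q" unfolding integral_MT using \<delta>(2)[OF x'] elim d by (simp add: dist_real_def)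
      finally have lt: "(LINT t|MT. (G x t)\<^sup>2) < q" .
      have "(LINT t|MT. \<bar>G x t\<bar>)\<^sup>2 \<le> (LINT t|MT. (G x t)\<^sup>2) * T"
        using MT.L1_le_L2[OF Gm G2i] by (simp only: measure_MT)
      also have "\<dots> \<le> q * T" using lt T_pos by (intro mult_right_mono) auto
      also have "\<dots> = (r / (M + 1))\<^sup>2" unfolding q_def using T_pos by simp
      finally have l: "(LINT t|MT. \<bar>G x t\<bar>) \<le> r / (M + 1)"
        by (rule power2_le_imp_le) (use r M in simp)
      have Gi: "integrable MT (G x)" by (rule MT.square_integrable_imp_integrable[OF Gm G2i])
      have em: "e \<in> borel_measurable MT" using e by (simp add: measurable_restrict_space1)
      have i: "integrable MT (\<lambda>t. G x t * e t)"
        by (rule integrable_mult_bounded[OF Gi em, where C=M]) (use e in simp)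
      have "time_moment (fn v) e x = (LINT t|MT. G x t * e t)"
        unfolding time_moment_def
      proof (rule integral_cong_AE)
        show "(\<lambda>t. fn v (x, t) * e t) \<in> borel_measurable MT"
        proof (rule borel_measurable_times[OF _ em])
          show "(\<lambda>t. fn v (x, t)) \<in> borel_measurable MT"
            using fn_measurable_Q[of v] x unfolding Q_def
            by (intro measurable_compose[OF measurable_Pair1'[of x MX MT]]) (auto simp: space_MX)
        qed
      qed (use i ae in \<open>auto elim!: eventually_mono\<close>)
      also have "\<bar>\<dots>\<bar> \<le> (LINT t|MT. \<bar>G x t * e t\<bar>)"
        using integral_norm_bound[of MT "\<lambda>t. G x t * e t"] by simp
      also have "\<dots> \<le> (LINT t|MT. M * \<bar>G x t\<bar>)"
      proof (rule integral_mono)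
        show "\<bar>G x t * e t\<bar> \<le> M * \<bar>G x t\<bar>" for t
          using mult_left_mono[OF e(2)[of t], of "\<bar>G x t\<bar>"] by (simp add: abs_mult mult.commute)
      qed (use i Gi in auto)
      also have "\<dots> = M * (LINT t|MT. \<bar>G x t\<bar>)" by simp
      also have "\<dots> \<le> (M + 1) * (r / (M + 1))" using l M by (intro mult_mono) auto
      also have "\<dots> = r" using M by simp
      finally show "\<bar>time_moment (fn v) e x\<bar> \<le> r" .
    qed
  qed
  then show ?thesis using \<delta>(1) by blast
qed

text \<open>
  The time moments \<open>U\<close>, \<open>V\<close>, \<open>W\<close> of \<open>u\<close>, its space derivative and its wave operator satisfy
  \<open>U' = V\<close> and \<open>V' = - (W + \<kappa>^2 U)\<close> weakly, with \<open>\<kappa> = k \<omega>\<close>.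
\<close>

lemma wave_moments:
  assumes u: "periodic_integrable u" and v: "periodic_integrable v" and w: "periodic_integrable w" and dx: "is_dx u v" and wv: "is_wave u w"
    and tr: "is_trace \<omega> v 0 (\<lambda>_. 0)" "is_trace \<omega> v 1 (\<lambda>_. 0)"
  shows "(LINT z|Q. fn w z * (cos_mode n (fst z) * trig k A B (snd z)))
    = ((real n * pi)\<^sup>2 - (of_int k * \<omega>)\<^sup>2) * (LINT z|Q. fn u z * (cos_mode n (fst z) * trig k A B (snd z)))"
proof -
  let ?e = "trig k A B"
  let ?\<kappa> = "of_int k * \<omega> :: real"
  let ?U = "time_moment (fn u) ?e" and ?V = "time_moment (fn v) ?e" and ?W = "time_moment (fn w) ?e"
  have b: "\<bar>?e t\<bar> \<le> \<bar>A\<bar> + \<bar>B\<bar>" for t by (rule trig_bound)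
  have int: "integrable MX (time_moment (fn f) ?e)" if "periodic_integrable f" for f
    by (rule time_moment_cell_integral(1)[OF periodic_integrable_integrable[OF that] trig_measurable b cos_mode_measurable cos_mode_bound])
  have UV: "(LINT x|MX. ?U x * deriv a x) = - (LINT x|MX. ?V x * a x)"
    if a: "smooth_real a" "0 < \<alpha>" "\<beta> < 1" "\<And>x. x \<notin> {\<alpha>..\<beta>} \<Longrightarrow> a x = 0" for a \<alpha> \<beta>
  proof -
    let ?\<phi> = "\<lambda>(x, t). a x * (trig k A B t * time_cutoff t)"
    have "(LINT z:strip|lborel. fn u z * - pd_x ?\<phi> z) = (LINT z:strip|lborel. fn v z * ?\<phi> z)"
      using dx product_test_unfold(1)[OF a u, of k A B] unfolding is_dx_def weakly_eq_def by blast
    moreover have "(LINT z:strip|lborel. fn u z * - pd_x ?\<phi> z) = - (LINT z:strip|lborel. fn u z * pd_x ?\<phi> z)"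
      by (simp add: set_lebesgue_integral_def)
    ultimately show ?thesis
      using product_test_unfold(2)[OF a v, of k A B] product_test_unfold(3)[OF a u, of k A B] by linarith
  qed
  have VZ: "(LINT x|MX. ?V x * deriv a x) = (LINT x|MX. (?W x + ?\<kappa>\<^sup>2 * ?U x) * a x)"
    if a: "smooth_real a" "0 < \<alpha>" "\<beta> < 1" "\<And>x. x \<notin> {\<alpha>..\<beta>} \<Longrightarrow> a x = 0" for a \<alpha> \<beta>
  proof -
    let ?\<phi> = "\<lambda>(x, t). a x * (trig k A B t * time_cutoff t)"
    have \<phi>: "test_function ?\<phi>" by (rule product_test_unfold(1)[OF a u])
    obtain C where C: "\<And>x. \<bar>a x\<bar> \<le> C" using supported_bounded[OF a(1,4)] by blast
    have "(LINT z:strip|lborel. fn u z * (pd_t (pd_t ?\<phi>) z - pd_x (pd_x ?\<phi>) z)) = (LINT z:strip|lborel. fn w z * ?\<phi> z)"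
      using wv \<phi> unfolding is_wave_def weakly_eq_def by blast
    moreover have "(LINT z:strip|lborel. fn u z * (pd_t (pd_t ?\<phi>) z - pd_x (pd_x ?\<phi>) z))
      = (LINT z:strip|lborel. fn u z * pd_t (pd_t ?\<phi>) z) - (LINT z:strip|lborel. fn u z * pd_x (pd_x ?\<phi>) z)"
      unfolding right_diff_distrib
      by (intro set_integral_diff(2) test_function_integrable periodic_integrable_locally_integrable u test_function_pd \<phi>)
    ultimately have "- ?\<kappa>\<^sup>2 * (LINT x|MX. ?U x * a x) - (LINT x|MX. ?U x * deriv (deriv a) x) = (LINT x|MX. ?W x * a x)"
      using product_test_unfold(2)[OF a w, of k A B] product_test_unfold(4)[OF a u, of k A B]
        product_test_unfold(5)[OF a u, of k A B] by linarith
    moreover have "(LINT x|MX. ?U x * deriv (deriv a) x) = - (LINT x|MX. ?V x * deriv a x)"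
      by (rule UV[OF smooth_real_deriv[OF a(1)] a(2,3)]) (use supported_deriv[of \<alpha> \<beta> a] a(4) in auto)
    moreover have "(LINT x|MX. (?W x + ?\<kappa>\<^sup>2 * ?U x) * a x) = (LINT x|MX. ?W x * a x) + ?\<kappa>\<^sup>2 * (LINT x|MX. ?U x * a x)"
    proof -
      have i: "integrable MX (\<lambda>x. time_moment (fn f) ?e x * a x)" if "periodic_integrable f" for f
        by (rule integrable_MX_mult[OF int[OF that] smooth_measurable[OF a(1)] C])
      show ?thesis
        unfolding distrib_right mult.assoc
        by (simp only: Bochner_Integration.integral_add[OF i[OF w] integrable_mult_right[OF i[OF u]]] integral_mult_right_zero)
    qed
    ultimately show ?thesis by simp
  qed
  have V0: "\<exists>\<delta>>0. AE x in MX. x < \<delta> \<or> x > 1 - \<delta> \<longrightarrow> \<bar>?V x\<bar> \<le> r" if r: "r > 0" for r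
  proof -
    obtain d0 where d0: "d0 > 0" "AE x in MX. \<bar>x - 0\<bar> < d0 \<longrightarrow> \<bar>?V x\<bar> \<le> r"
      using trace_zero_small[OF tr(1) _ trig_measurable b r] by auto
    obtain d1 where d1: "d1 > 0" "AE x in MX. \<bar>x - 1\<bar> < d1 \<longrightarrow> \<bar>?V x\<bar> \<le> r"
      using trace_zero_small[OF tr(2) _ trig_measurable b r] by auto
    have "AE x in MX. x < min d0 d1 \<or> x > 1 - min d0 d1 \<longrightarrow> \<bar>?V x\<bar> \<le> r"
      using d0(2) d1(2) AE_space
    proof eventually_elim
      case (elim x)
      then have "0 < x" "x < 1" by (auto simp: space_MX)
      then show ?case using elim by auto
    qed
    then show ?thesis using d0 d1 by (intro exI[of _ "min d0 d1"]) auto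
  qed
  let ?c = "if n = 0 then 1 else sqrt 2 :: real"
  let ?C = "\<lambda>x. cos ((real n * pi) * x)"
  have cb: "?C \<in> borel_measurable borel" "\<And>x. \<bar>?C x\<bar> \<le> 1" by auto
  have i: "integrable MX (\<lambda>x. time_moment (fn f) ?e x * ?C x)" if "periodic_integrable f" for f
    by (rule integrable_MX_mult[OF int[OF that] cb])
  have "(LINT x|MX. (?W x + ?\<kappa>\<^sup>2 * ?U x) * ?C x) = (real n * pi)\<^sup>2 * (LINT x|MX. ?U x * ?C x)"
  proof (rule Neumann_cosine_moments[OF int[OF u] int[OF v] _ UV VZ V0])
    show "integrable MX (\<lambda>x. ?W x + ?\<kappa>\<^sup>2 * ?U x)" using int[OF w] int[OF u] by simp
  qed auto
  moreover have "(LINT x|MX. (?W x + ?\<kappa>\<^sup>2 * ?U x) * ?C x) = (LINT x|MX. ?W x * ?C x) + ?\<kappa>\<^sup>2 * (LINT x|MX. ?U x * ?C x)"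
    unfolding distrib_right mult.assoc
    using i[OF w] i[OF u] by (simp add: Bochner_Integration.integral_add mult.assoc)
  ultimately have m: "(LINT x|MX. ?W x * ?C x) = ((real n * pi)\<^sup>2 - ?\<kappa>\<^sup>2) * (LINT x|MX. ?U x * ?C x)"
    by (simp add: algebra_simps)
  have p: "(LINT z|Q. fn f z * (cos_mode n (fst z) * ?e (snd z))) = ?c * (LINT x|MX. time_moment (fn f) ?e x * ?C x)" if "periodic_integrable f" for f
  proof -
    have "(LINT z|Q. fn f z * (cos_mode n (fst z) * ?e (snd z))) = (LINT x|MX. time_moment (fn f) ?e x * cos_mode n x)"
      by (rule time_moment_cell_integral(3)[OF periodic_integrable_integrable[OF that] trig_measurable b cos_mode_measurable cos_mode_bound])
    also have "\<dots> = (LINT x|MX. ?c * (time_moment (fn f) ?e x * ?C x))"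
      by (intro Bochner_Integration.integral_cong refl) (simp add: cos_mode_def)
    also have "\<dots> = ?c * (LINT x|MX. time_moment (fn f) ?e x * ?C x)" by (rule integral_mult_right_zero)
    finally show ?thesis .
  qed
  show ?thesis unfolding p[OF u] p[OF w] m by (simp only: mult.left_commute)
qed

lemma time_exp_trig: "time_exp k t = Complex (trig k 1 0 t) (trig k 0 (- 1) t)"
proof -
  have "- \<i> * of_int k * of_real \<omega> * of_real t = \<i> * of_real (- (of_int k * \<omega> * t))" by simp
  then show ?thesis unfolding time_exp_def by (simp only: cis_conv_exp[symmetric]) (simp add: complex_eq_iff trig_def)
qed

lemma coeff_of_Re_Im:
  assumes f: "integrable Q f"
  shows "Re (coeff_of f k n) = (LINT z|Q. f z * (cos_mode n (fst z) * trig k 1 0 (snd z)))"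
    and "Im (coeff_of f k n) = (LINT z|Q. f z * (cos_mode n (fst z) * trig k 0 (- 1) (snd z)))"
  unfolding coeff_of_cell_integral(1)[OF f] integral_Re[OF coeff_of_cell_integral(2)[OF f], symmetric] integral_Im[OF coeff_of_cell_integral(2)[OF f], symmetric]
  by (simp_all add: time_exp_trig mult_ac)

lemma wave_coeffs:
  assumes "periodic_integrable u" "periodic_integrable v" "periodic_integrable w" "is_dx u v" "is_wave u w"
    "is_trace \<omega> v 0 (\<lambda>_. 0)" "is_trace \<omega> v 1 (\<lambda>_. 0)"
  shows "coeff_of (fn w) k n = of_real ((real n * pi)\<^sup>2 - (of_int k * \<omega>)\<^sup>2) * coeff_of (fn u) k n"
  using wave_moments[OF assms, of n k] assms(1,3)
  by (simp add: complex_eq_iff coeff_of_Re_Im periodic_integrable_integrable)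

end

section \<open>Linear combinations and constants in the spaces H\<close>

lemma fn_add: "AE z in lborel. z \<in> strip \<longrightarrow> fn (u + v) z = fn u z + fn v z"
  unfolding AE_strip_iff[symmetric] plus_stripfun_def map_fun_def o_def id_def
  by (rule fn_stripfun_of) (intro borel_measurable_add fn_measurable_strip)

lemma fn_scaleR: "AE z in lborel. z \<in> strip \<longrightarrow> fn (c *\<^sub>R u) z = c * fn u z"
  unfolding AE_strip_iff[symmetric] scaleR_stripfun_def map_fun_def o_def id_def
  by (rule fn_stripfun_of) (intro borel_measurable_times borel_measurable_const fn_measurable_strip)

definition one_fun :: stripfun where "one_fun = stripfun_of (\<lambda>_. 1)"

lemma fn_one: "AE z in lborel. z \<in> strip \<longrightarrow> fn one_fun z = 1"
  unfolding AE_strip_iff[symmetric] one_fun_def by (rule fn_stripfun_of) simp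

context time_period begin

lemma fn_linear: "AE z in lborel. z \<in> strip \<longrightarrow> fn (a *\<^sub>R u + b *\<^sub>R v) z = a * fn u z + b * fn v z"
  using fn_add[of "a *\<^sub>R u" "b *\<^sub>R v"] fn_scaleR[of a u] fn_scaleR[of b v] by eventually_elim auto

lemma AE_strip_Q: "(AE z in lborel. z \<in> strip \<longrightarrow> P z) \<Longrightarrow> AE z in Q. P z"
  unfolding AE_Q_iff by (auto elim!: eventually_mono intro: cell_strip[THEN subsetD])

lemma periodic_integrable_linear:
  assumes u: "periodic_integrable u" and v: "periodic_integrable v"
  shows "periodic_integrable (a *\<^sub>R u + b *\<^sub>R v)"
  unfolding periodic_integrable_def
proof
  let ?w = "a *\<^sub>R u + b *\<^sub>R v"
  have "AE z in lborel. ((0, T) + z) \<in> strip \<longrightarrow> fn ?w ((0, T) + z) = a * fn u ((0, T) + z) + b * fn v ((0, T) + z)"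
    by (rule AE_lborel_translate[OF fn_linear])
  moreover have "AE z in lborel. z \<in> strip \<longrightarrow> fn u (z + (0, T)) = fn u z" "AE z in lborel. z \<in> strip \<longrightarrow> fn v (z + (0, T)) = fn v z"
    using u v by (auto simp: periodic_integrable_def)
  ultimately show "AE z in lborel. z \<in> strip \<longrightarrow> fn ?w (z + (0, T)) = fn ?w z"
    using fn_linear[of a u b v]
  proof eventually_elim
    case (elim z)
    have "z \<in> strip \<Longrightarrow> (0, T) + z \<in> strip" by (cases z) (simp add: strip_def)
    then show ?case using elim by (simp add: add.commute)
  qed
  have "integrable Q (\<lambda>z. a * fn u z + b * fn v z)" using u v by (simp add: periodic_integrable_integrable)
  then show "integrable Q (fn ?w)"
    by (rule integrable_cong_AE_imp) (use AE_strip_Q[OF fn_linear[of a u b v]] in \<open>auto elim!: eventually_mono\<close>)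
qed

lemma coeff_of_fn_linear:
  assumes u: "periodic_integrable u" and v: "periodic_integrable v"
  shows "coeff_of (fn (a *\<^sub>R u + b *\<^sub>R v)) k n = of_real a * coeff_of (fn u) k n + of_real b * coeff_of (fn v) k n"
proof -
  have "coeff_of (fn (a *\<^sub>R u + b *\<^sub>R v)) k n = coeff_of (\<lambda>z. a * fn u z + b * fn v z) k n"
    by (rule coeff_of_cong_AE[OF AE_strip_Q[OF fn_linear]]) (use u v periodic_integrable_linear[OF u v] in \<open>auto simp: periodic_integrable_integrable\<close>)
  then show ?thesis by (simp add: coeff_of_linear periodic_integrable_integrable u v)
qed

lemma periodic_integrable_one: "periodic_integrable one_fun"
  unfolding periodic_integrable_def
proof
  have "AE z in lborel. ((0, T) + z) \<in> strip \<longrightarrow> fn one_fun ((0, T) + z) = 1"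
    by (rule AE_lborel_translate[OF fn_one])
  then show "AE z in lborel. z \<in> strip \<longrightarrow> fn one_fun (z + (0, T)) = fn one_fun z"
    using fn_one
  proof eventually_elim
    case (elim z)
    have "z \<in> strip \<Longrightarrow> (0, T) + z \<in> strip" by (cases z) (simp add: strip_def)
    then show ?case using elim by (simp add: add.commute)
  qed
  show "integrable Q (fn one_fun)"
    by (rule integrable_cong_AE_imp[of _ "\<lambda>_. 1"]) (use AE_strip_Q[OF fn_one] in \<open>auto elim!: eventually_mono\<close>)
qed

lemma time_fourier_one: "AE x in MX. \<forall>k. time_fourier (fn one_fun) k x = (if k = 0 then of_real T else 0)"
proof -
  have "AE x in MX. \<forall>k. time_fourier (fn one_fun) k x = time_fourier (\<lambda>_. 1) k x"
    by (rule time_fourier_cong_AE[OF AE_strip_Q[OF fn_one]]) auto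
  then show ?thesis by eventually_elim (simp add: time_fourier_def time_exp_integral)
qed

lemma coeff_of_one: "coeff_of (fn one_fun) k n = (if k = 0 \<and> n = 0 then of_real T else 0)"
proof -
  have "coeff_of (fn one_fun) k n = (LINT x|MX. (if k = 0 then of_real T else 0) * complex_of_real (cos_mode n x))"
    unfolding coeff_of_def
  proof (rule integral_cong_AE)
    show "AE x in MX. time_fourier (fn one_fun) k x * of_real (cos_mode n x) = (if k = 0 then of_real T else 0) * of_real (cos_mode n x)"
      using time_fourier_one by eventually_elim simp
    have "cos_mode n \<in> borel_measurable MX" by (simp add: measurable_restrict_space1)
    then show "(\<lambda>x. time_fourier (fn one_fun) k x * complex_of_real (cos_mode n x)) \<in> borel_measurable MX"
      using time_fourier_measurable[OF periodic_integrable_integrable[OF periodic_integrable_one], of k] by measurable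
    show "(\<lambda>x. (if k = 0 then of_real T else 0) * complex_of_real (cos_mode n x)) \<in> borel_measurable MX"
      using \<open>cos_mode n \<in> borel_measurable MX\<close> by measurable
  qed
  also have "\<dots> = (if k = 0 then of_real T else 0) * of_real (LINT x|MX. cos_mode n x * cos_mode 0 x)"
    by (simp add: cos_mode_def[of 0])
  also have "(LINT x|MX. cos_mode n x * cos_mode 0 x) = (if n = 0 then 1 else 0)"
    using orth_cos_mode by (simp add: orth_family_def)
  finally show ?thesis by simp
qed

text \<open>
  A pointwise comparison of time coefficients yields a comparison of norms.
\<close>

lemma H_sqnorm_le:
  assumes w: "\<And>k. AE x in MX. weight s' k * (cmod (time_fourier (fn w) k x))\<^sup>2 \<le> C1 * (weight s1 k * (cmod (time_fourier (fn u) k x))\<^sup>2) + C2 * (weight s2 k * (cmod (time_fourier (fn v) k x))\<^sup>2)"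
    and C: "C1 \<ge> 0" "C2 \<ge> 0" and p: "periodic_integrable u" "periodic_integrable v" "periodic_integrable w"
  shows "H_sqnorm \<omega> s' w \<le> ennreal C1 * H_sqnorm \<omega> s1 u + ennreal C2 * H_sqnorm \<omega> s2 v"
proof -
  let ?t = "\<lambda>u k. \<integral>\<^sup>+x. ennreal ((cmod (time_fourier (fn u) k x))\<^sup>2) \<partial>MX"
  have m: "(\<lambda>x. ennreal ((cmod (time_fourier (fn f) k x))\<^sup>2)) \<in> borel_measurable MX" if "periodic_integrable f" for f k
    using time_fourier_measurable[OF periodic_integrable_integrable[OF that], of k] by measurable
  have le: "(\<Sum>k\<in>F. ennreal (weight s k) * ?t f k) \<le> H_sqnorm \<omega> s f" if "finite F" for F s f
    unfolding H_sqnorm_eq infsum_ennreal_SUP weight_def[symmetric] by (rule SUP_upper) (use that in auto)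
  have k: "ennreal (weight s' k) * ?t w k \<le> ennreal C1 * (ennreal (weight s1 k) * ?t u k) + ennreal C2 * (ennreal (weight s2 k) * ?t v k)" for k
  proof -
    have "ennreal (weight s' k) * ?t w k = (\<integral>\<^sup>+x. ennreal (weight s' k) * ennreal ((cmod (time_fourier (fn w) k x))\<^sup>2) \<partial>MX)"
      by (rule nn_integral_cmult[OF m[OF p(3)], symmetric])
    also have "\<dots> \<le> (\<integral>\<^sup>+x. ennreal (C1 * weight s1 k) * ennreal ((cmod (time_fourier (fn u) k x))\<^sup>2) + ennreal (C2 * weight s2 k) * ennreal ((cmod (time_fourier (fn v) k x))\<^sup>2) \<partial>MX)"
    proof (rule nn_integral_mono_AE)
      show "AE x in MX. ennreal (weight s' k) * ennreal ((cmod (time_fourier (fn w) k x))\<^sup>2)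
        \<le> ennreal (C1 * weight s1 k) * ennreal ((cmod (time_fourier (fn u) k x))\<^sup>2) + ennreal (C2 * weight s2 k) * ennreal ((cmod (time_fourier (fn v) k x))\<^sup>2)"
        using w[of k]
      proof eventually_elim
        case (elim x)
        then have "ennreal (weight s' k * (cmod (time_fourier (fn w) k x))\<^sup>2) \<le> ennreal ((C1 * weight s1 k) * (cmod (time_fourier (fn u) k x))\<^sup>2 + (C2 * weight s2 k) * (cmod (time_fourier (fn v) k x))\<^sup>2)"
          by (intro ennreal_leI) (simp add: mult.assoc)
        then show ?case using C weight_nonneg by (simp add: ennreal_mult ennreal_plus)
      qed
    qed
    also have "\<dots> = ennreal (C1 * weight s1 k) * ?t u k + ennreal (C2 * weight s2 k) * ?t v k"
      using m[OF p(1)] m[OF p(2)] by (simp add: nn_integral_add nn_integral_cmult)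
    finally show ?thesis using C weight_nonneg by (simp add: ennreal_mult mult.assoc)
  qed
  show ?thesis
    unfolding H_sqnorm_eq[of s' w] infsum_ennreal_SUP weight_def[symmetric]
  proof (rule SUP_least)
    fix F :: "int set" assume "F \<in> {F. finite F \<and> F \<subseteq> UNIV}"
    then have F: "finite F" by simp
    have "(\<Sum>k\<in>F. ennreal (weight s' k) * ?t w k) \<le> (\<Sum>k\<in>F. ennreal C1 * (ennreal (weight s1 k) * ?t u k) + ennreal C2 * (ennreal (weight s2 k) * ?t v k))"
      by (rule sum_mono[OF k])
    also have "\<dots> = ennreal C1 * (\<Sum>k\<in>F. ennreal (weight s1 k) * ?t u k) + ennreal C2 * (\<Sum>k\<in>F. ennreal (weight s2 k) * ?t v k)"
      by (simp only: sum.distrib sum_distrib_left)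
    also have "\<dots> \<le> ennreal C1 * H_sqnorm \<omega> s1 u + ennreal C2 * H_sqnorm \<omega> s2 v"
      by (intro add_mono mult_left_mono le F) auto
    finally show "(\<Sum>k\<in>F. ennreal (weight s' k) * ?t w k) \<le> ennreal C1 * H_sqnorm \<omega> s1 u + ennreal C2 * H_sqnorm \<omega> s2 v" .
  qed
qed

lemma H_sqnorm_linear:
  assumes u: "periodic_integrable u" and v: "periodic_integrable v"
  shows "H_sqnorm \<omega> s (a *\<^sub>R u + b *\<^sub>R v) \<le> ennreal (2 * a\<^sup>2) * H_sqnorm \<omega> s u + ennreal (2 * b\<^sup>2) * H_sqnorm \<omega> s v"
proof (rule H_sqnorm_le)
  fix k
  let ?w = "a *\<^sub>R u + b *\<^sub>R v"
  have "AE x in MX. \<forall>k. time_fourier (fn ?w) k x = time_fourier (\<lambda>z. a * fn u z + b * fn v z) k x"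
    by (rule time_fourier_cong_AE[OF AE_strip_Q[OF fn_linear]]) auto
  then show "AE x in MX. weight s k * (cmod (time_fourier (fn ?w) k x))\<^sup>2 \<le> 2 * a\<^sup>2 * (weight s k * (cmod (time_fourier (fn u) k x))\<^sup>2) + 2 * b\<^sup>2 * (weight s k * (cmod (time_fourier (fn v) k x))\<^sup>2)"
    using time_fourier_AE_diff[OF periodic_integrable_integrable[OF u] periodic_integrable_integrable[OF v], of a b]
  proof eventually_elim
    case (elim x)
    let ?p = "cmod (time_fourier (fn u) k x)" and ?q = "cmod (time_fourier (fn v) k x)"
    have "cmod (time_fourier (fn ?w) k x) \<le> \<bar>a\<bar> * ?p + \<bar>b\<bar> * ?q"
      using norm_triangle_ineq[of "of_real a * time_fourier (fn u) k x" "of_real b * time_fourier (fn v) k x"] elim by (simp add: norm_mult)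
    then have "(cmod (time_fourier (fn ?w) k x))\<^sup>2 \<le> (\<bar>a\<bar> * ?p + \<bar>b\<bar> * ?q)\<^sup>2" by (intro power_mono) auto
    also have "\<dots> \<le> 2 * (\<bar>a\<bar> * ?p)\<^sup>2 + 2 * (\<bar>b\<bar> * ?q)\<^sup>2"
      using sum_squares_bound[of "\<bar>a\<bar> * ?p" "\<bar>b\<bar> * ?q"] by (simp add: power2_sum)
    also have "\<dots> = 2 * a\<^sup>2 * ?p\<^sup>2 + 2 * b\<^sup>2 * ?q\<^sup>2" by (simp add: power_mult_distrib)
    finally have "weight s k * (cmod (time_fourier (fn ?w) k x))\<^sup>2 \<le> weight s k * (2 * a\<^sup>2 * ?p\<^sup>2 + 2 * b\<^sup>2 * ?q\<^sup>2)"
      by (intro mult_left_mono weight_nonneg)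
    then show ?case by (simp add: algebra_simps)
  qed
qed (use u v periodic_integrable_linear[OF u v] in auto)

lemma H_space_linear:
  assumes "u \<in> H_space \<omega> s" "v \<in> H_space \<omega> s"
  shows "a *\<^sub>R u + b *\<^sub>R v \<in> H_space \<omega> s"
proof -
  have p: "periodic_integrable u" "periodic_integrable v" "H_sqnorm \<omega> s u < \<infinity>" "H_sqnorm \<omega> s v < \<infinity>" using assms by (auto simp: H_space_iff)
  have "ennreal (2 * a\<^sup>2) * H_sqnorm \<omega> s u + ennreal (2 * b\<^sup>2) * H_sqnorm \<omega> s v < \<infinity>"
    using p(3,4) by (auto simp: ennreal_mult_less_top)
  then show ?thesis using H_sqnorm_linear[OF p(1,2), of s a b] periodic_integrable_linear[OF p(1,2)] by (auto simp: H_space_iff intro: le_less_trans)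
qed

lemma H_sqnorm_one: "H_sqnorm \<omega> s one_fun < \<infinity>"
proof -
  let ?t = "\<lambda>k. \<integral>\<^sup>+x. ennreal ((cmod (time_fourier (fn one_fun) k x))\<^sup>2) \<partial>MX"
  have t: "?t k = (if k = 0 then ennreal (T\<^sup>2) else 0)" for k
  proof -
    have "?t k = (\<integral>\<^sup>+x. (if k = 0 then ennreal (T\<^sup>2) else 0) \<partial>MX)"
    proof (rule nn_integral_cong_AE)
      show "AE x in MX. ennreal ((cmod (time_fourier (fn one_fun) k x))\<^sup>2) = (if k = 0 then ennreal (T\<^sup>2) else 0)"
        using time_fourier_one by eventually_elim simp
    qed
    then show ?thesis using measure_MX MX.emeasure_eq_measure[of "space MX"] by simp
  qed
  have "H_sqnorm \<omega> s one_fun \<le> ennreal (T\<^sup>2)"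
    unfolding H_sqnorm_eq infsum_ennreal_SUP weight_def[symmetric]
  proof (rule SUP_least)
    fix F :: "int set" assume "F \<in> {F. finite F \<and> F \<subseteq> UNIV}"
    then have F: "finite F" by simp
    have "(\<Sum>k\<in>F. ennreal (weight s k) * ?t k) = (\<Sum>k\<in>F. if k = 0 then ennreal (T\<^sup>2) else 0)"
      by (intro sum.cong refl) (simp add: t weight_def)
    also have "\<dots> \<le> ennreal (T\<^sup>2)" using F by simp
    finally show "(\<Sum>k\<in>F. ennreal (weight s k) * ?t k) \<le> ennreal (T\<^sup>2)" .
  qed
  then show ?thesis by (rule le_less_trans) simp
qed

lemma one_in_H: "one_fun \<in> H_space \<omega> s"
  using periodic_integrable_one H_sqnorm_one[of s] by (simp add: H_space_iff)

lemma subspace_H: "subspace (H_space \<omega> s)"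
proof (rule subspaceI)
  show "0 \<in> H_space \<omega> s" using H_space_linear[OF one_in_H one_in_H, where a=0 and b=0 and s=s] by simp
  show "u + v \<in> H_space \<omega> s" if "u \<in> H_space \<omega> s" "v \<in> H_space \<omega> s" for u v using H_space_linear[OF that, of 1 1] by simp
  show "c *\<^sub>R u \<in> H_space \<omega> s" if "u \<in> H_space \<omega> s" for c u using H_space_linear[OF that that, of c 0] by simp
qed

lemma coeff_of_le_H_norm:
  assumes "u \<in> H_space \<omega> s" "s \<ge> 0"
  shows "cmod (coeff_of (fn u) 0 0) \<le> H_norm \<omega> s u"
proof -
  have "weight s 0 * (cmod (coeff_of (fn u) 0 0))\<^sup>2 \<le> enn2real (H_sqnorm \<omega> s u)"
    using coeff_of_weighted_le[OF assms(1), of 0] by (simp add: freqs_def)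
  then have "(cmod (coeff_of (fn u) 0 0))\<^sup>2 \<le> enn2real (H_sqnorm \<omega> s u)" by (simp add: weight_def)
  then show ?thesis unfolding H_norm_def by (simp add: real_le_rsqrt)
qed

section \<open>The symbol and the solution of the telegraph equation\<close>

definition symbol :: "real \<Rightarrow> int \<Rightarrow> nat \<Rightarrow> complex" where
  "symbol \<mu> k n = Complex ((real n * pi)\<^sup>2 - (of_int k * \<omega>)\<^sup>2) (2 * \<mu> * (of_int k * \<omega>))"

lemma symbol_eq: "symbol \<mu> k n = of_real ((real n * pi)\<^sup>2 - (of_int k * \<omega>)\<^sup>2) + of_real (2 * \<mu>) * (\<i> * of_int k * of_real \<omega>)"
  by (simp add: symbol_def complex_eq_iff)

lemma symbol_0: "symbol \<mu> 0 0 = 0" by (simp add: symbol_def complex_eq_iff)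

text \<open>
  The imaginary part bounds \<open>k\<close>, and then the real part bounds \<open>(n pi)^2\<close>. For \<open>k = 0\<close> the
  symbol is \<open>(n pi)^2\<close>, which is at least 1. The last estimate is the one behind the trace of the space
  derivative of a solution.
\<close>

lemma symbol_bounds:
  assumes \<mu>: "\<mu> \<noteq> 0"
  obtains C where "C \<ge> 1"
    "\<And>k n. (k, n) \<noteq> (0, 0) \<Longrightarrow> 1 + (of_int k)\<^sup>2 \<le> C * (cmod (symbol \<mu> k n))\<^sup>2"
    "\<And>k n. (k, n) \<noteq> (0, 0) \<Longrightarrow> (real n * pi)\<^sup>2 \<le> C * (cmod (symbol \<mu> k n))\<^sup>2"
    "\<And>k n. (k, n) \<noteq> (0, 0) \<Longrightarrow> ((real n * pi)\<^sup>2)\<^sup>2 \<le> C * (1 + (of_int k)\<^sup>2) * (cmod (symbol \<mu> k n))\<^sup>2"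
proof -
  define m where "m = 2 * \<bar>\<mu>\<bar> * \<omega>"
  have m: "m > 0" unfolding m_def using \<mu> \<omega>_pos by simp
  \<comment> \<open>The modulus of the imaginary part is \<open>m |k|\<close>, and \<open>1 + k^2 <= 2 k^2\<close> unless \<open>k = 0\<close>; the summand 1 serves \<open>k = 0\<close>.\<close>
  define C1 where "C1 = 2 / m\<^sup>2 + 1"
  have C1: "C1 \<ge> 1" unfolding C1_def by simp
  have b1: "1 + (of_int k)\<^sup>2 \<le> C1 * (cmod (symbol \<mu> k n))\<^sup>2" if nz: "(k, n) \<noteq> (0, 0)" for k n
  proof (cases "k = 0")
    case True
    then have "n \<ge> 1" using nz by auto
    then have "real n * pi \<ge> 1 * 1" using pi_gt3 by (intro mult_mono) auto
    then have "(real n * pi)\<^sup>2 \<ge> 1" by (simp add: one_le_power)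
    then have "((real n * pi)\<^sup>2)\<^sup>2 \<ge> 1" by (rule one_le_power)
    moreover have "(cmod (symbol \<mu> k n))\<^sup>2 = ((real n * pi)\<^sup>2)\<^sup>2" using True by (simp add: symbol_def cmod_power2)
    moreover have "1 * ((real n * pi)\<^sup>2)\<^sup>2 \<le> C1 * ((real n * pi)\<^sup>2)\<^sup>2" by (rule mult_right_mono[OF C1]) simp
    ultimately show ?thesis using True by simp
  next
    case False
    then have "1 \<le> \<bar>of_int k :: real\<bar>" by simp
    then have "(1::real)\<^sup>2 \<le> \<bar>of_int k\<bar>\<^sup>2" by (intro power_mono) auto
    then have k: "(1::real) \<le> (of_int k)\<^sup>2" by simp
    have "(of_int k)\<^sup>2 * m\<^sup>2 = (2 * \<mu> * (of_int k * \<omega>))\<^sup>2" unfolding m_def by (simp add: power_mult_distrib)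
    also have "\<dots> \<le> (cmod (symbol \<mu> k n))\<^sup>2" unfolding cmod_power2 by (simp add: symbol_def)
    finally have "(of_int k)\<^sup>2 \<le> (cmod (symbol \<mu> k n))\<^sup>2 / m\<^sup>2" using m by (simp add: pos_le_divide_eq)
    then have "1 + (of_int k)\<^sup>2 \<le> 2 * ((cmod (symbol \<mu> k n))\<^sup>2 / m\<^sup>2)" using k by linarith
    also have "\<dots> \<le> C1 * (cmod (symbol \<mu> k n))\<^sup>2" unfolding C1_def by (simp add: algebra_simps)
    finally show ?thesis .
  qed
  have np: "(real n * pi)\<^sup>2 \<le> cmod (symbol \<mu> k n) + \<omega>\<^sup>2 * (of_int k)\<^sup>2" for k n
  proof -
    have "\<bar>(real n * pi)\<^sup>2 - (of_int k * \<omega>)\<^sup>2\<bar> \<le> cmod (symbol \<mu> k n)"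
      using abs_Re_le_cmod[of "symbol \<mu> k n"] by (simp add: symbol_def)
    then show ?thesis by (simp add: power_mult_distrib mult.commute)
  qed
  define C where "C = C1 + 1 + \<omega>\<^sup>2 * C1 + 2 + 2 * (\<omega>\<^sup>2)\<^sup>2 * C1"
  have C0: "0 \<le> \<omega>\<^sup>2 * C1" "0 \<le> 2 * (\<omega>\<^sup>2)\<^sup>2 * C1" using C1 by auto
  show thesis
  proof (rule that[of C])
    show "C \<ge> 1" unfolding C_def using C1 C0 by linarith
    fix k n assume nz: "(k, n) \<noteq> (0 :: int, 0 :: nat)"
    let ?\<theta> = "cmod (symbol \<mu> k n)"
    let ?k = "(of_int k :: real)\<^sup>2"
    have k0: "?k \<ge> 0" by simp
    note b = b1[OF nz]
    have "1 + ?k \<le> C1 * ?\<theta>\<^sup>2" by (rule b)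
    also have "\<dots> \<le> C * ?\<theta>\<^sup>2" unfolding C_def using C1 C0 by (intro mult_right_mono) auto
    finally show "1 + ?k \<le> C * ?\<theta>\<^sup>2" .
    have "2 * ?\<theta> \<le> 1 + ?\<theta>\<^sup>2" using sum_squares_bound[of 1 ?\<theta>] by simp
    then have "?\<theta> \<le> 1 + ?\<theta>\<^sup>2" using norm_ge_zero[of "symbol \<mu> k n"] by linarith
    moreover have "1 \<le> C1 * ?\<theta>\<^sup>2" using b k0 by linarith
    ultimately have t: "?\<theta> \<le> (C1 + 1) * ?\<theta>\<^sup>2" unfolding distrib_right mult_1 by linarith
    have "\<omega>\<^sup>2 * ?k \<le> \<omega>\<^sup>2 * (C1 * ?\<theta>\<^sup>2)" using b by (intro mult_left_mono) auto
    then have "(real n * pi)\<^sup>2 \<le> (C1 + 1 + \<omega>\<^sup>2 * C1) * ?\<theta>\<^sup>2"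
      using np[of n k] t by (simp add: algebra_simps)
    also have "\<dots> \<le> C * ?\<theta>\<^sup>2" unfolding C_def using C1 C0 by (intro mult_right_mono) auto
    finally show "(real n * pi)\<^sup>2 \<le> C * ?\<theta>\<^sup>2" .
    have "((real n * pi)\<^sup>2)\<^sup>2 \<le> (?\<theta> + \<omega>\<^sup>2 * ?k)\<^sup>2" by (intro power_mono np) auto
    also have "\<dots> \<le> 2 * ?\<theta>\<^sup>2 + 2 * (\<omega>\<^sup>2 * ?k)\<^sup>2"
      using sum_squares_bound[of ?\<theta> "\<omega>\<^sup>2 * ?k"] by (simp add: power2_sum)
    also have "2 * (\<omega>\<^sup>2 * ?k)\<^sup>2 = (2 * (\<omega>\<^sup>2)\<^sup>2) * (?k * ?k)" by (simp add: power2_eq_square)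
    also have "(2 * (\<omega>\<^sup>2)\<^sup>2) * (?k * ?k) \<le> (2 * (\<omega>\<^sup>2)\<^sup>2) * ((1 + ?k) * (C1 * ?\<theta>\<^sup>2))"
      using b k0 by (intro mult_left_mono mult_mono) auto
    also have "2 * ?\<theta>\<^sup>2 \<le> (2 * (1 + ?k)) * ?\<theta>\<^sup>2" using k0 by (intro mult_right_mono) auto
    finally have "((real n * pi)\<^sup>2)\<^sup>2 \<le> (2 + 2 * (\<omega>\<^sup>2)\<^sup>2 * C1) * ((1 + ?k) * ?\<theta>\<^sup>2)" by (simp add: algebra_simps)
    also have "\<dots> \<le> C * ((1 + ?k) * ?\<theta>\<^sup>2)" unfolding C_def using C1 C0 k0 by (intro mult_right_mono) auto
    finally show "((real n * pi)\<^sup>2)\<^sup>2 \<le> C * (1 + ?k) * ?\<theta>\<^sup>2" by (simp add: mult.assoc)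
  qed
qed

text \<open>
  The time derivative is found by synthesis from its coefficients. The wave operator contributes
  the real part of the symbol, and this is where the Neumann traces of an element of the domain enter.
\<close>

lemma L_TE_coeffs:
  assumes u: "u \<in> U_b \<omega> (s + 1)" and s: "s \<ge> 0"
  obtains w d where "w \<in> H_space \<omega> s" "d \<in> H_space \<omega> s" "wave u = w" "dt u = d"
    "L_TE \<mu> u = 1 *\<^sub>R w + (2 * \<mu>) *\<^sub>R d"
    "\<And>k n. coeff_of (fn d) k n = (\<i> * of_int k * of_real \<omega>) * coeff_of (fn u) k n"
    "\<And>k n. coeff_of (fn (L_TE \<mu> u)) k n = symbol \<mu> k n * coeff_of (fn u) k n"
proof -
  from u obtain v w where uH: "u \<in> H_space \<omega> (s + 1)" and v: "v \<in> H_space \<omega> s" "is_dx u v"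
    and w: "w \<in> H_space \<omega> s" "is_wave u w" and tr: "is_trace \<omega> (dx u) 0 (\<lambda>_. 0)" "is_trace \<omega> (dx u) 1 (\<lambda>_. 0)"
    by (auto simp: U_b_def U_space_def)
  obtain d where d: "d \<in> H_space \<omega> s" "is_dt u d" "\<And>k n. coeff_of (fn d) k n = (\<i> * of_int k * of_real \<omega>) * coeff_of (fn u) k n"
    using dt_exists[OF uH s] by blast
  have p: "periodic_integrable u" "periodic_integrable v" "periodic_integrable w" "periodic_integrable d" using uH v w d by (auto simp: H_space_iff)
  have L: "L_TE \<mu> u = 1 *\<^sub>R w + (2 * \<mu>) *\<^sub>R d"
    by (simp add: L_TE_def wave_eq[OF w(2)] dt_eq[OF d(2)])
  have "coeff_of (fn w) k n = of_real ((real n * pi)\<^sup>2 - (of_int k * \<omega>)\<^sup>2) * coeff_of (fn u) k n" for k n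
    by (rule wave_coeffs[OF p(1,2,3) v(2) w(2)]) (use tr dx_eq[OF v(2)] in auto)
  then have "coeff_of (fn (L_TE \<mu> u)) k n = symbol \<mu> k n * coeff_of (fn u) k n" for k n
    unfolding L coeff_of_fn_linear[OF p(3,4)] d(3) symbol_eq by (simp add: algebra_simps)
  with that w(1) d(1,3) L wave_eq[OF w(2)] dt_eq[OF d(2)] show thesis by blast
qed

text \<open>
  Divide the coefficients by the symbol; the coefficient of index \<open>(0, 0)\<close> of the solution is free, and
  prescribing it makes the solution unique.
\<close>

lemma L_TE_solve:
  assumes f: "f \<in> H_space \<omega> s" and f0: "coeff_of (fn f) 0 0 = 0" and s: "s \<ge> 1" and \<mu>: "\<mu> \<noteq> 0"
  obtains u where "u \<in> U_b \<omega> (s + 1)" "coeff_of (fn u) 0 0 = of_real r" "L_TE \<mu> u = f"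
proof -
  obtain C where C: "C \<ge> 1"
    "\<And>k n. (k, n) \<noteq> (0, 0) \<Longrightarrow> 1 + (of_int k)\<^sup>2 \<le> C * (cmod (symbol \<mu> k n))\<^sup>2"
    "\<And>k n. (k, n) \<noteq> (0, 0) \<Longrightarrow> (real n * pi)\<^sup>2 \<le> C * (cmod (symbol \<mu> k n))\<^sup>2"
    "\<And>k n. (k, n) \<noteq> (0, 0) \<Longrightarrow> ((real n * pi)\<^sup>2)\<^sup>2 \<le> C * (1 + (of_int k)\<^sup>2) * (cmod (symbol \<mu> k n))\<^sup>2"
    by (rule symbol_bounds[OF \<mu>]) blast
  have fp: "periodic_integrable f" using f by (simp add: H_space_iff)
  define \<alpha> where "\<alpha> = coeff_of (fn f)"
  \<comment> \<open>Coefficients of the solution, of its space derivative (in the sine system) and of its wave operator.\<close>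
  define \<beta> where "\<beta> k n = (if (k, n) = (0, 0) then of_real r else \<alpha> k n / symbol \<mu> k n)" for k n
  define cv where "cv k n = of_real (- (real n * pi)) * \<beta> k n" for k n
  define cw where "cw k n = of_real ((real n * pi)\<^sup>2 - (of_int k * \<omega>)\<^sup>2) * \<beta> k n" for k n
  have \<alpha>h: "hermitian \<alpha>" unfolding \<alpha>_def by (rule coeff_of_hermitian[OF periodic_integrable_integrable[OF fp]])
  have sh: "symbol \<mu> (- k) n = cnj (symbol \<mu> k n)" for k n by (simp add: symbol_def complex_eq_iff)
  have \<beta>h: "hermitian \<beta>" using \<alpha>h unfolding hermitian_def \<beta>_def by (simp add: sh)
  have cvh: "hermitian cv" and cwh: "hermitian cw" using \<beta>h unfolding hermitian_def cv_def cw_def by simp_all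
  have nz: "symbol \<mu> k n \<noteq> 0" if "(k, n) \<noteq> (0, 0)" for k n
  proof
    assume "symbol \<mu> k n = 0"
    then have "1 + (of_int k :: real)\<^sup>2 \<le> 0" using C(2)[OF that] by simp
    moreover have "(of_int k :: real)\<^sup>2 \<ge> 0" by simp
    ultimately show False by linarith
  qed
  have \<theta>\<beta>: "symbol \<mu> k n * \<beta> k n = \<alpha> k n" for k n
    using nz[of k n] f0 by (auto simp: \<beta>_def symbol_0 \<alpha>_def)
  obtain B where B: "\<And>N. (\<Sum>i\<in>freqs N. weight s (fst i) * (cmod (\<alpha> (fst i) (snd i)))\<^sup>2) \<le> B"
    unfolding \<alpha>_def using coeff_of_weighted_bounded[OF f] by blast
  \<comment> \<open>The symbol gives bounds away from the origin only; the origin contributes a single term.\<close>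
  have sums: "(\<Sum>i\<in>freqs N. h (fst i) (snd i)) \<le> K * B + h 0 0"
    if h: "\<And>k n. (k, n) \<noteq> (0, 0) \<Longrightarrow> h k n \<le> K * (weight s k * (cmod (\<alpha> k n))\<^sup>2)" and K: "K \<ge> 0" for h K N
  proof -
    have 0: "(0, 0) \<in> freqs N" by (simp add: freqs_def)
    have "(\<Sum>i\<in>freqs N. h (fst i) (snd i)) = h 0 0 + (\<Sum>i\<in>freqs N - {(0, 0)}. h (fst i) (snd i))"
      using sum.remove[OF finite_freqs 0, of "\<lambda>i. h (fst i) (snd i)"] by simp
    also have "(\<Sum>i\<in>freqs N - {(0, 0)}. h (fst i) (snd i)) \<le> (\<Sum>i\<in>freqs N - {(0, 0)}. K * (weight s (fst i) * (cmod (\<alpha> (fst i) (snd i)))\<^sup>2))"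
      by (intro sum_mono h) auto
    also have "\<dots> \<le> (\<Sum>i\<in>freqs N. K * (weight s (fst i) * (cmod (\<alpha> (fst i) (snd i)))\<^sup>2))"
      using K by (intro sum_mono2) (auto intro!: mult_nonneg_nonneg weight_nonneg)
    also have "\<dots> = K * (\<Sum>i\<in>freqs N. weight s (fst i) * (cmod (\<alpha> (fst i) (snd i)))\<^sup>2)" by (simp add: sum_distrib_left)
    also have "\<dots> \<le> K * B" by (intro mult_left_mono B K)
    finally show ?thesis by simp
  qed
  have bu: "weight (s + 1) k * (cmod (\<beta> k n))\<^sup>2 \<le> C * (weight s k * (cmod (\<alpha> k n))\<^sup>2)" if "(k, n) \<noteq> (0, 0)" for k n
  proof -
    have "weight (s + 1) k * (cmod (\<beta> k n))\<^sup>2 = weight s k * ((1 + (of_int k)\<^sup>2) * (cmod (\<beta> k n))\<^sup>2)" by (simp add: weight_add1)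
    also have "\<dots> \<le> weight s k * ((C * (cmod (symbol \<mu> k n))\<^sup>2) * (cmod (\<beta> k n))\<^sup>2)"
      by (intro mult_left_mono mult_right_mono C(2) that weight_nonneg) auto
    also have "\<dots> = C * (weight s k * (cmod (symbol \<mu> k n * \<beta> k n))\<^sup>2)" by (simp add: norm_mult power_mult_distrib)
    finally show ?thesis unfolding \<theta>\<beta> .
  qed
  have bv: "weight s k * (cmod (cv k n))\<^sup>2 \<le> C * (weight s k * (cmod (\<alpha> k n))\<^sup>2)" if "(k, n) \<noteq> (0, 0)" for k n
  proof -
    have "weight s k * (cmod (cv k n))\<^sup>2 = weight s k * ((real n * pi)\<^sup>2 * (cmod (\<beta> k n))\<^sup>2)" by (simp add: cv_def norm_mult power_mult_distrib)
    also have "\<dots> \<le> weight s k * ((C * (cmod (symbol \<mu> k n))\<^sup>2) * (cmod (\<beta> k n))\<^sup>2)"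
      by (intro mult_left_mono mult_right_mono C(3) that weight_nonneg) auto
    also have "\<dots> = C * (weight s k * (cmod (symbol \<mu> k n * \<beta> k n))\<^sup>2)" by (simp add: norm_mult power_mult_distrib)
    finally show ?thesis unfolding \<theta>\<beta> .
  qed
  have bw: "weight s k * (cmod (cw k n))\<^sup>2 \<le> 1 * (weight s k * (cmod (\<alpha> k n))\<^sup>2)" for k n
  proof -
    have "cmod (cw k n) \<le> cmod (symbol \<mu> k n) * cmod (\<beta> k n)"
      unfolding cw_def norm_mult norm_of_real
      using abs_Re_le_cmod[of "symbol \<mu> k n"] by (intro mult_right_mono) (auto simp: symbol_def)
    then have "(cmod (cw k n))\<^sup>2 \<le> (cmod (\<alpha> k n))\<^sup>2" by (intro power_mono) (simp_all add: norm_mult[symmetric] \<theta>\<beta>)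
    then show ?thesis using mult_left_mono[OF _ weight_nonneg] by simp
  qed
  have bt: "(real n * cmod (cv k n))\<^sup>2 \<le> C * (weight s k * (cmod (\<alpha> k n))\<^sup>2)" if "(k, n) \<noteq> (0, 0)" for k n
  proof -
    have "real n \<le> real n * pi" using pi_gt3 by (simp add: mult_le_cancel_left1)
    then have n2: "(real n)\<^sup>2 \<le> (real n * pi)\<^sup>2" by (intro power_mono) auto
    have "weight 1 k \<le> weight s k" unfolding weight_def using s by (intro powr_mono) auto
    then have w1: "1 + (of_int k)\<^sup>2 \<le> weight s k" by (simp add: weight_def)
    have "(real n * cmod (cv k n))\<^sup>2 = (real n)\<^sup>2 * ((real n * pi)\<^sup>2 * (cmod (\<beta> k n))\<^sup>2)" by (simp add: cv_def norm_mult power_mult_distrib)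
    also have "\<dots> \<le> (real n * pi)\<^sup>2 * ((real n * pi)\<^sup>2 * (cmod (\<beta> k n))\<^sup>2)" by (intro mult_right_mono n2) auto
    also have "\<dots> = ((real n * pi)\<^sup>2)\<^sup>2 * (cmod (\<beta> k n))\<^sup>2" by (simp add: power2_eq_square)
    also have "\<dots> \<le> (C * (1 + (of_int k)\<^sup>2) * (cmod (symbol \<mu> k n))\<^sup>2) * (cmod (\<beta> k n))\<^sup>2"
      by (intro mult_right_mono C(4) that) auto
    also have "\<dots> = C * ((1 + (of_int k)\<^sup>2) * (cmod (symbol \<mu> k n * \<beta> k n))\<^sup>2)" by (simp add: norm_mult power_mult_distrib)
    also have "\<dots> \<le> C * (weight s k * (cmod (symbol \<mu> k n * \<beta> k n))\<^sup>2)" using C(1) w1 by (intro mult_left_mono mult_right_mono) auto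
    finally show ?thesis unfolding \<theta>\<beta> .
  qed
  have s0: "s \<ge> 0" "s + 1 \<ge> 0" using s by auto
  have C0: "C \<ge> 0" using C(1) by simp
  obtain u where u: "u \<in> H_space \<omega> (s + 1)" "L2_lim (partial_sum cos_mode \<beta>) (fn u)"
    using synthesis[OF orth_cos_mode \<beta>h s0(2) sums[of "\<lambda>k n. weight (s + 1) k * (cmod (\<beta> k n))\<^sup>2", OF bu C0]] by blast
  obtain v where v: "v \<in> H_space \<omega> s" "L2_lim (partial_sum sin_mode cv) (fn v)"
    using synthesis[OF orth_sin_mode cvh s0(1) sums[of "\<lambda>k n. weight s k * (cmod (cv k n))\<^sup>2", OF bv C0]] by blast
  obtain w where w: "w \<in> H_space \<omega> s" "L2_lim (partial_sum cos_mode cw) (fn w)"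
    using synthesis[OF orth_cos_mode cwh s0(1) sums[of "\<lambda>k n. weight s k * (cmod (cw k n))\<^sup>2" 1, OF bw]] by auto
  have p: "periodic_integrable u" "periodic_integrable v" "periodic_integrable w" using u v w by (auto simp: H_space_iff)
  have dxu: "is_dx u v" by (rule series_dx[OF p(1) u(2) p(2)]) (use v(2) in \<open>simp add: cv_def[abs_def]\<close>)
  have wvu: "is_wave u w" by (rule series_wave[OF p(1) u(2) p(3)]) (use w(2) in \<open>simp add: cw_def[abs_def]\<close>)
  have tr: "is_trace \<omega> v x0 (\<lambda>_. 0)" if "x0 = 0 \<or> x0 = 1" for x0
    by (rule sine_series_trace[OF p(2) v(2) sums[of "\<lambda>k n. (real n * cmod (cv k n))\<^sup>2", OF bt C0] that])
  have uU: "u \<in> U_b \<omega> (s + 1)"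
    unfolding U_b_def U_space_def using u(1) v(1) w(1) dxu wvu tr by (auto simp: dx_eq[OF dxu])
  have ua: "coeff_of (fn u) k n = \<beta> k n" for k n by (rule coeff_of_limit[OF \<beta>h u(2)])
  obtain w' d where L: "w' \<in> H_space \<omega> s" "d \<in> H_space \<omega> s" "L_TE \<mu> u = 1 *\<^sub>R w' + (2 * \<mu>) *\<^sub>R d"
    "\<And>k n. coeff_of (fn (L_TE \<mu> u)) k n = symbol \<mu> k n * coeff_of (fn u) k n"
    using L_TE_coeffs[OF uU s0(1), of \<mu>] by metis
  have "L_TE \<mu> u \<in> H_space \<omega> s" unfolding L(3) by (rule H_space_linear[OF L(1,2)])
  then have "L_TE \<mu> u = f"
    by (intro periodic_integrable_eqI_coeff) (auto simp: H_space_iff fp L(4) ua \<theta>\<beta> \<alpha>_def)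
  moreover have "coeff_of (fn u) 0 0 = of_real r" unfolding ua by (simp add: \<beta>_def)
  ultimately show thesis using that uU by blast
qed

lemma U_b_H: "u \<in> U_b \<omega> \<gamma> \<Longrightarrow> u \<in> H_space \<omega> \<gamma>"
  by (simp add: U_b_def U_space_def)

lemma coeff_of_00_real: "periodic_integrable u \<Longrightarrow> coeff_of (fn u) 0 0 = of_real (Re (coeff_of (fn u) 0 0))"
proof -
  assume "periodic_integrable u"
  then have "hermitian (coeff_of (fn u))" by (rule coeff_of_hermitian[OF periodic_integrable_integrable])
  then have "coeff_of (fn u) (- 0) 0 = cnj (coeff_of (fn u) 0 0)" unfolding hermitian_def by blast
  then have "coeff_of (fn u) 0 0 = cnj (coeff_of (fn u) 0 0)" by simp
  then show ?thesis by (simp add: complex_eq_iff)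
qed

end

section \<open>The Fredholm property\<close>

text \<open>
  The operator of the theorem, with \<open>s = \<gamma> - 1\<close>. The adjoint is the instance with \<open>- \<mu>\<close>.
\<close>

locale telegraph = time_period +
  fixes \<mu> s :: real
  assumes \<mu>: "\<mu> \<noteq> 0" and s: "s \<ge> 1"
begin

lemma s0: "s \<ge> 0" using s by simp

lemma symbol_nonzero: "(k, n) \<noteq> (0, 0) \<Longrightarrow> symbol \<mu> k n \<noteq> 0"
proof -
  assume nz: "(k, n) \<noteq> (0, 0)"
  obtain C where C: "\<And>k n. (k, n) \<noteq> (0, 0) \<Longrightarrow> 1 + (of_int k)\<^sup>2 \<le> C * (cmod (symbol \<mu> k n))\<^sup>2"
    by (rule symbol_bounds[OF \<mu>]) blast
  have "(of_int k :: real)\<^sup>2 \<ge> 0" by simp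
  then have "0 < C * (cmod (symbol \<mu> k n))\<^sup>2" using C[OF nz] by linarith
  then show ?thesis by auto
qed

abbreviation "X \<equiv> U_b \<omega> (s + 1)"
abbreviation "Y \<equiv> H_space \<omega> s"

lemma X_periodic_integrable: "u \<in> X \<Longrightarrow> periodic_integrable u" using U_b_H by (auto simp: H_space_iff)

lemma L_in_H: "u \<in> X \<Longrightarrow> L_TE \<mu> u \<in> Y"
proof -
  assume u: "u \<in> X"
  obtain w d where wd: "w \<in> Y" "d \<in> Y" and L: "L_TE \<mu> u = 1 *\<^sub>R w + (2 * \<mu>) *\<^sub>R d"
    by (rule L_TE_coeffs[OF u s0, of \<mu>]) blast
  show ?thesis unfolding L by (rule H_space_linear[OF wd])
qed

lemma L_coeffs: "u \<in> X \<Longrightarrow> coeff_of (fn (L_TE \<mu> u)) k n = symbol \<mu> k n * coeff_of (fn u) k n"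
  by (rule L_TE_coeffs[OF _ s0, of u \<mu>])

text \<open>
  The domain in terms of coefficients. A function on the right-hand side coincides with the solution
  that has the same mean.
\<close>

lemma domain_iff_coeffs: "u \<in> X \<longleftrightarrow> periodic_integrable u \<and> (\<exists>f\<in>Y. \<forall>k n. coeff_of (fn f) k n = symbol \<mu> k n * coeff_of (fn u) k n)"
proof
  assume "u \<in> X" then show "periodic_integrable u \<and> (\<exists>f\<in>Y. \<forall>k n. coeff_of (fn f) k n = symbol \<mu> k n * coeff_of (fn u) k n)"
    using X_periodic_integrable L_in_H L_coeffs by blast
next
  assume "periodic_integrable u \<and> (\<exists>f\<in>Y. \<forall>k n. coeff_of (fn f) k n = symbol \<mu> k n * coeff_of (fn u) k n)"
  then obtain f where u: "periodic_integrable u" and f: "f \<in> Y" "\<And>k n. coeff_of (fn f) k n = symbol \<mu> k n * coeff_of (fn u) k n" by blast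
  obtain u' where u': "u' \<in> X" "coeff_of (fn u') 0 0 = of_real (Re (coeff_of (fn u) 0 0))" "L_TE \<mu> u' = f"
    by (rule L_TE_solve[OF f(1) _ s \<mu>]) (use f(2) symbol_0 in auto)
  have "u' = u"
  proof (rule periodic_integrable_eqI_coeff[OF X_periodic_integrable[OF u'(1)] u])
    fix k n
    show "coeff_of (fn u') k n = coeff_of (fn u) k n"
    proof (cases "(k, n) = (0, 0)")
      case True then show ?thesis using u'(2) coeff_of_00_real[OF u] by simp
    next
      case False
      have "symbol \<mu> k n * coeff_of (fn u') k n = coeff_of (fn (L_TE \<mu> u')) k n" by (rule L_coeffs[OF u'(1), symmetric])
      also have "\<dots> = symbol \<mu> k n * coeff_of (fn u) k n" unfolding u'(3) by (rule f(2))
      finally show ?thesis by (simp only: mult_left_cancel[OF symbol_nonzero[OF False]])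
    qed
  qed
  then show "u \<in> X" using u'(1) by simp
qed

lemma domain_linear: "u \<in> X \<Longrightarrow> v \<in> X \<Longrightarrow> a *\<^sub>R u + b *\<^sub>R v \<in> X"
  and L_linear: "u \<in> X \<Longrightarrow> v \<in> X \<Longrightarrow> L_TE \<mu> (a *\<^sub>R u + b *\<^sub>R v) = a *\<^sub>R L_TE \<mu> u + b *\<^sub>R L_TE \<mu> v"
proof -
  assume u: "u \<in> X" and v: "v \<in> X"
  have p: "periodic_integrable (L_TE \<mu> u)" "periodic_integrable (L_TE \<mu> v)" using L_in_H u v by (auto simp: H_space_iff)
  have e: "coeff_of (fn (a *\<^sub>R L_TE \<mu> u + b *\<^sub>R L_TE \<mu> v)) k n = symbol \<mu> k n * coeff_of (fn (a *\<^sub>R u + b *\<^sub>R v)) k n" for k n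
    unfolding coeff_of_fn_linear[OF p] coeff_of_fn_linear[OF X_periodic_integrable[OF u] X_periodic_integrable[OF v]] L_coeffs[OF u] L_coeffs[OF v] by (simp add: algebra_simps)
  show w: "a *\<^sub>R u + b *\<^sub>R v \<in> X"
    unfolding domain_iff_coeffs using periodic_integrable_linear[OF X_periodic_integrable[OF u] X_periodic_integrable[OF v]] e H_space_linear[OF L_in_H[OF u] L_in_H[OF v]] by blast
  show "L_TE \<mu> (a *\<^sub>R u + b *\<^sub>R v) = a *\<^sub>R L_TE \<mu> u + b *\<^sub>R L_TE \<mu> v"
    by (rule periodic_integrable_eqI_coeff) (use L_in_H[OF w] periodic_integrable_linear[OF p] L_coeffs[OF w] e in \<open>auto simp: H_space_iff\<close>)
qed

lemma L_image: "L_TE \<mu> ` X = {f \<in> Y. coeff_of (fn f) 0 0 = 0}"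
proof (intro equalityI subsetI)
  fix f assume "f \<in> L_TE \<mu> ` X"
  then show "f \<in> {f \<in> Y. coeff_of (fn f) 0 0 = 0}" using L_in_H L_coeffs symbol_0 by auto
next
  fix f assume "f \<in> {f \<in> Y. coeff_of (fn f) 0 0 = 0}"
  then show "f \<in> L_TE \<mu> ` X" using L_TE_solve[OF _ _ s \<mu>, of f 0] by blast
qed

lemma one_in_domain: "one_fun \<in> X"
  unfolding domain_iff_coeffs
proof (intro conjI periodic_integrable_one bexI[of _ 0] allI)
  show "0 \<in> Y" using subspace_H by (rule subspace_0)
  have "coeff_of (fn (0 *\<^sub>R one_fun + 0 *\<^sub>R one_fun)) k n = 0" for k n
    unfolding coeff_of_fn_linear[OF periodic_integrable_one periodic_integrable_one] by simp
  then show "coeff_of (fn 0) k n = symbol \<mu> k n * coeff_of (fn one_fun) k n" for k n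
    by (auto simp: coeff_of_one symbol_0)
qed

text \<open>
  Off the origin the symbol can be cancelled, so an element of the kernel has the coefficients of a constant.
\<close>

lemma L_kernel: "kernel_on X (L_TE \<mu>) = range (\<lambda>r. r *\<^sub>R one_fun)"
proof (intro equalityI subsetI)
  have z: "coeff_of (fn 0) k n = 0" for k n
    using coeff_of_fn_linear[OF periodic_integrable_one periodic_integrable_one, of 0 0] by simp
  fix u assume "u \<in> kernel_on X (L_TE \<mu>)"
  then have u: "u \<in> X" "L_TE \<mu> u = 0" by (auto simp: kernel_on_def)
  let ?r = "Re (coeff_of (fn u) 0 0) / T"
  have "u = ?r *\<^sub>R one_fun + 0 *\<^sub>R one_fun"
  proof (rule periodic_integrable_eqI_coeff[OF X_periodic_integrable[OF u(1)] periodic_integrable_linear[OF periodic_integrable_one periodic_integrable_one]])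
    fix k n
    show "coeff_of (fn u) k n = coeff_of (fn (?r *\<^sub>R one_fun + 0 *\<^sub>R one_fun)) k n"
    proof (cases "(k, n) = (0, 0)")
      case True
      then show ?thesis unfolding coeff_of_fn_linear[OF periodic_integrable_one periodic_integrable_one]
        using coeff_of_00_real[OF X_periodic_integrable[OF u(1)]] T_pos by (simp add: coeff_of_one)
    next
      case False
      have "symbol \<mu> k n * coeff_of (fn u) k n = 0" using L_coeffs[OF u(1), of k n] u(2) z by simp
      then show ?thesis unfolding coeff_of_fn_linear[OF periodic_integrable_one periodic_integrable_one] using symbol_nonzero[OF False] False by (auto simp: coeff_of_one)
    qed
  qed
  then show "u \<in> range (\<lambda>r. r *\<^sub>R one_fun)" by auto
next
  have z: "coeff_of (fn 0) k n = 0" for k n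
    using coeff_of_fn_linear[OF periodic_integrable_one periodic_integrable_one, of 0 0] by simp
  have p0: "periodic_integrable 0" using subspace_0[OF subspace_H] by (auto simp: H_space_iff)
  fix u assume "u \<in> range (\<lambda>r. r *\<^sub>R one_fun)"
  then obtain r where r: "u = r *\<^sub>R one_fun + 0 *\<^sub>R one_fun" by auto
  have uX: "u \<in> X" unfolding r by (rule domain_linear[OF one_in_domain one_in_domain])
  moreover have "L_TE \<mu> u = 0"
  proof (rule periodic_integrable_eqI_coeff[OF _ p0])
    show "periodic_integrable (L_TE \<mu> u)" using L_in_H[OF uX] by (simp add: H_space_iff)
    show "coeff_of (fn (L_TE \<mu> u)) k n = coeff_of (fn 0) k n" for k n
      unfolding L_coeffs[OF uX] z unfolding r coeff_of_fn_linear[OF periodic_integrable_one periodic_integrable_one] by (auto simp: coeff_of_one symbol_0)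
  qed
  ultimately show "u \<in> kernel_on X (L_TE \<mu>)" by (simp add: kernel_on_def)
qed

lemma time_derivative_bound:
  assumes u: "u \<in> H_space \<omega> (s + 1)" and d: "d \<in> Y" "\<And>k n. coeff_of (fn d) k n = (\<i> * of_int k * of_real \<omega>) * coeff_of (fn u) k n"
  shows "H_sqnorm \<omega> s d \<le> ennreal (\<omega>\<^sup>2) * H_sqnorm \<omega> (s + 1) u"
proof -
  have p: "periodic_integrable u" "periodic_integrable d" using u d by (auto simp: H_space_iff)
  have "H_sqnorm \<omega> s d \<le> ennreal (\<omega>\<^sup>2) * H_sqnorm \<omega> (s + 1) u + ennreal 0 * H_sqnorm \<omega> s u"
  proof (rule H_sqnorm_le)
    fix k
    have "AE x in MX. time_fourier (fn d) k x = (\<i> * of_int k * of_real \<omega>) * time_fourier (fn u) k x"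
      by (rule time_fourier_eqI[OF periodic_integrable_integrable[OF p(2)] periodic_integrable_integrable[OF p(1)] d(2)])
    then show "AE x in MX. weight s k * (cmod (time_fourier (fn d) k x))\<^sup>2 \<le> \<omega>\<^sup>2 * (weight (s + 1) k * (cmod (time_fourier (fn u) k x))\<^sup>2) + 0 * (weight s k * (cmod (time_fourier (fn u) k x))\<^sup>2)"
    proof eventually_elim
      case (elim x)
      have "weight s k * (cmod (time_fourier (fn d) k x))\<^sup>2 = (\<omega>\<^sup>2 * (weight s k * (cmod (time_fourier (fn u) k x))\<^sup>2)) * (of_int k)\<^sup>2"
        unfolding elim by (simp add: norm_mult power_mult_distrib)
      also have "\<dots> \<le> (\<omega>\<^sup>2 * (weight s k * (cmod (time_fourier (fn u) k x))\<^sup>2)) * (1 + (of_int k)\<^sup>2)"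
        by (intro mult_left_mono mult_nonneg_nonneg weight_nonneg) auto
      finally show ?case by (simp add: weight_add1 mult_ac)
    qed
  qed (use p in auto)
  then show ?thesis by simp
qed

lemma L_bounded: "bounded_linear_between X (U_norm \<omega> (s + 1)) Y (H_norm \<omega> s) (L_TE \<mu>)"
  unfolding bounded_linear_between_def
proof (intro conjI ballI allI)
  show "subspace X"
  proof (rule subspaceI)
    show "0 \<in> X" using domain_linear[OF one_in_domain one_in_domain, of 0 0] by simp
    show "u + v \<in> X" if "u \<in> X" "v \<in> X" for u v using domain_linear[OF that, of 1 1] by simp
    show "c *\<^sub>R u \<in> X" if "u \<in> X" for c u using domain_linear[OF that that, of c 0] by simp
  qed
  show "subspace Y" by (rule subspace_H)
  show "L_TE \<mu> ` X \<subseteq> Y" using L_in_H by blast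
  show "L_TE \<mu> (u + v) = L_TE \<mu> u + L_TE \<mu> v" if "u \<in> X" "v \<in> X" for u v
    using L_linear[OF that, of 1 1] by simp
  show "L_TE \<mu> (c *\<^sub>R u) = c *\<^sub>R L_TE \<mu> u" if "u \<in> X" for c u
    using L_linear[OF that that, of c 0] by simp
  \<comment> \<open>From \<open>(a + b)^2 <= 2 a^2 + 2 b^2\<close> with \<open>b = 2 mu u_t\<close>, where \<open>u_t\<close> costs a factor \<open>omega\<close>.\<close>
  define K where "K = 2 + 8 * \<mu>\<^sup>2 * \<omega>\<^sup>2"
  have K: "K \<ge> 0" unfolding K_def by simp
  show "\<exists>C. \<forall>u\<in>X. H_norm \<omega> s (L_TE \<mu> u) \<le> C * U_norm \<omega> (s + 1) u"
  proof (intro exI[of _ "sqrt K"] ballI)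
    fix u assume u: "u \<in> X"
    obtain w d where wd: "w \<in> Y" "d \<in> Y" "wave u = w" "L_TE \<mu> u = 1 *\<^sub>R w + (2 * \<mu>) *\<^sub>R d"
      "\<And>k n. coeff_of (fn d) k n = (\<i> * of_int k * of_real \<omega>) * coeff_of (fn u) k n"
      by (rule L_TE_coeffs[OF u s0, of \<mu>]) auto
    have uH: "u \<in> H_space \<omega> (s + 1)" by (rule U_b_H[OF u])
    define nw nu where "nw = enn2real (H_sqnorm \<omega> s w)" and "nu = enn2real (H_sqnorm \<omega> (s + 1) u)"
    have nn: "nw \<ge> 0" "nu \<ge> 0" by (auto simp: nw_def nu_def)
    have fin: "H_sqnorm \<omega> s w = ennreal nw" "H_sqnorm \<omega> (s + 1) u = ennreal nu"
      using wd(1) uH by (auto simp: H_space_iff nw_def nu_def)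
    have "H_sqnorm \<omega> s (L_TE \<mu> u) \<le> ennreal (2 * 1\<^sup>2) * H_sqnorm \<omega> s w + ennreal (2 * (2 * \<mu>)\<^sup>2) * H_sqnorm \<omega> s d"
      unfolding wd(4) by (rule H_sqnorm_linear) (use wd in \<open>auto simp: H_space_iff\<close>)
    also have "\<dots> \<le> ennreal (2 * 1\<^sup>2) * ennreal nw + ennreal (2 * (2 * \<mu>)\<^sup>2) * (ennreal (\<omega>\<^sup>2) * ennreal nu)"
      unfolding fin(1) using time_derivative_bound[OF uH wd(2,5)] unfolding fin(2) by (intro add_left_mono mult_left_mono) auto
    also have "\<dots> = ennreal (2 * 1\<^sup>2 * nw + 2 * (2 * \<mu>)\<^sup>2 * (\<omega>\<^sup>2 * nu))"
      using nn by (simp only: ennreal_mult[symmetric] ennreal_plus[symmetric] mult_nonneg_nonneg zero_le_power2 zero_le_numeral)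
    also have "\<dots> \<le> ennreal (K * (nu + nw))"
    proof (rule ennreal_leI)
      have "0 \<le> 2 * nu" "0 \<le> 8 * (\<mu>\<^sup>2 * \<omega>\<^sup>2) * nw" using nn by auto
      then show "2 * 1\<^sup>2 * nw + 2 * (2 * \<mu>)\<^sup>2 * (\<omega>\<^sup>2 * nu) \<le> K * (nu + nw)"
        unfolding K_def by (simp add: algebra_simps power_mult_distrib)
    qed
    finally have "enn2real (H_sqnorm \<omega> s (L_TE \<mu> u)) \<le> K * (nu + nw)"
      using K nn by (intro enn2real_leI) auto
    also have "\<dots> \<le> K * ((H_norm \<omega> (s + 1) u)\<^sup>2 + (H_norm \<omega> s (dx u))\<^sup>2 + (H_norm \<omega> s w)\<^sup>2)"
      using K by (intro mult_left_mono) (auto simp: H_norm_def nw_def nu_def)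
    finally have "sqrt (enn2real (H_sqnorm \<omega> s (L_TE \<mu> u))) \<le> sqrt (K * ((H_norm \<omega> (s + 1) u)\<^sup>2 + (H_norm \<omega> s (dx u))\<^sup>2 + (H_norm \<omega> s w)\<^sup>2))"
      by (rule real_sqrt_le_mono)
    then show "H_norm \<omega> s (L_TE \<mu> u) \<le> sqrt K * U_norm \<omega> (s + 1) u"
      unfolding U_norm_def H_norm_def[of \<omega> s "L_TE \<mu> u"] wd(3) by (simp add: real_sqrt_mult)
  qed
qed

text \<open>
  The image is the kernel of the mean, which is continuous for the norm.
\<close>

lemma image_closed:
  assumes l: "l \<in> Y" and y: "\<And>n::nat. y n \<in> L_TE \<mu> ` X" and lim: "(\<lambda>n. H_norm \<omega> s (y n - l)) \<longlonglongrightarrow> 0"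
  shows "l \<in> L_TE \<mu> ` X"
proof -
  have yn: "y n \<in> Y" "coeff_of (fn (y n)) 0 0 = 0" for n using y[of n] unfolding L_image by auto
  have "cmod (coeff_of (fn l) 0 0) \<le> H_norm \<omega> s (y n - l)" for n
  proof -
    have e: "y n - l = 1 *\<^sub>R y n + (- 1) *\<^sub>R l" by simp
    have m: "y n - l \<in> Y" unfolding e by (rule H_space_linear[OF yn(1) l])
    have "coeff_of (fn (y n - l)) 0 0 = - coeff_of (fn l) 0 0"
      unfolding e by (subst coeff_of_fn_linear) (use yn l in \<open>auto simp: H_space_iff\<close>)
    then show ?thesis using coeff_of_le_H_norm[OF m s0] by simp
  qed
  then have "cmod (coeff_of (fn l) 0 0) \<le> 0" using lim by (intro LIMSEQ_le_const) auto
  then show ?thesis unfolding L_image using l by simp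
qed

lemma image_codim: "has_codim Y (L_TE \<mu> ` X) 1"
  unfolding has_codim_def L_image
proof (intro exI[of _ "{one_fun}"] conjI ballI allI impI)
  fix y assume y: "y \<in> Y"
  let ?c = "Re (coeff_of (fn y) 0 0) / T"
  have yp: "periodic_integrable y" using y by (simp add: H_space_iff)
  have e: "y - ?c *\<^sub>R one_fun = 1 *\<^sub>R y + (- ?c) *\<^sub>R one_fun" by simp
  have "y - ?c *\<^sub>R one_fun \<in> Y" unfolding e by (rule H_space_linear[OF y one_in_H])
  moreover have "coeff_of (fn (y - ?c *\<^sub>R one_fun)) 0 0 = 0"
    unfolding e coeff_of_fn_linear[OF yp periodic_integrable_one] using coeff_of_00_real[OF yp] T_pos by (simp add: coeff_of_one)
  ultimately show "\<exists>c. y - (\<Sum>b\<in>{one_fun}. c b *\<^sub>R b) \<in> {f \<in> Y. coeff_of (fn f) 0 0 = 0}"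
    by (intro exI[of _ "\<lambda>_. ?c"]) simp
next
  fix c b assume c: "(\<Sum>b\<in>{one_fun}. c b *\<^sub>R b) \<in> {f \<in> Y. coeff_of (fn f) 0 0 = 0}" and b: "b \<in> {one_fun}"
  have "coeff_of (fn (c one_fun *\<^sub>R one_fun + 0 *\<^sub>R one_fun)) 0 0 = 0" using c by simp
  then have "c one_fun = 0" unfolding coeff_of_fn_linear[OF periodic_integrable_one periodic_integrable_one] using T_pos by (simp add: coeff_of_one)
  then show "c b = 0" using b by simp
qed (use one_in_H in auto)

lemma one_nonzero: "one_fun \<noteq> 0"
proof
  assume "one_fun = 0"
  then have "coeff_of (fn (0 *\<^sub>R one_fun + 0 *\<^sub>R one_fun)) 0 0 = of_real T" using coeff_of_one[of 0 0] by simp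
  then show False unfolding coeff_of_fn_linear[OF periodic_integrable_one periodic_integrable_one] using T_pos by simp
qed

lemma kernel_dim: "dim (kernel_on X (L_TE \<mu>)) = 1"
proof -
  have "kernel_on X (L_TE \<mu>) = span {one_fun}" unfolding L_kernel by (simp add: span_singleton)
  then have "dim (kernel_on X (L_TE \<mu>)) = card {one_fun}"
    using one_nonzero by (simp only: dim_span) (rule dim_eq_card_independent, simp)
  then show ?thesis by simp
qed

lemma L_fredholm: "fredholm_with_index X (U_norm \<omega> (s + 1)) Y (H_norm \<omega> s) (L_TE \<mu>) 0"
  unfolding fredholm_with_index_def
proof (intro conjI allI ballI impI)
  show "bounded_linear_between X (U_norm \<omega> (s + 1)) Y (H_norm \<omega> s) (L_TE \<mu>)" by (rule L_bounded)
  show "l \<in> L_TE \<mu> ` X" if "l \<in> Y" "(\<forall>n::nat. y n \<in> L_TE \<mu> ` X) \<and> (\<lambda>n. H_norm \<omega> s (y n - l)) \<longlonglongrightarrow> 0" for y l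
    by (rule image_closed[OF that(1)]) (use that(2) in auto)
  show "\<exists>S. finite S \<and> kernel_on X (L_TE \<mu>) \<subseteq> span S"
    unfolding L_kernel by (intro exI[of _ "{one_fun}"]) (auto simp: span_singleton)
  show "\<exists>n. has_codim Y (L_TE \<mu> ` X) n \<and> 0 = int (dim (kernel_on X (L_TE \<mu>))) - int n"
    using image_codim kernel_dim by (intro exI[of _ 1]) simp
qed

text \<open>
  The kernel of the adjoint consists of the constants, so orthogonality to it is the vanishing of the mean.
\<close>

lemma pairing_constant:
  assumes f: "periodic_integrable f"
  shows "(LINT t:{0..2*pi/\<omega>}|lborel. LINT x:{0<..<1}|lborel. fn f (x, t) * fn (r *\<^sub>R one_fun) (x, t)) = r * Re (coeff_of (fn f) 0 0)"
proof -
  let ?u = "r *\<^sub>R one_fun"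
  have "AE z in lborel. z \<in> strip \<longrightarrow> fn ?u z = r" using fn_scaleR[of r one_fun] fn_one by eventually_elim auto
  then have ae: "AE z in Q. fn ?u z = r" by (rule AE_strip_Q)
  have fi: "integrable Q (fn f)" by (rule periodic_integrable_integrable[OF f])
  have i: "integrable Q (\<lambda>z. fn f z * fn ?u z)"
    by (rule integrable_cong_AE_imp[of _ "\<lambda>z. fn f z * r"]) (use fi ae in \<open>auto elim!: eventually_mono\<close>)
  have "(LINT t:{0..2*pi/\<omega>}|lborel. LINT x:{0<..<1}|lborel. fn f (x, t) * fn ?u (x, t)) = (LINT t|MT. LINT x|MX. fn f (x, t) * fn ?u (x, t))"
    unfolding integral_MT integral_MX by (simp only: T_def)
  also have "\<dots> = (LINT z|Q. fn f z * fn ?u z)"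
    unfolding Q_def using XT.integral_snd[of "\<lambda>x t. fn f (x, t) * fn ?u (x, t)"] i by (simp add: Q_def case_prod_unfold)
  also have "\<dots> = (LINT z|Q. r * fn f z)"
    by (rule integral_cong_AE) (use ae in \<open>auto elim!: eventually_mono\<close>)
  also have "\<dots> = r * (LINT z|Q. fn f z)" by simp
  also have "(LINT z|Q. fn f z) = Re (coeff_of (fn f) 0 0)"
    unfolding coeff_of_Re_Im(1)[OF fi] by (simp add: cos_mode_def trig_def)
  finally show ?thesis .
qed

end

lemma L_TE_adj_eq: "L_TE_adj \<mu> = L_TE (- \<mu>)"
  by (rule ext) (simp add: L_TE_adj_def L_TE_def)

theorem theorem4p4:
  fixes \<omega> \<mu> \<gamma> :: real
  assumes "\<omega> > 0" and "\<gamma> \<ge> 2" and "\<mu> \<noteq> 0"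
  shows "fredholm_with_index (U_b \<omega> \<gamma>) (U_norm \<omega> \<gamma>) (H_space \<omega> (\<gamma> - 1)) (H_norm \<omega> (\<gamma> - 1)) (L_TE \<mu>) 0
    \<and> bounded_linear_between (U_b \<omega> \<gamma>) (U_norm \<omega> \<gamma>) (H_space \<omega> (\<gamma> - 1)) (H_norm \<omega> (\<gamma> - 1)) (L_TE_adj \<mu>)
    \<and> L_TE \<mu> ` U_b \<omega> \<gamma> =
        {f \<in> H_space \<omega> (\<gamma> - 1).
           \<forall>u \<in> kernel_on (U_b \<omega> \<gamma>) (L_TE_adj \<mu>).
             (LINT t:{0..2*pi/\<omega>}|lborel. LINT x:{0<..<1}|lborel. fn f (x, t) * fn u (x, t)) = 0}"
proof -
  interpret T: telegraph \<omega> \<mu> "\<gamma> - 1" by standard (use assms in auto)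
  interpret A: telegraph \<omega> "- \<mu>" "\<gamma> - 1" by standard (use assms in auto)
  have \<gamma>: "\<gamma> - 1 + 1 = \<gamma>" by simp
  have "(\<forall>u \<in> kernel_on (U_b \<omega> \<gamma>) (L_TE_adj \<mu>).
      (LINT t:{0..2*pi/\<omega>}|lborel. LINT x:{0<..<1}|lborel. fn f (x, t) * fn u (x, t)) = 0) \<longleftrightarrow> T.coeff_of (fn f) 0 0 = 0"
    if f: "f \<in> H_space \<omega> (\<gamma> - 1)" for f
  proof -
    have p: "T.periodic_integrable f" using f by (simp add: T.H_space_iff)
    have "(\<forall>u \<in> kernel_on (U_b \<omega> \<gamma>) (L_TE_adj \<mu>).
      (LINT t:{0..2*pi/\<omega>}|lborel. LINT x:{0<..<1}|lborel. fn f (x, t) * fn u (x, t)) = 0) \<longleftrightarrow> (\<forall>r. r * Re (T.coeff_of (fn f) 0 0) = 0)"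
      unfolding L_TE_adj_eq using A.L_kernel[unfolded \<gamma>] T.pairing_constant[OF p] by (auto simp: image_iff)
    also have "\<dots> \<longleftrightarrow> Re (T.coeff_of (fn f) 0 0) = 0" by (auto intro: spec[of _ 1])
    also have "\<dots> \<longleftrightarrow> T.coeff_of (fn f) 0 0 = 0" using T.coeff_of_00_real[OF p] by (metis of_real_0 zero_complex.sel(1))
    finally show ?thesis .
  qed
  then show ?thesis
    using T.L_fredholm[unfolded \<gamma>] A.L_bounded[unfolded \<gamma>] T.L_image[unfolded \<gamma>]
    unfolding L_TE_adj_eq by auto
qed

end
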